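(* Let $X$ be a scheme and let $\mathscr{O}_Y$ be a quadratic $\mathscr{O}_X$-algebra. On the category of pseudoregular $\mathscr{O}_Y$-modules under $\mathscr{O}_Y$-module isomorphisms, the composition of the dual functor and the norm functor, $\mathscr{I}\mapsto N_{\mathscr{I}^\vee}$, is naturally isomorphic to the functor $\mathscr{I}\mapsto Q_{\mathscr{I}^\vee}$, both being contravariant functors to binary quadratic $\mathscr{O}_X$-modules under similarities.
   Context: A quadratic $\mathscr{O}_X$-algebra is an $\mathscr{O}_X$-algebra locally free of rank $2$ as an $\mathscr{O}_X$-module. An $\mathscr{O}_Y$-module $\mathscr{I}$ that is locally free of rank $2$ over $\mathscr{O}_X$ is pseudoregular if for every affine open $U\subseteq X$ and $\alpha\in\mathscr{O}_Y(U)$, the characteristic polynomials over $\mathscr{O}_X(U)$ of multiplication by $\alpha$ on $\mathscr{O}_Y(U)$ and $\mathscr{I}(U)$ are equal. A binary quadratic $\mathscr{O}_X$-module is a quadratic map $Q\colon\mathscr{M}\to\mathscr{L}$ with $\mathscr{M}$ locally free of rank $2$ and $\mathscr{L}$ invertible; a similarity $Q\to Q'$ is a pair of isomorphisms $\varphi\colon\mathscr{M}\to\mathscr{M}'$, $\lambda\colon\mathscr{L}\to\mathscr{L}'$ with $Q'\circ\varphi=\lambda\circ Q$. Dual functor: $\mathscr{I}\mapsto\mathscr{I}^\vee=\mathscr{H}om_{\mathscr{O}_X}(\mathscr{I},\mathscr{O}_X)$, with its natural $\mathscr{O}_Y$-module structure (again pseudoregular), and $\psi\mapsto\psi^\vee$.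 Norm functor: $\mathscr{J}\mapsto N_{\mathscr{J}}\colon\mathscr{J}\to\bigwedge^2\mathscr{J}\otimes(\mathscr{O}_Y/\mathscr{O}_X)^\vee$, given locally, where $\mathscr{O}_Y=\mathscr{O}_X\oplus\mathscr{O}_X\alpha$, by $N_{\mathscr{J}}(x)=(\alpha x\wedge x)\otimes\overline{\alpha}^\vee$ ($\overline{\alpha}^\vee$ dual to the class of $\alpha$), and $\psi\mapsto(\psi,\wedge^2\psi\otimes\mathrm{id})$. The functor $\mathscr{I}\mapsto Q_{\mathscr{I}^\vee}$ (from Wood's construction): let $\mathscr{L}=(\bigwedge^2\mathscr{I})^\vee\otimes(\mathscr{O}_Y/\mathscr{O}_X)^\vee$ and let $\Psi\colon\mathscr{L}^\vee\to\operatorname{Sym}^2\mathscr{I}$ be the $\mathscr{O}_X$-linear map $(x\wedge y)\otimes\gamma\mapsto\gamma y\otimes x-\gamma x\otimes y$ (here $\operatorname{Sym}^2$ is the quotient of $\mathscr{I}^{\otimes2}$, and $\mathscr{L}^\vee\cong\bigwedge^2\mathscr{I}\otimes\mathscr{O}_Y/\mathscr{O}_X$). Its dual $(\operatorname{Sym}^2\mathscr{I})^\vee\to\mathscr{L}^{\vee\vee}\cong\mathscr{L}$, together with the canonical identification of $(\operatorname{Sym}^2\mathscr{I})^\vee$ with the symmetric tensors $\operatorname{Sym}_2(\mathscr{I}^\vee)\subseteq\mathscr{I}^\vee\otimes\mathscr{I}^\vee$, defines a quadratic map $Q_{\mathscr{I}^\vee}\colon\mathscr{I}^\vee\to\mathscr{L}$,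 $\theta\mapsto\Psi^\vee(\theta\otimes\theta)$. An isomorphism $\psi\colon\mathscr{I}\to\mathscr{I}'$ is sent to the similarity $(\psi^\vee,(\wedge^2\psi)^\vee\otimes\mathrm{id})$ from $Q_{\mathscr{I}'^\vee}$ to $Q_{\mathscr{I}^\vee}$. *)

theory Defs
  imports
    "HOL-Analysis.Abstract_Topology"
    "HOL-Algebra.QuotRing"
    "HOL-Algebra.UnivPoly"
begin

section \<open>Presheaves and ringed spaces\<close>

text \<open>
  A presheaf assigns to each open set a ring record (for rings), or an extension of it: a
  module record, used both for modules (whose multiplicative fields are then meaningless) and
  for algebras. Values at sets that are not open carry no information.
\<close>

record ('a, 'e, 'z) presheaf =
  sections :: "'a set \<Rightarrow> ('e, 'z) ring_scheme"
  restr :: "'a set \<Rightarrow> 'a set \<Rightarrow> 'e \<Rightarrow> 'e"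

type_synonym ('a, 'r, 'm) mod_presheaf = "('a, 'm, ('r, 'm, unit) module_ext) presheaf"

record ('a, 'r, 'z) ringed_space =
  top_of :: "'a topology"
  str :: "('a, 'r, 'z) presheaf"

type_synonym ('a, 'r) r_space = "('a, 'r, unit) ringed_space"

definition pts :: "('a, 'r, 'z) ringed_space \<Rightarrow> 'a set" where
  "pts X = topspace (top_of X)"

definition opens :: "('a, 'r, 'z) ringed_space \<Rightarrow> 'a set \<Rightarrow> 'a set set" where
  "opens X U = {V. openin (top_of X) V \<and> V \<subseteq> U}"

definition is_presheaf :: "('a, 'r, 'z) ringed_space \<Rightarrow> ('a, 'e, 'y) presheaf \<Rightarrow> bool" where
  "is_presheaf X F \<longleftrightarrow>
    (\<forall>U\<in>opens X (pts X). \<forall>s\<in>carrier (sections F U).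
      restr F U U s = s \<and>
      (\<forall>V\<in>opens X U. restr F U V s \<in> carrier (sections F V) \<and>
        (\<forall>W\<in>opens X V. restr F V W (restr F U V s) = restr F U W s)))"

definition is_sheaf :: "('a, 'r, 'z) ringed_space \<Rightarrow> ('a, 'e, 'y) presheaf \<Rightarrow> bool" where
  "is_sheaf X F \<longleftrightarrow> is_presheaf X F \<and>
    (\<forall>\<V>\<subseteq>opens X (pts X).
      (\<forall>s\<in>carrier (sections F (\<Union>\<V>)). \<forall>t\<in>carrier (sections F (\<Union>\<V>)).
        (\<forall>V\<in>\<V>. restr F (\<Union>\<V>) V s = restr F (\<Union>\<V>) V t) \<longrightarrow> s = t) \<and>
      (\<forall>\<sigma>. (\<forall>V\<in>\<V>. \<sigma> V \<in> carrier (sections F V)) \<and>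
            (\<forall>V\<in>\<V>. \<forall>W\<in>\<V>. restr F V (V \<inter> W) (\<sigma> V) = restr F W (V \<inter> W) (\<sigma> W)) \<longrightarrow>
        (\<exists>s\<in>carrier (sections F (\<Union>\<V>)). \<forall>V\<in>\<V>. restr F (\<Union>\<V>) V s = \<sigma> V)))"

definition ring_sheaf :: "('a, 'r, 'z) ringed_space \<Rightarrow> ('a, 'e, 'y) presheaf \<Rightarrow> bool" where
  "ring_sheaf X F \<longleftrightarrow> is_sheaf X F \<and>
    (\<forall>U\<in>opens X (pts X). cring (sections F U) \<and>
      (\<forall>V\<in>opens X U. restr F U V \<in> ring_hom (sections F U) (sections F V)))"

definition ringed_space :: "('a, 'r, 'z) ringed_space \<Rightarrow> bool" where
  "ringed_space X \<longleftrightarrow> ring_sheaf X (str X)"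

definition open_sub :: "('a, 'r, 'z) ringed_space \<Rightarrow> 'a set \<Rightarrow> ('a, 'r, 'z) ringed_space" where
  "open_sub X U = X\<lparr>top_of := subtopology (top_of X) U\<rparr>"

definition ringed_spaces_iso ::
    "('a, 'r, 'z) ringed_space \<Rightarrow> ('b, 's, 'y) ringed_space \<Rightarrow> bool" where
  "ringed_spaces_iso X Y \<longleftrightarrow>
    (\<exists>h g. homeomorphic_map (top_of X) (top_of Y) h \<and>
      (\<forall>U\<in>opens Y (pts Y).
        g U \<in> ring_iso (sections (str Y) U) (sections (str X) {x \<in> pts X. h x \<in> U}) \<and>
        (\<forall>V\<in>opens Y U. \<forall>s\<in>carrier (sections (str Y) U).
          g V (restr (str Y) U V s) =
            restr (str X) {x \<in> pts X. h x \<in> U} {x \<in> pts X. h x \<in> V} (g U s))))"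

section \<open>Affine schemes and schemes\<close>

text \<open>The fraction \<open>a/s\<close> in the localization of \<open>R\<close> at the prime ideal \<open>P\<close>.\<close>

definition loc_frac :: "'r ring \<Rightarrow> 'r set \<Rightarrow> 'r \<Rightarrow> 'r \<Rightarrow> ('r \<times> 'r) set" where
  "loc_frac R P a s = {(b, t). b \<in> carrier R \<and> t \<in> carrier R - P \<and>
     (\<exists>u\<in>carrier R - P. u \<otimes>\<^bsub>R\<^esub> (a \<otimes>\<^bsub>R\<^esub> t \<ominus>\<^bsub>R\<^esub> b \<otimes>\<^bsub>R\<^esub> s) = \<zero>\<^bsub>R\<^esub>)}"

definition localization :: "'r ring \<Rightarrow> 'r set \<Rightarrow> ('r \<times> 'r) set ring" where
  "localization R P = \<lparr>
     carrier = {loc_frac R P a s | a s. a \<in> carrier R \<and> s \<in> carrier R - P},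
     mult = (\<lambda>C D. \<Union>(a, s)\<in>C. \<Union>(b, t)\<in>D. loc_frac R P (a \<otimes>\<^bsub>R\<^esub> b) (s \<otimes>\<^bsub>R\<^esub> t)),
     one = loc_frac R P \<one>\<^bsub>R\<^esub> \<one>\<^bsub>R\<^esub>,
     zero = loc_frac R P \<zero>\<^bsub>R\<^esub> \<one>\<^bsub>R\<^esub>,
     add = (\<lambda>C D. \<Union>(a, s)\<in>C. \<Union>(b, t)\<in>D.
              loc_frac R P (a \<otimes>\<^bsub>R\<^esub> t \<oplus>\<^bsub>R\<^esub> b \<otimes>\<^bsub>R\<^esub> s) (s \<otimes>\<^bsub>R\<^esub> t))\<rparr>"

definition zariski :: "'r ring \<Rightarrow> 'r set topology" where
  "zariski R = topology (\<lambda>U. \<exists>S\<subseteq>carrier R. U = {P. primeideal P R \<and> \<not> S \<subseteq> P})"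

definition spec_sections :: "'r ring \<Rightarrow> 'r set set \<Rightarrow> ('r set \<Rightarrow> ('r \<times> 'r) set) ring" where
  "spec_sections R U = \<lparr>
     carrier = {\<sigma> \<in> (\<Pi>\<^sub>E P\<in>U. carrier (localization R P)).
       \<forall>P\<in>U. \<exists>V a s. openin (zariski R) V \<and> P \<in> V \<and> V \<subseteq> U \<and> a \<in> carrier R \<and> s \<in> carrier R \<and>
         (\<forall>Q\<in>V. s \<notin> Q \<and> \<sigma> Q = loc_frac R Q a s)},
     mult = (\<lambda>\<sigma> \<tau>. \<lambda>P\<in>U. \<sigma> P \<otimes>\<^bsub>localization R P\<^esub> \<tau> P),
     one = (\<lambda>P\<in>U. \<one>\<^bsub>localization R P\<^esub>),
     zero = (\<lambda>P\<in>U. \<zero>\<^bsub>localization R P\<^esub>),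
     add = (\<lambda>\<sigma> \<tau>. \<lambda>P\<in>U. \<sigma> P \<oplus>\<^bsub>localization R P\<^esub> \<tau> P)\<rparr>"

definition Spec :: "'r ring \<Rightarrow> ('r set, 'r set \<Rightarrow> ('r \<times> 'r) set) r_space" where
  "Spec R = \<lparr>top_of = zariski R,
     str = \<lparr>sections = spec_sections R, restr = (\<lambda>U V \<sigma>. restrict \<sigma> V)\<rparr>\<rparr>"

text \<open>
  Taking \<open>R\<close> on the type of the sections of the structure sheaf is no restriction: a ring whose
  spectrum is isomorphic to \<open>U\<close> is isomorphic to the ring of sections over \<open>U\<close>.
\<close>

definition affine_open :: "('a, 'r) r_space \<Rightarrow> 'a set \<Rightarrow> bool" where
  "affine_open X U \<longleftrightarrow> openin (top_of X) U \<and>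
     (\<exists>R :: 'r ring. cring R \<and> ringed_spaces_iso (open_sub X U) (Spec R))"

text \<open>
  Being locally isomorphic to a spectrum as a ringed space makes all stalks local, and an
  isomorphism of ringed spaces with local stalks is one of locally ringed spaces.
\<close>

definition scheme :: "('a, 'r) r_space \<Rightarrow> bool" where
  "scheme X \<longleftrightarrow> ringed_space X \<and> (\<forall>x\<in>pts X. \<exists>U. affine_open X U \<and> x \<in> U)"

section \<open>Sheaves of modules\<close>

definition module_sheaf :: "('a, 'r, 'z) ringed_space \<Rightarrow> ('a, 'r, 'm) mod_presheaf \<Rightarrow> bool" where
  "module_sheaf X M \<longleftrightarrow> is_sheaf X M \<and>
    (\<forall>U\<in>opens X (pts X). module (sections (str X) U) (sections M U) \<and>
      (\<forall>V\<in>opens X U. \<forall>x\<in>carrier (sections M U).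
        (\<forall>y\<in>carrier (sections M U).
          restr M U V (x \<oplus>\<^bsub>sections M U\<^esub> y) =
            restr M U V x \<oplus>\<^bsub>sections M V\<^esub> restr M U V y) \<and>
        (\<forall>r\<in>carrier (sections (str X) U).
          restr M U V (r \<odot>\<^bsub>sections M U\<^esub> x) =
            restr (str X) U V r \<odot>\<^bsub>sections M V\<^esub> restr M U V x)))"

text \<open>The sections \<open>e 0, \<dots>, e (n - 1)\<close> over \<open>U\<close> define an isomorphism of the \<open>n\<close>-th power of
  the structure sheaf with \<open>M\<close>, over \<open>U\<close>.\<close>

definition basis_on ::
    "('a, 'r, 'z) ringed_space \<Rightarrow> 'a set \<Rightarrow> ('a, 'r, 'm) mod_presheaf \<Rightarrow> nat \<Rightarrow> (nat \<Rightarrow> 'm) \<Rightarrow> bool"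
  where "basis_on X U M n e \<longleftrightarrow> (\<forall>i<n. e i \<in> carrier (sections M U)) \<and>
    (\<forall>V\<in>opens X U. \<forall>x\<in>carrier (sections M V).
      \<exists>!c. c \<in> {..<n} \<rightarrow>\<^sub>E carrier (sections (str X) V) \<and>
        x = (\<Oplus>\<^bsub>sections M V\<^esub>i\<in>{..<n}. c i \<odot>\<^bsub>sections M V\<^esub> restr M U V (e i)))"

definition locally_free ::
    "('a, 'r, 'z) ringed_space \<Rightarrow> nat \<Rightarrow> ('a, 'r, 'm) mod_presheaf \<Rightarrow> bool" where
  "locally_free X n M \<longleftrightarrow> module_sheaf X M \<and>
    (\<forall>x\<in>pts X. \<exists>U\<in>opens X (pts X). x \<in> U \<and> (\<exists>e. basis_on X U M n e))"

text \<open>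
  Linear maps of the restrictions of \<open>M\<close> and \<open>N\<close> to \<open>U\<close>. Extensionality makes equality of
  morphisms the equality of functions; the global morphisms are those over \<^term>\<open>pts X\<close>.
\<close>

definition mod_homs ::
    "('a, 'r, 'z) ringed_space \<Rightarrow> 'a set \<Rightarrow> ('a, 'r, 'm) mod_presheaf \<Rightarrow> ('a, 'r, 'n) mod_presheaf
      \<Rightarrow> ('a set \<Rightarrow> 'm \<Rightarrow> 'n) set" where
  "mod_homs X U M N = {f \<in> (\<Pi>\<^sub>E V\<in>opens X U. carrier (sections M V) \<rightarrow>\<^sub>E carrier (sections N V)).
    \<forall>V\<in>opens X U. \<forall>x\<in>carrier (sections M V).
      (\<forall>y\<in>carrier (sections M V).
        f V (x \<oplus>\<^bsub>sections M V\<^esub> y) = f V x \<oplus>\<^bsub>sections N V\<^esub> f V y) \<and>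
      (\<forall>r\<in>carrier (sections (str X) V).
        f V (r \<odot>\<^bsub>sections M V\<^esub> x) = r \<odot>\<^bsub>sections N V\<^esub> f V x) \<and>
      (\<forall>W\<in>opens X V. f W (restr M V W x) = restr N V W (f V x))}"

definition mod_isos ::
    "('a, 'r, 'z) ringed_space \<Rightarrow> ('a, 'r, 'm) mod_presheaf \<Rightarrow> ('a, 'r, 'n) mod_presheaf
      \<Rightarrow> ('a set \<Rightarrow> 'm \<Rightarrow> 'n) set" where
  "mod_isos X M N = {f \<in> mod_homs X (pts X) M N.
    \<forall>U\<in>opens X (pts X). bij_betw (f U) (carrier (sections M U)) (carrier (sections N U))}"

definition mod_id ::
    "('a, 'r, 'z) ringed_space \<Rightarrow> ('a, 'r, 'm) mod_presheaf \<Rightarrow> 'a set \<Rightarrow> 'm \<Rightarrow> 'm" where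
  "mod_id X M = (\<lambda>U\<in>opens X (pts X). \<lambda>x\<in>carrier (sections M U). x)"

definition mod_comp ::
    "('a, 'r, 'z) ringed_space \<Rightarrow> ('a, 'r, 'm) mod_presheaf \<Rightarrow> ('a set \<Rightarrow> 'n \<Rightarrow> 'k)
      \<Rightarrow> ('a set \<Rightarrow> 'm \<Rightarrow> 'n) \<Rightarrow> 'a set \<Rightarrow> 'm \<Rightarrow> 'k" where
  "mod_comp X M g f = (\<lambda>U\<in>opens X (pts X). \<lambda>x\<in>carrier (sections M U). g U (f U x))"

definition mod_inv ::
    "('a, 'r, 'z) ringed_space \<Rightarrow> ('a, 'r, 'm) mod_presheaf \<Rightarrow> ('a, 'r, 'n) mod_presheaf
      \<Rightarrow> ('a set \<Rightarrow> 'm \<Rightarrow> 'n) \<Rightarrow> 'a set \<Rightarrow> 'n \<Rightarrow> 'm" where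
  "mod_inv X M N f = (\<lambda>U\<in>opens X (pts X). \<lambda>y\<in>carrier (sections N U).
     inv_into (carrier (sections M U)) (f U) y)"

definition mk_module ::
    "'m set \<Rightarrow> 'm \<Rightarrow> ('m \<Rightarrow> 'm \<Rightarrow> 'm) \<Rightarrow> ('r \<Rightarrow> 'm \<Rightarrow> 'm) \<Rightarrow> ('r, 'm) module" where
  "mk_module C z a s = \<lparr>carrier = C, mult = (\<lambda>_ _. undefined), one = undefined,
     zero = z, add = a, smult = s\<rparr>"

definition struct_module :: "('a, 'r, 'z) ringed_space \<Rightarrow> ('a, 'r, 'r) mod_presheaf" where
  "struct_module X = \<lparr>
     sections = (\<lambda>U. mk_module (carrier (sections (str X) U)) \<zero>\<^bsub>sections (str X) U\<^esub>
       (\<lambda>a b. a \<oplus>\<^bsub>sections (str X) U\<^esub> b) (\<lambda>a b. a \<otimes>\<^bsub>sections (str X) U\<^esub> b)),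
     restr = restr (str X)\<rparr>"

definition dual ::
    "('a, 'r, 'z) ringed_space \<Rightarrow> ('a, 'r, 'm) mod_presheaf
      \<Rightarrow> ('a, 'r, 'a set \<Rightarrow> 'm \<Rightarrow> 'r) mod_presheaf" where
  "dual X M = \<lparr>
     sections = (\<lambda>U. mk_module (mod_homs X U M (struct_module X))
       (\<lambda>V\<in>opens X U. \<lambda>x\<in>carrier (sections M V). \<zero>\<^bsub>sections (str X) V\<^esub>)
       (\<lambda>f g. \<lambda>V\<in>opens X U. \<lambda>x\<in>carrier (sections M V). f V x \<oplus>\<^bsub>sections (str X) V\<^esub> g V x)
       (\<lambda>r f. \<lambda>V\<in>opens X U. \<lambda>x\<in>carrier (sections M V).
          restr (str X) U V r \<otimes>\<^bsub>sections (str X) V\<^esub> f V x)),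
     restr = (\<lambda>U V f. restrict f (opens X V))\<rparr>"

definition dual_map ::
    "('a, 'r, 'z) ringed_space \<Rightarrow> ('a, 'r, 'm) mod_presheaf \<Rightarrow> ('a, 'r, 'n) mod_presheaf
      \<Rightarrow> ('a set \<Rightarrow> 'm \<Rightarrow> 'n) \<Rightarrow> 'a set \<Rightarrow> ('a set \<Rightarrow> 'n \<Rightarrow> 'r) \<Rightarrow> ('a set \<Rightarrow> 'm \<Rightarrow> 'r)" where
  "dual_map X M N f = (\<lambda>U\<in>opens X (pts X). \<lambda>\<theta>\<in>carrier (sections (dual X N) U).
     \<lambda>V\<in>opens X U. \<lambda>x\<in>carrier (sections M V). \<theta> V (f V x))"

definition eval_bidual ::
    "('a, 'r, 'z) ringed_space \<Rightarrow> ('a, 'r, 'm) mod_presheaf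
      \<Rightarrow> 'a set \<Rightarrow> 'm \<Rightarrow> ('a set \<Rightarrow> ('a set \<Rightarrow> 'm \<Rightarrow> 'r) \<Rightarrow> 'r)" where
  "eval_bidual X M = (\<lambda>U\<in>opens X (pts X). \<lambda>x\<in>carrier (sections M U).
     \<lambda>V\<in>opens X U. \<lambda>\<theta>\<in>carrier (sections (dual X M) V). \<theta> V (restr M U V x))"

section \<open>Sheafification\<close>

definition germ ::
    "('a, 'r, 'z) ringed_space \<Rightarrow> ('a, 'e, 'y) presheaf \<Rightarrow> 'a set \<Rightarrow> 'e \<Rightarrow> 'a \<Rightarrow> ('a set \<times> 'e) set"
  where "germ X P V s x = {(W, t). W \<in> opens X (pts X) \<and> x \<in> W \<and> t \<in> carrier (sections P W) \<and>
     (\<exists>Z\<in>opens X (V \<inter> W). x \<in> Z \<and> restr P V Z s = restr P W Z t)}"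

definition stalk ::
    "('a, 'r, 'z) ringed_space \<Rightarrow> ('a, 'e, 'y) presheaf \<Rightarrow> 'a \<Rightarrow> ('a set \<times> 'e) set set" where
  "stalk X P x = {germ X P V s x | V s. V \<in> opens X (pts X) \<and> x \<in> V \<and> s \<in> carrier (sections P V)}"

definition germ_add ::
    "('a, 'r, 'z) ringed_space \<Rightarrow> ('a, 'e, 'y) presheaf \<Rightarrow> 'a
      \<Rightarrow> ('a set \<times> 'e) set \<Rightarrow> ('a set \<times> 'e) set \<Rightarrow> ('a set \<times> 'e) set" where
  "germ_add X P x C D = (\<Union>(V, s)\<in>C. \<Union>(W, t)\<in>D.
     germ X P (V \<inter> W)
       (restr P V (V \<inter> W) s \<oplus>\<^bsub>sections P (V \<inter> W)\<^esub> restr P W (V \<inter> W) t) x)"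

definition germ_smult ::
    "('a, 'r, 'z) ringed_space \<Rightarrow> ('a, 'r, 'm) mod_presheaf \<Rightarrow> 'a set \<Rightarrow> 'r \<Rightarrow> 'a
      \<Rightarrow> ('a set \<times> 'm) set \<Rightarrow> ('a set \<times> 'm) set" where
  "germ_smult X P U r x C = (\<Union>(V, s)\<in>C.
     germ X P (U \<inter> V)
       (restr (str X) U (U \<inter> V) r \<odot>\<^bsub>sections P (U \<inter> V)\<^esub> restr P V (U \<inter> V) s) x)"

definition sheafify ::
    "('a, 'r, 'z) ringed_space \<Rightarrow> ('a, 'r, 'm) mod_presheaf
      \<Rightarrow> ('a, 'r, 'a \<Rightarrow> ('a set \<times> 'm) set) mod_presheaf" where
  "sheafify X P = \<lparr>
     sections = (\<lambda>U. mk_module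
       {\<sigma> \<in> (\<Pi>\<^sub>E x\<in>U. stalk X P x).
         \<forall>x\<in>U. \<exists>V\<in>opens X U. x \<in> V \<and> (\<exists>s\<in>carrier (sections P V). \<forall>y\<in>V. \<sigma> y = germ X P V s y)}
       (\<lambda>x\<in>U. germ X P U \<zero>\<^bsub>sections P U\<^esub> x)
       (\<lambda>\<sigma> \<tau>. \<lambda>x\<in>U. germ_add X P x (\<sigma> x) (\<tau> x))
       (\<lambda>r \<sigma>. \<lambda>x\<in>U. germ_smult X P U r x (\<sigma> x))),
     restr = (\<lambda>U V \<sigma>. restrict \<sigma> V)\<rparr>"

definition sheaf_section ::
    "('a, 'r, 'z) ringed_space \<Rightarrow> ('a, 'e, 'y) presheaf \<Rightarrow> 'a set \<Rightarrow> 'e \<Rightarrow> 'a \<Rightarrow> ('a set \<times> 'e) set"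
  where "sheaf_section X P U s = (\<lambda>x\<in>U. germ X P U s x)"

section \<open>Quotients, tensor products, exterior and symmetric squares\<close>

definition quot_presheaf ::
    "('a, 'r, 'm) mod_presheaf \<Rightarrow> ('a set \<Rightarrow> 'm set) \<Rightarrow> ('a, 'r, 'm set) mod_presheaf" where
  "quot_presheaf P N = \<lparr>
     sections = (\<lambda>U. mk_module (a_rcosets\<^bsub>sections P U\<^esub> (N U)) (N U)
       (\<lambda>C D. C <+>\<^bsub>sections P U\<^esub> D)
       (\<lambda>r C. \<Union>c\<in>C. N U +>\<^bsub>sections P U\<^esub> (r \<odot>\<^bsub>sections P U\<^esub> c))),
     restr = (\<lambda>U V C. \<Union>c\<in>C. N V +>\<^bsub>sections P V\<^esub> restr P U V c)\<rparr>"

definition fgen :: "('a, 'r, 'z) ringed_space \<Rightarrow> 'a set \<Rightarrow> 'g \<Rightarrow> 'g \<Rightarrow> 'r" where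
  "fgen X U g = (\<lambda>h. if h = g then \<one>\<^bsub>sections (str X) U\<^esub> else \<zero>\<^bsub>sections (str X) U\<^esub>)"

definition free_presheaf ::
    "('a, 'r, 'z) ringed_space \<Rightarrow> ('a set \<Rightarrow> 'g set) \<Rightarrow> ('a set \<Rightarrow> 'a set \<Rightarrow> 'g \<Rightarrow> 'g)
      \<Rightarrow> ('a, 'r, 'g \<Rightarrow> 'r) mod_presheaf" where
  "free_presheaf X G \<rho> = \<lparr>
     sections = (\<lambda>U. mk_module
       {f. (\<forall>g. f g \<in> carrier (sections (str X) U)) \<and> finite {g. f g \<noteq> \<zero>\<^bsub>sections (str X) U\<^esub>} \<and>
           {g. f g \<noteq> \<zero>\<^bsub>sections (str X) U\<^esub>} \<subseteq> G U}
       (\<lambda>_. \<zero>\<^bsub>sections (str X) U\<^esub>)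
       (\<lambda>f f' g. f g \<oplus>\<^bsub>sections (str X) U\<^esub> f' g)
       (\<lambda>r f g. r \<otimes>\<^bsub>sections (str X) U\<^esub> f g)),
     restr = (\<lambda>U V f h. \<Oplus>\<^bsub>sections (str X) V\<^esub>g\<in>{g. f g \<noteq> \<zero>\<^bsub>sections (str X) U\<^esub> \<and> \<rho> U V g = h}.
       restr (str X) U V (f g))\<rparr>"

definition mod_span :: "('r, 'z) ring_scheme \<Rightarrow> ('r, 'm) module \<Rightarrow> 'm set \<Rightarrow> 'm set" where
  "mod_span R F S = \<Inter>{N. submodule N R F \<and> S \<subseteq> N}"

definition pair_free ::
    "('a, 'r, 'z) ringed_space \<Rightarrow> ('a, 'r, 'm) mod_presheaf \<Rightarrow> ('a, 'r, 'n) mod_presheaf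
      \<Rightarrow> ('a, 'r, 'm \<times> 'n \<Rightarrow> 'r) mod_presheaf" where
  "pair_free X M N = free_presheaf X
     (\<lambda>U. carrier (sections M U) \<times> carrier (sections N U))
     (\<lambda>U V. map_prod (restr M U V) (restr N U V))"

definition bilinear_rels ::
    "('a, 'r, 'z) ringed_space \<Rightarrow> ('a, 'r, 'm) mod_presheaf \<Rightarrow> ('a, 'r, 'n) mod_presheaf
      \<Rightarrow> 'a set \<Rightarrow> ('m \<times> 'n \<Rightarrow> 'r) set" where
  "bilinear_rels X M N U = (
     let R = sections (str X) U; A = sections M U; B = sections N U;
         F = sections (pair_free X M N) U; d = (\<lambda>x y. fgen X U (x, y))
     in {d (x \<oplus>\<^bsub>A\<^esub> x') y \<ominus>\<^bsub>F\<^esub> (d x y \<oplus>\<^bsub>F\<^esub> d x' y) | x x' y.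
           x \<in> carrier A \<and> x' \<in> carrier A \<and> y \<in> carrier B}
      \<union> {d x (y \<oplus>\<^bsub>B\<^esub> y') \<ominus>\<^bsub>F\<^esub> (d x y \<oplus>\<^bsub>F\<^esub> d x y') | x y y'.
           x \<in> carrier A \<and> y \<in> carrier B \<and> y' \<in> carrier B}
      \<union> {d (r \<odot>\<^bsub>A\<^esub> x) y \<ominus>\<^bsub>F\<^esub> (r \<odot>\<^bsub>F\<^esub> d x y) | r x y.
           r \<in> carrier R \<and> x \<in> carrier A \<and> y \<in> carrier B}
      \<union> {d x (r \<odot>\<^bsub>B\<^esub> y) \<ominus>\<^bsub>F\<^esub> (r \<odot>\<^bsub>F\<^esub> d x y) | r x y.
           r \<in> carrier R \<and> x \<in> carrier A \<and> y \<in> carrier B})"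

text \<open>
  Over each open set, the quotient of the tensor product by the submodule generated by the
  classes of the extra relations \<open>E U\<close>, presented in one step as a quotient of the free module
  on pairs.
\<close>

definition pair_presheaf ::
    "('a, 'r, 'z) ringed_space \<Rightarrow> ('a, 'r, 'm) mod_presheaf \<Rightarrow> ('a, 'r, 'n) mod_presheaf
      \<Rightarrow> ('a set \<Rightarrow> ('m \<times> 'n \<Rightarrow> 'r) set) \<Rightarrow> ('a, 'r, ('m \<times> 'n \<Rightarrow> 'r) set) mod_presheaf" where
  "pair_presheaf X M N E = quot_presheaf (pair_free X M N)
     (\<lambda>U. mod_span (sections (str X) U) (sections (pair_free X M N) U)
            (bilinear_rels X M N U \<union> E U))"

definition pair_class ::
    "('a, 'r, 'z) ringed_space \<Rightarrow> ('a, 'r, 'm) mod_presheaf \<Rightarrow> ('a, 'r, 'n) mod_presheaf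
      \<Rightarrow> ('a set \<Rightarrow> ('m \<times> 'n \<Rightarrow> 'r) set) \<Rightarrow> 'a set \<Rightarrow> 'm \<Rightarrow> 'n
      \<Rightarrow> 'a \<Rightarrow> ('a set \<times> ('m \<times> 'n \<Rightarrow> 'r) set) set" where
  "pair_class X M N E U x y = sheaf_section X (pair_presheaf X M N E) U
     (mod_span (sections (str X) U) (sections (pair_free X M N) U) (bilinear_rels X M N U \<union> E U)
        +>\<^bsub>sections (pair_free X M N) U\<^esub> fgen X U (x, y))"

type_synonym ('a, 'r, 'm, 'n) pair_section = "'a \<Rightarrow> ('a set \<times> ('m \<times> 'n \<Rightarrow> 'r) set) set"

definition tensor ::
    "('a, 'r, 'z) ringed_space \<Rightarrow> ('a, 'r, 'm) mod_presheaf \<Rightarrow> ('a, 'r, 'n) mod_presheaf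
      \<Rightarrow> ('a, 'r, ('a, 'r, 'm, 'n) pair_section) mod_presheaf" where
  "tensor X M N = sheafify X (pair_presheaf X M N (\<lambda>U. {}))"

definition tens ::
    "('a, 'r, 'z) ringed_space \<Rightarrow> ('a, 'r, 'm) mod_presheaf \<Rightarrow> ('a, 'r, 'n) mod_presheaf
      \<Rightarrow> 'a set \<Rightarrow> 'm \<Rightarrow> 'n \<Rightarrow> ('a, 'r, 'm, 'n) pair_section" where
  "tens X M N = pair_class X M N (\<lambda>U. {})"

definition alternating_rels ::
    "('a, 'r, 'z) ringed_space \<Rightarrow> ('a, 'r, 'm) mod_presheaf \<Rightarrow> 'a set \<Rightarrow> ('m \<times> 'm \<Rightarrow> 'r) set" where
  "alternating_rels X M U = {fgen X U (x, x) | x. x \<in> carrier (sections M U)}"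

definition ext2 ::
    "('a, 'r, 'z) ringed_space \<Rightarrow> ('a, 'r, 'm) mod_presheaf
      \<Rightarrow> ('a, 'r, ('a, 'r, 'm, 'm) pair_section) mod_presheaf" where
  "ext2 X M = sheafify X (pair_presheaf X M M (alternating_rels X M))"

definition wedge ::
    "('a, 'r, 'z) ringed_space \<Rightarrow> ('a, 'r, 'm) mod_presheaf
      \<Rightarrow> 'a set \<Rightarrow> 'm \<Rightarrow> 'm \<Rightarrow> ('a, 'r, 'm, 'm) pair_section" where
  "wedge X M = pair_class X M M (alternating_rels X M)"

definition symmetric_rels ::
    "('a, 'r, 'z) ringed_space \<Rightarrow> ('a, 'r, 'm) mod_presheaf \<Rightarrow> 'a set \<Rightarrow> ('m \<times> 'm \<Rightarrow> 'r) set" where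
  "symmetric_rels X M U =
     {fgen X U (x, y) \<ominus>\<^bsub>sections (pair_free X M M) U\<^esub> fgen X U (y, x) | x y.
        x \<in> carrier (sections M U) \<and> y \<in> carrier (sections M U)}"

definition sym2 ::
    "('a, 'r, 'z) ringed_space \<Rightarrow> ('a, 'r, 'm) mod_presheaf
      \<Rightarrow> ('a, 'r, ('a, 'r, 'm, 'm) pair_section) mod_presheaf" where
  "sym2 X M = sheafify X (pair_presheaf X M M (symmetric_rels X M))"

definition sprod ::
    "('a, 'r, 'z) ringed_space \<Rightarrow> ('a, 'r, 'm) mod_presheaf
      \<Rightarrow> 'a set \<Rightarrow> 'm \<Rightarrow> 'm \<Rightarrow> ('a, 'r, 'm, 'm) pair_section" where
  "sprod X M = pair_class X M M (symmetric_rels X M)"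

text \<open>
  Morphisms out of these sheaves are determined by their values on pure tensors, so that the
  following definite descriptions are the usual induced morphisms.
\<close>

definition tensor_map ::
    "('a, 'r, 'z) ringed_space
      \<Rightarrow> ('a, 'r, 'm) mod_presheaf \<Rightarrow> ('a, 'r, 'n) mod_presheaf
      \<Rightarrow> ('a, 'r, 'm2) mod_presheaf \<Rightarrow> ('a, 'r, 'n2) mod_presheaf
      \<Rightarrow> ('a set \<Rightarrow> 'm \<Rightarrow> 'm2) \<Rightarrow> ('a set \<Rightarrow> 'n \<Rightarrow> 'n2)
      \<Rightarrow> 'a set \<Rightarrow> ('a, 'r, 'm, 'n) pair_section \<Rightarrow> ('a, 'r, 'm2, 'n2) pair_section" where
  "tensor_map X M N M' N' f g = (THE h. h \<in> mod_homs X (pts X) (tensor X M N) (tensor X M' N') \<and>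
     (\<forall>U\<in>opens X (pts X). \<forall>x\<in>carrier (sections M U). \<forall>y\<in>carrier (sections N U).
       h U (tens X M N U x y) = tens X M' N' U (f U x) (g U y)))"

definition ext2_map ::
    "('a, 'r, 'z) ringed_space \<Rightarrow> ('a, 'r, 'm) mod_presheaf \<Rightarrow> ('a, 'r, 'n) mod_presheaf
      \<Rightarrow> ('a set \<Rightarrow> 'm \<Rightarrow> 'n)
      \<Rightarrow> 'a set \<Rightarrow> ('a, 'r, 'm, 'm) pair_section \<Rightarrow> ('a, 'r, 'n, 'n) pair_section" where
  "ext2_map X M N f = (THE h. h \<in> mod_homs X (pts X) (ext2 X M) (ext2 X N) \<and>
     (\<forall>U\<in>opens X (pts X). \<forall>x\<in>carrier (sections M U). \<forall>y\<in>carrier (sections M U).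
       h U (wedge X M U x y) = wedge X N U (f U x) (f U y)))"

text \<open>
  The canonical morphisms from the tensor product of the duals of \<open>M\<close> and \<open>N\<close> to the dual of the
  tensor product, and from the tensor product of \<open>M\<close> and \<open>N\<close> to the dual of the tensor product of
  their duals. Both are given by the pairing of \<open>\<theta> \<otimes> \<eta>\<close> with \<open>x \<otimes> y\<close> to \<open>\<theta>(x) \<eta>(y)\<close>, and both
  are isomorphisms when \<open>M\<close> and \<open>N\<close> are locally free of finite rank.
\<close>

definition tensor_of_duals ::
    "('a, 'r, 'z) ringed_space \<Rightarrow> ('a, 'r, 'm) mod_presheaf \<Rightarrow> ('a, 'r, 'n) mod_presheaf
      \<Rightarrow> 'a set \<Rightarrow> ('a, 'r, 'a set \<Rightarrow> 'm \<Rightarrow> 'r, 'a set \<Rightarrow> 'n \<Rightarrow> 'r) pair_section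
      \<Rightarrow> 'a set \<Rightarrow> ('a, 'r, 'm, 'n) pair_section \<Rightarrow> 'r" where
  "tensor_of_duals X M N =
     (THE h. h \<in> mod_homs X (pts X) (tensor X (dual X M) (dual X N)) (dual X (tensor X M N)) \<and>
       (\<forall>U\<in>opens X (pts X).
         \<forall>\<theta>\<in>carrier (sections (dual X M) U). \<forall>\<eta>\<in>carrier (sections (dual X N) U).
         \<forall>V\<in>opens X U. \<forall>x\<in>carrier (sections M V). \<forall>y\<in>carrier (sections N V).
           h U (tens X (dual X M) (dual X N) U \<theta> \<eta>) V (tens X M N V x y) =
             \<theta> V x \<otimes>\<^bsub>sections (str X) V\<^esub> \<eta> V y))"

definition tensor_to_dual ::
    "('a, 'r, 'z) ringed_space \<Rightarrow> ('a, 'r, 'm) mod_presheaf \<Rightarrow> ('a, 'r, 'n) mod_presheaf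
      \<Rightarrow> 'a set \<Rightarrow> ('a, 'r, 'm, 'n) pair_section
      \<Rightarrow> 'a set \<Rightarrow> ('a, 'r, 'a set \<Rightarrow> 'm \<Rightarrow> 'r, 'a set \<Rightarrow> 'n \<Rightarrow> 'r) pair_section \<Rightarrow> 'r" where
  "tensor_to_dual X M N =
     (THE h. h \<in> mod_homs X (pts X) (tensor X M N) (dual X (tensor X (dual X M) (dual X N))) \<and>
       (\<forall>U\<in>opens X (pts X). \<forall>x\<in>carrier (sections M U). \<forall>y\<in>carrier (sections N U).
         \<forall>V\<in>opens X U.
         \<forall>\<theta>\<in>carrier (sections (dual X M) V). \<forall>\<eta>\<in>carrier (sections (dual X N) V).
           h U (tens X M N U x y) V (tens X (dual X M) (dual X N) V \<theta> \<eta>) =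
             \<theta> V (restr M U V x) \<otimes>\<^bsub>sections (str X) V\<^esub> \<eta> V (restr N U V y)))"

section \<open>Quadratic algebras and pseudoregular modules\<close>

definition algebra_sheaf :: "('a, 'r, 'z) ringed_space \<Rightarrow> ('a, 'r, 'b) mod_presheaf \<Rightarrow> bool" where
  "algebra_sheaf X Y \<longleftrightarrow> ring_sheaf X Y \<and> module_sheaf X Y \<and>
     (\<forall>U\<in>opens X (pts X). algebra (sections (str X) U) (sections Y U))"

definition quadratic_algebra ::
    "('a, 'r, 'z) ringed_space \<Rightarrow> ('a, 'r, 'b) mod_presheaf \<Rightarrow> bool" where
  "quadratic_algebra X Y \<longleftrightarrow> algebra_sheaf X Y \<and> locally_free X 2 Y"

text \<open>The space of \<open>X\<close> with \<open>Y\<close> as its structure sheaf, so that \<open>Y\<close>-modules are modules over it.\<close>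

definition over ::
    "('a, 'r) r_space \<Rightarrow> ('a, 'r, 'b) mod_presheaf
      \<Rightarrow> ('a, 'b, ('r, 'b, unit) module_ext) ringed_space" where
  "over X Y = \<lparr>top_of = top_of X, str = Y\<rparr>"

definition restr_scalars ::
    "('a, 'r, 'b) mod_presheaf \<Rightarrow> ('a, 'b, 'm) mod_presheaf \<Rightarrow> ('a, 'r, 'm) mod_presheaf" where
  "restr_scalars Y I = \<lparr>
     sections = (\<lambda>U. mk_module (carrier (sections I U)) \<zero>\<^bsub>sections I U\<^esub>
       (\<lambda>x y. x \<oplus>\<^bsub>sections I U\<^esub> y)
       (\<lambda>r x. (r \<odot>\<^bsub>sections Y U\<^esub> \<one>\<^bsub>sections Y U\<^esub>) \<odot>\<^bsub>sections I U\<^esub> x)),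
     restr = restr I\<rparr>"

definition charpoly2 :: "('r, 'z) ring_scheme \<Rightarrow> 'r \<Rightarrow> 'r \<Rightarrow> 'r \<Rightarrow> 'r \<Rightarrow> nat \<Rightarrow> 'r" where
  "charpoly2 R a b c d = (
     let P = UP R; x = monom P \<one>\<^bsub>R\<^esub> 1; k = (\<lambda>r. monom P r 0)
     in (x \<ominus>\<^bsub>P\<^esub> k a) \<otimes>\<^bsub>P\<^esub> (x \<ominus>\<^bsub>P\<^esub> k d) \<ominus>\<^bsub>P\<^esub> k b \<otimes>\<^bsub>P\<^esub> k c)"

text \<open>
  The characteristic polynomial of the endomorphism \<open>f\<close> of the restriction to \<open>U\<close> of a module \<open>M\<close>
  that is locally free of rank 2: the polynomial over the ring of sections on \<open>U\<close> that restricts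
  to the determinant of \<open>T - A\<close> on every open \<open>V \<subseteq> U\<close> on which \<open>M\<close> has a basis and \<open>f\<close> has
  matrix \<open>A\<close> in it. For \<open>U\<close> affine this is the characteristic polynomial of an endomorphism of
  the finitely generated projective module of sections on \<open>U\<close>.
\<close>

definition charpoly ::
    "('a, 'r) r_space \<Rightarrow> 'a set \<Rightarrow> ('a, 'r, 'm) mod_presheaf \<Rightarrow> ('a set \<Rightarrow> 'm \<Rightarrow> 'm) \<Rightarrow> nat \<Rightarrow> 'r"
  where "charpoly X U M f = (THE p. p \<in> carrier (UP (sections (str X) U)) \<and>
     (\<forall>V\<in>opens X U. \<forall>e. basis_on X V M 2 e \<longrightarrow>
       (\<forall>a\<in>carrier (sections (str X) V). \<forall>b\<in>carrier (sections (str X) V).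
        \<forall>c\<in>carrier (sections (str X) V). \<forall>d\<in>carrier (sections (str X) V).
         f V (e 0) = a \<odot>\<^bsub>sections M V\<^esub> e 0 \<oplus>\<^bsub>sections M V\<^esub> c \<odot>\<^bsub>sections M V\<^esub> e 1 \<and>
         f V (e 1) = b \<odot>\<^bsub>sections M V\<^esub> e 0 \<oplus>\<^bsub>sections M V\<^esub> d \<odot>\<^bsub>sections M V\<^esub> e 1 \<longrightarrow>
         (\<lambda>n. restr (str X) U V (p n)) = charpoly2 (sections (str X) V) a b c d)))"

definition pseudoregular ::
    "('a, 'r) r_space \<Rightarrow> ('a, 'r, 'b) mod_presheaf \<Rightarrow> ('a, 'b, 'm) mod_presheaf \<Rightarrow> bool" where
  "pseudoregular X Y I \<longleftrightarrow>
     module_sheaf (over X Y) I \<and> locally_free X 2 (restr_scalars Y I) \<and>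
     (\<forall>U \<alpha>. affine_open X U \<and> \<alpha> \<in> carrier (sections Y U) \<longrightarrow>
       charpoly X U Y (\<lambda>V x. restr Y U V \<alpha> \<otimes>\<^bsub>sections Y V\<^esub> x) =
       charpoly X U (restr_scalars Y I) (\<lambda>V x. restr Y U V \<alpha> \<odot>\<^bsub>sections I V\<^esub> x))"

section \<open>Binary quadratic modules and similarities\<close>

record ('a, 'r, 'm, 'l) bqm =
  qdom :: "('a, 'r, 'm) mod_presheaf"
  qcod :: "('a, 'r, 'l) mod_presheaf"
  qmap :: "'a set \<Rightarrow> 'm \<Rightarrow> 'l"

definition polar :: "('r, 'm) module \<Rightarrow> ('r, 'l) module \<Rightarrow> ('m \<Rightarrow> 'l) \<Rightarrow> 'm \<Rightarrow> 'm \<Rightarrow> 'l" where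
  "polar A B q x y = q (x \<oplus>\<^bsub>A\<^esub> y) \<ominus>\<^bsub>B\<^esub> q x \<ominus>\<^bsub>B\<^esub> q y"

text \<open>The polar form is symmetric, so that linearity in one argument is enough.\<close>

definition quadratic_map ::
    "('a, 'r) r_space \<Rightarrow> ('a, 'r, 'm) mod_presheaf \<Rightarrow> ('a, 'r, 'l) mod_presheaf
      \<Rightarrow> ('a set \<Rightarrow> 'm \<Rightarrow> 'l) \<Rightarrow> bool" where
  "quadratic_map X M L Q \<longleftrightarrow>
    (\<forall>U\<in>opens X (pts X). \<forall>x\<in>carrier (sections M U).
      Q U x \<in> carrier (sections L U) \<and>
      (\<forall>V\<in>opens X U. Q V (restr M U V x) = restr L U V (Q U x)) \<and>
      (\<forall>r\<in>carrier (sections (str X) U).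
        Q U (r \<odot>\<^bsub>sections M U\<^esub> x) = (r \<otimes>\<^bsub>sections (str X) U\<^esub> r) \<odot>\<^bsub>sections L U\<^esub> Q U x) \<and>
      (\<forall>y\<in>carrier (sections M U).
        (\<forall>z\<in>carrier (sections M U).
          polar (sections M U) (sections L U) (Q U) (x \<oplus>\<^bsub>sections M U\<^esub> y) z =
            polar (sections M U) (sections L U) (Q U) x z
              \<oplus>\<^bsub>sections L U\<^esub> polar (sections M U) (sections L U) (Q U) y z) \<and>
        (\<forall>r\<in>carrier (sections (str X) U).
          polar (sections M U) (sections L U) (Q U) (r \<odot>\<^bsub>sections M U\<^esub> x) y =
            r \<odot>\<^bsub>sections L U\<^esub> polar (sections M U) (sections L U) (Q U) x y)))"

definition binary_quadratic_module :: "('a, 'r) r_space \<Rightarrow> ('a, 'r, 'm, 'l) bqm \<Rightarrow> bool" where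
  "binary_quadratic_module X B \<longleftrightarrow>
     locally_free X 2 (qdom B) \<and> locally_free X 1 (qcod B) \<and>
     quadratic_map X (qdom B) (qcod B) (qmap B)"

definition similarities ::
    "('a, 'r) r_space \<Rightarrow> ('a, 'r, 'm, 'l) bqm \<Rightarrow> ('a, 'r, 'n, 'k) bqm
      \<Rightarrow> (('a set \<Rightarrow> 'm \<Rightarrow> 'n) \<times> ('a set \<Rightarrow> 'l \<Rightarrow> 'k)) set" where
  "similarities X B B' = {(\<phi>, \<mu>).
     \<phi> \<in> mod_isos X (qdom B) (qdom B') \<and> \<mu> \<in> mod_isos X (qcod B) (qcod B') \<and>
     (\<forall>U\<in>opens X (pts X). \<forall>x\<in>carrier (sections (qdom B) U).
       qmap B' U (\<phi> U x) = \<mu> U (qmap B U x))}"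

definition sim_id ::
    "('a, 'r) r_space \<Rightarrow> ('a, 'r, 'm, 'l) bqm
      \<Rightarrow> ('a set \<Rightarrow> 'm \<Rightarrow> 'm) \<times> ('a set \<Rightarrow> 'l \<Rightarrow> 'l)" where
  "sim_id X B = (mod_id X (qdom B), mod_id X (qcod B))"

text \<open>\<open>sim_comp X B t s\<close> is \<open>t\<close> after \<open>s\<close>, where \<open>B\<close> is the source of \<open>s\<close>.\<close>

definition sim_comp ::
    "('a, 'r) r_space \<Rightarrow> ('a, 'r, 'm, 'l) bqm
      \<Rightarrow> ('a set \<Rightarrow> 'n \<Rightarrow> 'p) \<times> ('a set \<Rightarrow> 'k \<Rightarrow> 'q)
      \<Rightarrow> ('a set \<Rightarrow> 'm \<Rightarrow> 'n) \<times> ('a set \<Rightarrow> 'l \<Rightarrow> 'k)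
      \<Rightarrow> ('a set \<Rightarrow> 'm \<Rightarrow> 'p) \<times> ('a set \<Rightarrow> 'l \<Rightarrow> 'q)" where
  "sim_comp X B t s = (mod_comp X (qdom B) (fst t) (fst s), mod_comp X (qcod B) (snd t) (snd s))"

section \<open>Functors and natural isomorphisms\<close>

text \<open>
  A contravariant functor from pseudoregular \<open>Y\<close>-modules under \<open>Y\<close>-module isomorphisms to binary
  quadratic modules under similarities, as an object map \<open>F\<close> and a morphism map \<open>F'\<close>; the latter
  takes the source \<open>I\<close> and target \<open>J\<close> of the morphism as arguments.
\<close>

definition contravariant_functor ::
    "('a, 'r) r_space \<Rightarrow> ('a, 'r, 'b) mod_presheaf
      \<Rightarrow> (('a, 'b, 'm) mod_presheaf \<Rightarrow> ('a, 'r, 'n, 'l) bqm)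
      \<Rightarrow> (('a, 'b, 'm) mod_presheaf \<Rightarrow> ('a, 'b, 'm) mod_presheaf \<Rightarrow> ('a set \<Rightarrow> 'm \<Rightarrow> 'm)
            \<Rightarrow> ('a set \<Rightarrow> 'n \<Rightarrow> 'n) \<times> ('a set \<Rightarrow> 'l \<Rightarrow> 'l))
      \<Rightarrow> bool" where
  "contravariant_functor X Y F F' \<longleftrightarrow>
    (\<forall>I. pseudoregular X Y I \<longrightarrow>
      binary_quadratic_module X (F I) \<and> F' I I (mod_id (over X Y) I) = sim_id X (F I)) \<and>
    (\<forall>I J \<psi>. pseudoregular X Y I \<and> pseudoregular X Y J \<and> \<psi> \<in> mod_isos (over X Y) I J \<longrightarrow>
      F' I J \<psi> \<in> similarities X (F J) (F I)) \<and>
    (\<forall>I J K \<psi> \<chi>. pseudoregular X Y I \<and> pseudoregular X Y J \<and> pseudoregular X Y K \<and>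
      \<psi> \<in> mod_isos (over X Y) I J \<and> \<chi> \<in> mod_isos (over X Y) J K \<longrightarrow>
      F' I K (mod_comp (over X Y) I \<chi> \<psi>) = sim_comp X (F K) (F' I J \<psi>) (F' J K \<chi>))"

definition natural_isomorphism ::
    "('a, 'r) r_space \<Rightarrow> ('a, 'r, 'b) mod_presheaf
      \<Rightarrow> (('a, 'b, 'm) mod_presheaf \<Rightarrow> ('a, 'r, 'n, 'l) bqm)
      \<Rightarrow> (('a, 'b, 'm) mod_presheaf \<Rightarrow> ('a, 'b, 'm) mod_presheaf \<Rightarrow> ('a set \<Rightarrow> 'm \<Rightarrow> 'm)
            \<Rightarrow> ('a set \<Rightarrow> 'n \<Rightarrow> 'n) \<times> ('a set \<Rightarrow> 'l \<Rightarrow> 'l))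
      \<Rightarrow> (('a, 'b, 'm) mod_presheaf \<Rightarrow> ('a, 'r, 'p, 'q) bqm)
      \<Rightarrow> (('a, 'b, 'm) mod_presheaf \<Rightarrow> ('a, 'b, 'm) mod_presheaf \<Rightarrow> ('a set \<Rightarrow> 'm \<Rightarrow> 'm)
            \<Rightarrow> ('a set \<Rightarrow> 'p \<Rightarrow> 'p) \<times> ('a set \<Rightarrow> 'q \<Rightarrow> 'q))
      \<Rightarrow> (('a, 'b, 'm) mod_presheaf \<Rightarrow> ('a set \<Rightarrow> 'n \<Rightarrow> 'p) \<times> ('a set \<Rightarrow> 'l \<Rightarrow> 'q))
      \<Rightarrow> bool" where
  "natural_isomorphism X Y F F' G G' \<eta> \<longleftrightarrow>
    (\<forall>I. pseudoregular X Y I \<longrightarrow> \<eta> I \<in> similarities X (F I) (G I)) \<and>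
    (\<forall>I J \<psi>. pseudoregular X Y I \<and> pseudoregular X Y J \<and> \<psi> \<in> mod_isos (over X Y) I J \<longrightarrow>
      sim_comp X (F J) (\<eta> I) (F' I J \<psi>) = sim_comp X (F J) (G' I J \<psi>) (\<eta> J))"

section \<open>The dual functor\<close>

definition dual_obj ::
    "('a, 'r) r_space \<Rightarrow> ('a, 'r, 'b) mod_presheaf \<Rightarrow> ('a, 'b, 'm) mod_presheaf
      \<Rightarrow> ('a, 'b, 'a set \<Rightarrow> 'm \<Rightarrow> 'r) mod_presheaf" where
  "dual_obj X Y I = (let D = dual X (restr_scalars Y I) in \<lparr>
     sections = (\<lambda>U. mk_module (carrier (sections D U)) \<zero>\<^bsub>sections D U\<^esub>
       (\<lambda>\<theta> \<eta>. \<theta> \<oplus>\<^bsub>sections D U\<^esub> \<eta>)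
       (\<lambda>\<gamma> \<theta>. \<lambda>V\<in>opens X U. \<lambda>x\<in>carrier (sections I V).
          \<theta> V (restr Y U V \<gamma> \<odot>\<^bsub>sections I V\<^esub> x))),
     restr = restr D\<rparr>)"

definition dual_mor ::
    "('a, 'r) r_space \<Rightarrow> ('a, 'r, 'b) mod_presheaf
      \<Rightarrow> ('a, 'b, 'm) mod_presheaf \<Rightarrow> ('a, 'b, 'n) mod_presheaf
      \<Rightarrow> ('a set \<Rightarrow> 'm \<Rightarrow> 'n) \<Rightarrow> 'a set \<Rightarrow> ('a set \<Rightarrow> 'n \<Rightarrow> 'r) \<Rightarrow> 'a set \<Rightarrow> 'm \<Rightarrow> 'r" where
  "dual_mor X Y I J \<psi> = dual_map X (restr_scalars Y I) (restr_scalars Y J) \<psi>"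

section \<open>The norm functor\<close>

definition base_image :: "('a, 'r) r_space \<Rightarrow> ('a, 'r, 'b) mod_presheaf \<Rightarrow> 'a set \<Rightarrow> 'b set" where
  "base_image X Y U =
     {r \<odot>\<^bsub>sections Y U\<^esub> \<one>\<^bsub>sections Y U\<^esub> | r. r \<in> carrier (sections (str X) U)}"

definition alg_quot ::
    "('a, 'r) r_space \<Rightarrow> ('a, 'r, 'b) mod_presheaf
      \<Rightarrow> ('a, 'r, 'a \<Rightarrow> ('a set \<times> 'b set) set) mod_presheaf" where
  "alg_quot X Y = sheafify X (quot_presheaf Y (base_image X Y))"

definition alg_class ::
    "('a, 'r) r_space \<Rightarrow> ('a, 'r, 'b) mod_presheaf
      \<Rightarrow> 'a set \<Rightarrow> 'b \<Rightarrow> 'a \<Rightarrow> ('a set \<times> 'b set) set" where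
  "alg_class X Y U \<gamma> = sheaf_section X (quot_presheaf Y (base_image X Y)) U
     (base_image X Y U +>\<^bsub>sections Y U\<^esub> \<gamma>)"

definition norm_target where
  "norm_target X Y J =
     tensor X (ext2 X (restr_scalars Y J)) (dual X (alg_quot X Y))"

definition norm_map where
  "norm_map X Y J = (\<lambda>U\<in>opens X (pts X). \<lambda>x\<in>carrier (sections J U).
     (THE s. s \<in> carrier (sections (norm_target X Y J) U) \<and>
       (\<forall>V\<in>opens X U. \<forall>\<alpha>\<in>carrier (sections Y V). \<forall>\<delta>\<in>carrier (sections (dual X (alg_quot X Y)) V).
         basis_on X V Y 2 (\<lambda>i. if i = 0 then \<one>\<^bsub>sections Y V\<^esub> else \<alpha>) \<and>
         \<delta> V (alg_class X Y V \<alpha>) = \<one>\<^bsub>sections (str X) V\<^esub> \<longrightarrow>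
         restr (norm_target X Y J) U V s =
           tens X (ext2 X (restr_scalars Y J)) (dual X (alg_quot X Y)) V
             (wedge X (restr_scalars Y J) V
               (\<alpha> \<odot>\<^bsub>sections J V\<^esub> restr J U V x) (restr J U V x)) \<delta>)))"

definition norm_obj where
  "norm_obj X Y J = \<lparr>qdom = restr_scalars Y J, qcod = norm_target X Y J, qmap = norm_map X Y J\<rparr>"

definition norm_mor where
  "norm_mor X Y J K \<psi> = (\<psi>,
     tensor_map X
       (ext2 X (restr_scalars Y J)) (dual X (alg_quot X Y))
       (ext2 X (restr_scalars Y K)) (dual X (alg_quot X Y))
       (ext2_map X (restr_scalars Y J) (restr_scalars Y K) \<psi>)
       (mod_id X (dual X (alg_quot X Y))))"

section \<open>Wood's construction\<close>

definition wood_target where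
  "wood_target X Y I =
     tensor X (dual X (ext2 X (restr_scalars Y I))) (dual X (alg_quot X Y))"

text \<open>On \<open>(x \<and> y) \<otimes> \<gamma>\<close> the value depends only on the class of \<open>\<gamma>\<close>, as \<open>Sym\<^sup>2\<close> is commutative.\<close>

definition wood_tensor_map where
  "wood_tensor_map X Y I = (let M = restr_scalars Y I in
     THE h. h \<in> mod_homs X (pts X) (tensor X (ext2 X M) (alg_quot X Y)) (sym2 X M) \<and>
       (\<forall>U\<in>opens X (pts X). \<forall>x\<in>carrier (sections I U). \<forall>y\<in>carrier (sections I U).
         \<forall>\<gamma>\<in>carrier (sections Y U).
         h U (tens X (ext2 X M) (alg_quot X Y) U (wedge X M U x y) (alg_class X Y U \<gamma>)) =
           sprod X M U (\<gamma> \<odot>\<^bsub>sections I U\<^esub> y) x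
             \<ominus>\<^bsub>sections (sym2 X M) U\<^esub> sprod X M U (\<gamma> \<odot>\<^bsub>sections I U\<^esub> x) y))"

text \<open>
  \<open>wood_Psi\<close> is a morphism from the dual of \<^term>\<open>wood_target X Y I\<close> to the symmetric square of
  \<open>I\<close>.
\<close>

definition wood_Psi where
  "wood_Psi X Y I = (let E = ext2 X (restr_scalars Y I); B = alg_quot X Y in
     mod_comp X (dual X (wood_target X Y I)) (wood_tensor_map X Y I)
       (mod_inv X (tensor X E B) (dual X (wood_target X Y I)) (tensor_to_dual X E B)))"

text \<open>
  The inverse of the canonical identification of the dual of \<open>Sym\<^sup>2 M\<close> with the symmetric tensors
  in the tensor square of the dual of \<open>M\<close>: a functional \<open>f\<close> corresponds to the tensor \<open>t\<close> that
  induces the same functional on the tensor square of \<open>M\<close>.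
\<close>

definition functional_of_symmetric_tensor where
  "functional_of_symmetric_tensor X M U t =
     (THE f. f \<in> carrier (sections (dual X (sym2 X M)) U) \<and>
       (\<forall>V\<in>opens X U. \<forall>x\<in>carrier (sections M V). \<forall>y\<in>carrier (sections M V).
         f V (sprod X M V x y) = tensor_of_duals X M M U t V (tens X M M V x y)))"

definition wood_map where
  "wood_map X Y I = (let M = restr_scalars Y I; L = wood_target X Y I in
     (\<lambda>U\<in>opens X (pts X). \<lambda>\<theta>\<in>carrier (sections (dual X M) U).
       mod_inv X L (dual X (dual X L)) (eval_bidual X L) U
         (dual_map X (dual X L) (sym2 X M) (wood_Psi X Y I) U
           (functional_of_symmetric_tensor X M U (tens X (dual X M) (dual X M) U \<theta> \<theta>)))))"

definition wood_obj where
  "wood_obj X Y I = \<lparr>qdom = dual X (restr_scalars Y I), qcod = wood_target X Y I,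
     qmap = wood_map X Y I\<rparr>"

definition wood_mor where
  "wood_mor X Y I J \<psi> = (let M = restr_scalars Y I; N = restr_scalars Y J in
     (dual_mor X Y I J \<psi>,
      tensor_map X
        (dual X (ext2 X N)) (dual X (alg_quot X Y))
        (dual X (ext2 X M)) (dual X (alg_quot X Y))
        (dual_map X (ext2 X M) (ext2 X N) (ext2_map X M N \<psi>))
        (mod_id X (dual X (alg_quot X Y)))))"

section \<open>The composite of the dual functor and the norm functor\<close>

definition norm_dual_obj where
  "norm_dual_obj X Y I = norm_obj X Y (dual_obj X Y I)"

definition norm_dual_mor where
  "norm_dual_mor X Y I J \<psi> =
     norm_mor X Y (dual_obj X Y J) (dual_obj X Y I) (dual_mor X Y I J \<psi>)"

end

theory Submission
  imports Defs
begin

text \<open>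
  Let \<open>D\<close> be the dual of \<open>I\<close>. In rank 2 the pairing of \<open>\<theta> \<and> \<eta>\<close> with \<open>x \<and> y\<close> to
  \<open>\<theta>(y) \<eta>(x) - \<theta>(x) \<eta>(y)\<close> is perfect, so that it identifies the exterior square of \<open>D\<close> with the
  dual of the exterior square of \<open>I\<close>, naturally in \<open>I\<close>; tensoring with the dual of \<open>Y/X\<close> identifies
  the targets of the two quadratic maps. A section of the target is determined by its
  pairings with the tensors \<open>(x \<and> y) \<otimes> \<gamma>\<close>. For Wood's quadratic map at \<open>\<theta>\<close> this pairing is
  \<open>\<theta>(\<gamma>y) \<theta>(x) - \<theta>(\<gamma>x) \<theta>(y)\<close>, and for the norm, locally given by \<open>\<alpha>\<theta> \<and> \<theta>\<close> and the functional that
  is 1 at the class of \<open>\<alpha>\<close>, it is the coefficient of \<open>\<alpha>\<close> in \<open>\<gamma>\<close> times the same expression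
  with \<open>\<alpha>\<close> for \<open>\<gamma>\<close>. The two agree, as the expression vanishes for \<open>\<gamma> = 1\<close>. Hence the norm is Wood's
  quadratic map transported along the identification, and inherits its properties from it.
\<close>

section \<open>Presheaves of modules\<close>

text \<open>The obstacle is that tensor products, exterior and symmetric squares are sheafifications
  of presheaf quotients, and that the maps between them are definite descriptions. A general section
  is neither a sum of pure tensors nor the class of a section of \<open>Y\<close>. Each map is
  therefore obtained from a universal property or glued from local maps, and is pinned down by its
  values on pure tensors. Frames are carried with their coordinates as morphisms, so that a section
  is shown to generate by an equality of two morphisms. For the sheaves of rank one this reduces an
  isomorphism to a generator going to a generator. The inverses of canonical maps in Wood's
  construction cancel once a section of the target is paired with (x \<and> y) \<otimes> \<gamma>. A
  second difficulty is formal: the norm lives on the \<open>Y\<close>-module dual with scalars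
  restricted to \<open>X\<close>, Wood's map on the dual over \<open>X\<close>. These are distinct
  records with the same modules over open sets, so the comparison is the identity between them on
  the sources.\<close>

text \<open>\<open>M$V\<close> is the ring or module of sections of \<open>M\<close> over \<open>V\<close>, and \<open>sec M V\<close> its carrier.\<close>

notation sections (infixl "$" 200)

abbreviation sec :: "('a, 'e, 'y) presheaf \<Rightarrow> 'a set \<Rightarrow> 'e set" where
  "sec F U \<equiv> carrier (F$U)"

abbreviation (input) lc :: "('a, 'r, 'm) mod_presheaf \<Rightarrow> 'a set \<Rightarrow> 'r \<Rightarrow> 'm \<Rightarrow> 'r \<Rightarrow> 'm \<Rightarrow> 'm" where
  "lc M U a e b f \<equiv> a \<odot>\<^bsub>M$U\<^esub> e \<oplus>\<^bsub>M$U\<^esub> b \<odot>\<^bsub>M$U\<^esub> f"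

lemma mk_module_simps [simp]:
  "carrier (mk_module C z a s) = C" "\<zero>\<^bsub>mk_module C z a s\<^esub> = z"
  "x \<oplus>\<^bsub>mk_module C z a s\<^esub> y = a x y" "r \<odot>\<^bsub>mk_module C z a s\<^esub> x = s r x"
  by (simp_all add: mk_module_def)

text \<open>Split off from \<open>module_sheaf\<close> because free and quotient presheaves satisfy
  only this part until they are sheafified.\<close>

definition mod_pre :: "('a, 'r, 'z) ringed_space \<Rightarrow> ('a, 'r, 'm) mod_presheaf \<Rightarrow> bool" where
  "mod_pre X M \<longleftrightarrow> is_presheaf X M \<and>
    (\<forall>U\<in>opens X (pts X). module (str X$U) (M$U) \<and>
      (\<forall>V\<in>opens X U. \<forall>x\<in>sec M U.
        (\<forall>y\<in>sec M U.
          restr M U V (x \<oplus>\<^bsub>M$U\<^esub> y) =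
            restr M U V x \<oplus>\<^bsub>M$V\<^esub> restr M U V y) \<and>
        (\<forall>r\<in>sec (str X) U.
          restr M U V (r \<odot>\<^bsub>M$U\<^esub> x) =
            restr (str X) U V r \<odot>\<^bsub>M$V\<^esub> restr M U V x)))"

lemma module_sheaf_iff: "module_sheaf X M \<longleftrightarrow> mod_pre X M \<and> is_sheaf X M"
  by (auto simp: module_sheaf_def mod_pre_def is_sheaf_def)

lemma module_sheaf_pre [simp, intro]: "module_sheaf X M \<Longrightarrow> mod_pre X M"
  and module_sheaf_sheaf: "module_sheaf X M \<Longrightarrow> is_sheaf X M"
  by (auto simp: module_sheaf_iff)

text \<open>Members of \<open>mod_homs\<close> are extensional in both arguments. This truncation
  turns a formula into such a member, so that equal morphisms are equal functions.\<close>

definition mkhom :: "('a, 'r, 'z) ringed_space \<Rightarrow> 'a set \<Rightarrow> ('a, 'r, 'm) mod_presheaf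
    \<Rightarrow> ('a set \<Rightarrow> 'm \<Rightarrow> 'n) \<Rightarrow> 'a set \<Rightarrow> 'm \<Rightarrow> 'n" where
  "mkhom X U M f = (\<lambda>V\<in>opens X U. \<lambda>x\<in>sec M V. f V x)"

text \<open>The part of \<open>mod_homs\<close> without extensionality, for raw families such as the
  passage to cosets or to germs, which are composed before being packaged.\<close>

definition lin :: "('a, 'r, 'z) ringed_space \<Rightarrow> 'a set \<Rightarrow> ('a, 'r, 'm) mod_presheaf
    \<Rightarrow> ('a, 'r, 'n) mod_presheaf \<Rightarrow> ('a set \<Rightarrow> 'm \<Rightarrow> 'n) \<Rightarrow> bool" where
  "lin X U M N f \<longleftrightarrow> (\<forall>V\<in>opens X U. \<forall>x\<in>sec M V.
      f V x \<in> sec N V \<and>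
      (\<forall>y\<in>sec M V.
        f V (x \<oplus>\<^bsub>M$V\<^esub> y) = f V x \<oplus>\<^bsub>N$V\<^esub> f V y) \<and>
      (\<forall>r\<in>sec (str X) V.
        f V (r \<odot>\<^bsub>M$V\<^esub> x) = r \<odot>\<^bsub>N$V\<^esub> f V x) \<and>
      (\<forall>W\<in>opens X V. f W (restr M V W x) = restr N V W (f V x)))"

lemma hom_iff:
  "f \<in> mod_homs X U M N \<longleftrightarrow>
    f \<in> extensional (opens X U) \<and> (\<forall>V\<in>opens X U. f V \<in> extensional (sec M V)) \<and>
    lin X U M N f"
  by (auto simp: mod_homs_def lin_def PiE_iff)

text \<open>The extension of the ring records is kept arbitrary so that the locale also applies to
  \<open>over X Y\<close>, whose structure sheaf consists of algebras.\<close>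

locale ringed =
  fixes X :: "('a, 'r, 'z) ringed_space"
  assumes ringed: "ringed_space X"
begin

abbreviation opn :: "'a set \<Rightarrow> bool" where "opn U \<equiv> openin (top_of X) U"
abbreviation R :: "'a set \<Rightarrow> ('r, 'z) ring_scheme" where "R U \<equiv> str X$U"
abbreviation (input) \<O> :: "'a set \<Rightarrow> 'r set" where "\<O> U \<equiv> sec (str X) U"
abbreviation (input) OX :: "('a, 'r, 'r) mod_presheaf" where "OX \<equiv> struct_module X"
abbreviation (input) "dot U a b c d \<equiv> a \<otimes>\<^bsub>R U\<^esub> b \<oplus>\<^bsub>R U\<^esub> c \<otimes>\<^bsub>R U\<^esub> d"
abbreviation (input) "cross U a b c d \<equiv> a \<otimes>\<^bsub>R U\<^esub> b \<ominus>\<^bsub>R U\<^esub> c \<otimes>\<^bsub>R U\<^esub> d"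
abbreviation rr :: "'a set \<Rightarrow> 'a set \<Rightarrow> 'r \<Rightarrow> 'r" where "rr \<equiv> restr (str X)"

section \<open>Open sets and the structure sheaf\<close>

lemma opens_iff [simp]: "V \<in> opens X U \<longleftrightarrow> opn V \<and> V \<subseteq> U"
  by (auto simp: opens_def)

lemma opn_pts [simp]: "opn V \<Longrightarrow> V \<subseteq> pts X"
  by (auto simp: pts_def openin_subset)

lemma opn_top [simp]: "opn (pts X)"
  by (auto simp: pts_def)

lemma opn_Int [simp]: "opn U \<Longrightarrow> opn V \<Longrightarrow> opn (U \<inter> V)"
  by auto

lemma cring_R: "opn U \<Longrightarrow> cring (R U)"
  using ringed by (simp add: ringed_space_def ring_sheaf_def)

lemma rr_hom: "\<lbrakk>opn U; opn V; V \<subseteq> U\<rbrakk> \<Longrightarrow> rr U V \<in> ring_hom (R U) (R V)"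
  using ringed by (auto simp add: ringed_space_def ring_sheaf_def)

lemma sheaf_R: "is_sheaf X (str X)"
  using ringed by (auto simp add: ringed_space_def ring_sheaf_def)

lemma presheaf_R: "is_presheaf X (str X)"
  using sheaf_R by (auto simp add: is_sheaf_def)

context
  fixes F :: "('a, 'e, 'y) presheaf"
  assumes F: "is_presheaf X F"
begin

lemma pre_closed: "\<lbrakk>opn U; opn V; V \<subseteq> U; s \<in> sec F U\<rbrakk> \<Longrightarrow>
    restr F U V s \<in> sec F V"
  and pre_id: "opn U \<Longrightarrow> s \<in> sec F U \<Longrightarrow> restr F U U s = s"
  and pre_trans: "\<lbrakk>opn U; opn V; V \<subseteq> U; opn W; W \<subseteq> V;
    s \<in> sec F U\<rbrakk> \<Longrightarrow> restr F V W (restr F U V s) = restr F U W s"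
  using F by (auto simp: is_presheaf_def)

end

lemmas rr_closed [simp] = pre_closed[OF presheaf_R]
lemmas rr_id [simp] = pre_id[OF presheaf_R]
lemmas rr_trans [simp] = pre_trans[OF presheaf_R]

context
  fixes U assumes U: "opn U"
begin

interpretation cring "R U" using cring_R[OF U] .

lemma R_closed [simp]:
  "\<zero>\<^bsub>R U\<^esub> \<in> \<O> U" "\<one>\<^bsub>R U\<^esub> \<in> \<O> U"
  "a \<in> \<O> U \<Longrightarrow> b \<in> \<O> U \<Longrightarrow> a \<oplus>\<^bsub>R U\<^esub> b \<in> \<O> U"
  "a \<in> \<O> U \<Longrightarrow> b \<in> \<O> U \<Longrightarrow> a \<otimes>\<^bsub>R U\<^esub> b \<in> \<O> U"
  "a \<in> \<O> U \<Longrightarrow> b \<in> \<O> U \<Longrightarrow> a \<ominus>\<^bsub>R U\<^esub> b \<in> \<O> U"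
  "a \<in> \<O> U \<Longrightarrow> \<ominus>\<^bsub>R U\<^esub> a \<in> \<O> U"
  by auto

lemma R_simps [simp]:
  "a \<in> \<O> U \<Longrightarrow> \<zero>\<^bsub>R U\<^esub> \<oplus>\<^bsub>R U\<^esub> a = a"
  "a \<in> \<O> U \<Longrightarrow> a \<oplus>\<^bsub>R U\<^esub> \<zero>\<^bsub>R U\<^esub> = a"
  "a \<in> \<O> U \<Longrightarrow> \<one>\<^bsub>R U\<^esub> \<otimes>\<^bsub>R U\<^esub> a = a"
  "a \<in> \<O> U \<Longrightarrow> a \<otimes>\<^bsub>R U\<^esub> \<one>\<^bsub>R U\<^esub> = a"
  "a \<in> \<O> U \<Longrightarrow> \<zero>\<^bsub>R U\<^esub> \<otimes>\<^bsub>R U\<^esub> a = \<zero>\<^bsub>R U\<^esub>"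
  "a \<in> \<O> U \<Longrightarrow> a \<otimes>\<^bsub>R U\<^esub> \<zero>\<^bsub>R U\<^esub> = \<zero>\<^bsub>R U\<^esub>"
  by auto

lemma R_ac:
  "\<lbrakk>a \<in> \<O> U; b \<in> \<O> U; c \<in> \<O> U\<rbrakk> \<Longrightarrow>
    a \<oplus>\<^bsub>R U\<^esub> b \<oplus>\<^bsub>R U\<^esub> c = a \<oplus>\<^bsub>R U\<^esub> (b \<oplus>\<^bsub>R U\<^esub> c)"
  "a \<in> \<O> U \<Longrightarrow> b \<in> \<O> U \<Longrightarrow> a \<oplus>\<^bsub>R U\<^esub> b = b \<oplus>\<^bsub>R U\<^esub> a"
  "\<lbrakk>a \<in> \<O> U; b \<in> \<O> U; c \<in> \<O> U\<rbrakk> \<Longrightarrow>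
    a \<oplus>\<^bsub>R U\<^esub> (b \<oplus>\<^bsub>R U\<^esub> c) = b \<oplus>\<^bsub>R U\<^esub> (a \<oplus>\<^bsub>R U\<^esub> c)"
  "\<lbrakk>a \<in> \<O> U; b \<in> \<O> U; c \<in> \<O> U\<rbrakk> \<Longrightarrow>
    a \<otimes>\<^bsub>R U\<^esub> b \<otimes>\<^bsub>R U\<^esub> c = a \<otimes>\<^bsub>R U\<^esub> (b \<otimes>\<^bsub>R U\<^esub> c)"
  "a \<in> \<O> U \<Longrightarrow> b \<in> \<O> U \<Longrightarrow> a \<otimes>\<^bsub>R U\<^esub> b = b \<otimes>\<^bsub>R U\<^esub> a"
  "\<lbrakk>a \<in> \<O> U; b \<in> \<O> U; c \<in> \<O> U\<rbrakk> \<Longrightarrow>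
    a \<otimes>\<^bsub>R U\<^esub> (b \<otimes>\<^bsub>R U\<^esub> c) = b \<otimes>\<^bsub>R U\<^esub> (a \<otimes>\<^bsub>R U\<^esub> c)"
  by (simp_all add: a_ac m_ac)

lemma R_distr:
  "\<lbrakk>a \<in> \<O> U; b \<in> \<O> U; c \<in> \<O> U\<rbrakk> \<Longrightarrow>
    (a \<oplus>\<^bsub>R U\<^esub> b) \<otimes>\<^bsub>R U\<^esub> c = a \<otimes>\<^bsub>R U\<^esub> c \<oplus>\<^bsub>R U\<^esub> b \<otimes>\<^bsub>R U\<^esub> c"
  "\<lbrakk>a \<in> \<O> U; b \<in> \<O> U; c \<in> \<O> U\<rbrakk> \<Longrightarrow>
    c \<otimes>\<^bsub>R U\<^esub> (a \<oplus>\<^bsub>R U\<^esub> b) = c \<otimes>\<^bsub>R U\<^esub> a \<oplus>\<^bsub>R U\<^esub> c \<otimes>\<^bsub>R U\<^esub> b"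
  by (simp_all add: l_distr r_distr)

end

lemma rr_simps [simp]:
  assumes "opn U" "opn V" "V \<subseteq> U"
  shows "rr U V \<zero>\<^bsub>R U\<^esub> = \<zero>\<^bsub>R V\<^esub>" "rr U V \<one>\<^bsub>R U\<^esub> = \<one>\<^bsub>R V\<^esub>"
    "a \<in> \<O> U \<Longrightarrow> b \<in> \<O> U \<Longrightarrow> rr U V (a \<oplus>\<^bsub>R U\<^esub> b) = rr U V a \<oplus>\<^bsub>R V\<^esub> rr U V b"
    "a \<in> \<O> U \<Longrightarrow> b \<in> \<O> U \<Longrightarrow> rr U V (a \<otimes>\<^bsub>R U\<^esub> b) = rr U V a \<otimes>\<^bsub>R V\<^esub> rr U V b"
    "a \<in> \<O> U \<Longrightarrow> rr U V (\<ominus>\<^bsub>R U\<^esub> a) = \<ominus>\<^bsub>R V\<^esub> rr U V a"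
    "a \<in> \<O> U \<Longrightarrow> b \<in> \<O> U \<Longrightarrow> rr U V (a \<ominus>\<^bsub>R U\<^esub> b) = rr U V a \<ominus>\<^bsub>R V\<^esub> rr U V b"
proof -
  interpret ring_hom_cring "R U" "R V" "rr U V"
    using rr_hom[OF assms] cring_R assms by (simp add: ring_hom_cring_def ring_hom_cring_axioms_def)
  show "rr U V \<zero>\<^bsub>R U\<^esub> = \<zero>\<^bsub>R V\<^esub>" "rr U V \<one>\<^bsub>R U\<^esub> = \<one>\<^bsub>R V\<^esub>"
    "a \<in> \<O> U \<Longrightarrow> b \<in> \<O> U \<Longrightarrow> rr U V (a \<oplus>\<^bsub>R U\<^esub> b) = rr U V a \<oplus>\<^bsub>R V\<^esub> rr U V b"
    "a \<in> \<O> U \<Longrightarrow> b \<in> \<O> U \<Longrightarrow> rr U V (a \<otimes>\<^bsub>R U\<^esub> b) = rr U V a \<otimes>\<^bsub>R V\<^esub> rr U V b"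
    "a \<in> \<O> U \<Longrightarrow> rr U V (\<ominus>\<^bsub>R U\<^esub> a) = \<ominus>\<^bsub>R V\<^esub> rr U V a"
    "a \<in> \<O> U \<Longrightarrow> b \<in> \<O> U \<Longrightarrow> rr U V (a \<ominus>\<^bsub>R U\<^esub> b) = rr U V a \<ominus>\<^bsub>R V\<^esub> rr U V b"
    by (simp_all add: a_minus_def)
qed

section \<open>Arithmetic in presheaves of modules\<close>

context
  fixes M :: "('a, 'r, 'm) mod_presheaf"
  assumes M: "mod_pre X M"
begin

lemma pre_module: "opn U \<Longrightarrow> module (R U) (M$U)"
  and pre_presheaf: "is_presheaf X M"
  using M by (auto simp: mod_pre_def)

lemmas res_closed [simp] = pre_closed[OF pre_presheaf]
lemmas res_id [simp] = pre_id[OF pre_presheaf]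
lemmas res_trans [simp] = pre_trans[OF pre_presheaf]

lemma res_simps [simp]:
  assumes "opn U" "opn V" "V \<subseteq> U" "x \<in> sec M U"
  shows "y \<in> sec M U \<Longrightarrow>
      restr M U V (x \<oplus>\<^bsub>M$U\<^esub> y) = restr M U V x \<oplus>\<^bsub>M$V\<^esub> restr M U V y"
    "r \<in> \<O> U \<Longrightarrow> restr M U V (r \<odot>\<^bsub>M$U\<^esub> x) = rr U V r \<odot>\<^bsub>M$V\<^esub> restr M U V x"
  using M assms by (auto simp: mod_pre_def)

context
  fixes U assumes U: "opn U"
begin

interpretation module "R U" "M$U" using pre_module[OF U] .

lemma mod_closed [simp]:
  "\<zero>\<^bsub>M$U\<^esub> \<in> sec M U"
  "x \<in> sec M U \<Longrightarrow> y \<in> sec M U \<Longrightarrow> x \<oplus>\<^bsub>M$U\<^esub> y \<in> sec M U"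
  "x \<in> sec M U \<Longrightarrow> y \<in> sec M U \<Longrightarrow> x \<ominus>\<^bsub>M$U\<^esub> y \<in> sec M U"
  "x \<in> sec M U \<Longrightarrow> \<ominus>\<^bsub>M$U\<^esub> x \<in> sec M U"
  "r \<in> \<O> U \<Longrightarrow> x \<in> sec M U \<Longrightarrow> r \<odot>\<^bsub>M$U\<^esub> x \<in> sec M U"
  by auto

lemma mod_simps [simp]:
  "x \<in> sec M U \<Longrightarrow> \<zero>\<^bsub>M$U\<^esub> \<oplus>\<^bsub>M$U\<^esub> x = x"
  "x \<in> sec M U \<Longrightarrow> x \<oplus>\<^bsub>M$U\<^esub> \<zero>\<^bsub>M$U\<^esub> = x"
  "x \<in> sec M U \<Longrightarrow> \<one>\<^bsub>R U\<^esub> \<odot>\<^bsub>M$U\<^esub> x = x"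
  "x \<in> sec M U \<Longrightarrow> \<zero>\<^bsub>R U\<^esub> \<odot>\<^bsub>M$U\<^esub> x = \<zero>\<^bsub>M$U\<^esub>"
  "r \<in> \<O> U \<Longrightarrow> r \<odot>\<^bsub>M$U\<^esub> \<zero>\<^bsub>M$U\<^esub> = \<zero>\<^bsub>M$U\<^esub>"
  by auto

lemma mod_ac:
  "\<lbrakk>x \<in> sec M U; y \<in> sec M U; z \<in> sec M U\<rbrakk> \<Longrightarrow>
    x \<oplus>\<^bsub>M$U\<^esub> y \<oplus>\<^bsub>M$U\<^esub> z = x \<oplus>\<^bsub>M$U\<^esub> (y \<oplus>\<^bsub>M$U\<^esub> z)"
  "x \<in> sec M U \<Longrightarrow> y \<in> sec M U \<Longrightarrow>
    x \<oplus>\<^bsub>M$U\<^esub> y = y \<oplus>\<^bsub>M$U\<^esub> x"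
  "\<lbrakk>x \<in> sec M U; y \<in> sec M U; z \<in> sec M U\<rbrakk> \<Longrightarrow>
    x \<oplus>\<^bsub>M$U\<^esub> (y \<oplus>\<^bsub>M$U\<^esub> z) = y \<oplus>\<^bsub>M$U\<^esub> (x \<oplus>\<^bsub>M$U\<^esub> z)"
  by (simp_all add: M.a_ac)

lemma mod_smult:
  "\<lbrakk>r \<in> \<O> U; x \<in> sec M U; y \<in> sec M U\<rbrakk> \<Longrightarrow>
    r \<odot>\<^bsub>M$U\<^esub> (x \<oplus>\<^bsub>M$U\<^esub> y) = r \<odot>\<^bsub>M$U\<^esub> x \<oplus>\<^bsub>M$U\<^esub> r \<odot>\<^bsub>M$U\<^esub> y"
  "\<lbrakk>r \<in> \<O> U; s \<in> \<O> U; x \<in> sec M U\<rbrakk> \<Longrightarrow>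
    (r \<oplus>\<^bsub>R U\<^esub> s) \<odot>\<^bsub>M$U\<^esub> x = r \<odot>\<^bsub>M$U\<^esub> x \<oplus>\<^bsub>M$U\<^esub> s \<odot>\<^bsub>M$U\<^esub> x"
  by (simp_all add: smult_r_distr smult_l_distr)

lemma mod_assoc:
  "\<lbrakk>r \<in> \<O> U; s \<in> \<O> U; x \<in> sec M U\<rbrakk> \<Longrightarrow>
    (r \<otimes>\<^bsub>R U\<^esub> s) \<odot>\<^bsub>M$U\<^esub> x = r \<odot>\<^bsub>M$U\<^esub> (s \<odot>\<^bsub>M$U\<^esub> x)"
  by (simp add: smult_assoc1)

lemma mod_minus:
  "x \<in> sec M U \<Longrightarrow> (\<ominus>\<^bsub>R U\<^esub> \<one>\<^bsub>R U\<^esub>) \<odot>\<^bsub>M$U\<^esub> x = \<ominus>\<^bsub>M$U\<^esub> x"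
  by (simp add: smult_l_minus)

text \<open>Subtraction becomes addition of a multiple by -1, so that additivity and homogeneity of
  a map already cover differences.\<close>

lemma mod_diff:
  "x \<in> sec M U \<Longrightarrow> y \<in> sec M U \<Longrightarrow>
   x \<ominus>\<^bsub>M$U\<^esub> y = x \<oplus>\<^bsub>M$U\<^esub> (\<ominus>\<^bsub>R U\<^esub> \<one>\<^bsub>R U\<^esub>) \<odot>\<^bsub>M$U\<^esub> y"
  by (simp add: smult_l_minus a_minus_def)

end

lemma res_zero [simp]:
  assumes "opn U" "opn V" "V \<subseteq> U"
  shows "restr M U V \<zero>\<^bsub>M$U\<^esub> = \<zero>\<^bsub>M$V\<^esub>"
  using res_simps(2)[OF assms, of "\<zero>\<^bsub>M$U\<^esub>" "\<zero>\<^bsub>R U\<^esub>"] assms by simp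

lemma res_neg [simp]:
  assumes "opn U" "opn V" "V \<subseteq> U" "x \<in> sec M U"
  shows "restr M U V (\<ominus>\<^bsub>M$U\<^esub> x) = \<ominus>\<^bsub>M$V\<^esub> restr M U V x"
  using res_simps(2)[OF assms, of "\<ominus>\<^bsub>R U\<^esub> \<one>\<^bsub>R U\<^esub>"] assms by (simp add: mod_minus)

lemma res_diff [simp]:
  assumes "opn U" "opn V" "V \<subseteq> U" "x \<in> sec M U" "y \<in> sec M U"
  shows "restr M U V (x \<ominus>\<^bsub>M$U\<^esub> y) = restr M U V x \<ominus>\<^bsub>M$V\<^esub> restr M U V y"
  using assms by (simp add: a_minus_def)

end

lemma mod_preI:
  assumes "is_presheaf X M" "\<And>U. opn U \<Longrightarrow> module (R U) (M$U)"
    and "\<And>U V x y. \<lbrakk>opn U; opn V; V \<subseteq> U; x \<in> sec M U;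
      y \<in> sec M U\<rbrakk> \<Longrightarrow>
      restr M U V (x \<oplus>\<^bsub>M$U\<^esub> y) = restr M U V x \<oplus>\<^bsub>M$V\<^esub> restr M U V y"
    and "\<And>U V x r. \<lbrakk>opn U; opn V; V \<subseteq> U; x \<in> sec M U;
      r \<in> \<O> U\<rbrakk> \<Longrightarrow>
      restr M U V (r \<odot>\<^bsub>M$U\<^esub> x) = rr U V r \<odot>\<^bsub>M$V\<^esub> restr M U V x"
  shows "mod_pre X M"
  using assms by (simp add: mod_pre_def)

lemma is_presheafI:
  assumes "\<And>U V s. \<lbrakk>opn U; opn V; V \<subseteq> U; s \<in> sec F U\<rbrakk> \<Longrightarrow>
      restr F U V s \<in> sec F V"
    and "\<And>U s. opn U \<Longrightarrow> s \<in> sec F U \<Longrightarrow> restr F U U s = s"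
    and "\<And>U V W s. \<lbrakk>opn U; opn V; V \<subseteq> U; opn W; W \<subseteq> V;
      s \<in> sec F U\<rbrakk> \<Longrightarrow> restr F V W (restr F U V s) = restr F U W s"
  shows "is_presheaf X F"
  using assms by (auto simp: is_presheaf_def)

text \<open>The last hypothesis replaces inverses: (-1 + 1) x = 0 x = 0 makes (-1) x the negative of
  x. For each constructed module only zero, addition and scalars then have to be checked.\<close>

lemma moduleI_sub:
  fixes M :: "('r, 'm) module"
  assumes "opn U" and closed: "\<zero>\<^bsub>M\<^esub> \<in> carrier M"
    "\<And>x y. x \<in> carrier M \<Longrightarrow> y \<in> carrier M \<Longrightarrow> x \<oplus>\<^bsub>M\<^esub> y \<in> carrier M"
    "\<And>r x. r \<in> \<O> U \<Longrightarrow> x \<in> carrier M \<Longrightarrow> r \<odot>\<^bsub>M\<^esub> x \<in> carrier M"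
    and ac: "\<And>x y z. \<lbrakk>x \<in> carrier M; y \<in> carrier M; z \<in> carrier M\<rbrakk> \<Longrightarrow>
      x \<oplus>\<^bsub>M\<^esub> y \<oplus>\<^bsub>M\<^esub> z = x \<oplus>\<^bsub>M\<^esub> (y \<oplus>\<^bsub>M\<^esub> z)"
    "\<And>x y. x \<in> carrier M \<Longrightarrow> y \<in> carrier M \<Longrightarrow> x \<oplus>\<^bsub>M\<^esub> y = y \<oplus>\<^bsub>M\<^esub> x"
    "\<And>x. x \<in> carrier M \<Longrightarrow> \<zero>\<^bsub>M\<^esub> \<oplus>\<^bsub>M\<^esub> x = x"
    and sm: "\<And>r x y. \<lbrakk>r \<in> \<O> U; x \<in> carrier M; y \<in> carrier M\<rbrakk> \<Longrightarrow>
      r \<odot>\<^bsub>M\<^esub> (x \<oplus>\<^bsub>M\<^esub> y) = r \<odot>\<^bsub>M\<^esub> x \<oplus>\<^bsub>M\<^esub> r \<odot>\<^bsub>M\<^esub> y"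
    "\<And>r s x. \<lbrakk>r \<in> \<O> U; s \<in> \<O> U; x \<in> carrier M\<rbrakk> \<Longrightarrow>
      (r \<oplus>\<^bsub>R U\<^esub> s) \<odot>\<^bsub>M\<^esub> x = r \<odot>\<^bsub>M\<^esub> x \<oplus>\<^bsub>M\<^esub> s \<odot>\<^bsub>M\<^esub> x"
    "\<And>r s x. \<lbrakk>r \<in> \<O> U; s \<in> \<O> U; x \<in> carrier M\<rbrakk> \<Longrightarrow>
      (r \<otimes>\<^bsub>R U\<^esub> s) \<odot>\<^bsub>M\<^esub> x = r \<odot>\<^bsub>M\<^esub> (s \<odot>\<^bsub>M\<^esub> x)"
    "\<And>x. x \<in> carrier M \<Longrightarrow> \<one>\<^bsub>R U\<^esub> \<odot>\<^bsub>M\<^esub> x = x"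
    "\<And>x. x \<in> carrier M \<Longrightarrow> \<zero>\<^bsub>R U\<^esub> \<odot>\<^bsub>M\<^esub> x = \<zero>\<^bsub>M\<^esub>"
  shows "module (R U) M"
proof (rule moduleI)
  interpret cring "R U" using cring_R[OF \<open>opn U\<close>] .
  show "cring (R U)" ..
  show "abelian_group M"
  proof (rule abelian_groupI)
    fix x assume x: "x \<in> carrier M"
    have "((\<ominus>\<^bsub>R U\<^esub> \<one>\<^bsub>R U\<^esub>) \<oplus>\<^bsub>R U\<^esub> \<one>\<^bsub>R U\<^esub>) \<odot>\<^bsub>M\<^esub> x = \<zero>\<^bsub>M\<^esub>"
      using sm(5)[OF x] by (simp add: l_neg)
    then have "(\<ominus>\<^bsub>R U\<^esub> \<one>\<^bsub>R U\<^esub>) \<odot>\<^bsub>M\<^esub> x \<oplus>\<^bsub>M\<^esub> x = \<zero>\<^bsub>M\<^esub>"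
      using sm(2)[of "\<ominus>\<^bsub>R U\<^esub> \<one>\<^bsub>R U\<^esub>" "\<one>\<^bsub>R U\<^esub>" x] x sm(4) by simp
    then show "\<exists>y\<in>carrier M. y \<oplus>\<^bsub>M\<^esub> x = \<zero>\<^bsub>M\<^esub>"
      using closed(3)[of "\<ominus>\<^bsub>R U\<^esub> \<one>\<^bsub>R U\<^esub>" x] x by blast
  qed (use assms in simp_all)
qed (use assms in simp_all)

section \<open>Gluing\<close>

text \<open>The open sets on which the two sections agree cover \<open>U\<close>, so separatedness
  applies to that cover.\<close>

lemma sheaf_eqI:
  assumes F: "is_sheaf X F" and U: "opn U"
    and st: "s \<in> sec F U" "t \<in> sec F U"
    and loc: "\<And>x. x \<in> U \<Longrightarrow> \<exists>V. opn V \<and> x \<in> V \<and> V \<subseteq> U \<and> restr F U V s = restr F U V t"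
  shows "s = t"
proof -
  define \<V> where "\<V> = {V. opn V \<and> V \<subseteq> U \<and> restr F U V s = restr F U V t}"
  have "\<Union>\<V> = U" using loc by (auto simp: \<V>_def)
  moreover have "\<V> \<subseteq> opens X (pts X)" by (auto simp: \<V>_def dest: openin_subset)
  moreover have "\<forall>V\<in>\<V>. restr F U V s = restr F U V t" by (simp add: \<V>_def)
  ultimately show ?thesis using F st unfolding is_sheaf_def by metis
qed

text \<open>Gluing for a local specification \<open>P\<close> instead of a compatible family. Two
  local solutions agree on overlaps because both restrict to solutions there and solutions are
  unique.\<close>

lemma sheaf_glue:
  assumes F: "is_sheaf X F" and U: "opn U"
    and loc: "\<And>x. x \<in> U \<Longrightarrow> \<exists>V. opn V \<and> x \<in> V \<and> V \<subseteq> U \<and> (\<exists>s\<in>sec F V. P V s)"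
    and res: "\<And>V W s. \<lbrakk>opn V; opn W; W \<subseteq> V; V \<subseteq> U; s \<in> sec F V; P V s\<rbrakk> \<Longrightarrow>
      P W (restr F V W s)"
    and uniq: "\<And>V s t. \<lbrakk>opn V; V \<subseteq> U; s \<in> sec F V; t \<in> sec F V;
      P V s; P V t\<rbrakk> \<Longrightarrow> s = t"
  obtains s where "s \<in> sec F U"
    "\<And>V t. \<lbrakk>opn V; V \<subseteq> U; t \<in> sec F V; P V t\<rbrakk> \<Longrightarrow> restr F U V s = t"
proof -
  have pre: "is_presheaf X F" using F by (simp add: is_sheaf_def)
  note [simp] = pre_closed[OF pre]
  define \<V> where "\<V> = {V. opn V \<and> V \<subseteq> U \<and> (\<exists>s\<in>sec F V. P V s)}"
  define \<sigma> where "\<sigma> V = (SOME s. s \<in> sec F V \<and> P V s)" for V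
  have \<sigma>: "\<sigma> V \<in> sec F V \<and> P V (\<sigma> V)" if "V \<in> \<V>" for V
  proof -
    have "\<exists>s. s \<in> sec F V \<and> P V s" using that by (auto simp only: \<V>_def)
    from someI_ex[OF this] show ?thesis by (simp add: \<sigma>_def)
  qed
  have un: "\<Union>\<V> = U"
  proof
    show "U \<subseteq> \<Union>\<V>" using loc unfolding \<V>_def by blast
  qed (auto simp only: \<V>_def)
  have sub: "\<V> \<subseteq> opens X (pts X)" by (auto simp only: \<V>_def opens_iff opn_pts)
  have comp: "restr F V (V \<inter> W) (\<sigma> V) = restr F W (V \<inter> W) (\<sigma> W)" if "V \<in> \<V>" "W \<in> \<V>" for V W
  proof (rule uniq)
    have VW: "opn V" "V \<subseteq> U" "opn W" "W \<subseteq> U" using that by (auto simp only: \<V>_def)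
    note VW' = \<sigma> [OF that(1)] \<sigma> [OF that(2)]
    show "opn (V \<inter> W)" "V \<inter> W \<subseteq> U" using VW by auto
    show "restr F V (V \<inter> W) (\<sigma> V) \<in> sec F (V \<inter> W)"
      "restr F W (V \<inter> W) (\<sigma> W) \<in> sec F (V \<inter> W)" using VW VW' by simp_all
    show "P (V \<inter> W) (restr F V (V \<inter> W) (\<sigma> V))" using VW VW' by (intro res) simp_all
    show "P (V \<inter> W) (restr F W (V \<inter> W) (\<sigma> W))" using VW VW' by (intro res) simp_all
  qed
  have \<sigma>': "\<forall>V\<in>\<V>. \<sigma> V \<in> sec F V" using \<sigma> by blast
  have comp': "\<forall>V\<in>\<V>. \<forall>W\<in>\<V>. restr F V (V \<inter> W) (\<sigma> V) = restr F W (V \<inter> W) (\<sigma> W)"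
    by (intro ballI comp)
  have "\<exists>s\<in>sec F (\<Union>\<V>). \<forall>V\<in>\<V>. restr F (\<Union>\<V>) V s = \<sigma> V"
    by (rule F[unfolded is_sheaf_def, THEN conjunct2, THEN spec, THEN mp, OF sub,
          THEN conjunct2, THEN spec, THEN mp, OF conjI[OF \<sigma>' comp']])
  then obtain s where s: "s \<in> sec F U" "\<And>V. V \<in> \<V> \<Longrightarrow> restr F U V s = \<sigma> V"
    unfolding un by blast
  show ?thesis
  proof (rule that[OF s(1)])
    fix V t assume "opn V" "V \<subseteq> U" "t \<in> sec F V" "P V t"
    then show "restr F U V s = t"
      using s(2)[of V] \<sigma> [of V] uniq[of V "\<sigma> V" t] unfolding \<V>_def by blast
  qed
qed

section \<open>Morphisms\<close>

lemma linI:
  assumes "\<And>V x. \<lbrakk>opn V; V \<subseteq> U; x \<in> sec M V\<rbrakk> \<Longrightarrow> f V x \<in> sec N V"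
    and "\<And>V x y. \<lbrakk>opn V; V \<subseteq> U; x \<in> sec M V; y \<in> sec M V\<rbrakk> \<Longrightarrow>
      f V (x \<oplus>\<^bsub>M$V\<^esub> y) = f V x \<oplus>\<^bsub>N$V\<^esub> f V y"
    and "\<And>V x r. \<lbrakk>opn V; V \<subseteq> U; x \<in> sec M V; r \<in> \<O> V\<rbrakk> \<Longrightarrow>
      f V (r \<odot>\<^bsub>M$V\<^esub> x) = r \<odot>\<^bsub>N$V\<^esub> f V x"
    and "\<And>V W x. \<lbrakk>opn V; V \<subseteq> U; opn W; W \<subseteq> V; x \<in> sec M V\<rbrakk> \<Longrightarrow>
      f W (restr M V W x) = restr N V W (f V x)"
  shows "lin X U M N f"
  using assms by (simp add: lin_def)

lemma mkhom_apply [simp]: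
  "\<lbrakk>opn V; V \<subseteq> U; x \<in> sec M V\<rbrakk> \<Longrightarrow> mkhom X U M f V x = f V x"
  by (simp add: mkhom_def)

lemma mkhom_in:
  assumes "mod_pre X M" "lin X U M N f" shows "mkhom X U M f \<in> mod_homs X U M N"
proof -
  have "mkhom X U M f V x = f V x" if "V \<in> opens X U" "x \<in> sec M V" for V x
    using that by simp
  moreover have "W \<in> opens X U" if "V \<in> opens X U" "W \<in> opens X V" for V W
    using that order_trans[of W V U] by simp
  ultimately have "lin X U M N (mkhom X U M f)"
    using assms by (simp add: lin_def del: opens_iff) (simp add: opens_def)
  then show ?thesis by (simp add: hom_iff mkhom_def)
qed

lemma mkhomI:
  assumes "mod_pre X M"
    and "\<And>V x. \<lbrakk>opn V; V \<subseteq> U; x \<in> sec M V\<rbrakk> \<Longrightarrow> f V x \<in> sec N V"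
    and "\<And>V x y. \<lbrakk>opn V; V \<subseteq> U; x \<in> sec M V; y \<in> sec M V\<rbrakk> \<Longrightarrow>
      f V (x \<oplus>\<^bsub>M$V\<^esub> y) = f V x \<oplus>\<^bsub>N$V\<^esub> f V y"
    and "\<And>V x r. \<lbrakk>opn V; V \<subseteq> U; x \<in> sec M V; r \<in> \<O> V\<rbrakk> \<Longrightarrow>
      f V (r \<odot>\<^bsub>M$V\<^esub> x) = r \<odot>\<^bsub>N$V\<^esub> f V x"
    and "\<And>V W x. \<lbrakk>opn V; V \<subseteq> U; opn W; W \<subseteq> V; x \<in> sec M V\<rbrakk> \<Longrightarrow>
      f W (restr M V W x) = restr N V W (f V x)"
  shows "mkhom X U M f \<in> mod_homs X U M N"
  using assms by (intro mkhom_in linI)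

text \<open>The targets may differ, since extensionality involves only the source.\<close>

lemma hom_eqI:
  assumes "f \<in> mod_homs X U M N" "g \<in> mod_homs X U M N'"
    and "\<And>V x. \<lbrakk>opn V; V \<subseteq> U; x \<in> sec M V\<rbrakk> \<Longrightarrow> f V x = g V x"
  shows "f = g"
proof (rule extensionalityI[of _ "opens X U"])
  fix V assume "V \<in> opens X U"
  then show "f V = g V"
    using assms by (intro extensionalityI[of _ "sec M V"]) (auto simp: hom_iff)
qed (use assms in \<open>auto simp: hom_iff\<close>)

lemma hom_simps:
  assumes "f \<in> mod_homs X U M N" "opn V" "V \<subseteq> U" "x \<in> sec M V"
  shows hom_closed: "f V x \<in> sec N V"
    and hom_add: "y \<in> sec M V \<Longrightarrow>
      f V (x \<oplus>\<^bsub>M$V\<^esub> y) = f V x \<oplus>\<^bsub>N$V\<^esub> f V y"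
    and hom_smult: "r \<in> \<O> V \<Longrightarrow> f V (r \<odot>\<^bsub>M$V\<^esub> x) = r \<odot>\<^bsub>N$V\<^esub> f V x"
    and hom_res: "opn W \<Longrightarrow> W \<subseteq> V \<Longrightarrow> f W (restr M V W x) = restr N V W (f V x)"
  using assms by (auto simp: mod_homs_def)

lemma hom_more:
  assumes "f \<in> mod_homs X U M N" "mod_pre X M" "mod_pre X N" "opn V" "V \<subseteq> U"
  shows hom_zero: "f V \<zero>\<^bsub>M$V\<^esub> = \<zero>\<^bsub>N$V\<^esub>"
    and hom_neg: "x \<in> sec M V \<Longrightarrow> f V (\<ominus>\<^bsub>M$V\<^esub> x) = \<ominus>\<^bsub>N$V\<^esub> f V x"
    and hom_diff: "x \<in> sec M V \<Longrightarrow> y \<in> sec M V \<Longrightarrow>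
      f V (x \<ominus>\<^bsub>M$V\<^esub> y) = f V x \<ominus>\<^bsub>N$V\<^esub> f V y"
proof -
  show "f V \<zero>\<^bsub>M$V\<^esub> = \<zero>\<^bsub>N$V\<^esub>"
    using hom_smult[OF assms(1,4,5), of "\<zero>\<^bsub>M$V\<^esub>" "\<zero>\<^bsub>R V\<^esub>"]
      hom_closed[OF assms(1,4,5), of "\<zero>\<^bsub>M$V\<^esub>"] assms by simp
  have neg: "f V (\<ominus>\<^bsub>M$V\<^esub> x) = \<ominus>\<^bsub>N$V\<^esub> f V x" if "x \<in> sec M V" for x
    using hom_smult[OF assms(1,4,5), of x "\<ominus>\<^bsub>R V\<^esub> \<one>\<^bsub>R V\<^esub>"] hom_closed[OF assms(1,4,5), of x]
      assms that by (simp add: mod_minus)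
  then show "x \<in> sec M V \<Longrightarrow> f V (\<ominus>\<^bsub>M$V\<^esub> x) = \<ominus>\<^bsub>N$V\<^esub> f V x" .
  show "x \<in> sec M V \<Longrightarrow> y \<in> sec M V \<Longrightarrow>
      f V (x \<ominus>\<^bsub>M$V\<^esub> y) = f V x \<ominus>\<^bsub>N$V\<^esub> f V y"
    using assms by (simp add: a_minus_def neg hom_add[OF assms(1)])
qed

lemma hom_restrict: "f \<in> mod_homs X U M N \<Longrightarrow> V \<subseteq> U \<Longrightarrow> restrict f (opens X V) \<in> mod_homs X V M N"
  unfolding hom_iff lin_def by (auto simp: subset_iff)

lemma struct_simps [simp]:
  "sec OX U = \<O> U"
  "\<zero>\<^bsub>OX$U\<^esub> = \<zero>\<^bsub>R U\<^esub>"
  "a \<oplus>\<^bsub>OX$U\<^esub> b = a \<oplus>\<^bsub>R U\<^esub> b"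
  "r \<odot>\<^bsub>OX$U\<^esub> a = r \<otimes>\<^bsub>R U\<^esub> a"
  "restr OX = rr"
  by (simp_all add: struct_module_def)

text \<open>The structure module has the same sections and restrictions as the structure sheaf, and
  the sheaf condition sees nothing else.\<close>

lemma is_sheaf_struct: "is_sheaf X OX"
  using sheaf_R unfolding is_sheaf_def is_presheaf_def by (simp only: struct_simps)

lemma struct_sheaf [simp]: "module_sheaf X OX"
  unfolding module_sheaf_iff
proof (intro conjI is_sheaf_struct mod_preI)
  show "is_presheaf X OX" using is_sheaf_struct by (simp add: is_sheaf_def)
  fix U assume "opn U"
  then show "module (R U) (OX$U)"
    by (intro moduleI_sub) (auto simp: R_distr R_ac)
qed auto

lemma mod_id_apply [simp]: "opn V \<Longrightarrow> x \<in> sec M V \<Longrightarrow> mod_id X M V x = x"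
  by (simp add: mod_id_def)

lemma mod_comp_apply [simp]:
  "opn V \<Longrightarrow> x \<in> sec M V \<Longrightarrow> mod_comp X M g f V x = g V (f V x)"
  by (simp add: mod_comp_def)

lemma mod_id_hom: "mod_pre X M \<Longrightarrow> mod_id X M \<in> mod_homs X (pts X) M M"
  using mkhomI[of M "pts X" "\<lambda>V x. x" M] by (simp add: mkhom_def mod_id_def)

lemma mod_comp_hom:
  assumes "mod_pre X M" "f \<in> mod_homs X (pts X) M N" "g \<in> mod_homs X (pts X) N K"
  shows "mod_comp X M g f \<in> mod_homs X (pts X) M K"
  using assms mkhomI[of M "pts X" "\<lambda>V x. g V (f V x)" K]
  by (simp add: mkhom_def mod_comp_def hom_simps[OF assms(2)] hom_simps[OF assms(3)])

lemma iso_hom: "f \<in> mod_isos X M N \<Longrightarrow> f \<in> mod_homs X (pts X) M N"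
  and iso_bij: "f \<in> mod_isos X M N \<Longrightarrow> opn V \<Longrightarrow>
    bij_betw (f V) (sec M V) (sec N V)"
  by (auto simp: mod_isos_def)

lemma mod_id_iso: "mod_pre X M \<Longrightarrow> mod_id X M \<in> mod_isos X M M"
proof -
  assume M: "mod_pre X M"
  have "bij_betw (mod_id X M V) (sec M V) (sec M V)" if "opn V" for V
    using that by (intro bij_betw_byWitness[where f' = "\<lambda>x. x"]) auto
  then show ?thesis using mod_id_hom[OF M] by (simp add: mod_isos_def)
qed

lemma isoI_inverse:
  assumes "f \<in> mod_homs X (pts X) M N" "g \<in> mod_homs X (pts X) N M"
    and "\<And>V x. opn V \<Longrightarrow> x \<in> sec M V \<Longrightarrow> g V (f V x) = x"
    and "\<And>V y. opn V \<Longrightarrow> y \<in> sec N V \<Longrightarrow> f V (g V y) = y"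
  shows "f \<in> mod_isos X M N"
proof -
  have "bij_betw (f V) (sec M V) (sec N V)" if "opn V" for V
    using that assms(3,4)
    by (intro bij_betw_byWitness[where f' = "g V"])
      (simp_all add: hom_closed[OF assms(1)] hom_closed[OF assms(2)] image_subset_iff)
  then show ?thesis using assms(1) by (simp add: mod_isos_def)
qed

lemma mod_inv_left:
  assumes "f \<in> mod_isos X M N" "opn V" "x \<in> sec M V"
  shows "mod_inv X M N f V (f V x) = x"
  using iso_bij[OF assms(1,2)] assms
  by (simp add: mod_inv_def bij_betw_def inv_into_f_f hom_closed[OF iso_hom])

lemma mod_inv_right:
  assumes "f \<in> mod_isos X M N" "opn V" "y \<in> sec N V"
  shows "f V (mod_inv X M N f V y) = y"
  using iso_bij[OF assms(1,2)] assms
  by (simp add: mod_inv_def bij_betw_def f_inv_into_f)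

lemma iso_inj:
  assumes "f \<in> mod_isos X M N" "opn V" "x \<in> sec M V" "y \<in> sec M V" "f V x = f V y"
  shows "x = y"
  using iso_bij[OF assms(1,2)] assms by (auto simp: bij_betw_def inj_on_def)

lemma mod_inv_closed:
  assumes "f \<in> mod_isos X M N" "opn V" "y \<in> sec N V"
  shows "mod_inv X M N f V y \<in> sec M V"
  using iso_bij[OF assms(1,2)] assms
  by (simp add: mod_inv_def bij_betw_def inv_into_into)

text \<open>Each law holds for the inverse because it holds after applying \<open>f\<close>, which
  is injective on sections.\<close>

lemma mod_inv_hom:
  assumes f: "f \<in> mod_isos X M N" and "mod_pre X M" "mod_pre X N"
  shows "mod_inv X M N f \<in> mod_homs X (pts X) N M"
proof -
  note [simp] = mod_inv_closed[OF f] mod_inv_right[OF f] hom_simps[OF iso_hom[OF f]]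
  have "mkhom X (pts X) N (mod_inv X M N f) \<in> mod_homs X (pts X) N M"
  proof (rule mkhomI)
    fix V x y assume "opn V" "V \<subseteq> pts X" "x \<in> sec N V" "y \<in> sec N V"
    then show "mod_inv X M N f V (x \<oplus>\<^bsub>N$V\<^esub> y) =
        mod_inv X M N f V x \<oplus>\<^bsub>M$V\<^esub> mod_inv X M N f V y"
      using assms by (intro iso_inj[OF f, of V]) simp_all
  next
    fix V x r assume "opn V" "V \<subseteq> pts X" "x \<in> sec N V" "r \<in> \<O> V"
    then show "mod_inv X M N f V (r \<odot>\<^bsub>N$V\<^esub> x) = r \<odot>\<^bsub>M$V\<^esub> mod_inv X M N f V x"
      using assms by (intro iso_inj[OF f, of V]) simp_all
  next
    fix V W x assume "opn V" "V \<subseteq> pts X" "opn W" "W \<subseteq> V" "x \<in> sec N V"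
    then show "mod_inv X M N f W (restr N V W x) = restr M V W (mod_inv X M N f V x)"
      using assms by (intro iso_inj[OF f, of W]) simp_all
  qed (use assms in simp_all)
  moreover have "mkhom X (pts X) N (mod_inv X M N f) = mod_inv X M N f"
    by (auto simp: mkhom_def mod_inv_def fun_eq_iff)
  ultimately show ?thesis by simp
qed

text \<open>Injectivity over every open set follows from separatedness of \<open>M\<close>. A
  preimage is then glued from local preimages, which are unique by injectivity, and separatedness of
  \<open>N\<close> confirms that the glued section is a preimage.\<close>

lemma isoI_local:
  assumes h: "h \<in> mod_homs X (pts X) M N" and M: "module_sheaf X M" and N: "module_sheaf X N"
    and loc: "\<And>x. x \<in> pts X \<Longrightarrow> \<exists>U. opn U \<and> x \<in> U \<and>
      (\<forall>V. opn V \<longrightarrow> V \<subseteq> U \<longrightarrow> bij_betw (h V) (sec M V) (sec N V))"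
  shows "h \<in> mod_isos X M N"
proof -
  note [simp] = hom_simps[OF h] M N
  have good: "\<exists>V. opn V \<and> x \<in> V \<and> V \<subseteq> U \<and>
      (\<forall>W. opn W \<longrightarrow> W \<subseteq> V \<longrightarrow> bij_betw (h W) (sec M W) (sec N W))"
    if "opn U" "x \<in> U" for U x
  proof -
    obtain V where "opn V" "x \<in> V"
      "\<forall>W. opn W \<longrightarrow> W \<subseteq> V \<longrightarrow> bij_betw (h W) (sec M W) (sec N W)"
      using loc[of x] \<open>x \<in> U\<close> opn_pts[OF \<open>opn U\<close>] by auto
    then show ?thesis using that by (intro exI[of _ "U \<inter> V"]) auto
  qed
  have inj: "s = t" if U: "opn U" and st: "s \<in> sec M U" "t \<in> sec M U" "h U s = h U t" for U s t
  proof (rule sheaf_eqI[OF module_sheaf_sheaf[OF M] U st(1,2)])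
    fix x assume "x \<in> U"
    obtain V where V: "opn V" "x \<in> V" "V \<subseteq> U" "bij_betw (h V) (sec M V) (sec N V)"
      using good[OF U \<open>x \<in> U\<close>] by blast
    have "h V (restr M U V s) = h V (restr M U V t)" using V U st hom_res[OF h U _ _ V(1,3)] by simp
    then have "restr M U V s = restr M U V t"
      using V U st by (auto simp: bij_betw_def inj_on_def)
    then show "\<exists>V. opn V \<and> x \<in> V \<and> V \<subseteq> U \<and> restr M U V s = restr M U V t" using V by blast
  qed
  have surj: "\<exists>s\<in>sec M U. h U s = t" if U: "opn U" and t: "t \<in> sec N U" for U t
  proof -
    have loc': "\<exists>V. opn V \<and> x \<in> V \<and> V \<subseteq> U \<and> (\<exists>s\<in>sec M V. h V s = restr N U V t)" if x: "x \<in> U" for x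
    proof -
      obtain V where V: "opn V" "x \<in> V" "V \<subseteq> U" "bij_betw (h V) (sec M V) (sec N V)"
        using good[OF U x] by blast
      have "restr N U V t \<in> h V ` sec M V" using V U t by (simp add: bij_betw_def)
      then show ?thesis using V by (intro exI[of _ V]) force
    qed
    obtain s where s: "s \<in> sec M U"
      "\<And>V r. \<lbrakk>opn V; V \<subseteq> U; r \<in> sec M V; h V r = restr N U V t\<rbrakk> \<Longrightarrow> restr M U V s = r"
      by (rule sheaf_glue[OF module_sheaf_sheaf[OF M] U, where P = "\<lambda>V s. h V s = restr N U V t"])
        (use loc' U t inj in \<open>auto\<close>)
    have "h U s = t"
    proof (rule sheaf_eqI[OF module_sheaf_sheaf[OF N] U])
      fix x assume "x \<in> U"
      then obtain V r where V: "opn V" "x \<in> V" "V \<subseteq> U" "r \<in> sec M V" "h V r = restr N U V t"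
        using loc' by blast
      then have "restr N U V (h U s) = restr N U V t"
        using s(2)[OF V(1,3,4,5)] s(1) U hom_res[OF h U _ s(1) V(1,3)] by simp
      then show "\<exists>V. opn V \<and> x \<in> V \<and> V \<subseteq> U \<and> restr N U V (h U s) = restr N U V t" using V by blast
    qed (use s U t in auto)
    with s(1) show ?thesis by blast
  qed
  have "bij_betw (h U) (sec M U) (sec N U)" if "opn U" for U
  proof -
    have "inj_on (h U) (sec M U)" using inj[OF that] by (simp add: inj_on_def)
    moreover have "h U ` sec M U = sec N U"
      using that by (fastforce simp: image_iff dest: surj[OF that])
    ultimately show ?thesis by (simp add: bij_betw_def)
  qed
  then show ?thesis using h by (simp add: mod_isos_def)
qed

end

section \<open>The universal property of sheafification\<close>

text \<open>The operations on germs are unions over all representatives. If the terms do not depend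
  on the representatives, such a union is their common value.\<close>

lemma UN_pair_const:
  assumes "q \<in> C" "\<And>V s. (V, s) \<in> C \<Longrightarrow> f V s = g"
  shows "(\<Union>(V, s)\<in>C. f V s) = g"
proof -
  have "(\<Union>(V, s)\<in>C. f V s) = (\<Union>q\<in>C. g)"
    by (rule SUP_cong) (use assms in \<open>auto split: prod.split\<close>)
  then show ?thesis using assms(1) by auto
qed

section \<open>Germs and their arithmetic\<close>

context ringed
begin

context
  fixes P :: "('a, 'r, 'm) mod_presheaf"
  assumes P [simp]: "mod_pre X P"
begin

lemma res_eq_sub:
  assumes "restr P V Z s = restr P W Z t" "opn V" "s \<in> sec P V" "opn W" "t \<in> sec P W"
    "opn Z" "Z \<subseteq> V" "Z \<subseteq> W" "opn Z'" "Z' \<subseteq> Z"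
  shows "restr P V Z' s = restr P W Z' t"
proof -
  have "restr P V Z' s = restr P Z Z' (restr P V Z s)" using assms(2-) by simp
  also have "\<dots> = restr P Z Z' (restr P W Z t)" by (simp only: assms(1))
  also have "\<dots> = restr P W Z' t" using assms(2-) by simp
  finally show ?thesis .
qed

lemma germ_self:
  "\<lbrakk>opn V; s \<in> sec P V; x \<in> V\<rbrakk> \<Longrightarrow> (V, s) \<in> germ X P V s x"
  by (auto simp: germ_def intro: exI[of _ V])

text \<open>A germ is the set of all its representatives, so equality needs two inclusions. Each of
  them intersects the given neighbourhood with the one that witnesses membership.\<close>

lemma germ_eqI:
  assumes V: "opn V" "s \<in> sec P V" and W: "opn W" "t \<in> sec P W"
    and Z: "opn Z" "x \<in> Z" "Z \<subseteq> V" "Z \<subseteq> W" "restr P V Z s = restr P W Z t"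
  shows "germ X P V s x = germ X P W t x"
proof -
  have sub: "germ X P V s x \<subseteq> germ X P W t x"
    if V: "opn V" "s \<in> sec P V" and W: "opn W" "t \<in> sec P W"
      and Z: "Z \<subseteq> V" "Z \<subseteq> W" "restr P V Z s = restr P W Z t" for V W s t
  proof
    fix q assume q: "q \<in> germ X P V s x"
    obtain V' s' where q_def: "q = (V', s')" by (cases q)
    obtain Z' where Z': "opn V'" "x \<in> V'" "s' \<in> sec P V'" "opn Z'" "Z' \<subseteq> V \<inter> V'" "x \<in> Z'"
      "restr P V Z' s = restr P V' Z' s'"
      using q by (auto simp: germ_def q_def)
    have sub: "Z \<inter> Z' \<subseteq> Z" "Z \<inter> Z' \<subseteq> Z'" "opn (Z \<inter> Z')" "Z' \<subseteq> V" "Z' \<subseteq> V'" using Z' \<open>opn Z\<close> by auto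
    have "restr P W (Z \<inter> Z') t = restr P Z (Z \<inter> Z') (restr P W Z t)" using W Z \<open>opn Z\<close> Z' sub by (subst res_trans) auto
    also have "\<dots> = restr P V (Z \<inter> Z') s"
      unfolding Z(3)[symmetric] using V Z \<open>opn Z\<close> Z' sub by (subst res_trans) auto
    also have "\<dots> = restr P Z' (Z \<inter> Z') (restr P V Z' s)" using V Z' sub by (subst res_trans) auto
    also have "\<dots> = restr P V' (Z \<inter> Z') s'" unfolding Z'(7) using Z' sub by (subst res_trans) auto
    finally have "restr P W (Z \<inter> Z') t = restr P V' (Z \<inter> Z') s'" .
    moreover have "Z \<inter> Z' \<in> opens X (W \<inter> V')" "x \<in> Z \<inter> Z'"
      using sub Z Z' \<open>x \<in> Z\<close> by auto
    ultimately show "q \<in> germ X P W t x" unfolding germ_def q_def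
      using Z'(1-3) opens_iff opn_pts by blast
  qed
  show ?thesis using sub[OF V W Z(3-5)] sub[OF W V Z(4,3) Z(5)[symmetric]] by auto
qed

lemma germ_eqD:
  assumes "germ X P V s x = germ X P W t x" "opn W" "t \<in> sec P W" "x \<in> W"
  obtains Z where "opn Z" "x \<in> Z" "Z \<subseteq> V" "Z \<subseteq> W" "restr P V Z s = restr P W Z t"
proof -
  have "(W, t) \<in> germ X P V s x" unfolding assms(1) using assms by (intro germ_self)
  then show ?thesis using that by (auto simp: germ_def)
qed

lemma germ_mem:
  assumes "(W, t) \<in> germ X P V s x" "opn V" "s \<in> sec P V"
  shows "opn W" "t \<in> sec P W" "x \<in> W" "germ X P W t x = germ X P V s x"
proof -
  obtain Z where Z: "opn W" "x \<in> W" "t \<in> sec P W" "opn Z" "Z \<subseteq> V \<inter> W" "x \<in> Z"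
      "restr P V Z s = restr P W Z t"
    using assms(1) by (auto simp: germ_def)
  then show "opn W" "t \<in> sec P W" "x \<in> W" by auto
  show "germ X P W t x = germ X P V s x"
    using Z assms by (intro germ_eqI[of W t V s Z]) auto
qed

lemma germ_restr:
  assumes "opn V" "s \<in> sec P V" "opn W" "W \<subseteq> V" "x \<in> W"
  shows "germ X P W (restr P V W s) x = germ X P V s x"
  using assms by (intro germ_eqI[of W _ V s W]) auto

text \<open>Arbitrary representatives agree with \<open>s\<close> and with \<open>t\<close> on two
  different neighbourhoods. On the intersection of these their sum is the sum of \<open>s\<close>
  and \<open>t\<close>.\<close>

lemma germ_add:
  assumes V: "opn V" "s \<in> sec P V" "t \<in> sec P V" "x \<in> V"
  shows "germ_add X P x (germ X P V s x) (germ X P V t x) = germ X P V (s \<oplus>\<^bsub>P$V\<^esub> t) x"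
proof -
  have "germ X P (V' \<inter> W') (restr P V' (V' \<inter> W') s' \<oplus>\<^bsub>P$(V' \<inter> W')\<^esub> restr P W' (V' \<inter> W') t') x
      = germ X P V (s \<oplus>\<^bsub>P$V\<^esub> t) x"
    if s': "(V', s') \<in> germ X P V s x" and t': "(W', t') \<in> germ X P V t x" for V' s' W' t'
  proof -
    note 1 = germ_mem[OF s' V(1,2)] and 2 = germ_mem[OF t' V(1,3)]
    obtain Z1 where Z1: "opn Z1" "x \<in> Z1" "Z1 \<subseteq> V'" "Z1 \<subseteq> V" "restr P V' Z1 s' = restr P V Z1 s"
      by (rule germ_eqD[OF 1(4) V(1,2,4)])
    obtain Z2 where Z2: "opn Z2" "x \<in> Z2" "Z2 \<subseteq> W'" "Z2 \<subseteq> V" "restr P W' Z2 t' = restr P V Z2 t"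
      by (rule germ_eqD[OF 2(4) V(1,3,4)])
    have sub: "opn (Z1 \<inter> Z2)" "opn (V' \<inter> W')" "Z1 \<inter> Z2 \<subseteq> Z1" "Z1 \<inter> Z2 \<subseteq> Z2" "Z1 \<inter> Z2 \<subseteq> V' \<inter> W'"
      "V' \<inter> W' \<subseteq> V'" "V' \<inter> W' \<subseteq> W'" "Z1 \<inter> Z2 \<subseteq> V" "Z1 \<inter> Z2 \<subseteq> V'" "Z1 \<inter> Z2 \<subseteq> W'"
      using Z1 Z2 1 2 by auto
    have "restr P V' (Z1 \<inter> Z2) s' = restr P V (Z1 \<inter> Z2) s"
      by (rule res_eq_sub[OF Z1(5) 1(1,2) V(1,2) Z1(1,3,4) sub(1,3)])
    moreover have "restr P W' (Z1 \<inter> Z2) t' = restr P V (Z1 \<inter> Z2) t"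
      by (rule res_eq_sub[OF Z2(5) 2(1,2) V(1,3) Z2(1,3,4) sub(1,4)])
    ultimately show ?thesis
      using sub 1 2 V Z1 Z2
      by (intro germ_eqI[of "V' \<inter> W'" _ V _ "Z1 \<inter> Z2"]) (simp_all del: Int_subset_iff)
  qed
  then show ?thesis unfolding germ_add_def
    by (intro UN_pair_const[OF germ_self[OF V(1,2,4)]] UN_pair_const[OF germ_self[OF V(1,3,4)]])
qed

text \<open>The scalar lives over \<open>U\<close> and a representative over some other open set, so
  the product is formed over the intersection and compared on a smaller neighbourhood.\<close>

lemma germ_smult:
  assumes U: "opn U" "r \<in> \<O> U" and V: "opn V" "s \<in> sec P V" "V \<subseteq> U" "x \<in> V"
  shows "germ_smult X P U r x (germ X P V s x) = germ X P V (rr U V r \<odot>\<^bsub>P$V\<^esub> s) x"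
proof -
  have "germ X P (U \<inter> V') (rr U (U \<inter> V') r \<odot>\<^bsub>P$(U \<inter> V')\<^esub> restr P V' (U \<inter> V') s') x
      = germ X P V (rr U V r \<odot>\<^bsub>P$V\<^esub> s) x"
    if s': "(V', s') \<in> germ X P V s x" for V' s'
  proof -
    note 1 = germ_mem[OF s' V(1,2)]
    obtain Z where Z: "opn Z" "x \<in> Z" "Z \<subseteq> V'" "Z \<subseteq> V" "restr P V' Z s' = restr P V Z s"
      by (rule germ_eqD[OF 1(4) V(1,2,4)])
    have sub: "opn (U \<inter> V')" "Z \<subseteq> U \<inter> V'" "U \<inter> V' \<subseteq> U" "U \<inter> V' \<subseteq> V'" "Z \<subseteq> U"
      using Z V 1 U by auto
    show ?thesis
      using sub 1 U V Z
      by (intro germ_eqI[of "U \<inter> V'" _ V _ Z]) (simp_all del: Int_subset_iff)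
  qed
  then show ?thesis unfolding germ_smult_def
    by (intro UN_pair_const[OF germ_self[OF V(1,2,4)]])
qed

section \<open>The sections of the sheafification as a sheaf of modules\<close>

lemma sheafify_simps:
  "\<zero>\<^bsub>sheafify X P$U\<^esub> = (\<lambda>x\<in>U. germ X P U \<zero>\<^bsub>P$U\<^esub> x)"
  "\<sigma> \<oplus>\<^bsub>sheafify X P$U\<^esub> \<tau> = (\<lambda>x\<in>U. germ_add X P x (\<sigma> x) (\<tau> x))"
  "r \<odot>\<^bsub>sheafify X P$U\<^esub> \<sigma> = (\<lambda>x\<in>U. germ_smult X P U r x (\<sigma> x))"
  "restr (sheafify X P) U V \<sigma> = restrict \<sigma> V"
  by (simp_all add: sheafify_def)

text \<open>A local representative already puts the values into the stalks, so that membership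
  reduces to extensionality and local representability.\<close>

lemma sheafify_secI:
  assumes "\<sigma> \<in> extensional U"
    and "\<And>x. x \<in> U \<Longrightarrow> \<exists>V s. opn V \<and> x \<in> V \<and> V \<subseteq> U \<and> s \<in> sec P V \<and>
      restrict \<sigma> V = sheaf_section X P V s"
  shows "\<sigma> \<in> sec (sheafify X P) U"
proof -
  have *: "\<exists>V s. opn V \<and> x \<in> V \<and> V \<subseteq> U \<and> s \<in> sec P V \<and> (\<forall>y\<in>V. \<sigma> y = germ X P V s y)"
    if x: "x \<in> U" for x
  proof -
    obtain V s where V: "opn V" "x \<in> V" "V \<subseteq> U" "s \<in> sec P V"
      and eq: "restrict \<sigma> V = sheaf_section X P V s"
      using assms(2)[OF x] by blast
    have "\<sigma> y = germ X P V s y" if "y \<in> V" for y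
      using fun_cong[OF eq, of y] that by (simp add: sheaf_section_def)
    then show ?thesis using V by blast
  qed
  have "\<sigma> x \<in> stalk X P x" if x: "x \<in> U" for x
  proof -
    obtain V s where V: "opn V" "x \<in> V" "s \<in> sec P V" "\<sigma> x = germ X P V s x"
      using * [OF x] by blast
    then show ?thesis unfolding stalk_def mem_Collect_eq using opens_iff opn_pts by metis
  qed
  then have "\<sigma> \<in> (\<Pi>\<^sub>E x\<in>U. stalk X P x)" using assms(1) by (simp add: PiE_iff)
  moreover have "\<exists>V\<in>opens X U. x \<in> V \<and> (\<exists>s\<in>sec P V. \<forall>y\<in>V. \<sigma> y = germ X P V s y)" if x: "x \<in> U" for x
    using * [OF x] unfolding Bex_def opens_iff by metis
  ultimately show ?thesis by (simp add: sheafify_def del: opens_iff)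
qed

lemma sheafify_ext: "\<sigma> \<in> sec (sheafify X P) U \<Longrightarrow> \<sigma> \<in> extensional U"
  by (auto simp: sheafify_def PiE_def)

lemma sheafify_rep:
  assumes "\<sigma> \<in> sec (sheafify X P) U" "x \<in> U"
  obtains V s where "opn V" "x \<in> V" "V \<subseteq> U" "s \<in> sec P V"
    "restrict \<sigma> V = sheaf_section X P V s"
proof -
  obtain V s where V: "opn V" "x \<in> V" "V \<subseteq> U" "s \<in> sec P V" "\<forall>y\<in>V. \<sigma> y = germ X P V s y"
    using assms unfolding sheafify_def by (simp del: opens_iff) (simp add: opens_def, blast)
  then have "restrict \<sigma> V = sheaf_section X P V s"
    by (auto simp: sheaf_section_def fun_eq_iff)
  then show ?thesis using that V by blast
qed

lemma ss_restr:
  assumes "opn V" "s \<in> sec P V" "opn W" "W \<subseteq> V"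
  shows "restrict (sheaf_section X P V s) W = sheaf_section X P W (restr P V W s)"
  using assms by (auto simp: sheaf_section_def fun_eq_iff germ_restr subset_iff)

lemma sheafify_rep_sub:
  assumes "restrict \<sigma> V = sheaf_section X P V s" "opn V" "s \<in> sec P V" "opn W" "W \<subseteq> V"
  shows "restrict \<sigma> W = sheaf_section X P W (restr P V W s)"
proof -
  have "restrict \<sigma> W = restrict (restrict \<sigma> V) W" using assms(5) by (auto simp: fun_eq_iff)
  then show ?thesis using ss_restr[of V s W] assms by simp
qed

lemma sheafify_rep2:
  assumes "\<sigma> \<in> sec (sheafify X P) U" "\<tau> \<in> sec (sheafify X P) U" "x \<in> U"
  obtains V s t where "opn V" "x \<in> V" "V \<subseteq> U" "s \<in> sec P V" "t \<in> sec P V"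
    "restrict \<sigma> V = sheaf_section X P V s" "restrict \<tau> V = sheaf_section X P V t"
proof -
  obtain V s where V: "opn V" "x \<in> V" "V \<subseteq> U" "s \<in> sec P V"
    "restrict \<sigma> V = sheaf_section X P V s" by (rule sheafify_rep[OF assms(1,3)])
  obtain W t where W: "opn W" "x \<in> W" "W \<subseteq> U" "t \<in> sec P W"
    "restrict \<tau> W = sheaf_section X P W t" by (rule sheafify_rep[OF assms(2,3)])
  have sub: "V \<inter> W \<subseteq> V" "V \<inter> W \<subseteq> W" "opn (V \<inter> W)" using V W by auto
  show ?thesis
    by (rule that[OF sub(3), of "restr P V (V \<inter> W) s" "restr P W (V \<inter> W) t"])
      (use V W sub sheafify_rep_sub[OF V(5,1,4) sub(3,1)] sheafify_rep_sub[OF W(5,1,4) sub(3,2)] in auto)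
qed

lemma ss_in [simp]:
  "opn V \<Longrightarrow> s \<in> sec P V \<Longrightarrow> sheaf_section X P V s \<in> sec (sheafify X P) V"
  by (rule sheafify_secI) (auto simp: sheaf_section_def intro!: exI[of _ V])

lemma ss_add:
  assumes "opn V" "s \<in> sec P V" "t \<in> sec P V"
  shows "sheaf_section X P V s \<oplus>\<^bsub>sheafify X P$V\<^esub> sheaf_section X P V t =
    sheaf_section X P V (s \<oplus>\<^bsub>P$V\<^esub> t)"
  using assms by (simp add: sheafify_simps sheaf_section_def germ_add cong: restrict_cong)

lemma ss_smult:
  assumes "opn V" "s \<in> sec P V" "r \<in> \<O> V"
  shows "r \<odot>\<^bsub>sheafify X P$V\<^esub> sheaf_section X P V s =
    sheaf_section X P V (r \<odot>\<^bsub>P$V\<^esub> s)"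
  using assms by (simp add: sheafify_simps sheaf_section_def germ_smult cong: restrict_cong)

lemma ss_zero: "sheaf_section X P V \<zero>\<^bsub>P$V\<^esub> = \<zero>\<^bsub>sheafify X P$V\<^esub>"
  by (auto simp: sheafify_simps sheaf_section_def)

lemma sheafify_restr_add:
  "V \<subseteq> U \<Longrightarrow> restrict (\<sigma> \<oplus>\<^bsub>sheafify X P$U\<^esub> \<tau>) V =
    restrict \<sigma> V \<oplus>\<^bsub>sheafify X P$V\<^esub> restrict \<tau> V"
  by (auto simp: sheafify_simps fun_eq_iff)

text \<open>The action on germs is indexed by the open set on which the scalar lives. Hence it needs
  an argument, through a local representative, that restricting the scalar first gives the same
  germ.\<close>

lemma sheafify_restr_smult:
  assumes "opn U" "opn V" "V \<subseteq> U" "r \<in> \<O> U" "\<sigma> \<in> sec (sheafify X P) U"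
  shows "restrict (r \<odot>\<^bsub>sheafify X P$U\<^esub> \<sigma>) V =
    rr U V r \<odot>\<^bsub>sheafify X P$V\<^esub> restrict \<sigma> V"
proof
  fix x
  show "restrict (r \<odot>\<^bsub>sheafify X P$U\<^esub> \<sigma>) V x =
    (rr U V r \<odot>\<^bsub>sheafify X P$V\<^esub> restrict \<sigma> V) x"
  proof (cases "x \<in> V")
    case True
    then have x: "x \<in> U" using assms by auto
    obtain W s where W: "opn W" "x \<in> W" "W \<subseteq> U" "s \<in> sec P W"
      "restrict \<sigma> W = sheaf_section X P W s" by (rule sheafify_rep[OF assms(5) x])
    have sub: "W \<inter> V \<subseteq> V" "W \<inter> V \<subseteq> W" "W \<inter> V \<subseteq> U" "opn (W \<inter> V)" "x \<in> W \<inter> V" using W assms True by auto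
    have "restrict \<sigma> (W \<inter> V) x = sheaf_section X P (W \<inter> V) (restr P W (W \<inter> V) s) x"
      using sheafify_rep_sub[OF W(5,1,4) sub(4,2)] by simp
    then have "\<sigma> x = germ X P (W \<inter> V) (restr P W (W \<inter> V) s) x"
      using sub by (simp add: sheaf_section_def)
    then show ?thesis using True x sub assms W
      by (simp add: sheafify_simps germ_smult)
  qed (simp add: sheafify_simps)
qed

lemma sheafify_eqI:
  assumes "\<sigma> \<in> extensional U" "\<tau> \<in> extensional U"
    and "\<And>x. x \<in> U \<Longrightarrow> \<exists>V. x \<in> V \<and> restrict \<sigma> V = restrict \<tau> V"
  shows "\<sigma> = \<tau>"
proof (rule extensionalityI[OF assms(1,2)])
  fix x assume "x \<in> U"
  then obtain V where "x \<in> V" "restrict \<sigma> V = restrict \<tau> V" using assms(3) by blast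
  then show "\<sigma> x = \<tau> x" by (metis restrict_apply')
qed

lemma sheafify_ext_ops:
  "\<sigma> \<oplus>\<^bsub>sheafify X P$U\<^esub> \<tau> \<in> extensional U"
  "r \<odot>\<^bsub>sheafify X P$U\<^esub> \<sigma> \<in> extensional U"
  "\<zero>\<^bsub>sheafify X P$U\<^esub> \<in> extensional U"
  by (simp_all add: sheafify_simps)

lemma sheafify_zero_restr:
  "\<lbrakk>opn U; opn V; V \<subseteq> U\<rbrakk> \<Longrightarrow>
    restrict \<zero>\<^bsub>sheafify X P$U\<^esub> V = sheaf_section X P V \<zero>\<^bsub>P$V\<^esub>"
  using ss_restr[of U "\<zero>\<^bsub>P$U\<^esub>" V] by (simp add: ss_zero)

lemma sheafify_add_closed:
  assumes U: "opn U" and \<sigma>: "\<sigma> \<in> sec (sheafify X P) U" "\<tau> \<in> sec (sheafify X P) U"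
  shows "\<sigma> \<oplus>\<^bsub>sheafify X P$U\<^esub> \<tau> \<in> sec (sheafify X P) U"
proof (rule sheafify_secI[OF sheafify_ext_ops(1)])
  fix x assume x: "x \<in> U"
  obtain V s t where V: "opn V" "x \<in> V" "V \<subseteq> U" "s \<in> sec P V" "t \<in> sec P V"
    "restrict \<sigma> V = sheaf_section X P V s" "restrict \<tau> V = sheaf_section X P V t"
    by (rule sheafify_rep2[OF \<sigma> x])
  show "\<exists>V s. opn V \<and> x \<in> V \<and> V \<subseteq> U \<and> s \<in> sec P V \<and>
      restrict (\<sigma> \<oplus>\<^bsub>sheafify X P$U\<^esub> \<tau>) V = sheaf_section X P V s"
    by (rule exI[of _ V], rule exI[of _ "s \<oplus>\<^bsub>P$V\<^esub> t"])
      (simp add: V sheafify_restr_add ss_add)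
qed

lemma sheafify_smult_closed:
  assumes U: "opn U" and \<sigma>: "\<sigma> \<in> sec (sheafify X P) U" and r: "r \<in> \<O> U"
  shows "r \<odot>\<^bsub>sheafify X P$U\<^esub> \<sigma> \<in> sec (sheafify X P) U"
proof (rule sheafify_secI[OF sheafify_ext_ops(2)])
  fix x assume x: "x \<in> U"
  obtain V s where V: "opn V" "x \<in> V" "V \<subseteq> U" "s \<in> sec P V"
    "restrict \<sigma> V = sheaf_section X P V s"
    by (rule sheafify_rep[OF \<sigma> x])
  show "\<exists>V s. opn V \<and> x \<in> V \<and> V \<subseteq> U \<and> s \<in> sec P V \<and>
      restrict (r \<odot>\<^bsub>sheafify X P$U\<^esub> \<sigma>) V = sheaf_section X P V s"
    by (rule exI[of _ V], rule exI[of _ "rr U V r \<odot>\<^bsub>P$V\<^esub> s"])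
      (simp add: U r \<sigma> V sheafify_restr_smult ss_smult)
qed

lemma sheafify_zero_closed: "opn U \<Longrightarrow> \<zero>\<^bsub>sheafify X P$U\<^esub> \<in> sec (sheafify X P) U"
  using ss_in[of U "\<zero>\<^bsub>P$U\<^esub>"] by (simp add: ss_zero)

text \<open>An identity between expressions in \<open>\<sigma>\<close> need only be seen where
  \<open>\<sigma>\<close> comes from a section of \<open>P\<close>. There it becomes a law of the
  modules of \<open>P\<close>.\<close>

lemma sheafify_eqI1:
  assumes \<sigma>: "\<sigma> \<in> sec (sheafify X P) U"
    and ext: "lhs \<in> extensional U" "rhs \<in> extensional U"
    and eq: "\<And>V s. \<lbrakk>opn V; V \<subseteq> U; s \<in> sec P V;
      restrict \<sigma> V = sheaf_section X P V s\<rbrakk> \<Longrightarrow> restrict lhs V = restrict rhs V"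
  shows "lhs = rhs"
proof (rule sheafify_eqI[OF ext])
  fix x assume x: "x \<in> U"
  obtain V s where V: "opn V" "x \<in> V" "V \<subseteq> U" "s \<in> sec P V"
    "restrict \<sigma> V = sheaf_section X P V s" by (rule sheafify_rep[OF \<sigma> x])
  show "\<exists>V. x \<in> V \<and> restrict lhs V = restrict rhs V" using eq[OF V(1,3,4,5)] V(2) by metis
qed

lemma sheafify_eqI2:
  assumes \<sigma>: "\<sigma> \<in> sec (sheafify X P) U" and \<tau>: "\<tau> \<in> sec (sheafify X P) U"
    and ext: "lhs \<in> extensional U" "rhs \<in> extensional U"
    and eq: "\<And>V s t. \<lbrakk>opn V; V \<subseteq> U; s \<in> sec P V; t \<in> sec P V;
      restrict \<sigma> V = sheaf_section X P V s; restrict \<tau> V = sheaf_section X P V t\<rbrakk> \<Longrightarrow>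
      restrict lhs V = restrict rhs V"
  shows "lhs = rhs"
proof (rule sheafify_eqI[OF ext])
  fix x assume x: "x \<in> U"
  obtain V s t where V: "opn V" "x \<in> V" "V \<subseteq> U" "s \<in> sec P V" "t \<in> sec P V"
    "restrict \<sigma> V = sheaf_section X P V s" "restrict \<tau> V = sheaf_section X P V t"
    by (rule sheafify_rep2[OF \<sigma> \<tau> x])
  show "\<exists>V. x \<in> V \<and> restrict lhs V = restrict rhs V" using eq[OF V(1,3-7)] V(2) by metis
qed

lemma module_sheafify:
  assumes U: "opn U"
  shows "module (R U) (sheafify X P$U)"
proof (rule moduleI_sub[OF U])
  note [simp] = sheafify_restr_add sheafify_restr_smult sheafify_zero_restr ss_add ss_smult
    sheafify_add_closed sheafify_smult_closed sheafify_zero_closed mod_smult mod_assoc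
  let ?S = "sheafify X P$U"
  show "\<zero>\<^bsub>?S\<^esub> \<in> carrier ?S" using U by (rule sheafify_zero_closed)
  fix \<sigma> assume \<sigma> [simp]: "\<sigma> \<in> carrier ?S"
  note un = sheafify_eqI1[OF \<sigma>]
  show "\<zero>\<^bsub>?S\<^esub> \<oplus>\<^bsub>?S\<^esub> \<sigma> = \<sigma>"
    by (rule un) (simp_all add: U sheafify_ext_ops sheafify_ext[OF \<sigma>])
  show "\<one>\<^bsub>R U\<^esub> \<odot>\<^bsub>?S\<^esub> \<sigma> = \<sigma>" "\<zero>\<^bsub>R U\<^esub> \<odot>\<^bsub>?S\<^esub> \<sigma> = \<zero>\<^bsub>?S\<^esub>"
    by (rule un; simp add: U sheafify_ext_ops sheafify_ext[OF \<sigma>])+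
  fix \<tau> assume \<tau> [simp]: "\<tau> \<in> carrier ?S"
  show "\<sigma> \<oplus>\<^bsub>?S\<^esub> \<tau> \<in> carrier ?S" by (simp add: U)
  note bin = sheafify_eqI2[OF \<sigma> \<tau>]
  show "\<sigma> \<oplus>\<^bsub>?S\<^esub> \<tau> = \<tau> \<oplus>\<^bsub>?S\<^esub> \<sigma>"
    by (rule bin) (simp_all add: U sheafify_ext_ops mod_ac)
  fix \<rho> assume \<rho> [simp]: "\<rho> \<in> carrier ?S"
  show "\<sigma> \<oplus>\<^bsub>?S\<^esub> \<tau> \<oplus>\<^bsub>?S\<^esub> \<rho> = \<sigma> \<oplus>\<^bsub>?S\<^esub> (\<tau> \<oplus>\<^bsub>?S\<^esub> \<rho>)"
  proof (rule sheafify_eqI)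
    fix x assume x: "x \<in> U"
    obtain V s t where V: "opn V" "x \<in> V" "V \<subseteq> U" "s \<in> sec P V" "t \<in> sec P V"
      "restrict \<sigma> V = sheaf_section X P V s" "restrict \<tau> V = sheaf_section X P V t"
      by (rule sheafify_rep2[OF \<sigma> \<tau> x])
    \<comment> \<open>Associativity involves three sections, so the neighbourhood representing the
      first two is intersected with one for the third.\<close>
    obtain W r where W: "opn W" "x \<in> W" "W \<subseteq> U" "r \<in> sec P W"
      "restrict \<rho> W = sheaf_section X P W r" by (rule sheafify_rep[OF \<rho> x])
    have sub: "V \<inter> W \<subseteq> V" "V \<inter> W \<subseteq> W" "opn (V \<inter> W)" "x \<in> V \<inter> W" "V \<inter> W \<subseteq> U" using V W by auto
    note reps = sheafify_rep_sub[OF V(6,1,4) sub(3,1)] sheafify_rep_sub[OF V(7,1,5) sub(3,1)]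
      sheafify_rep_sub[OF W(5,1,4) sub(3,2)]
    show "\<exists>V. x \<in> V \<and> restrict (\<sigma> \<oplus>\<^bsub>?S\<^esub> \<tau> \<oplus>\<^bsub>?S\<^esub> \<rho>) V = restrict (\<sigma> \<oplus>\<^bsub>?S\<^esub> (\<tau> \<oplus>\<^bsub>?S\<^esub> \<rho>)) V"
      using V(1-5) W(1-4) sub
      by (intro exI[of _ "V \<inter> W"])
        (simp add: reps mod_ac del: Int_iff Int_subset_iff)
  qed (simp_all add: sheafify_ext_ops)
next
  note [simp] = sheafify_restr_add sheafify_restr_smult sheafify_zero_restr ss_add ss_smult
    sheafify_add_closed sheafify_smult_closed sheafify_zero_closed mod_smult mod_assoc
  let ?S = "sheafify X P$U"
  fix r \<sigma> assume [simp]: "r \<in> \<O> U" and \<sigma> [simp]: "\<sigma> \<in> carrier ?S"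
  show "r \<odot>\<^bsub>?S\<^esub> \<sigma> \<in> carrier ?S" by (simp add: U)
  { fix s assume [simp]: "s \<in> \<O> U"
    show "(r \<oplus>\<^bsub>R U\<^esub> s) \<odot>\<^bsub>?S\<^esub> \<sigma> = r \<odot>\<^bsub>?S\<^esub> \<sigma> \<oplus>\<^bsub>?S\<^esub> s \<odot>\<^bsub>?S\<^esub> \<sigma>"
      "(r \<otimes>\<^bsub>R U\<^esub> s) \<odot>\<^bsub>?S\<^esub> \<sigma> = r \<odot>\<^bsub>?S\<^esub> (s \<odot>\<^bsub>?S\<^esub> \<sigma>)"
      by (rule sheafify_eqI1[OF \<sigma>]; simp add: U sheafify_ext_ops)+ }
  fix \<tau> assume \<tau> [simp]: "\<tau> \<in> carrier ?S"
  show "r \<odot>\<^bsub>?S\<^esub> (\<sigma> \<oplus>\<^bsub>?S\<^esub> \<tau>) = r \<odot>\<^bsub>?S\<^esub> \<sigma> \<oplus>\<^bsub>?S\<^esub> r \<odot>\<^bsub>?S\<^esub> \<tau>"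
    by (rule sheafify_eqI2[OF \<sigma> \<tau>]) (simp_all add: U sheafify_ext_ops)
qed

lemma is_presheaf_sheafify: "is_presheaf X (sheafify X P)"
proof (rule is_presheafI)
  fix U V \<sigma> assume U: "opn U" "opn V" "V \<subseteq> U" and \<sigma>: "\<sigma> \<in> sec (sheafify X P) U"
  show "restr (sheafify X P) U V \<sigma> \<in> sec (sheafify X P) V"
    unfolding sheafify_simps
  proof (rule sheafify_secI)
    fix x assume x: "x \<in> V"
    obtain W s where W: "opn W" "x \<in> W" "W \<subseteq> U" "s \<in> sec P W"
      "restrict \<sigma> W = sheaf_section X P W s" using sheafify_rep[OF \<sigma>, of x] x U by blast
    have sub: "V \<inter> W \<subseteq> V" "V \<inter> W \<subseteq> W" "opn (V \<inter> W)" "x \<in> V \<inter> W" using U W x by auto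
    have "restrict (restrict \<sigma> V) (V \<inter> W) = restrict \<sigma> (V \<inter> W)" by (auto simp: fun_eq_iff)
    then show "\<exists>W s. opn W \<and> x \<in> W \<and> W \<subseteq> V \<and> s \<in> sec P W \<and>
        restrict (restrict \<sigma> V) W = sheaf_section X P W s"
      using sheafify_rep_sub[OF W(5,1,4) sub(3,2)] sub W res_closed[OF P W(1) sub(3,2) W(4)] by metis
  qed auto
next
  fix U \<sigma> assume "\<sigma> \<in> sec (sheafify X P) U"
  then show "restr (sheafify X P) U U \<sigma> = \<sigma>"
    unfolding sheafify_simps by (auto dest: sheafify_ext simp: extensional_restrict)
next
  fix U V W :: "'a set" and \<sigma> assume "W \<subseteq> V"
  then show "restr (sheafify X P) V W (restr (sheafify X P) U V \<sigma>) = restr (sheafify X P) U W \<sigma>"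
    unfolding sheafify_simps by (auto simp: fun_eq_iff)
qed

lemma is_sheaf_sheafify: "is_sheaf X (sheafify X P)"
  unfolding is_sheaf_def
proof (intro conjI is_presheaf_sheafify allI impI ballI)
  fix \<V> \<sigma> \<tau>
  assume ext: "\<sigma> \<in> sec (sheafify X P) (\<Union>\<V>)" "\<tau> \<in> sec (sheafify X P) (\<Union>\<V>)"
    and eq: "\<forall>V\<in>\<V>. restr (sheafify X P) (\<Union>\<V>) V \<sigma> = restr (sheafify X P) (\<Union>\<V>) V \<tau>"
  show "\<sigma> = \<tau>"
    by (rule sheafify_eqI[OF ext[THEN sheafify_ext]]) (use eq in \<open>auto simp: sheafify_simps\<close>)
next
  fix \<V> \<sigma> assume \<V>: "\<V> \<subseteq> opens X (pts X)"
    and *: "(\<forall>V\<in>\<V>. \<sigma> V \<in> sec (sheafify X P) V) \<and>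
      (\<forall>V\<in>\<V>. \<forall>W\<in>\<V>. restr (sheafify X P) V (V \<inter> W) (\<sigma> V) = restr (sheafify X P) W (V \<inter> W) (\<sigma> W))"
  \<comment> \<open>The value at \<open>x\<close> is read off in some member of the cover containing
    \<open>x\<close>; compatibility makes the choice immaterial.\<close>
  define s where "s = (\<lambda>x\<in>\<Union>\<V>. \<sigma> (SOME V. V \<in> \<V> \<and> x \<in> V) x)"
  have s: "s x = \<sigma> V x" if V: "V \<in> \<V>" "x \<in> V" for V x
  proof -
    define W where "W = (SOME V. V \<in> \<V> \<and> x \<in> V)"
    have "V \<in> \<V> \<and> x \<in> V" using V by simp
    then have W: "W \<in> \<V> \<and> x \<in> W" unfolding W_def by (rule someI)
    have "restrict (\<sigma> V) (V \<inter> W) = restrict (\<sigma> W) (V \<inter> W)"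
      using conjunct2[OF *, rule_format, of V W] V W unfolding sheafify_simps(4) by blast
    from fun_cong[OF this, of x] have "\<sigma> V x = \<sigma> W x" using V W by simp
    moreover have "x \<in> \<Union>\<V>" using V by blast
    moreover from this have "s x = \<sigma> W x" unfolding s_def W_def by (rule restrict_apply')
    ultimately show ?thesis by simp
  qed
  have s_restr: "restrict s V = \<sigma> V" if "V \<in> \<V>" for V
  proof -
    have "\<sigma> V \<in> extensional V" using conjunct1[OF *] that sheafify_ext by simp
    then show ?thesis using s[OF that]
      by (intro extensionalityI[of _ V]) simp_all
  qed
  have "s \<in> sec (sheafify X P) (\<Union>\<V>)"
  proof (rule sheafify_secI)
    show "s \<in> extensional (\<Union>\<V>)" by (simp add: s_def)
    fix x assume "x \<in> \<Union>\<V>"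
    then obtain V where V: "V \<in> \<V>" "x \<in> V" by blast
    then have \<sigma>V: "\<sigma> V \<in> sec (sheafify X P) V" using conjunct1[OF *] by simp
    obtain W r where W: "opn W" "x \<in> W" "W \<subseteq> V" "r \<in> sec P W"
      "restrict (\<sigma> V) W = sheaf_section X P W r" by (rule sheafify_rep[OF \<sigma>V V(2)])
    have "restrict s W = restrict (restrict s V) W" using W(3) by (simp add: Int_absorb1)
    then have "restrict s W = sheaf_section X P W r" using s_restr[OF V(1)] W by simp
    then show "\<exists>V r. opn V \<and> x \<in> V \<and> V \<subseteq> \<Union>\<V> \<and> r \<in> sec P V \<and>
        restrict s V = sheaf_section X P V r"
      using W V(1) by (intro exI[of _ W] exI[of _ r] conjI) auto
  qed
  then show "\<exists>s\<in>sec (sheafify X P) (\<Union>\<V>). \<forall>V\<in>\<V>. restr (sheafify X P) (\<Union>\<V>) V s = \<sigma> V"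
    by (rule bexI [rotated]) (simp add: sheafify_simps(4) s_restr)
qed

lemma sheafify_sheaf: "module_sheaf X (sheafify X P)"
  unfolding module_sheaf_iff
  by (intro conjI is_sheaf_sheafify mod_preI is_presheaf_sheafify module_sheafify)
    (simp_all add: sheafify_simps(4) sheafify_restr_add sheafify_restr_smult)

section \<open>Morphisms out of the sheafification\<close>

lemma ss_lin: "lin X U P (sheafify X P) (sheaf_section X P)"
  by (rule linI) (simp_all add: ss_add ss_smult sheafify_simps(4) ss_restr)

text \<open>\<open>P\<close> need not be separated, so sections with the same image in the
  sheafification agree only near each point.\<close>

lemma ss_eqD:
  assumes "sheaf_section X P V s = sheaf_section X P V t" "opn V"
    "t \<in> sec P V" "x \<in> V"
  obtains Z where "opn Z" "x \<in> Z" "Z \<subseteq> V" "restr P V Z s = restr P V Z t"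
proof -
  have "germ X P V s x = germ X P V t x"
    using fun_cong[OF assms(1), of x] assms(4) by (simp add: sheaf_section_def)
  then show ?thesis using germ_eqD assms that by metis
qed

text \<open>Every section of the sheafification is locally the image of a section of
  \<open>P\<close>, and \<open>L\<close> is separated.\<close>

lemma sheafify_hom_eqI:
  assumes h: "h \<in> mod_homs X U (sheafify X P) L" "k \<in> mod_homs X U (sheafify X P) L"
    and L: "module_sheaf X L"
    and eq: "\<And>V s. \<lbrakk>opn V; V \<subseteq> U; s \<in> sec P V\<rbrakk> \<Longrightarrow>
      h V (sheaf_section X P V s) = k V (sheaf_section X P V s)"
  shows "h = k"
proof (rule hom_eqI[OF h])
  fix V \<sigma> assume V: "opn V" "V \<subseteq> U" and \<sigma>: "\<sigma> \<in> sec (sheafify X P) V"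
  show "h V \<sigma> = k V \<sigma>"
  proof (rule sheaf_eqI[OF module_sheaf_sheaf[OF L] V(1)])
    fix x assume "x \<in> V"
    then obtain W s where W: "opn W" "x \<in> W" "W \<subseteq> V" "s \<in> sec P W"
      "restrict \<sigma> W = sheaf_section X P W s" by (rule sheafify_rep[OF \<sigma>])
    have "restr L V W (h V \<sigma>) = restr L V W (k V \<sigma>)"
      using hom_res[OF h(1) V \<sigma> W(1,3)] hom_res[OF h(2) V \<sigma> W(1,3)] eq[of W s] V W
      by (simp add: sheafify_simps(4))
    then show "\<exists>W. opn W \<and> x \<in> W \<and> W \<subseteq> V \<and> restr L V W (h V \<sigma>) = restr L V W (k V \<sigma>)"
      using W by blast
  qed (use hom_closed[OF h(1) V \<sigma>] hom_closed[OF h(2) V \<sigma>] in auto)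
qed

text \<open>The image of a section is glued from the values of \<open>f\<close> at its local
  representatives. The sheaf property of \<open>L\<close> provides both the gluing and the
  independence of the representatives.\<close>

lemma sheafify_lift:
  assumes L: "module_sheaf X L" and f: "lin X U P L f" and U: "opn U"
  obtains h where "h \<in> mod_homs X U (sheafify X P) L"
    "\<And>V s. \<lbrakk>opn V; V \<subseteq> U; s \<in> sec P V\<rbrakk> \<Longrightarrow> h V (sheaf_section X P V s) = f V s"
proof -
  have f_simps: "f V x \<in> sec L V"
    "y \<in> sec P V \<Longrightarrow> f V (x \<oplus>\<^bsub>P$V\<^esub> y) = f V x \<oplus>\<^bsub>L$V\<^esub> f V y"
    "r \<in> \<O> V \<Longrightarrow> f V (r \<odot>\<^bsub>P$V\<^esub> x) = r \<odot>\<^bsub>L$V\<^esub> f V x"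
    "opn W \<Longrightarrow> W \<subseteq> V \<Longrightarrow> f W (restr P V W x) = restr L V W (f V x)"
    if "opn V" "V \<subseteq> U" "x \<in> sec P V" for V W x y r
    using f that by (simp_all add: lin_def)
  note [simp] = L
  \<comment> \<open>\<open>Q \<sigma> W t\<close> says that \<open>t\<close> restricts to the value
    of \<open>f\<close> wherever \<open>\<sigma>\<close> is represented over an open subset of
    \<open>W\<close>. As it quantifies over all representatives, no choice has to be
    tracked.\<close>
  define Q where "Q \<sigma> W t \<longleftrightarrow> (\<forall>V s. opn V \<longrightarrow> V \<subseteq> W \<longrightarrow> s \<in> sec P V \<longrightarrow>
    restrict \<sigma> V = sheaf_section X P V s \<longrightarrow> restr L W V t = f V s)" for \<sigma> W t
  have QD: "restr L W V t = f V s" if "Q \<sigma> W t" "opn V" "V \<subseteq> W" "s \<in> sec P V"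
    "restrict \<sigma> V = sheaf_section X P V s" for \<sigma> W t V s
    using that unfolding Q_def by blast
  have Q_local: "Q \<sigma> W (f W s)" if W: "opn W" "W \<subseteq> U" "s \<in> sec P W"
    and \<sigma>: "restrict \<sigma> W = sheaf_section X P W s" for \<sigma> W s
    unfolding Q_def
  proof (intro allI impI)
    fix V t assume V: "opn V" "V \<subseteq> W" "t \<in> sec P V" "restrict \<sigma> V = sheaf_section X P V t"
    have VU: "V \<subseteq> U" using V W by order
    \<comment> \<open>The restriction of \<open>s\<close> and the competing representative
      \<open>t\<close> induce the same section, so they agree near each point, and separatedness of
      \<open>L\<close> equates their images.\<close>
    have eq: "sheaf_section X P V (restr P W V s) = sheaf_section X P V t"
      using sheafify_rep_sub[OF \<sigma> W(1,3) V(1,2)] V by simp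
    have "f V (restr P W V s) = f V t"
    proof (rule sheaf_eqI[OF module_sheaf_sheaf[OF L] V(1)])
      show "f V (restr P W V s) \<in> sec L V" "f V t \<in> sec L V"
        using V W VU by (simp_all add: f_simps)
      fix x assume x: "x \<in> V"
      obtain Z where Z: "opn Z" "x \<in> Z" "Z \<subseteq> V" "restr P V Z (restr P W V s) = restr P V Z t"
        by (rule ss_eqD[OF eq V(1,3) x])
      have "restr L V Z (f V (restr P W V s)) = restr L V Z (f V t)"
        using f_simps(4)[OF V(1) VU _ Z(1,3), of "restr P W V s"] f_simps(4)[OF V(1) VU V(3) Z(1,3)] Z V W
        by simp
      then show "\<exists>Z. opn Z \<and> x \<in> Z \<and> Z \<subseteq> V \<and> restr L V Z (f V (restr P W V s)) = restr L V Z (f V t)"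
        using Z by blast
    qed
    then show "restr L W V (f W s) = f V t" using f_simps(4)[OF W V(1,2)] by simp
  qed
  have Q_uniq: "s = t" if W: "opn W" "W \<subseteq> U" and \<sigma>: "\<sigma> \<in> sec (sheafify X P) W"
    and st: "s \<in> sec L W" "t \<in> sec L W" "Q \<sigma> W s" "Q \<sigma> W t" for \<sigma> W s t
  proof (rule sheaf_eqI[OF module_sheaf_sheaf[OF L] W(1) st(1,2)])
    fix x assume "x \<in> W"
    then obtain V p where V: "opn V" "x \<in> V" "V \<subseteq> W" "p \<in> sec P V"
      "restrict \<sigma> V = sheaf_section X P V p" by (rule sheafify_rep[OF \<sigma>])
    then show "\<exists>V. opn V \<and> x \<in> V \<and> V \<subseteq> W \<and> restr L W V s = restr L W V t"
      using QD[OF st(3) V(1,3,4,5)] QD[OF st(4) V(1,3,4,5)] by metis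
  qed
  have Q_res: "Q \<sigma> W (restr L V W s)" if "opn V" "opn W" "W \<subseteq> V" "s \<in> sec L V" "Q \<sigma> V s" for \<sigma> V W s
    unfolding Q_def
  proof (intro allI impI)
    fix Z p assume "opn Z" "Z \<subseteq> W" "p \<in> sec P Z" "restrict \<sigma> Z = sheaf_section X P Z p"
    moreover from this have "Z \<subseteq> V" using \<open>W \<subseteq> V\<close> by order
    ultimately show "restr L W Z (restr L V W s) = f Z p" using QD[OF that(5)] that by simp
  qed
  have restrS: "restrict \<sigma> W \<in> sec (sheafify X P) W"
    if "opn V" "opn W" "W \<subseteq> V" "\<sigma> \<in> sec (sheafify X P) V" for V W \<sigma>
    using pre_closed[OF is_presheaf_sheafify that] by (simp add: sheafify_simps(4))
  have Q_cong: "Q (restrict \<sigma> W) W' t \<longleftrightarrow> Q \<sigma> W' t" if "W' \<subseteq> W" for \<sigma> W W' t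
  proof -
    have "restrict (restrict \<sigma> W) V = restrict \<sigma> V" if "V \<subseteq> W'" for V
      using that \<open>W' \<subseteq> W\<close> by (auto simp: fun_eq_iff)
    then show ?thesis unfolding Q_def by (metis (no_types, lifting))
  qed
  have ex: "\<exists>t\<in>sec L V. Q \<sigma> V t" if V: "opn V" "V \<subseteq> U" and \<sigma>: "\<sigma> \<in> sec (sheafify X P) V" for V \<sigma>
  proof -
    have loc: "\<exists>W. opn W \<and> x \<in> W \<and> W \<subseteq> V \<and> (\<exists>s\<in>sec L W. Q \<sigma> W s)" if x: "x \<in> V" for x
    proof -
      obtain W p where W: "opn W" "x \<in> W" "W \<subseteq> V" "p \<in> sec P W"
        "restrict \<sigma> W = sheaf_section X P W p" by (rule sheafify_rep[OF \<sigma> x])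
      have "W \<subseteq> U" using W V by order
      then show ?thesis using W Q_local[OF W(1) _ W(4,5)] f_simps(1)[OF W(1) _ W(4)] by blast
    qed
    have uniq: "s = t" if "opn W" "W \<subseteq> V" "s \<in> sec L W" "t \<in> sec L W"
      "Q \<sigma> W s" "Q \<sigma> W t" for W s t
      using Q_uniq[OF that(1) _ restrS[OF V(1) that(1,2) \<sigma>] that(3,4)] that V Q_cong[of W W \<sigma>]
      by (metis order_refl order_trans)
    obtain t where t: "t \<in> sec L V"
      "\<And>W r. \<lbrakk>opn W; W \<subseteq> V; r \<in> sec L W; Q \<sigma> W r\<rbrakk> \<Longrightarrow> restr L V W t = r"
      by (rule sheaf_glue[OF module_sheaf_sheaf[OF L] V(1), where P = "Q \<sigma>"])
        (use loc uniq Q_res in blast)+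
    have "Q \<sigma> V t" unfolding Q_def
    proof (intro allI impI)
      fix W s assume W: "opn W" "W \<subseteq> V" "s \<in> sec P W" "restrict \<sigma> W = sheaf_section X P W s"
      moreover have "W \<subseteq> U" using W V by order
      ultimately show "restr L V W t = f W s" using t(2)[OF W(1,2)] Q_local f_simps(1) by blast
    qed
    with t(1) show ?thesis by blast
  qed
  define g where "g V \<sigma> = (SOME t. t \<in> sec L V \<and> Q \<sigma> V t)" for V \<sigma>
  have g: "g V \<sigma> \<in> sec L V" "Q \<sigma> V (g V \<sigma>)"
    if "opn V" "V \<subseteq> U" "\<sigma> \<in> sec (sheafify X P) V" for V \<sigma>
  proof -
    have "\<exists>t. t \<in> sec L V \<and> Q \<sigma> V t" using ex[OF that] by blast
    from someI_ex[OF this] show "g V \<sigma> \<in> sec L V" "Q \<sigma> V (g V \<sigma>)" by (simp_all add: g_def)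
  qed
  have gI: "g V \<sigma> = t" if "opn V" "V \<subseteq> U" "\<sigma> \<in> sec (sheafify X P) V"
    "t \<in> sec L V" "Q \<sigma> V t" for V \<sigma> t
    using Q_uniq[OF that(1-3) g(1)[OF that(1-3)] that(4) g(2)[OF that(1-3)] that(5)] .
  have "mkhom X U (sheafify X P) g \<in> mod_homs X U (sheafify X P) L"
  proof (rule mkhomI)
    show "mod_pre X (sheafify X P)" using sheafify_sheaf by simp
    show "\<lbrakk>opn V; V \<subseteq> U; \<sigma> \<in> sec (sheafify X P) V\<rbrakk> \<Longrightarrow>
      g V \<sigma> \<in> sec L V" for V \<sigma> by (rule g)
    fix V \<sigma> assume V: "opn V" "V \<subseteq> U" and \<sigma>: "\<sigma> \<in> sec (sheafify X P) V"
    { fix \<tau> assume \<tau>: "\<tau> \<in> sec (sheafify X P) V"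
      show "g V (\<sigma> \<oplus>\<^bsub>sheafify X P$V\<^esub> \<tau>) = g V \<sigma> \<oplus>\<^bsub>L$V\<^esub> g V \<tau>"
      proof (rule sheaf_eqI[OF module_sheaf_sheaf[OF L] V(1)])
        fix x assume "x \<in> V"
        then obtain W s t where W: "opn W" "x \<in> W" "W \<subseteq> V" "s \<in> sec P W" "t \<in> sec P W"
          "restrict \<sigma> W = sheaf_section X P W s" "restrict \<tau> W = sheaf_section X P W t"
          by (rule sheafify_rep2[OF \<sigma> \<tau>])
        have WU: "W \<subseteq> U" using W V by order
        have "restrict (\<sigma> \<oplus>\<^bsub>sheafify X P$V\<^esub> \<tau>) W = sheaf_section X P W (s \<oplus>\<^bsub>P$W\<^esub> t)"
          using W by (simp add: sheafify_restr_add ss_add)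
        then have "restr L V W (g V (\<sigma> \<oplus>\<^bsub>sheafify X P$V\<^esub> \<tau>)) =
            restr L V W (g V \<sigma> \<oplus>\<^bsub>L$V\<^esub> g V \<tau>)"
          using QD[OF g(2)[OF V sheafify_add_closed[OF V(1) \<sigma> \<tau>]] W(1,3), of "s \<oplus>\<^bsub>P$W\<^esub> t"]
            QD[OF g(2)[OF V \<sigma>] W(1,3,4,6)] QD[OF g(2)[OF V \<tau>] W(1,3,5,7)] W V WU
          by (simp add: f_simps g \<sigma> \<tau>)
        then show "\<exists>W. opn W \<and> x \<in> W \<and> W \<subseteq> V \<and>
          restr L V W (g V (\<sigma> \<oplus>\<^bsub>sheafify X P$V\<^esub> \<tau>)) =
          restr L V W (g V \<sigma> \<oplus>\<^bsub>L$V\<^esub> g V \<tau>)" using W by blast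
      qed (use V \<sigma> \<tau> in \<open>simp_all add: g sheafify_add_closed\<close>) }
    { fix r assume r: "r \<in> \<O> V"
      show "g V (r \<odot>\<^bsub>sheafify X P$V\<^esub> \<sigma>) = r \<odot>\<^bsub>L$V\<^esub> g V \<sigma>"
      proof (rule sheaf_eqI[OF module_sheaf_sheaf[OF L] V(1)])
        fix x assume "x \<in> V"
        then obtain W s where W: "opn W" "x \<in> W" "W \<subseteq> V" "s \<in> sec P W"
          "restrict \<sigma> W = sheaf_section X P W s"
          by (rule sheafify_rep[OF \<sigma>])
        have WU: "W \<subseteq> U" using W V by order
        have "restrict (r \<odot>\<^bsub>sheafify X P$V\<^esub> \<sigma>) W = sheaf_section X P W (rr V W r \<odot>\<^bsub>P$W\<^esub> s)"
          using W V \<sigma> r by (simp add: sheafify_restr_smult ss_smult)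
        then have "restr L V W (g V (r \<odot>\<^bsub>sheafify X P$V\<^esub> \<sigma>)) =
            restr L V W (r \<odot>\<^bsub>L$V\<^esub> g V \<sigma>)"
          using QD[OF g(2)[OF V sheafify_smult_closed[OF V(1) \<sigma> r]] W(1,3), of "rr V W r \<odot>\<^bsub>P$W\<^esub> s"]
            QD[OF g(2)[OF V \<sigma>] W(1,3,4,5)] W V WU r
          by (simp add: f_simps g \<sigma>)
        then show "\<exists>W. opn W \<and> x \<in> W \<and> W \<subseteq> V \<and>
          restr L V W (g V (r \<odot>\<^bsub>sheafify X P$V\<^esub> \<sigma>)) =
          restr L V W (r \<odot>\<^bsub>L$V\<^esub> g V \<sigma>)" using W by blast
      qed (use V \<sigma> r in \<open>simp_all add: g sheafify_smult_closed\<close>) }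
    fix W assume W: "opn W" "W \<subseteq> V"
    have WU: "W \<subseteq> U" using W V by order
    show "g W (restr (sheafify X P) V W \<sigma>) = restr L V W (g V \<sigma>)"
      unfolding sheafify_simps(4)
    proof (rule gI[OF W(1) WU restrS[OF V(1) W \<sigma>]])
      show "restr L V W (g V \<sigma>) \<in> sec L W" using V W \<sigma> by (simp add: g)
      show "Q (restrict \<sigma> W) W (restr L V W (g V \<sigma>))"
        using Q_res[OF V(1) W g[OF V \<sigma>]] Q_cong[of W W \<sigma>] by simp
    qed
  qed
  moreover have "mkhom X U (sheafify X P) g V (sheaf_section X P V s) = f V s"
    if V: "opn V" "V \<subseteq> U" and s: "s \<in> sec P V" for V s
  proof -
    have "g V (sheaf_section X P V s) = f V s"
    proof (rule gI[OF V])
      show "Q (sheaf_section X P V s) V (f V s)"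
        by (rule Q_local[OF V s]) (simp add: sheaf_section_def)
    qed (use V s in \<open>simp_all add: f_simps\<close>)
    then show ?thesis using V s by simp
  qed
  ultimately show ?thesis using that by blast
qed

end

end

section \<open>Quotient presheaves\<close>

context module
begin

lemma coset_facts:
  assumes N: "submodule N R M" and x: "x \<in> carrier M" and y: "y \<in> carrier M"
  shows coset_add: "(N +>\<^bsub>M\<^esub> x) <+>\<^bsub>M\<^esub> (N +>\<^bsub>M\<^esub> y) = N +>\<^bsub>M\<^esub> (x \<oplus>\<^bsub>M\<^esub> y)"
    and coset_eq_iff: "N +>\<^bsub>M\<^esub> x = N +>\<^bsub>M\<^esub> y \<longleftrightarrow> x \<ominus>\<^bsub>M\<^esub> y \<in> N"
    and coset_mem_iff: "y \<in> N +>\<^bsub>M\<^esub> x \<longleftrightarrow> y \<in> carrier M \<and> N +>\<^bsub>M\<^esub> y = N +>\<^bsub>M\<^esub> x"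
    and coset_zero: "N +>\<^bsub>M\<^esub> \<zero>\<^bsub>M\<^esub> = N"
    and coset_self: "x \<in> N +>\<^bsub>M\<^esub> x"
proof -
  interpret abelian_subgroup N M
    using submodule.axioms(1)[OF N] by (intro abelian_subgroupI3 additive_subgroup.intro) (simp_all add: M.abelian_group_axioms)
  show "(N +>\<^bsub>M\<^esub> x) <+>\<^bsub>M\<^esub> (N +>\<^bsub>M\<^esub> y) = N +>\<^bsub>M\<^esub> (x \<oplus>\<^bsub>M\<^esub> y)"
    using x y by (rule a_rcos_sum)
  show iff: "N +>\<^bsub>M\<^esub> x = N +>\<^bsub>M\<^esub> y \<longleftrightarrow> x \<ominus>\<^bsub>M\<^esub> y \<in> N"
    using a_rcos_module[OF y x] x y a_repr_independence'[of x y] a_rcos_self[OF x]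
    unfolding a_minus_def by metis
  show "y \<in> N +>\<^bsub>M\<^esub> x \<longleftrightarrow> y \<in> carrier M \<and> N +>\<^bsub>M\<^esub> y = N +>\<^bsub>M\<^esub> x"
    using x y a_repr_independence'[of y x] a_rcos_self[OF y] by metis
  show "N +>\<^bsub>M\<^esub> \<zero>\<^bsub>M\<^esub> = N" by (rule a_rcos_const) (rule zero_closed)
  show "x \<in> N +>\<^bsub>M\<^esub> x" using x by (rule a_rcos_self)
qed

lemma coset_carrier:
  assumes N: "submodule N R M" and x: "x \<in> carrier M" and y: "y \<in> N +>\<^bsub>M\<^esub> x"
  shows "y \<in> carrier M"
proof -
  interpret abelian_subgroup N M
    using submodule.axioms(1)[OF N] by (intro abelian_subgroupI3 additive_subgroup.intro) (simp_all add: M.abelian_group_axioms)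
  show ?thesis using a_elemrcos_carrier[OF x y] .
qed

text \<open>The operations on a quotient are unions over a coset. This evaluates them at one
  representative once the value is constant on the coset.\<close>

lemma UN_coset:
  assumes N: "submodule N R M" and x: "x \<in> carrier M"
    and f: "\<And>c. c \<in> carrier M \<Longrightarrow> N +>\<^bsub>M\<^esub> c = N +>\<^bsub>M\<^esub> x \<Longrightarrow> f c = f x"
  shows "(\<Union>c\<in>N +>\<^bsub>M\<^esub> x. f c) = f x"
proof -
  have "f c = f x" if "c \<in> N +>\<^bsub>M\<^esub> x" for c
    using f coset_mem_iff[OF N x coset_carrier[OF N x that]] that by blast
  then have "(\<Union>c\<in>N +>\<^bsub>M\<^esub> x. f c) = (\<Union>c\<in>N +>\<^bsub>M\<^esub> x. f x)" by (rule SUP_cong[OF refl])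
  then show ?thesis using coset_self[OF N x x] by auto
qed

lemma submodule_diff: "\<lbrakk>submodule N R M; x \<in> N; y \<in> N\<rbrakk> \<Longrightarrow> x \<ominus>\<^bsub>M\<^esub> y \<in> N"
  unfolding a_minus_def by (meson submoduleE)

lemma submodule_zero: "submodule N R M \<Longrightarrow> \<zero>\<^bsub>M\<^esub> \<in> N"
  using subgroup.one_closed[OF submodule.axioms(1), of N R M] by simp

end

context ringed
begin

context
  fixes P :: "('a, 'r, 'm) mod_presheaf" and N :: "'a set \<Rightarrow> 'm set"
  assumes P [simp]: "mod_pre X P"
    and N: "\<And>U. opn U \<Longrightarrow> submodule (N U) (R U) (P$U)"
    and N_res: "\<And>U V x. \<lbrakk>opn U; opn V; V \<subseteq> U; x \<in> N U\<rbrakk> \<Longrightarrow> restr P U V x \<in> N V"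
begin

lemma quot_simps:
  "sec (quot_presheaf P N) U = {N U +>\<^bsub>P$U\<^esub> x | x. x \<in> sec P U}"
  "\<zero>\<^bsub>quot_presheaf P N$U\<^esub> = N U"
  "C \<oplus>\<^bsub>quot_presheaf P N$U\<^esub> D = C <+>\<^bsub>P$U\<^esub> D"
  by (auto simp: quot_presheaf_def A_RCOSETS_def')

context
  fixes U assumes U: "opn U"
begin

interpretation module "R U" "P$U" using pre_module[OF P U] .

lemmas quot_coset = coset_facts[OF N[OF U]]

lemma quot_class_in:
  "x \<in> sec P U \<Longrightarrow> N U +>\<^bsub>P$U\<^esub> x \<in> sec (quot_presheaf P N) U"
  by (auto simp: quot_simps)

lemma quot_add:
  "x \<in> sec P U \<Longrightarrow> y \<in> sec P U \<Longrightarrow>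
   (N U +>\<^bsub>P$U\<^esub> x) \<oplus>\<^bsub>quot_presheaf P N$U\<^esub> (N U +>\<^bsub>P$U\<^esub> y) =
    N U +>\<^bsub>P$U\<^esub> (x \<oplus>\<^bsub>P$U\<^esub> y)"
  by (simp add: quot_simps quot_coset)

lemma quot_zero: "N U = N U +>\<^bsub>P$U\<^esub> \<zero>\<^bsub>P$U\<^esub>"
  using quot_coset(4)[of "\<zero>\<^bsub>P$U\<^esub>" "\<zero>\<^bsub>P$U\<^esub>"] by simp

lemma quot_class_zero: "x \<in> N U \<Longrightarrow> N U +>\<^bsub>P$U\<^esub> x = \<zero>\<^bsub>quot_presheaf P N$U\<^esub>"
proof -
  assume x: "x \<in> N U"
  then have "x \<in> sec P U" using submoduleE(1)[OF N[OF U]] by blast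
  then have "N U +>\<^bsub>P$U\<^esub> x = N U +>\<^bsub>P$U\<^esub> \<zero>\<^bsub>P$U\<^esub>"
    using submodule_diff[OF N[OF U] x submodule_zero[OF N[OF U]]] quot_coset(2)[of x "\<zero>\<^bsub>P$U\<^esub>"]
    by blast
  then show ?thesis using quot_zero by (simp add: quot_simps(2))
qed

lemma quot_smult:
  assumes x: "x \<in> sec P U" and r: "r \<in> \<O> U"
  shows "r \<odot>\<^bsub>quot_presheaf P N$U\<^esub> (N U +>\<^bsub>P$U\<^esub> x) =
    N U +>\<^bsub>P$U\<^esub> (r \<odot>\<^bsub>P$U\<^esub> x)"
proof -
  have "N U +>\<^bsub>P$U\<^esub> (r \<odot>\<^bsub>P$U\<^esub> c) = N U +>\<^bsub>P$U\<^esub> (r \<odot>\<^bsub>P$U\<^esub> x)"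
    if c: "c \<in> sec P U" "N U +>\<^bsub>P$U\<^esub> c = N U +>\<^bsub>P$U\<^esub> x" for c
  proof -
    have "r \<odot>\<^bsub>P$U\<^esub> (c \<ominus>\<^bsub>P$U\<^esub> x) \<in> N U"
      using c x r quot_coset(2)[OF c(1) x] submoduleE(4)[OF N[OF U]] by blast
    then show ?thesis using c x r
      by (subst quot_coset(2)) (auto simp: a_minus_def smult_r_distr smult_r_minus)
  qed
  then show ?thesis unfolding quot_presheaf_def
    by (simp add: UN_coset[OF N[OF U] x])
qed

lemma quot_res:
  assumes x: "x \<in> sec P U" and V: "opn V" "V \<subseteq> U"
  shows "restr (quot_presheaf P N) U V (N U +>\<^bsub>P$U\<^esub> x) = N V +>\<^bsub>P$V\<^esub> restr P U V x"
proof -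
  interpret V: module "R V" "P$V" using pre_module[OF P V(1)] .
  have "N V +>\<^bsub>P$V\<^esub> restr P U V c = N V +>\<^bsub>P$V\<^esub> restr P U V x"
    if c: "c \<in> sec P U" "N U +>\<^bsub>P$U\<^esub> c = N U +>\<^bsub>P$U\<^esub> x" for c
  proof -
    have "restr P U V (c \<ominus>\<^bsub>P$U\<^esub> x) \<in> N V"
      using c x quot_coset(2)[OF c(1) x] N_res[OF U V] by blast
    then show ?thesis using c x U V
      by (subst V.coset_eq_iff[OF N[OF V(1)]]) auto
  qed
  then show ?thesis unfolding quot_presheaf_def
    by (simp add: UN_coset[OF N[OF U] x])
qed

lemma module_quot: "module (R U) (quot_presheaf P N$U)"
proof (rule moduleI_sub[OF U])
  let ?Q = "quot_presheaf P N$U"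
  have zero: "\<zero>\<^bsub>?Q\<^esub> = N U +>\<^bsub>P$U\<^esub> \<zero>\<^bsub>P$U\<^esub>"
    using quot_zero by (simp add: quot_simps(2))
  note [simp] = zero quot_add quot_smult quot_class_in
  show "\<zero>\<^bsub>?Q\<^esub> \<in> carrier ?Q" by simp
  fix C assume "C \<in> carrier ?Q"
  then obtain x where x: "x \<in> sec P U" "C = N U +>\<^bsub>P$U\<^esub> x"
    by (auto simp: quot_simps(1))
  show "\<zero>\<^bsub>?Q\<^esub> \<oplus>\<^bsub>?Q\<^esub> C = C" "\<one>\<^bsub>R U\<^esub> \<odot>\<^bsub>?Q\<^esub> C = C" "\<zero>\<^bsub>R U\<^esub> \<odot>\<^bsub>?Q\<^esub> C = \<zero>\<^bsub>?Q\<^esub>"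
    using x by simp_all
  { fix r s assume r: "r \<in> \<O> U"
    then show "r \<odot>\<^bsub>?Q\<^esub> C \<in> carrier ?Q" using x by simp
    assume s: "s \<in> \<O> U"
    show "(r \<oplus>\<^bsub>R U\<^esub> s) \<odot>\<^bsub>?Q\<^esub> C = r \<odot>\<^bsub>?Q\<^esub> C \<oplus>\<^bsub>?Q\<^esub> s \<odot>\<^bsub>?Q\<^esub> C"
      "(r \<otimes>\<^bsub>R U\<^esub> s) \<odot>\<^bsub>?Q\<^esub> C = r \<odot>\<^bsub>?Q\<^esub> (s \<odot>\<^bsub>?Q\<^esub> C)"
      using x r s by (simp_all add: smult_l_distr smult_assoc1) }
  fix D assume "D \<in> carrier ?Q"
  then obtain y where y: "y \<in> sec P U" "D = N U +>\<^bsub>P$U\<^esub> y"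
    by (auto simp: quot_simps(1))
  show "C \<oplus>\<^bsub>?Q\<^esub> D \<in> carrier ?Q" "C \<oplus>\<^bsub>?Q\<^esub> D = D \<oplus>\<^bsub>?Q\<^esub> C"
    using x y by (simp_all add: M.a_comm)
  { fix r assume r: "r \<in> \<O> U"
    show "r \<odot>\<^bsub>?Q\<^esub> (C \<oplus>\<^bsub>?Q\<^esub> D) = r \<odot>\<^bsub>?Q\<^esub> C \<oplus>\<^bsub>?Q\<^esub> r \<odot>\<^bsub>?Q\<^esub> D"
      using x y r by (simp add: smult_r_distr) }
  fix E assume "E \<in> carrier ?Q"
  then obtain z where z: "z \<in> sec P U" "E = N U +>\<^bsub>P$U\<^esub> z"
    by (auto simp: quot_simps(1))
  show "C \<oplus>\<^bsub>?Q\<^esub> D \<oplus>\<^bsub>?Q\<^esub> E = C \<oplus>\<^bsub>?Q\<^esub> (D \<oplus>\<^bsub>?Q\<^esub> E)"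
    using x y z by (simp add: M.a_assoc)
qed

end

lemma quot_pre: "mod_pre X (quot_presheaf P N)"
proof (intro mod_preI is_presheafI)
  fix U V x assume "opn U" "opn V" "V \<subseteq> U" "x \<in> sec (quot_presheaf P N) U"
  then show "restr (quot_presheaf P N) U V x \<in> sec (quot_presheaf P N) V"
    by (auto simp: quot_simps(1) quot_res)
qed (auto simp: quot_simps(1) quot_res quot_add quot_smult module_quot)

lemma quot_class_lin: "lin X U P (quot_presheaf P N) (\<lambda>U x. N U +>\<^bsub>P$U\<^esub> x)"
  by (rule linI) (simp_all add: quot_class_in quot_add quot_smult quot_res)

text \<open>The value is taken at a chosen representative of the coset; the choice is harmless
  because \<open>f\<close> vanishes on \<open>N\<close>.\<close>

lemma quot_lift:
  assumes f: "lin X U P L f" and L [simp]: "mod_pre X L"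
    and ker: "\<And>V x. \<lbrakk>opn V; V \<subseteq> U; x \<in> N V\<rbrakk> \<Longrightarrow> f V x = \<zero>\<^bsub>L$V\<^esub>"
  obtains g where "lin X U (quot_presheaf P N) L g"
    "\<And>V x. \<lbrakk>opn V; V \<subseteq> U; x \<in> sec P V\<rbrakk> \<Longrightarrow> g V (N V +>\<^bsub>P$V\<^esub> x) = f V x"
proof -
  define g where "g V C = f V (SOME x. x \<in> sec P V \<and> C = N V +>\<^bsub>P$V\<^esub> x)" for V C
  have f_in: "f V x \<in> sec L V" if "opn V" "V \<subseteq> U" "x \<in> sec P V" for V x
    using f that by (simp add: lin_def)
  have g: "g V (N V +>\<^bsub>P$V\<^esub> x) = f V x" if V: "opn V" "V \<subseteq> U" and x: "x \<in> sec P V" for V x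
  proof -
    interpret module "R V" "P$V" using pre_module[OF P V(1)] .
    interpret L: module "R V" "L$V" using pre_module[OF L V(1)] .
    define y where "y = (SOME y. y \<in> sec P V \<and> N V +>\<^bsub>P$V\<^esub> x = N V +>\<^bsub>P$V\<^esub> y)"
    have "x \<in> sec P V \<and> N V +>\<^bsub>P$V\<^esub> x = N V +>\<^bsub>P$V\<^esub> x" using x by simp
    then have y: "y \<in> sec P V \<and> N V +>\<^bsub>P$V\<^esub> x = N V +>\<^bsub>P$V\<^esub> y"
      unfolding y_def by (rule someI)
    then have "x \<ominus>\<^bsub>P$V\<^esub> y \<in> N V" using coset_eq_iff[OF N[OF V(1)] x, of y] by blast
    then have "f V (x \<ominus>\<^bsub>P$V\<^esub> y) = \<zero>\<^bsub>L$V\<^esub>" using ker V by blast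
    moreover have "x = y \<oplus>\<^bsub>P$V\<^esub> (x \<ominus>\<^bsub>P$V\<^esub> y)"
      using x y by (simp add: a_minus_def M.a_ac M.r_neg M.r_neg1)
    moreover have "f V (y \<oplus>\<^bsub>P$V\<^esub> (x \<ominus>\<^bsub>P$V\<^esub> y)) =
        f V y \<oplus>\<^bsub>L$V\<^esub> f V (x \<ominus>\<^bsub>P$V\<^esub> y)"
      using f V x y by (simp add: lin_def)
    ultimately have "f V x = f V y"
      using f_in[OF V, of y] y by simp
    then show ?thesis unfolding g_def y_def by simp
  qed
  have "lin X U (quot_presheaf P N) L g"
    using f by (intro linI) (auto simp: quot_simps(1) quot_add quot_smult quot_res g lin_def)
  then show ?thesis using g that by blast
qed

end

section \<open>Free presheaves\<close>

end

text \<open>A presheaf of sets \<open>G\<close> with restriction maps \<open>\<rho>\<close>, whose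
  free modules form a presheaf of modules.\<close>

locale generators = ringed X for X :: "('a, 'r, 'z) ringed_space" +
  fixes G :: "'a set \<Rightarrow> 'g set" and \<rho> :: "'a set \<Rightarrow> 'a set \<Rightarrow> 'g \<Rightarrow> 'g"
  assumes \<rho>_closed: "\<And>U V g. \<lbrakk>opn U; opn V; V \<subseteq> U; g \<in> G U\<rbrakk> \<Longrightarrow> \<rho> U V g \<in> G V"
    and \<rho>_id: "\<And>U g. opn U \<Longrightarrow> g \<in> G U \<Longrightarrow> \<rho> U U g = g"
    and \<rho>_trans: "\<And>U V W g. \<lbrakk>opn U; opn V; V \<subseteq> U; opn W; W \<subseteq> V; g \<in> G U\<rbrakk> \<Longrightarrow>
      \<rho> V W (\<rho> U V g) = \<rho> U W g"
begin

abbreviation (input) "FF \<equiv> free_presheaf X G \<rho>"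

lemma free_simps:
  "f \<in> sec FF U \<longleftrightarrow> (\<forall>g. f g \<in> \<O> U) \<and> finite {g. f g \<noteq> \<zero>\<^bsub>R U\<^esub>} \<and>
      {g. f g \<noteq> \<zero>\<^bsub>R U\<^esub>} \<subseteq> G U"
  "\<zero>\<^bsub>FF$U\<^esub> = (\<lambda>_. \<zero>\<^bsub>R U\<^esub>)"
  "f \<oplus>\<^bsub>FF$U\<^esub> f' = (\<lambda>g. f g \<oplus>\<^bsub>R U\<^esub> f' g)"
  "r \<odot>\<^bsub>FF$U\<^esub> f = (\<lambda>g. r \<otimes>\<^bsub>R U\<^esub> f g)"
  by (simp_all add: free_presheaf_def)

lemma free_val: "f \<in> sec FF U \<Longrightarrow> f g \<in> \<O> U"
  by (simp add: free_simps)

lemma free_add_closed: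
  assumes "opn U" "f \<in> sec FF U" "f' \<in> sec FF U"
  shows "f \<oplus>\<^bsub>FF$U\<^esub> f' \<in> sec FF U"
proof -
  have sub: "{g. f g \<oplus>\<^bsub>R U\<^esub> f' g \<noteq> \<zero>\<^bsub>R U\<^esub>} \<subseteq> {g. f g \<noteq> \<zero>\<^bsub>R U\<^esub>} \<union> {g. f' g \<noteq> \<zero>\<^bsub>R U\<^esub>}"
    using assms(1) by auto
  have "finite {g. f g \<oplus>\<^bsub>R U\<^esub> f' g \<noteq> \<zero>\<^bsub>R U\<^esub>}"
    by (rule finite_subset[OF sub]) (use assms in \<open>simp add: free_simps(1)\<close>)
  moreover have "{g. f g \<oplus>\<^bsub>R U\<^esub> f' g \<noteq> \<zero>\<^bsub>R U\<^esub>} \<subseteq> G U"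
    using sub assms by (auto simp only: free_simps(1))
  ultimately show ?thesis using assms by (simp add: free_simps)
qed

lemma free_smult_closed:
  assumes "opn U" "f \<in> sec FF U" "r \<in> \<O> U"
  shows "r \<odot>\<^bsub>FF$U\<^esub> f \<in> sec FF U"
proof -
  have sub: "{g. r \<otimes>\<^bsub>R U\<^esub> f g \<noteq> \<zero>\<^bsub>R U\<^esub>} \<subseteq> {g. f g \<noteq> \<zero>\<^bsub>R U\<^esub>}"
    using assms(1,3) by auto
  then show ?thesis using assms finite_subset[OF sub] by (auto simp: free_simps)
qed

lemma free_zero_closed: "opn U \<Longrightarrow> \<zero>\<^bsub>FF$U\<^esub> \<in> sec FF U"
  by (simp add: free_simps)

lemma free_gen_closed:
  assumes "opn U" "g \<in> G U" shows "fgen X U g \<in> sec FF U"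
proof -
  have "{h. fgen X U g h \<noteq> \<zero>\<^bsub>R U\<^esub>} \<subseteq> {g}" by (auto simp: fgen_def)
  then show ?thesis using assms by (auto simp: free_simps fgen_def intro: finite_subset)
qed

lemma module_free: "opn U \<Longrightarrow> module (R U) (FF$U)"
proof (rule moduleI_sub)
  assume U: "opn U"
  note [simp] = free_val
  fix f assume f [simp]: "f \<in> sec FF U"
  { fix r s assume rs [simp]: "r \<in> \<O> U" "s \<in> \<O> U"
  show "(r \<oplus>\<^bsub>R U\<^esub> s) \<odot>\<^bsub>FF$U\<^esub> f =
      r \<odot>\<^bsub>FF$U\<^esub> f \<oplus>\<^bsub>FF$U\<^esub> s \<odot>\<^bsub>FF$U\<^esub> f"
    "(r \<otimes>\<^bsub>R U\<^esub> s) \<odot>\<^bsub>FF$U\<^esub> f = r \<odot>\<^bsub>FF$U\<^esub> (s \<odot>\<^bsub>FF$U\<^esub> f)"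
    using U by (simp_all add: free_simps(2-) R_distr R_ac) }
  fix f' assume f' [simp]: "f' \<in> sec FF U"
  show "f \<oplus>\<^bsub>FF$U\<^esub> f' = f' \<oplus>\<^bsub>FF$U\<^esub> f"
    using U by (simp add: free_simps(2-) R_ac)
  { fix r assume [simp]: "r \<in> \<O> U"
  show "r \<odot>\<^bsub>FF$U\<^esub> (f \<oplus>\<^bsub>FF$U\<^esub> f') =
      r \<odot>\<^bsub>FF$U\<^esub> f \<oplus>\<^bsub>FF$U\<^esub> r \<odot>\<^bsub>FF$U\<^esub> f'"
    using U by (simp add: free_simps(2-) R_distr) }
  fix f'' assume f'' [simp]: "f'' \<in> sec FF U"
  show "f \<oplus>\<^bsub>FF$U\<^esub> f' \<oplus>\<^bsub>FF$U\<^esub> f'' = f \<oplus>\<^bsub>FF$U\<^esub> (f' \<oplus>\<^bsub>FF$U\<^esub> f'')"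
    using U by (simp_all add: free_simps(2-) R_ac)
qed (simp_all add: free_add_closed free_smult_closed free_zero_closed, simp_all add: free_simps(2-) free_val)

text \<open>Induction on a finite set containing the support: clearing one coefficient splits off a
  multiple of a generator.\<close>

lemma free_induct [consumes 2, case_names zero add gen]:
  assumes U: "opn U" and f: "f \<in> sec FF U"
    and zero: "Q \<zero>\<^bsub>FF$U\<^esub>"
    and add: "\<And>f f'. \<lbrakk>f \<in> sec FF U; f' \<in> sec FF U; Q f; Q f'\<rbrakk> \<Longrightarrow>
      Q (f \<oplus>\<^bsub>FF$U\<^esub> f')"
    and gen: "\<And>r g. r \<in> \<O> U \<Longrightarrow> g \<in> G U \<Longrightarrow> Q (r \<odot>\<^bsub>FF$U\<^esub> fgen X U g)"
  shows "Q f"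
proof -
  have "\<forall>f. f \<in> sec FF U \<longrightarrow> {g. f g \<noteq> \<zero>\<^bsub>R U\<^esub>} \<subseteq> A \<longrightarrow> Q f" if "finite A" for A
    using that
  proof (induction A)
    case empty
    then show ?case using zero by (auto simp: free_simps(2) fun_eq_iff dest: ext)
  next
    case (insert a A)
    show ?case
    proof (intro allI impI)
      fix f assume f: "f \<in> sec FF U" and sub: "{g. f g \<noteq> \<zero>\<^bsub>R U\<^esub>} \<subseteq> insert a A"
      show "Q f"
      proof (cases "f a = \<zero>\<^bsub>R U\<^esub>")
        case True
        then have "{g. f g \<noteq> \<zero>\<^bsub>R U\<^esub>} \<subseteq> A" using sub by auto
        then show ?thesis using insert.IH f by blast
      next
        case False
        then have a: "a \<in> G U" using f by (auto simp: free_simps(1))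
        define f0 where "f0 = f(a := \<zero>\<^bsub>R U\<^esub>)"
        have sub0: "{g. f0 g \<noteq> \<zero>\<^bsub>R U\<^esub>} \<subseteq> {g. f g \<noteq> \<zero>\<^bsub>R U\<^esub>}" by (auto simp: f0_def)
        have "{g. f g \<noteq> \<zero>\<^bsub>R U\<^esub>} \<subseteq> G U" "finite {g. f g \<noteq> \<zero>\<^bsub>R U\<^esub>}" using f by (simp_all add: free_simps(1))
        then have "{g. f0 g \<noteq> \<zero>\<^bsub>R U\<^esub>} \<subseteq> G U" "finite {g. f0 g \<noteq> \<zero>\<^bsub>R U\<^esub>}"
          using sub0 finite_subset by blast+
        moreover have "\<forall>g. f0 g \<in> \<O> U" using f U by (simp add: f0_def free_simps(1))
        ultimately have f0: "f0 \<in> sec FF U" by (simp add: free_simps(1))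
        have "{g. f0 g \<noteq> \<zero>\<^bsub>R U\<^esub>} \<subseteq> A" using sub by (auto simp: f0_def)
        then have "Q f0" using insert.IH f0 by blast
        moreover have "f = f0 \<oplus>\<^bsub>FF$U\<^esub> f a \<odot>\<^bsub>FF$U\<^esub> fgen X U a"
          using f U by (simp add: free_simps f0_def fgen_def fun_eq_iff)
        ultimately show ?thesis
          using add[OF f0 _ _ gen[of "f a" a]] gen[of "f a" a] a free_val[OF f, of a] free_smult_closed free_gen_closed U by metis
      qed
    qed
  qed
  then show ?thesis using f by (auto simp: free_simps(1))
qed

text \<open>The linear extension of \<open>\<beta>\<close> along the restriction of scalars from
  \<open>U\<close> to \<open>V\<close>. The two open sets differ when it expresses restriction maps,
  and coincide when it induces morphisms.\<close>

definition flift :: "'a set \<Rightarrow> 'a set \<Rightarrow> ('r, 'l) module \<Rightarrow> ('g \<Rightarrow> 'l) \<Rightarrow> ('g \<Rightarrow> 'r) \<Rightarrow> 'l" where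
  "flift U V L \<beta> f = (\<Oplus>\<^bsub>L\<^esub>g\<in>{g. f g \<noteq> \<zero>\<^bsub>R U\<^esub>}. rr U V (f g) \<odot>\<^bsub>L\<^esub> \<beta> g)"

context
  fixes U V :: "'a set" and L :: "('r, 'l) module" and \<beta> :: "'g \<Rightarrow> 'l"
  assumes U: "opn U" and V: "opn V" "V \<subseteq> U" and L: "module (R V) L" and \<beta>: "\<And>g. g \<in> G U \<Longrightarrow> \<beta> g \<in> carrier L"
begin

interpretation L: module "R V" L by (rule L)

text \<open>Summing over a fixed finite set that contains the support lets the sums for different
  arguments be compared term by term.\<close>

lemma flift_superset:
  assumes f: "f \<in> sec FF U" and A: "finite A" "{g. f g \<noteq> \<zero>\<^bsub>R U\<^esub>} \<subseteq> A" "A \<subseteq> G U"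
  shows "flift U V L \<beta> f = (\<Oplus>\<^bsub>L\<^esub>g\<in>A. rr U V (f g) \<odot>\<^bsub>L\<^esub> \<beta> g)"
  unfolding flift_def
  using f A U V \<beta>
  by (intro L.M.add.finprod_mono_neutral_cong_left) (auto simp: free_val subset_iff)

lemma flift_closed: "f \<in> sec FF U \<Longrightarrow> flift U V L \<beta> f \<in> carrier L"
  unfolding flift_def using \<beta> U V by (intro L.finsum_closed) (auto simp: free_simps(1))

lemma flift_add:
  assumes "f \<in> sec FF U" "f' \<in> sec FF U"
  shows "flift U V L \<beta> (f \<oplus>\<^bsub>FF$U\<^esub> f') = flift U V L \<beta> f \<oplus>\<^bsub>L\<^esub> flift U V L \<beta> f'"
proof -
  \<comment> \<open>The support of a sum can be smaller than the union of the supports, so all three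
    sums are taken over this union.\<close>
  define A where "A = {g. f g \<noteq> \<zero>\<^bsub>R U\<^esub>} \<union> {g. f' g \<noteq> \<zero>\<^bsub>R U\<^esub>}"
  have A: "finite A" "A \<subseteq> G U" "{g. f g \<noteq> \<zero>\<^bsub>R U\<^esub>} \<subseteq> A" "{g. f' g \<noteq> \<zero>\<^bsub>R U\<^esub>} \<subseteq> A"
    using assms by (simp_all add: A_def free_simps(1))
  have A': "{g. (f \<oplus>\<^bsub>FF$U\<^esub> f') g \<noteq> \<zero>\<^bsub>R U\<^esub>} \<subseteq> A"
    using U by (auto simp: A_def free_simps)
  have fin: "(\<lambda>g. rr U V (h g) \<odot>\<^bsub>L\<^esub> \<beta> g) \<in> A \<rightarrow> carrier L" if "h \<in> sec FF U" for h
    using A(2) \<beta> U V that by (auto simp: free_val)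
  have "flift U V L \<beta> (f \<oplus>\<^bsub>FF$U\<^esub> f') =
      (\<Oplus>\<^bsub>L\<^esub>g\<in>A. rr U V (f g) \<odot>\<^bsub>L\<^esub> \<beta> g \<oplus>\<^bsub>L\<^esub> rr U V (f' g) \<odot>\<^bsub>L\<^esub> \<beta> g)"
    unfolding flift_superset[OF free_add_closed[OF U assms] A(1) A' A(2)]
    using assms A(2) \<beta> U V
    by (intro L.finsum_cong') (auto simp: free_simps(3) free_val L.smult_l_distr)
  also have "\<dots> = flift U V L \<beta> f \<oplus>\<^bsub>L\<^esub> flift U V L \<beta> f'"
    unfolding flift_superset[OF assms(1) A(1,3,2)] flift_superset[OF assms(2) A(1,4,2)]
    using fin[OF assms(1)] fin[OF assms(2)] by (rule L.finsum_addf)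
  finally show ?thesis .
qed

lemma flift_smult:
  assumes f: "f \<in> sec FF U" and r: "r \<in> \<O> U"
  shows "flift U V L \<beta> (r \<odot>\<^bsub>FF$U\<^esub> f) = rr U V r \<odot>\<^bsub>L\<^esub> flift U V L \<beta> f"
proof -
  define A where "A = {g. f g \<noteq> \<zero>\<^bsub>R U\<^esub>}"
  have A: "finite A" "A \<subseteq> G U" "{g. f g \<noteq> \<zero>\<^bsub>R U\<^esub>} \<subseteq> A"
    using f by (simp_all add: A_def free_simps(1))
  have A': "{g. (r \<odot>\<^bsub>FF$U\<^esub> f) g \<noteq> \<zero>\<^bsub>R U\<^esub>} \<subseteq> A"
    using U r by (auto simp: A_def free_simps)
  have "flift U V L \<beta> (r \<odot>\<^bsub>FF$U\<^esub> f) = (\<Oplus>\<^bsub>L\<^esub>g\<in>A. rr U V r \<odot>\<^bsub>L\<^esub> (rr U V (f g) \<odot>\<^bsub>L\<^esub> \<beta> g))"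
    unfolding flift_superset[OF free_smult_closed[OF U f r] A(1) A' A(2)]
    using f r A(2) \<beta> U V
    by (intro L.finsum_cong') (auto simp: free_simps(4) free_val L.smult_assoc1)
  also have "\<dots> = rr U V r \<odot>\<^bsub>L\<^esub> flift U V L \<beta> f"
    unfolding flift_superset[OF f A(1,3,2)]
    using A \<beta> U V r f by (intro L.finsum_smult_ldistr[symmetric]) (auto simp: free_val)
  finally show ?thesis .
qed

lemma flift_gen:
  assumes g: "g \<in> G U" shows "flift U V L \<beta> (fgen X U g) = \<beta> g"
proof -
  have "flift U V L \<beta> (fgen X U g) = (\<Oplus>\<^bsub>L\<^esub>h\<in>{g}. rr U V (fgen X U g h) \<odot>\<^bsub>L\<^esub> \<beta> h)"
    using g by (intro flift_superset free_gen_closed U) (auto simp: fgen_def)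
  also have "\<dots> = \<beta> g"
    using \<beta> [OF g] U V L.finsum_insert[of "{}" g "\<lambda>h. rr U V (fgen X U g h) \<odot>\<^bsub>L\<^esub> \<beta> h"] by (simp add: fgen_def)
  finally show ?thesis .
qed

lemma flift_zero: "flift U V L \<beta> \<zero>\<^bsub>FF$U\<^esub> = \<zero>\<^bsub>L\<^esub>"
  by (simp add: flift_def free_simps)

lemmas flift_simps = flift_closed flift_add flift_smult flift_gen flift_zero

end

end

section \<open>Restriction maps of free presheaves\<close>

context generators
begin

text \<open>The structure module leaves the multiplicative fields undefined and so is a different
  record from the ring, but finite sums use only the additive structure.\<close>

lemma finsum_struct: "finsum (OX$V) = finsum (R V)"
proof -
  have "(\<oplus>\<^bsub>OX$V\<^esub>) = (\<oplus>\<^bsub>R V\<^esub>)" by (intro ext) simp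
  then show ?thesis by (intro ext) (simp add: finsum_def finprod_def)
qed

text \<open>Restriction adds the coefficients of all generators that become equal to
  \<open>h\<close>. This is the linear extension of the indicator function of those generators, so
  restriction inherits its linearity from \<open>flift\<close>.\<close>

lemma free_restr_eq:
  assumes U: "opn U" and V: "opn V" "V \<subseteq> U" and f: "f \<in> sec FF U"
  shows "restr FF U V f h = flift U V (OX$V)
    (\<lambda>g. if \<rho> U V g = h then \<one>\<^bsub>R V\<^esub> else \<zero>\<^bsub>R V\<^esub>) f"
proof -
  interpret V: cring "R V" using cring_R[OF V(1)] .
  have fin: "finite {g. f g \<noteq> \<zero>\<^bsub>R U\<^esub>}" using f by (simp add: free_simps(1))
  show ?thesis
    unfolding flift_def finsum_struct
    using U V f
    by (simp add: free_presheaf_def, intro V.add.finprod_mono_neutral_cong_left fin)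
      (auto simp: free_val)
qed

context
  fixes U V assumes U: "opn U" and V: "opn V" "V \<subseteq> U"
begin

lemma struct_mod: "module (R V) (OX$V)"
  using pre_module[OF module_sheaf_pre[OF struct_sheaf] V(1)] .

lemmas flift_res = flift_simps[OF U V struct_mod]

lemma free_res_closed:
  assumes f: "f \<in> sec FF U" shows "restr FF U V f \<in> sec FF V"
proof -
  have val: "restr FF U V f h \<in> \<O> V" for h
    using flift_res(1)[of "\<lambda>g. if \<rho> U V g = h then \<one>\<^bsub>R V\<^esub> else \<zero>\<^bsub>R V\<^esub>"] V f
    by (simp add: free_restr_eq[OF U V f])
  \<comment> \<open>Several generators may acquire the same restriction and their coefficients may
    cancel, so the new support is only contained in the image of the old one.\<close>
  have sub: "{h. restr FF U V f h \<noteq> \<zero>\<^bsub>R V\<^esub>} \<subseteq> \<rho> U V ` {g. f g \<noteq> \<zero>\<^bsub>R U\<^esub>}"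
  proof
    fix h assume h: "h \<in> {h. restr FF U V f h \<noteq> \<zero>\<^bsub>R V\<^esub>}"
    interpret V: cring "R V" using cring_R[OF V(1)] .
    have "{g. f g \<noteq> \<zero>\<^bsub>R U\<^esub> \<and> \<rho> U V g = h} \<noteq> {}"
    proof
      assume "{g. f g \<noteq> \<zero>\<^bsub>R U\<^esub> \<and> \<rho> U V g = h} = {}"
      then have "restr FF U V f h = \<zero>\<^bsub>R V\<^esub>"
        by (simp only: free_presheaf_def presheaf.simps V.finsum_empty)
      then show False using h by simp
    qed
    then show "h \<in> \<rho> U V ` {g. f g \<noteq> \<zero>\<^bsub>R U\<^esub>}" by auto
  qed
  have "finite {g. f g \<noteq> \<zero>\<^bsub>R U\<^esub>}" "{g. f g \<noteq> \<zero>\<^bsub>R U\<^esub>} \<subseteq> G U" using f by (simp_all add: free_simps(1))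
  then have "finite {h. restr FF U V f h \<noteq> \<zero>\<^bsub>R V\<^esub>}" "{h. restr FF U V f h \<noteq> \<zero>\<^bsub>R V\<^esub>} \<subseteq> G V"
    using sub \<rho>_closed[OF U V] by (auto intro: finite_subset[OF sub])
  then show ?thesis using val by (simp add: free_simps(1))
qed

lemma free_res_add:
  assumes "f \<in> sec FF U" "f' \<in> sec FF U"
  shows "restr FF U V (f \<oplus>\<^bsub>FF$U\<^esub> f') = restr FF U V f \<oplus>\<^bsub>FF$V\<^esub> restr FF U V f'"
proof
  fix h
  show "restr FF U V (f \<oplus>\<^bsub>FF$U\<^esub> f') h = (restr FF U V f \<oplus>\<^bsub>FF$V\<^esub> restr FF U V f') h"
    unfolding free_simps(3)[of V]
    using assms V flift_res(2)[of "\<lambda>g. if \<rho> U V g = h then \<one>\<^bsub>R V\<^esub> else \<zero>\<^bsub>R V\<^esub>"]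
    by (simp add: free_restr_eq[OF U V] free_add_closed[OF U])
qed

lemma free_res_smult:
  assumes "f \<in> sec FF U" "r \<in> \<O> U"
  shows "restr FF U V (r \<odot>\<^bsub>FF$U\<^esub> f) = rr U V r \<odot>\<^bsub>FF$V\<^esub> restr FF U V f"
proof
  fix h
  show "restr FF U V (r \<odot>\<^bsub>FF$U\<^esub> f) h = (rr U V r \<odot>\<^bsub>FF$V\<^esub> restr FF U V f) h"
    unfolding free_simps(4)[of V]
    using assms V flift_res(3)[of "\<lambda>g. if \<rho> U V g = h then \<one>\<^bsub>R V\<^esub> else \<zero>\<^bsub>R V\<^esub>"]
    by (simp add: free_restr_eq[OF U V] free_smult_closed[OF U])
qed

lemma free_res_gen:
  assumes "g \<in> G U" shows "restr FF U V (fgen X U g) = fgen X V (\<rho> U V g)"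
proof
  fix h
  show "restr FF U V (fgen X U g) h = fgen X V (\<rho> U V g) h"
    using assms V flift_res(4)[of "\<lambda>g. if \<rho> U V g = h then \<one>\<^bsub>R V\<^esub> else \<zero>\<^bsub>R V\<^esub>" g]
    by (simp add: free_restr_eq[OF U V] free_gen_closed[OF U]) (auto simp: fgen_def)
qed

lemma free_res_zero: "restr FF U V \<zero>\<^bsub>FF$U\<^esub> = \<zero>\<^bsub>FF$V\<^esub>"
proof
  fix h
  show "restr FF U V \<zero>\<^bsub>FF$U\<^esub> h = \<zero>\<^bsub>FF$V\<^esub> h"
    using V flift_res(5)[of "\<lambda>g. if \<rho> U V g = h then \<one>\<^bsub>R V\<^esub> else \<zero>\<^bsub>R V\<^esub>"]
    by (simp add: free_restr_eq[OF U V] free_zero_closed[OF U]) (simp add: free_simps(2))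
qed

end

text \<open>Functoriality of restriction is clear on generators and extends by linearity through
  \<open>free_induct\<close>.\<close>

lemma free_pre: "mod_pre X FF"
proof (intro mod_preI is_presheafI)
  fix U f assume U: "opn U" and f: "f \<in> sec FF U"
  show "restr FF U U f = f"
    using U f by (induction rule: free_induct)
      (simp_all add: free_res_zero free_res_add free_res_smult free_res_gen free_gen_closed U \<rho>_id)
next
  fix U V W f assume U: "opn U" "opn V" "V \<subseteq> U" "opn W" "W \<subseteq> V" and f: "f \<in> sec FF U"
  have WU: "W \<subseteq> U" using U by order
  show "restr FF V W (restr FF U V f) = restr FF U W f"
    using U(1) f by (induction rule: free_induct)
      (simp_all add: free_res_zero free_res_add free_res_smult free_res_gen free_gen_closed free_res_closed U WU \<rho>_trans \<rho>_closed)
qed (simp_all add: module_free free_res_closed free_res_add free_res_smult)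

end

section \<open>Spans and preimages of submodules\<close>

lemma mod_span_submodule:
  fixes M :: "('r, 'm) module"
  assumes M: "module R M" and "S \<subseteq> carrier M" shows "submodule (mod_span R M S) R M"
proof -
  interpret module R M by (rule M)
  have c: "submodule (carrier M) R M" by (rule carrier_is_submodule)
  show ?thesis
  proof (rule submoduleI)
    show "mod_span R M S \<subseteq> carrier M" using c assms(2) unfolding mod_span_def by blast
    show "\<zero>\<^bsub>M\<^esub> \<in> mod_span R M S" unfolding mod_span_def using submodule_zero by blast
  qed (auto simp: mod_span_def intro: submoduleE)
qed

lemma mod_span_sub: "S \<subseteq> mod_span R M S"
  unfolding mod_span_def by blast

lemma mod_span_least: "submodule N R M \<Longrightarrow> S \<subseteq> N \<Longrightarrow> mod_span R M S \<subseteq> N"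
  unfolding mod_span_def by blast

text \<open>The map \<open>f\<close> is only semilinear over \<open>\<phi>\<close>, so that this
  covers the preimage of a submodule under a restriction map as well as the kernel of a linear
  map.\<close>

lemma submodule_kernel:
  assumes "module R M"
    and f: "\<And>x. x \<in> carrier M \<Longrightarrow> f x \<in> carrier L"
      "\<And>x y. x \<in> carrier M \<Longrightarrow> y \<in> carrier M \<Longrightarrow> f (x \<oplus>\<^bsub>M\<^esub> y) = f x \<oplus>\<^bsub>L\<^esub> f y"
      "\<And>r x. r \<in> carrier R \<Longrightarrow> x \<in> carrier M \<Longrightarrow> f (r \<odot>\<^bsub>M\<^esub> x) = \<phi> r \<odot>\<^bsub>L\<^esub> f x"
    and K: "submodule K S L" "module S L" and \<phi>: "\<And>r. r \<in> carrier R \<Longrightarrow> \<phi> r \<in> carrier S"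
  shows "submodule {x \<in> carrier M. f x \<in> K} R M"
proof -
  interpret M: module R M by fact
  interpret L: module S L by fact
  note K' = L.submoduleE[OF K(1)] L.submodule_zero[OF K(1)]
  have zero: "f \<zero>\<^bsub>M\<^esub> = \<zero>\<^bsub>L\<^esub>"
  proof -
    have "f \<zero>\<^bsub>M\<^esub> \<oplus>\<^bsub>L\<^esub> f \<zero>\<^bsub>M\<^esub> = f \<zero>\<^bsub>M\<^esub>" using f(2)[of "\<zero>\<^bsub>M\<^esub>" "\<zero>\<^bsub>M\<^esub>"] by simp
    then show ?thesis using f(1)[of "\<zero>\<^bsub>M\<^esub>"] by (simp add: L.M.add.l_cancel_one)
  qed
  have neg: "f (\<ominus>\<^bsub>M\<^esub> x) = \<ominus>\<^bsub>L\<^esub> f x" if x: "x \<in> carrier M" for x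
    using f(2)[of "\<ominus>\<^bsub>M\<^esub> x" x] f(1)[of x] f(1)[of "\<ominus>\<^bsub>M\<^esub> x"] x zero
    by (metis L.M.minus_equality M.M.a_inv_closed M.M.l_neg)
  show ?thesis
    by (rule M.submoduleI) (use K' f \<phi> zero neg in auto)
qed

section \<open>Sheaves presented by generating pairs\<close>

definition bilin where
  "bilin X U M N L \<beta> \<longleftrightarrow> (\<forall>V\<in>opens X U. \<forall>x\<in>sec M V. \<forall>y\<in>sec N V. \<beta> V x y \<in> sec L V \<and>
    (\<forall>x'\<in>sec M V. \<beta> V (x \<oplus>\<^bsub>M$V\<^esub> x') y = \<beta> V x y \<oplus>\<^bsub>L$V\<^esub> \<beta> V x' y) \<and>
    (\<forall>y'\<in>sec N V. \<beta> V x (y \<oplus>\<^bsub>N$V\<^esub> y') = \<beta> V x y \<oplus>\<^bsub>L$V\<^esub> \<beta> V x y') \<and>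
    (\<forall>r\<in>sec (str X) V.
      \<beta> V (r \<odot>\<^bsub>M$V\<^esub> x) y = r \<odot>\<^bsub>L$V\<^esub> \<beta> V x y \<and>
      \<beta> V x (r \<odot>\<^bsub>N$V\<^esub> y) = r \<odot>\<^bsub>L$V\<^esub> \<beta> V x y) \<and>
    (\<forall>W\<in>opens X V. \<beta> W (restr M V W x) (restr N V W y) = restr L V W (\<beta> V x y)))"

context ringed
begin

lemma mod_diff_zero:
  assumes M: "mod_pre X M" and U: "opn U" and x: "x \<in> sec M U" and y: "y \<in> sec M U"
  shows "x \<ominus>\<^bsub>M$U\<^esub> y = \<zero>\<^bsub>M$U\<^esub> \<longleftrightarrow> x = y"
proof -
  interpret module "R U" "M$U" using pre_module[OF M U] .
  show ?thesis
  proof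
    assume "x \<ominus>\<^bsub>M$U\<^esub> y = \<zero>\<^bsub>M$U\<^esub>"
    then show "x = y" using M.minus_equality[of x "\<ominus>\<^bsub>M$U\<^esub> y"] x y by (simp add: a_minus_def)
  qed (use y in \<open>simp add: a_minus_def M.r_neg\<close>)
qed

lemma bilinI:
  assumes "\<And>V x y. \<lbrakk>opn V; V \<subseteq> U; x \<in> sec M V; y \<in> sec N V\<rbrakk> \<Longrightarrow> \<beta> V x y \<in> sec L V"
    "\<And>V x y x'. \<lbrakk>opn V; V \<subseteq> U; x \<in> sec M V; x' \<in> sec M V; y \<in> sec N V\<rbrakk> \<Longrightarrow>
      \<beta> V (x \<oplus>\<^bsub>M$V\<^esub> x') y = \<beta> V x y \<oplus>\<^bsub>L$V\<^esub> \<beta> V x' y"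
    "\<And>V x y y'. \<lbrakk>opn V; V \<subseteq> U; x \<in> sec M V; y \<in> sec N V; y' \<in> sec N V\<rbrakk> \<Longrightarrow>
      \<beta> V x (y \<oplus>\<^bsub>N$V\<^esub> y') = \<beta> V x y \<oplus>\<^bsub>L$V\<^esub> \<beta> V x y'"
    "\<And>V x y r. \<lbrakk>opn V; V \<subseteq> U; x \<in> sec M V; y \<in> sec N V; r \<in> \<O> V\<rbrakk> \<Longrightarrow>
      \<beta> V (r \<odot>\<^bsub>M$V\<^esub> x) y = r \<odot>\<^bsub>L$V\<^esub> \<beta> V x y"
    "\<And>V x y r. \<lbrakk>opn V; V \<subseteq> U; x \<in> sec M V; y \<in> sec N V; r \<in> \<O> V\<rbrakk> \<Longrightarrow>
      \<beta> V x (r \<odot>\<^bsub>N$V\<^esub> y) = r \<odot>\<^bsub>L$V\<^esub> \<beta> V x y"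
    "\<And>V x y W. \<lbrakk>opn V; V \<subseteq> U; x \<in> sec M V; y \<in> sec N V; opn W; W \<subseteq> V\<rbrakk> \<Longrightarrow>
      \<beta> W (restr M V W x) (restr N V W y) = restr L V W (\<beta> V x y)"
  shows "bilin X U M N L \<beta>"
  using assms by (simp add: bilin_def)

lemma bilinD:
  assumes "bilin X U M N L \<beta>" "opn V" "V \<subseteq> U" "x \<in> sec M V" "y \<in> sec N V"
  shows "\<beta> V x y \<in> sec L V"
    "x' \<in> sec M V \<Longrightarrow> \<beta> V (x \<oplus>\<^bsub>M$V\<^esub> x') y = \<beta> V x y \<oplus>\<^bsub>L$V\<^esub> \<beta> V x' y"
    "y' \<in> sec N V \<Longrightarrow> \<beta> V x (y \<oplus>\<^bsub>N$V\<^esub> y') = \<beta> V x y \<oplus>\<^bsub>L$V\<^esub> \<beta> V x y'"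
    "r \<in> \<O> V \<Longrightarrow> \<beta> V (r \<odot>\<^bsub>M$V\<^esub> x) y = r \<odot>\<^bsub>L$V\<^esub> \<beta> V x y"
    "r \<in> \<O> V \<Longrightarrow> \<beta> V x (r \<odot>\<^bsub>N$V\<^esub> y) = r \<odot>\<^bsub>L$V\<^esub> \<beta> V x y"
    "opn W \<Longrightarrow> W \<subseteq> V \<Longrightarrow> \<beta> W (restr M V W x) (restr N V W y) = restr L V W (\<beta> V x y)"
  using assms by (simp_all add: bilin_def)

end

text \<open>Tensor products, exterior squares and symmetric squares are treated at once. They differ
  only in the extra relations \<open>E\<close>: none, the generators at (x, x), and the differences
  of the generators at (x, y) and (y, x).\<close>

locale pairs = ringed X for X :: "('a, 'r, 'z) ringed_space" +
  fixes M :: "('a, 'r, 'm) mod_presheaf" and N :: "('a, 'r, 'n) mod_presheaf"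
    and E :: "'a set \<Rightarrow> ('m \<times> 'n \<Rightarrow> 'r) set"
  assumes M [simp]: "mod_pre X M" and N [simp]: "mod_pre X N"
    and E_sub: "\<And>U. opn U \<Longrightarrow> E U \<subseteq> sec (pair_free X M N) U"
    and E_res: "\<And>U V e. \<lbrakk>opn U; opn V; V \<subseteq> U; e \<in> E U\<rbrakk> \<Longrightarrow> restr (pair_free X M N) U V e \<in> E V"
begin

sublocale gens: generators X "\<lambda>U. sec M U \<times> sec N U" "\<lambda>U V. map_prod (restr M U V) (restr N U V)"
  by unfold_locales auto

abbreviation (input) "F \<equiv> pair_free X M N"

lemmas pf_defs = pair_free_def[symmetric]
lemmas pf_pre [simp] = gens.free_pre[unfolded pf_defs]
lemmas pf_gen [simp] = gens.free_gen_closed[unfolded pf_defs]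
lemmas pf_res_gen = gens.free_res_gen[unfolded pf_defs]
lemmas pf_flift = gens.flift_simps[unfolded pf_defs]
lemmas pf_induct [consumes 2, case_names zero add gen] = gens.free_induct[unfolded pf_defs]

abbreviation (input) "d U x y \<equiv> fgen X U (x, y)"

definition span :: "'a set \<Rightarrow> ('m \<times> 'n \<Rightarrow> 'r) set" where
  "span U = mod_span (R U) (F$U) (bilinear_rels X M N U \<union> E U)"

lemma rels_cases:
  assumes "e \<in> bilinear_rels X M N U"
  obtains x x' y where "x \<in> sec M U" "x' \<in> sec M U" "y \<in> sec N U"
      "e = d U (x \<oplus>\<^bsub>M$U\<^esub> x') y \<ominus>\<^bsub>F$U\<^esub> (d U x y \<oplus>\<^bsub>F$U\<^esub> d U x' y)"
    | x y y' where "x \<in> sec M U" "y \<in> sec N U" "y' \<in> sec N U"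
      "e = d U x (y \<oplus>\<^bsub>N$U\<^esub> y') \<ominus>\<^bsub>F$U\<^esub> (d U x y \<oplus>\<^bsub>F$U\<^esub> d U x y')"
    | r x y where "r \<in> \<O> U" "x \<in> sec M U" "y \<in> sec N U"
      "e = d U (r \<odot>\<^bsub>M$U\<^esub> x) y \<ominus>\<^bsub>F$U\<^esub> (r \<odot>\<^bsub>F$U\<^esub> d U x y)"
    | r x y where "r \<in> \<O> U" "x \<in> sec M U" "y \<in> sec N U"
      "e = d U x (r \<odot>\<^bsub>N$U\<^esub> y) \<ominus>\<^bsub>F$U\<^esub> (r \<odot>\<^bsub>F$U\<^esub> d U x y)"
  using assms unfolding bilinear_rels_def Let_def by blast

lemma rels_intros:
  "\<lbrakk>x \<in> sec M U; x' \<in> sec M U; y \<in> sec N U\<rbrakk> \<Longrightarrow>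
    d U (x \<oplus>\<^bsub>M$U\<^esub> x') y \<ominus>\<^bsub>F$U\<^esub> (d U x y \<oplus>\<^bsub>F$U\<^esub> d U x' y) \<in> bilinear_rels X M N U"
  "\<lbrakk>x \<in> sec M U; y \<in> sec N U; y' \<in> sec N U\<rbrakk> \<Longrightarrow>
    d U x (y \<oplus>\<^bsub>N$U\<^esub> y') \<ominus>\<^bsub>F$U\<^esub> (d U x y \<oplus>\<^bsub>F$U\<^esub> d U x y') \<in> bilinear_rels X M N U"
  "\<lbrakk>r \<in> \<O> U; x \<in> sec M U; y \<in> sec N U\<rbrakk> \<Longrightarrow>
    d U (r \<odot>\<^bsub>M$U\<^esub> x) y \<ominus>\<^bsub>F$U\<^esub> (r \<odot>\<^bsub>F$U\<^esub> d U x y) \<in> bilinear_rels X M N U"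
  "\<lbrakk>r \<in> \<O> U; x \<in> sec M U; y \<in> sec N U\<rbrakk> \<Longrightarrow>
    d U x (r \<odot>\<^bsub>N$U\<^esub> y) \<ominus>\<^bsub>F$U\<^esub> (r \<odot>\<^bsub>F$U\<^esub> d U x y) \<in> bilinear_rels X M N U"
  unfolding bilinear_rels_def Let_def by blast+

lemma rels_sub: "opn U \<Longrightarrow> bilinear_rels X M N U \<subseteq> sec F U"
proof
  fix e assume "opn U" "e \<in> bilinear_rels X M N U"
  then show "e \<in> sec F U" by - (erule rels_cases; simp)
qed

lemma rels_res:
  assumes "opn U" "opn V" "V \<subseteq> U" "e \<in> bilinear_rels X M N U"
  shows "restr F U V e \<in> bilinear_rels X M N V"
  using assms(4)
  by (rule rels_cases) (use assms(1-3) in \<open>simp_all add: pf_res_gen rels_intros\<close>)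

lemma span_submodule: "opn U \<Longrightarrow> submodule (span U) (R U) (F$U)"
  unfolding span_def
  by (intro mod_span_submodule pre_module) (use rels_sub E_sub in auto)

text \<open>The elements whose restriction lies in the span over \<open>V\<close> form a submodule,
  and it contains all relations over \<open>U\<close>.\<close>

lemma span_res:
  assumes U: "opn U" "opn V" "V \<subseteq> U" and x: "x \<in> span U"
  shows "restr F U V x \<in> span V"
proof -
  interpret module "R U" "F$U" using pre_module[OF pf_pre U(1)] .
  interpret V: module "R V" "F$V" using pre_module[OF pf_pre U(2)] .
  have "submodule {x \<in> sec F U. restr F U V x \<in> span V} (R U) (F$U)"
    by (rule submodule_kernel[where L = "F$V" and \<phi> = "rr U V" and S = "R V"])
      (use U span_submodule[OF U(2)] module_axioms V.module_axioms in simp_all)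
  moreover have "bilinear_rels X M N U \<union> E U \<subseteq> {x \<in> sec F U. restr F U V x \<in> span V}"
    using rels_sub[OF U(1)] E_sub[OF U(1)] rels_res[OF U] E_res[OF U]
      mod_span_sub[of "bilinear_rels X M N V \<union> E V"] unfolding span_def by blast
  ultimately show ?thesis using x mod_span_least unfolding span_def by blast
qed

abbreviation (input) "PP \<equiv> pair_presheaf X M N E"
abbreviation (input) "PS \<equiv> sheafify X PP"
abbreviation (input) "pc \<equiv> pair_class X M N E"

lemma PP_eq: "PP = quot_presheaf F span"
  by (simp add: pair_presheaf_def span_def [abs_def])

lemma pc_eq: "pc U x y = sheaf_section X PP U (span U +>\<^bsub>F$U\<^esub> d U x y)"
  by (simp add: pair_class_def span_def)

lemma quot_facts:
  "mod_pre X PP"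
  "lin X U F PP (\<lambda>U x. span U +>\<^bsub>F$U\<^esub> x)"
  "opn U \<Longrightarrow> x \<in> span U \<Longrightarrow> span U +>\<^bsub>F$U\<^esub> x = \<zero>\<^bsub>PP$U\<^esub>"
  "sec PP U = {span U +>\<^bsub>F$U\<^esub> x | x. x \<in> sec F U}"
  unfolding PP_eq
  by (rule quot_pre quot_class_lin quot_class_zero quot_simps(1); simp add: span_submodule span_res)+

lemma PP_pre [simp]: "mod_pre X PP"
  by (rule quot_facts)

lemma PS_sheaf [simp]: "module_sheaf X PS"
  by (rule sheafify_sheaf) simp

definition cl :: "'a set \<Rightarrow> ('m \<times> 'n \<Rightarrow> 'r) \<Rightarrow> 'a \<Rightarrow> ('a set \<times> ('m \<times> 'n \<Rightarrow> 'r) set) set" where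
  "cl U f = sheaf_section X PP U (span U +>\<^bsub>F$U\<^esub> f)"

lemma cl_lin: "lin X U F PS cl"
  using ss_lin[of PP U] quot_facts(2)[of U] unfolding lin_def cl_def by simp

lemma cl_hom: "mkhom X (pts X) F cl \<in> mod_homs X (pts X) F PS"
  by (intro mkhom_in cl_lin) simp

lemma cl_simps:
  assumes "opn U" "f \<in> sec F U"
  shows "cl U f \<in> sec PS U"
    "g \<in> sec F U \<Longrightarrow> cl U (f \<oplus>\<^bsub>F$U\<^esub> g) = cl U f \<oplus>\<^bsub>PS$U\<^esub> cl U g"
    "r \<in> \<O> U \<Longrightarrow> cl U (r \<odot>\<^bsub>F$U\<^esub> f) = r \<odot>\<^bsub>PS$U\<^esub> cl U f"
    "opn V \<Longrightarrow> V \<subseteq> U \<Longrightarrow> cl V (restr F U V f) = restr PS U V (cl U f)"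
    "g \<in> sec F U \<Longrightarrow> cl U (f \<ominus>\<^bsub>F$U\<^esub> g) = cl U f \<ominus>\<^bsub>PS$U\<^esub> cl U g"
  using cl_lin[of U] assms hom_diff[OF cl_hom, of U f g] by (simp_all add: lin_def)

lemma cl_rel:
  assumes U: "opn U" and e: "e \<in> bilinear_rels X M N U \<union> E U"
  shows "cl U e = \<zero>\<^bsub>PS$U\<^esub>"
proof -
  interpret module "R U" "F$U" using pre_module[OF pf_pre U] .
  have "e \<in> span U" unfolding span_def by (rule subsetD[OF mod_span_sub e])
  then show ?thesis unfolding cl_def by (simp only: quot_facts(3)[OF U] ss_zero[OF PP_pre])
qed

lemma pc_cl: "pc U x y = cl U (d U x y)"
  by (simp add: pc_eq cl_def)

lemma cl_eqI:
  assumes U: "opn U" and fg: "f \<in> sec F U" "g \<in> sec F U" "f \<ominus>\<^bsub>F$U\<^esub> g \<in> bilinear_rels X M N U \<union> E U"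
  shows "cl U f = cl U g"
proof -
  show ?thesis using cl_rel[OF U fg(3)] cl_simps(5)[OF U fg(1,2)] cl_simps(1)[OF U fg(1)] cl_simps(1)[OF U fg(2)] U
    by (simp add: mod_diff_zero)
qed

lemma pc_bilin: "bilin X (pts X) M N PS pc"
proof (rule bilinI)
  fix V x y assume V: "opn V" and x: "x \<in> sec M V" and y: "y \<in> sec N V"
  note cs = cl_simps[OF V]
  show "pc V x y \<in> sec PS V" using V x y by (simp add: pc_cl cs)
  { fix x' assume x': "x' \<in> sec M V"
    have "cl V (d V (x \<oplus>\<^bsub>M$V\<^esub> x') y) = cl V (d V x y \<oplus>\<^bsub>F$V\<^esub> d V x' y)"
      using V x y x' by (intro cl_eqI) (simp_all add: rels_intros)
    then show "pc V (x \<oplus>\<^bsub>M$V\<^esub> x') y = pc V x y \<oplus>\<^bsub>PS$V\<^esub> pc V x' y"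
      using V x y x' by (simp add: pc_cl cs) }
  { fix y' assume y': "y' \<in> sec N V"
    have "cl V (d V x (y \<oplus>\<^bsub>N$V\<^esub> y')) = cl V (d V x y \<oplus>\<^bsub>F$V\<^esub> d V x y')"
      using V x y y' by (intro cl_eqI) (simp_all add: rels_intros)
    then show "pc V x (y \<oplus>\<^bsub>N$V\<^esub> y') = pc V x y \<oplus>\<^bsub>PS$V\<^esub> pc V x y'"
      using V x y y' by (simp add: pc_cl cs) }
  { fix r assume r: "r \<in> \<O> V"
    have "cl V (d V (r \<odot>\<^bsub>M$V\<^esub> x) y) = cl V (r \<odot>\<^bsub>F$V\<^esub> d V x y)"
      "cl V (d V x (r \<odot>\<^bsub>N$V\<^esub> y)) = cl V (r \<odot>\<^bsub>F$V\<^esub> d V x y)"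
      using V x y r by (intro cl_eqI; simp add: rels_intros)+
    then show "pc V (r \<odot>\<^bsub>M$V\<^esub> x) y = r \<odot>\<^bsub>PS$V\<^esub> pc V x y"
      "pc V x (r \<odot>\<^bsub>N$V\<^esub> y) = r \<odot>\<^bsub>PS$V\<^esub> pc V x y"
      using V x y r by (simp_all add: pc_cl cs) }
  fix W assume W: "opn W" "W \<subseteq> V"
  show "pc W (restr M V W x) (restr N V W y) = restr PS V W (pc V x y)"
    using V x y W by (simp add: pc_cl cs(4)[OF _ W, symmetric] pf_res_gen)
qed

text \<open>Locally every section comes from a formal combination of pairs, and induction over such
  combinations reduces the claim to a single pair.\<close>

lemma pair_hom_eqI:
  assumes h: "h \<in> mod_homs X U PS L" and k: "k \<in> mod_homs X U PS L" and L: "module_sheaf X L"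
    and eq: "\<And>V x y. \<lbrakk>opn V; V \<subseteq> U; x \<in> sec M V; y \<in> sec N V\<rbrakk> \<Longrightarrow> h V (pc V x y) = k V (pc V x y)"
  shows "h = k"
proof (rule sheafify_hom_eqI[OF PP_pre h k L])
  fix V s assume V: "opn V" "V \<subseteq> U" and s: "s \<in> sec PP V"
  then obtain f where f: "f \<in> sec F V" "s = span V +>\<^bsub>F$V\<^esub> f"
    by (auto simp: quot_facts(4))
  have "h V (cl V f) = k V (cl V f)"
    using V(1) f(1)
  proof (induction rule: pf_induct)
    case zero
    then show ?case using V cl_rel hom_zero[OF h _ _ V] hom_zero[OF k _ _ V] L
        hom_zero[OF cl_hom, of V] by simp
  next
    case (add f f')
    then show ?case using V by (simp add: cl_simps hom_add[OF h] hom_add[OF k])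
  next
    case (gen r g)
    then show ?case using V eq[of V "fst g" "snd g"]
      by (auto simp: cl_simps hom_smult[OF h] hom_smult[OF k] pc_cl)
  qed
  then show "h V (sheaf_section X PP V s) = k V (sheaf_section X PP V s)" by (simp add: cl_def f(2))
qed

definition lift_sum :: "('a, 'r, 'l) mod_presheaf \<Rightarrow> ('a set \<Rightarrow> 'm \<Rightarrow> 'n \<Rightarrow> 'l) \<Rightarrow> 'a set \<Rightarrow> ('m \<times> 'n \<Rightarrow> 'r) \<Rightarrow> 'l" where
  "lift_sum L \<beta> V = gens.flift V V (L$V) (\<lambda>(x, y). \<beta> V x y)"

lemma lift_sum_simps:
  assumes \<beta>: "bilin X U M N L \<beta>" and L: "mod_pre X L" and V: "opn V" "V \<subseteq> U"
  shows "f \<in> sec F V \<Longrightarrow> lift_sum L \<beta> V f \<in> sec L V"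
    "f \<in> sec F V \<Longrightarrow> g \<in> sec F V \<Longrightarrow>
      lift_sum L \<beta> V (f \<oplus>\<^bsub>F$V\<^esub> g) = lift_sum L \<beta> V f \<oplus>\<^bsub>L$V\<^esub> lift_sum L \<beta> V g"
    "f \<in> sec F V \<Longrightarrow> r \<in> \<O> V \<Longrightarrow>
      lift_sum L \<beta> V (r \<odot>\<^bsub>F$V\<^esub> f) = r \<odot>\<^bsub>L$V\<^esub> lift_sum L \<beta> V f"
    "x \<in> sec M V \<Longrightarrow> y \<in> sec N V \<Longrightarrow> lift_sum L \<beta> V (d V x y) = \<beta> V x y"
    "lift_sum L \<beta> V \<zero>\<^bsub>F$V\<^esub> = \<zero>\<^bsub>L$V\<^esub>"
proof -
  have \<beta>': "(\<lambda>(x, y). \<beta> V x y) g \<in> sec L V" if "g \<in> sec M V \<times> sec N V" for g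
    using that bilinD(1)[OF \<beta> V] by auto
  note fl = pf_flift[OF V(1) V(1) order_refl pre_module[OF L V(1)]]
  show "lift_sum L \<beta> V f \<in> sec L V" if "f \<in> sec F V"
    unfolding lift_sum_def by (rule fl(1)[OF \<beta>' that])
  show "lift_sum L \<beta> V (f \<oplus>\<^bsub>F$V\<^esub> g) = lift_sum L \<beta> V f \<oplus>\<^bsub>L$V\<^esub> lift_sum L \<beta> V g"
    if "f \<in> sec F V" "g \<in> sec F V"
    unfolding lift_sum_def by (rule fl(2)[OF \<beta>' that])
  show "lift_sum L \<beta> V \<zero>\<^bsub>F$V\<^esub> = \<zero>\<^bsub>L$V\<^esub>" unfolding lift_sum_def by (rule fl(5)[OF \<beta>'])
  show "lift_sum L \<beta> V (r \<odot>\<^bsub>F$V\<^esub> f) = r \<odot>\<^bsub>L$V\<^esub> lift_sum L \<beta> V f"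
    if "f \<in> sec F V" "r \<in> \<O> V"
  proof -
    have "lift_sum L \<beta> V (r \<odot>\<^bsub>F$V\<^esub> f) = rr V V r \<odot>\<^bsub>L$V\<^esub> lift_sum L \<beta> V f"
      unfolding lift_sum_def by (rule fl(3)[OF \<beta>' that])
    then show ?thesis using V that by simp
  qed
  show "lift_sum L \<beta> V (d V x y) = \<beta> V x y" if "x \<in> sec M V" "y \<in> sec N V"
  proof -
    have "lift_sum L \<beta> V (d V x y) = (\<lambda>(x, y). \<beta> V x y) (x, y)"
      unfolding lift_sum_def by (rule fl(4)[OF \<beta>']) (use that in simp_all)
    then show ?thesis by simp
  qed
qed

lemma lift_sum_diff:
  assumes \<beta>: "bilin X U M N L \<beta>" and L: "mod_pre X L" and V: "opn V" "V \<subseteq> U"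
    and "f \<in> sec F V" "g \<in> sec F V"
  shows "lift_sum L \<beta> V (f \<ominus>\<^bsub>F$V\<^esub> g) = lift_sum L \<beta> V f \<ominus>\<^bsub>L$V\<^esub> lift_sum L \<beta> V g"
  using assms(3-) by (simp add: mod_diff[OF pf_pre] mod_diff[OF L] lift_sum_simps[OF \<beta> L])

text \<open>The universal properties of the free module, the quotient and the sheafification are
  applied in turn. Bilinearity of \<open>\<beta>\<close> kills the bilinear relations, so that only
  the extra ones have to be treated by a hypothesis.\<close>

lemma pair_lift:
  assumes L: "module_sheaf X L" and \<beta>: "bilin X U M N L \<beta>" and U: "opn U"
    and E: "\<And>V e. \<lbrakk>opn V; V \<subseteq> U; e \<in> E V\<rbrakk> \<Longrightarrow> lift_sum L \<beta> V e = \<zero>\<^bsub>L$V\<^esub>"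
  obtains h where "h \<in> mod_homs X U PS L"
    "\<And>V x y. \<lbrakk>opn V; V \<subseteq> U; x \<in> sec M V; y \<in> sec N V\<rbrakk> \<Longrightarrow> h V (pc V x y) = \<beta> V x y"
proof -
  note L' [simp] = module_sheaf_pre[OF L]
  note ls = lift_sum_simps[OF \<beta> L']
  have lin: "lin X U F L (lift_sum L \<beta>)"
  proof (rule linI)
    fix V W f assume V: "opn V" "V \<subseteq> U" "opn W" "W \<subseteq> V" and f: "f \<in> sec F V"
    have WU: "W \<subseteq> U" using V by order
    show "lift_sum L \<beta> W (restr F V W f) = restr L V W (lift_sum L \<beta> V f)"
      using V(1) f
    proof (induction rule: pf_induct)
      case (gen r g)
      then show ?case using V WU bilinD(1)[OF \<beta> V(1,2), of "fst g" "snd g"] bilinD(6)[OF \<beta> V(1,2) _ _ V(3,4), of "fst g" "snd g"]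
        by (auto simp: ls pf_res_gen)
    qed (use V WU in \<open>simp_all add: ls\<close>)
  qed (simp_all add: ls)
  have ker: "lift_sum L \<beta> V x = \<zero>\<^bsub>L$V\<^esub>" if V: "opn V" "V \<subseteq> U" and x: "x \<in> span V" for V x
  proof -
    interpret module "R V" "F$V" using pre_module[OF pf_pre V(1)] .
    interpret L: module "R V" "L$V" using pre_module[OF L' V(1)] .
    have z: "submodule {\<zero>\<^bsub>L$V\<^esub>} (R V) (L$V)" by (rule L.submoduleI) auto
    \<comment> \<open>The kernel of the linear extension is a submodule, hence contains the span as
      soon as it contains the relations.\<close>
    have "submodule {x \<in> sec F V. lift_sum L \<beta> V x \<in> {\<zero>\<^bsub>L$V\<^esub>}} (R V) (F$V)"
      by (rule submodule_kernel[where L = "L$V" and \<phi> = "\<lambda>r. r" and S = "R V"])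
        (use V z module_axioms L.module_axioms in \<open>simp_all add: ls\<close>)
    moreover have "bilinear_rels X M N V \<union> E V \<subseteq> {x \<in> sec F V. lift_sum L \<beta> V x \<in> {\<zero>\<^bsub>L$V\<^esub>}}"
    proof
      fix e assume e: "e \<in> bilinear_rels X M N V \<union> E V"
      then have eF: "e \<in> sec F V" using rels_sub[OF V(1)] E_sub[OF V(1)] by blast
      from e have "lift_sum L \<beta> V e = \<zero>\<^bsub>L$V\<^esub>"
      proof
        assume "e \<in> bilinear_rels X M N V"
        then show ?thesis
          by (rule rels_cases)
            (use V in \<open>simp_all add: lift_sum_diff[OF \<beta> L'] ls bilinD[OF \<beta>] mod_diff_zero\<close>)
      qed (use E V in blast)
      then show "e \<in> {x \<in> sec F V. lift_sum L \<beta> V x \<in> {\<zero>\<^bsub>L$V\<^esub>}}" using eF by simp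
    qed
    ultimately show ?thesis using x mod_span_least unfolding span_def by blast
  qed
  obtain g where g: "lin X U PP L g"
    "\<And>V x. \<lbrakk>opn V; V \<subseteq> U; x \<in> sec F V\<rbrakk> \<Longrightarrow> g V (span V +>\<^bsub>F$V\<^esub> x) = lift_sum L \<beta> V x"
    using quot_lift[OF pf_pre _ _ lin L' ker] span_submodule span_res unfolding PP_eq by blast
  obtain h where h: "h \<in> mod_homs X U PS L"
    "\<And>V s. \<lbrakk>opn V; V \<subseteq> U; s \<in> sec PP V\<rbrakk> \<Longrightarrow> h V (sheaf_section X PP V s) = g V s"
    by (rule sheafify_lift[OF PP_pre L g(1) U]) blast
  show ?thesis
  proof (rule that[OF h(1)])
    fix V x y assume "opn V" "V \<subseteq> U" "x \<in> sec M V" "y \<in> sec N V"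
    then show "h V (pc V x y) = \<beta> V x y"
      using quot_facts(2)[of V] by (simp add: pc_eq h(2) g(2) ls lin_def)
  qed
qed

end

section \<open>Tensor products, exterior and symmetric squares\<close>

context ringed
begin

lemma pairs_tensor: "mod_pre X M \<Longrightarrow> mod_pre X N \<Longrightarrow> pairs X M N (\<lambda>_. {})"
  by unfold_locales auto

lemma pairs_ext2:
  assumes M: "mod_pre X M" shows "pairs X M M (alternating_rels X M)"
proof -
  interpret T: pairs X M M "\<lambda>_. {}" by (rule pairs_tensor[OF M M])
  show ?thesis
  proof unfold_locales
    fix U V e assume "opn U" "opn V" "V \<subseteq> U" "e \<in> alternating_rels X M U"
    then show "restr (pair_free X M M) U V e \<in> alternating_rels X M V"
      using M by (auto simp: alternating_rels_def T.pf_res_gen)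
  qed (auto simp: M alternating_rels_def)
qed

lemma pairs_sym2:
  assumes M: "mod_pre X M" shows "pairs X M M (symmetric_rels X M)"
proof -
  interpret T: pairs X M M "\<lambda>_. {}" by (rule pairs_tensor[OF M M])
  show ?thesis
  proof unfold_locales
    fix U V e assume U: "opn U" "opn V" "V \<subseteq> U" and "e \<in> symmetric_rels X M U"
    then obtain x y where xy: "x \<in> sec M U" "y \<in> sec M U"
      "e = fgen X U (x, y) \<ominus>\<^bsub>pair_free X M M$U\<^esub> fgen X U (y, x)"
      by (auto simp: symmetric_rels_def)
    then have "restr (pair_free X M M) U V e = fgen X V (restr M U V x, restr M U V y)
        \<ominus>\<^bsub>pair_free X M M$V\<^esub> fgen X V (restr M U V y, restr M U V x)"
      using M U by (simp add: T.pf_res_gen)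
    moreover have "restr M U V x \<in> sec M V" "restr M U V y \<in> sec M V" using M U xy by simp_all
    ultimately show "restr (pair_free X M M) U V e \<in> symmetric_rels X M V"
      unfolding symmetric_rels_def by blast
  qed (auto simp: M symmetric_rels_def)
qed

context
  fixes M :: "('a, 'r, 'm) mod_presheaf" and N :: "('a, 'r, 'n) mod_presheaf"
  assumes M: "mod_pre X M" and N: "mod_pre X N"
begin

interpretation T: pairs X M N "\<lambda>_. {}" by (rule pairs_tensor[OF M N])

lemma tensor_sheaf [simp]: "module_sheaf X (tensor X M N)"
  unfolding tensor_def by (rule T.PS_sheaf)

lemma tens_bilin: "bilin X (pts X) M N (tensor X M N) (tens X M N)"
  unfolding tensor_def tens_def by (rule T.pc_bilin)

lemmas tens_simps [simp] = bilinD[OF tens_bilin _ opn_pts]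

lemma tensor_hom_eqI:
  assumes "h \<in> mod_homs X U (tensor X M N) L" "k \<in> mod_homs X U (tensor X M N) L" "module_sheaf X L"
    "\<And>V x y. \<lbrakk>opn V; V \<subseteq> U; x \<in> sec M V; y \<in> sec N V\<rbrakk> \<Longrightarrow>
      h V (tens X M N V x y) = k V (tens X M N V x y)"
  shows "h = k"
  using assms unfolding tensor_def tens_def by (rule T.pair_hom_eqI)

lemma tensor_lift:
  assumes "module_sheaf X L" "bilin X U M N L \<beta>" "opn U"
  obtains h where "h \<in> mod_homs X U (tensor X M N) L"
    "\<And>V x y. \<lbrakk>opn V; V \<subseteq> U; x \<in> sec M V; y \<in> sec N V\<rbrakk> \<Longrightarrow> h V (tens X M N V x y) = \<beta> V x y"
  unfolding tensor_def tens_def using assms by (rule T.pair_lift) auto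

end

context
  fixes M :: "('a, 'r, 'm) mod_presheaf"
  assumes M: "mod_pre X M"
begin

interpretation W: pairs X M M "alternating_rels X M" by (rule pairs_ext2[OF M])

lemma ext2_sheaf [simp]: "module_sheaf X (ext2 X M)"
  unfolding ext2_def by (rule W.PS_sheaf)

lemma wedge_bilin: "bilin X (pts X) M M (ext2 X M) (wedge X M)"
  unfolding ext2_def wedge_def by (rule W.pc_bilin)

lemmas wedge_simps [simp] = bilinD[OF wedge_bilin _ opn_pts]

lemma wedge_self [simp]: "opn V \<Longrightarrow> x \<in> sec M V \<Longrightarrow> wedge X M V x x = \<zero>\<^bsub>ext2 X M$V\<^esub>"
  unfolding ext2_def wedge_def W.pc_cl
  by (rule W.cl_rel) (auto simp: alternating_rels_def)

text \<open>Expanding (x + y) \<and> (x + y) = 0 leaves the two mixed terms. The sign is written as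
  a scalar so that it can be merged with other coefficients.\<close>

lemma wedge_swap:
  assumes V: "opn V" and x: "x \<in> sec M V" and y: "y \<in> sec M V"
  shows "wedge X M V y x = (\<ominus>\<^bsub>R V\<^esub> \<one>\<^bsub>R V\<^esub>) \<odot>\<^bsub>ext2 X M$V\<^esub> wedge X M V x y"
proof -
  interpret E: module "R V" "ext2 X M$V" using pre_module[OF module_sheaf_pre[OF ext2_sheaf] V] .
  have in_E: "wedge X M V x y \<in> sec (ext2 X M) V" "wedge X M V y x \<in> sec (ext2 X M) V" using V x y by simp_all
  have "wedge X M V (x \<oplus>\<^bsub>M$V\<^esub> y) (x \<oplus>\<^bsub>M$V\<^esub> y) = \<zero>\<^bsub>ext2 X M$V\<^esub>"
    using V x y M by (intro wedge_self) auto
  moreover have "wedge X M V (x \<oplus>\<^bsub>M$V\<^esub> y) (x \<oplus>\<^bsub>M$V\<^esub> y) =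
      wedge X M V y x \<oplus>\<^bsub>ext2 X M$V\<^esub> wedge X M V x y"
    using V x y M in_E wedge_self[OF V x] wedge_self[OF V y] by (simp del: wedge_self)
  ultimately have "\<ominus>\<^bsub>ext2 X M$V\<^esub> wedge X M V x y = wedge X M V y x"
    using in_E by (intro E.M.minus_equality) simp_all
  then show ?thesis using in_E by (simp add: E.smult_l_minus)
qed

lemma ext2_hom_eqI:
  assumes "h \<in> mod_homs X U (ext2 X M) L" "k \<in> mod_homs X U (ext2 X M) L" "module_sheaf X L"
    "\<And>V x y. \<lbrakk>opn V; V \<subseteq> U; x \<in> sec M V; y \<in> sec M V\<rbrakk> \<Longrightarrow>
      h V (wedge X M V x y) = k V (wedge X M V x y)"
  shows "h = k"
  using assms unfolding ext2_def wedge_def by (rule W.pair_hom_eqI)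

lemma ext2_lift:
  assumes L: "module_sheaf X L" and \<beta>: "bilin X U M M L \<beta>" and U: "opn U"
    and alt: "\<And>V x. \<lbrakk>opn V; V \<subseteq> U; x \<in> sec M V\<rbrakk> \<Longrightarrow> \<beta> V x x = \<zero>\<^bsub>L$V\<^esub>"
  obtains h where "h \<in> mod_homs X U (ext2 X M) L"
    "\<And>V x y. \<lbrakk>opn V; V \<subseteq> U; x \<in> sec M V; y \<in> sec M V\<rbrakk> \<Longrightarrow> h V (wedge X M V x y) = \<beta> V x y"
  unfolding ext2_def wedge_def using L \<beta> U
  by (rule W.pair_lift)
    (auto simp: alternating_rels_def W.lift_sum_simps[OF \<beta> module_sheaf_pre[OF L]] alt)

end

context
  fixes M :: "('a, 'r, 'm) mod_presheaf"
  assumes M: "mod_pre X M"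
begin

interpretation S: pairs X M M "symmetric_rels X M" by (rule pairs_sym2[OF M])

lemma sym2_sheaf [simp]: "module_sheaf X (sym2 X M)"
  unfolding sym2_def by (rule S.PS_sheaf)

lemma sprod_bilin: "bilin X (pts X) M M (sym2 X M) (sprod X M)"
  unfolding sym2_def sprod_def by (rule S.pc_bilin)

lemmas sprod_simps [simp] = bilinD[OF sprod_bilin _ opn_pts]

lemma sprod_comm: "\<lbrakk>opn V; x \<in> sec M V; y \<in> sec M V\<rbrakk> \<Longrightarrow> sprod X M V x y = sprod X M V y x"
  unfolding sprod_def S.pc_cl
  by (rule S.cl_eqI) (auto simp: symmetric_rels_def)

lemma sym2_hom_eqI:
  assumes "h \<in> mod_homs X U (sym2 X M) L" "k \<in> mod_homs X U (sym2 X M) L" "module_sheaf X L"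
    "\<And>V x y. \<lbrakk>opn V; V \<subseteq> U; x \<in> sec M V; y \<in> sec M V\<rbrakk> \<Longrightarrow>
      h V (sprod X M V x y) = k V (sprod X M V x y)"
  shows "h = k"
  using assms unfolding sym2_def sprod_def by (rule S.pair_hom_eqI)

lemma sym2_lift:
  assumes L: "module_sheaf X L" and \<beta>: "bilin X U M M L \<beta>" and U: "opn U"
    and sym: "\<And>V x y. \<lbrakk>opn V; V \<subseteq> U; x \<in> sec M V; y \<in> sec M V\<rbrakk> \<Longrightarrow> \<beta> V x y = \<beta> V y x"
  obtains h where "h \<in> mod_homs X U (sym2 X M) L"
    "\<And>V x y. \<lbrakk>opn V; V \<subseteq> U; x \<in> sec M V; y \<in> sec M V\<rbrakk> \<Longrightarrow> h V (sprod X M V x y) = \<beta> V x y"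
proof -
  note L' = module_sheaf_pre[OF L]
  have "S.lift_sum L \<beta> V e = \<zero>\<^bsub>L$V\<^esub>" if V: "opn V" "V \<subseteq> U" and e: "e \<in> symmetric_rels X M V" for V e
  proof -
    obtain x y where xy: "x \<in> sec M V" "y \<in> sec M V"
      "e = fgen X V (x, y) \<ominus>\<^bsub>pair_free X M M$V\<^esub> fgen X V (y, x)"
      using e by (auto simp: symmetric_rels_def)
    then show ?thesis using V sym[OF V xy(1,2)] bilinD(1)[OF \<beta> V xy(2,1)]
      by (simp add: S.lift_sum_diff[OF \<beta> L'] S.lift_sum_simps[OF \<beta> L'] mod_diff_zero[OF L'])
  qed
  then show ?thesis using that L \<beta> U unfolding sym2_def sprod_def by (rule S.pair_lift [rotated 3])
qed

end

section \<open>Gluing morphisms\<close>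

text \<open>Morphisms into a sheaf form a sheaf: the value at a section \<open>x\<close> is glued
  from the values of the given morphisms at the restrictions of \<open>x\<close>. Both the sheaf
  property of duals and the construction of global morphisms rest on this.\<close>

lemma hom_glue:
  assumes M: "mod_pre X M" and N [simp]: "module_sheaf X N" and opV: "\<And>V. V \<in> \<V> \<Longrightarrow> opn V"
    and \<sigma>: "\<And>V. V \<in> \<V> \<Longrightarrow> \<sigma> V \<in> mod_homs X V M N"
    and comp: "\<And>V W Z x. \<lbrakk>V \<in> \<V>; W \<in> \<V>; opn Z; Z \<subseteq> V; Z \<subseteq> W; x \<in> sec M Z\<rbrakk> \<Longrightarrow> \<sigma> V Z x = \<sigma> W Z x"
  obtains h where "h \<in> mod_homs X (\<Union>\<V>) M N"
    "\<And>V Z x. \<lbrakk>V \<in> \<V>; opn Z; Z \<subseteq> V; x \<in> sec M Z\<rbrakk> \<Longrightarrow> h Z x = \<sigma> V Z x"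
proof -
  note NS = module_sheaf_sheaf[OF N]
  note \<sigma>h = hom_simps[OF \<sigma>]
  \<comment> \<open>\<open>Q W x Z t\<close> says that \<open>t\<close> is the value over
    \<open>Z\<close> which the given morphisms prescribe for the restriction of
    \<open>x\<close>.\<close>
  define Q where "Q W x Z t \<longleftrightarrow> (\<forall>V\<in>\<V>. \<forall>Z'. opn Z' \<longrightarrow> Z' \<subseteq> Z \<longrightarrow> Z' \<subseteq> V \<longrightarrow>
    restr N Z Z' t = \<sigma> V Z' (restr M W Z' x))" for W x Z t
  have QD: "restr N Z Z' t = \<sigma> V Z' (restr M W Z' x)" if "Q W x Z t" "V \<in> \<V>" "opn Z'" "Z' \<subseteq> Z" "Z' \<subseteq> V" for W x Z t V Z'
    using that unfolding Q_def by blast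
  have uniq: "s = t" if W: "opn W" "W \<subseteq> \<Union>\<V>" and Z: "opn Z" "Z \<subseteq> W" and st: "s \<in> sec N Z" "t \<in> sec N Z"
    "Q W x Z s" "Q W x Z t" for W x Z s t
  proof (rule sheaf_eqI[OF NS Z(1) st(1,2)])
    fix p assume p: "p \<in> Z"
    then obtain V where V: "V \<in> \<V>" "p \<in> V" using W(2) Z(2) by blast
    have Z': "opn (V \<inter> Z)" "V \<inter> Z \<subseteq> Z" "V \<inter> Z \<subseteq> V" using opV[OF V(1)] Z by auto
    show "\<exists>V. opn V \<and> p \<in> V \<and> V \<subseteq> Z \<and> restr N Z V s = restr N Z V t"
      using QD[OF st(3) V(1) Z'] QD[OF st(4) V(1) Z'] Z' V p by (intro exI[of _ "V \<inter> Z"]) simp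
  qed
  have local: "Q W x Z (\<sigma> V Z (restr M W Z x))" if V: "V \<in> \<V>" and W: "opn W" "x \<in> sec M W"
    and Z: "opn Z" "Z \<subseteq> V" "Z \<subseteq> W" for V W x Z
    unfolding Q_def
  proof (intro ballI allI impI)
    fix V' Z' assume V': "V' \<in> \<V>" and Z': "opn Z'" "Z' \<subseteq> Z" "Z' \<subseteq> V'"
    have sub: "Z' \<subseteq> V" "Z' \<subseteq> W" using Z Z' by order+
    have "restr N Z Z' (\<sigma> V Z (restr M W Z x)) = \<sigma> V Z' (restr M Z Z' (restr M W Z x))"
      using \<sigma>h(4)[OF V Z(1,2) _ Z'(1,2), of "restr M W Z x"] M W Z by simp
    also have "\<dots> = \<sigma> V' Z' (restr M W Z' x)" using M W Z Z' comp[OF V V' Z'(1) sub(1) Z'(3), of "restr M W Z' x"] sub by simp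
    finally show "restr N Z Z' (\<sigma> V Z (restr M W Z x)) = \<sigma> V' Z' (restr M W Z' x)" .
  qed
  have Q_res: "Q W x Z' (restr N Z Z' t)" if "Q W x Z t" "opn Z" "opn Z'" "Z' \<subseteq> Z" "t \<in> sec N Z" for W x Z Z' t
    unfolding Q_def
  proof (intro ballI allI impI)
    fix V Z'' assume "V \<in> \<V>" "opn Z''" "Z'' \<subseteq> Z'" "Z'' \<subseteq> V"
    moreover from this have "Z'' \<subseteq> Z" using that by order
    ultimately show "restr N Z' Z'' (restr N Z Z' t) = \<sigma> V Z'' (restr M W Z'' x)"
      using QD[OF that(1)] that by simp
  qed
  have ex: "\<exists>t. t \<in> sec N W \<and> Q W x W t" if W: "opn W" "W \<subseteq> \<Union>\<V>" and x: "x \<in> sec M W" for W x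
  proof -
    have loc: "\<exists>Z. opn Z \<and> p \<in> Z \<and> Z \<subseteq> W \<and> (\<exists>s\<in>sec N Z. Q W x Z s)" if p: "p \<in> W" for p
    proof -
      obtain V where V: "V \<in> \<V>" "p \<in> V" using W(2) p by blast
      have Z: "opn (V \<inter> W)" "V \<inter> W \<subseteq> V" "V \<inter> W \<subseteq> W" using opV[OF V(1)] W by auto
      have "\<sigma> V (V \<inter> W) (restr M W (V \<inter> W) x) \<in> sec N (V \<inter> W)"
        using \<sigma>h(1)[OF V(1) Z(1,2)] M W x Z by simp
      then show ?thesis using local[OF V(1) W(1) x Z] Z p V(2) by blast
    qed
    obtain t where t: "t \<in> sec N W"
      "\<And>Z s. \<lbrakk>opn Z; Z \<subseteq> W; s \<in> sec N Z; Q W x Z s\<rbrakk> \<Longrightarrow> restr N W Z t = s"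
      by (rule sheaf_glue[OF NS W(1), where P = "Q W x"], erule loc, rule Q_res, assumption+,
          rule uniq[OF W], assumption+, blast)
    have "Q W x W t" unfolding Q_def
    proof (intro ballI allI impI)
      fix V Z assume V: "V \<in> \<V>" and Z: "opn Z" "Z \<subseteq> W" "Z \<subseteq> V"
      show "restr N W Z t = \<sigma> V Z (restr M W Z x)"
        using t(2)[OF Z(1,2) _ local[OF V W(1) x Z(1,3,2)]] \<sigma>h(1)[OF V Z(1,3)] M W x Z by simp
    qed
    with t(1) show ?thesis by blast
  qed
  define f where "f W x = (SOME t. t \<in> sec N W \<and> Q W x W t)" for W x
  have f: "f W x \<in> sec N W" "Q W x W (f W x)" if "opn W" "W \<subseteq> \<Union>\<V>" "x \<in> sec M W" for W x
    using someI_ex[OF ex[OF that]] by (simp_all add: f_def)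
  have f_loc: "restr N W Z (f W x) = \<sigma> V Z (restr M W Z x)"
    if "opn W" "W \<subseteq> \<Union>\<V>" "x \<in> sec M W" "V \<in> \<V>" "opn Z" "Z \<subseteq> W" "Z \<subseteq> V" for W x V Z
    using QD[OF f(2)[OF that(1-3)] that(4-7)] .
  \<comment> \<open>A value of \<open>f\<close> is recognized on the members of the cover, where
    \<open>f\<close> is one of the given morphisms; every law for \<open>f\<close> is reduced to
    them in this way.\<close>
  have f_eqI: "f W x = t" if W: "opn W" "W \<subseteq> \<Union>\<V>" and x: "x \<in> sec M W" and t: "t \<in> sec N W"
    and eq: "\<And>V Z. \<lbrakk>V \<in> \<V>; opn Z; Z \<subseteq> W; Z \<subseteq> V\<rbrakk> \<Longrightarrow> restr N W Z t = \<sigma> V Z (restr M W Z x)" for W x t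
    using uniq[OF W W(1) order_refl f(1)[OF W x] t f(2)[OF W x]] eq unfolding Q_def by blast
  have "mkhom X (\<Union>\<V>) M f \<in> mod_homs X (\<Union>\<V>) M N"
  proof (rule mkhomI[OF M])
    fix W x assume W: "opn W" "W \<subseteq> \<Union>\<V>" and x: "x \<in> sec M W"
    show "f W x \<in> sec N W" using f(1)[OF W x] by simp
    { fix y assume y: "y \<in> sec M W"
      show "f W (x \<oplus>\<^bsub>M$W\<^esub> y) = f W x \<oplus>\<^bsub>N$W\<^esub> f W y"
        by (rule f_eqI) (use W x y M in \<open>simp_all add: f f_loc \<sigma>h\<close>) }
    { fix r assume r: "r \<in> \<O> W"
      show "f W (r \<odot>\<^bsub>M$W\<^esub> x) = r \<odot>\<^bsub>N$W\<^esub> f W x"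
        by (rule f_eqI) (use W x r M in \<open>simp_all add: f f_loc \<sigma>h\<close>) }
    fix W' assume W': "opn W'" "W' \<subseteq> W"
    then have W'U: "W' \<subseteq> \<Union>\<V>" using W by order
    show "f W' (restr M W W' x) = restr N W W' (f W x)"
      by (rule f_eqI) (use W W' W'U x M in \<open>simp_all add: f f_loc order_trans[of _ W' W]\<close>)
  qed
  moreover have "mkhom X (\<Union>\<V>) M f W x = \<sigma> V W x" if V: "V \<in> \<V>" and W: "opn W" "W \<subseteq> V" and x: "x \<in> sec M W" for V W x
  proof -
    have WU: "W \<subseteq> \<Union>\<V>" using V W by blast
    have "f W x = \<sigma> V W x" using f_loc[OF W(1) WU x V W(1) order_refl W(2)] W x M f(1)[OF W(1) WU x] by simp
    then show ?thesis using W WU x by simp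
  qed
  ultimately show ?thesis using that by blast
qed

section \<open>Dual sheaves\<close>

lemma dual_mkhom:
  "\<zero>\<^bsub>dual X M$U\<^esub> = mkhom X U M (\<lambda>V x. \<zero>\<^bsub>R V\<^esub>)"
  "\<theta> \<oplus>\<^bsub>dual X M$U\<^esub> \<eta> = mkhom X U M (\<lambda>V x. \<theta> V x \<oplus>\<^bsub>R V\<^esub> \<eta> V x)"
  "r \<odot>\<^bsub>dual X M$U\<^esub> \<theta> = mkhom X U M (\<lambda>V x. rr U V r \<otimes>\<^bsub>R V\<^esub> \<theta> V x)"
  by (simp_all add: dual_def mkhom_def)

lemma dual_sec [simp]: "sec (dual X M) U = mod_homs X U M OX"
  by (simp add: dual_def)

lemma dual_restr: "restr (dual X M) U V \<theta> = restrict \<theta> (opens X V)"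
  by (simp add: dual_def)

lemma dual_restr_apply [simp]: "opn W \<Longrightarrow> W \<subseteq> V \<Longrightarrow> restr (dual X M) U V \<theta> W = \<theta> W"
  by (simp add: dual_def)

lemma dual_apply [simp]:
  assumes "opn V" "V \<subseteq> U" "x \<in> sec M V"
  shows "\<zero>\<^bsub>dual X M$U\<^esub> V x = \<zero>\<^bsub>R V\<^esub>"
    "(\<theta> \<oplus>\<^bsub>dual X M$U\<^esub> \<eta>) V x = \<theta> V x \<oplus>\<^bsub>R V\<^esub> \<eta> V x"
    "(r \<odot>\<^bsub>dual X M$U\<^esub> \<theta>) V x = rr U V r \<otimes>\<^bsub>R V\<^esub> \<theta> V x"
  using assms by (simp_all add: dual_mkhom)

lemma dual_closed [simp]:
  assumes "opn U" "\<theta> \<in> mod_homs X U M OX" "opn V" "V \<subseteq> U" "x \<in> sec M V"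
  shows "\<theta> V x \<in> \<O> V"
  using hom_closed[OF assms(2-)] by simp

context
  fixes M :: "('a, 'r, 'm) mod_presheaf"
  assumes M: "mod_pre X M"
begin

lemma dual_ops_closed:
  assumes U: "opn U" and \<theta>: "\<theta> \<in> sec (dual X M) U"
  shows "\<zero>\<^bsub>dual X M$U\<^esub> \<in> sec (dual X M) U"
    "\<eta> \<in> sec (dual X M) U \<Longrightarrow> \<theta> \<oplus>\<^bsub>dual X M$U\<^esub> \<eta> \<in> sec (dual X M) U"
    "r \<in> \<O> U \<Longrightarrow> r \<odot>\<^bsub>dual X M$U\<^esub> \<theta> \<in> sec (dual X M) U"
proof -
  note h = hom_simps[OF \<theta> [unfolded dual_sec]]
  show "\<zero>\<^bsub>dual X M$U\<^esub> \<in> sec (dual X M) U"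
    unfolding dual_mkhom dual_sec using M by (intro mkhomI) simp_all
  show "\<theta> \<oplus>\<^bsub>dual X M$U\<^esub> \<eta> \<in> sec (dual X M) U" if \<eta>: "\<eta> \<in> sec (dual X M) U"
    unfolding dual_mkhom dual_sec using M h hom_simps[OF \<eta> [unfolded dual_sec]]
    by (intro mkhomI) (simp_all add: R_ac R_distr)
  show "r \<odot>\<^bsub>dual X M$U\<^esub> \<theta> \<in> sec (dual X M) U" if r: "r \<in> \<O> U"
    unfolding dual_mkhom dual_sec using M h U r
    by (intro mkhomI) (simp_all add: R_ac R_distr)
qed

lemma dual_eqI:
  assumes "\<theta> \<in> sec (dual X M) U" "\<eta> \<in> sec (dual X M) U"
    "\<And>V x. \<lbrakk>opn V; V \<subseteq> U; x \<in> sec M V\<rbrakk> \<Longrightarrow> \<theta> V x = \<eta> V x"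
  shows "\<theta> = \<eta>"
  using assms unfolding dual_sec by (rule hom_eqI)

lemma module_dual:
  assumes U: "opn U" shows "module (R U) (dual X M$U)"
proof (rule moduleI_sub[OF U])
  have z: "\<zero>\<^bsub>dual X M$U\<^esub> \<in> sec (dual X M) U"
    unfolding dual_mkhom dual_sec using M by (intro mkhomI) simp_all
  then show "\<zero>\<^bsub>dual X M$U\<^esub> \<in> sec (dual X M) U" .
  note cl [simp del] = dual_ops_closed[OF U]
  note v [simp] = dual_closed[OF U, folded dual_sec]
  fix \<theta> assume \<theta>: "\<theta> \<in> sec (dual X M) U"
  show "\<zero>\<^bsub>dual X M$U\<^esub> \<oplus>\<^bsub>dual X M$U\<^esub> \<theta> = \<theta>"
    by (rule dual_eqI[of _ U]) (use U \<theta> z cl v in \<open>simp_all del: dual_sec\<close>)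
  show "\<one>\<^bsub>R U\<^esub> \<odot>\<^bsub>dual X M$U\<^esub> \<theta> = \<theta>"
    by (rule dual_eqI[of _ U]) (use U \<theta> cl v in \<open>simp_all del: dual_sec\<close>)
  show "\<zero>\<^bsub>R U\<^esub> \<odot>\<^bsub>dual X M$U\<^esub> \<theta> = \<zero>\<^bsub>dual X M$U\<^esub>"
    by (rule dual_eqI[of _ U]) (use U \<theta> cl v in \<open>simp_all del: dual_sec\<close>)
  { fix r s assume r: "r \<in> \<O> U"
    show "r \<odot>\<^bsub>dual X M$U\<^esub> \<theta> \<in> sec (dual X M) U" using \<theta> r by (rule cl(3))
    assume s: "s \<in> \<O> U"
    show "(r \<oplus>\<^bsub>R U\<^esub> s) \<odot>\<^bsub>dual X M$U\<^esub> \<theta> =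
        r \<odot>\<^bsub>dual X M$U\<^esub> \<theta> \<oplus>\<^bsub>dual X M$U\<^esub> s \<odot>\<^bsub>dual X M$U\<^esub> \<theta>"
      by (rule dual_eqI[of _ U]) (use U \<theta> r s cl v in \<open>simp_all add: R_distr del: dual_sec\<close>)
    show "(r \<otimes>\<^bsub>R U\<^esub> s) \<odot>\<^bsub>dual X M$U\<^esub> \<theta> =
        r \<odot>\<^bsub>dual X M$U\<^esub> (s \<odot>\<^bsub>dual X M$U\<^esub> \<theta>)"
      by (rule dual_eqI[of _ U]) (use U \<theta> r s cl v in \<open>simp_all add: R_ac del: dual_sec\<close>) }
  fix \<eta> assume \<eta>: "\<eta> \<in> sec (dual X M) U"
  show "\<theta> \<oplus>\<^bsub>dual X M$U\<^esub> \<eta> \<in> sec (dual X M) U" using \<theta> \<eta> by (rule cl(2))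
  show "\<theta> \<oplus>\<^bsub>dual X M$U\<^esub> \<eta> = \<eta> \<oplus>\<^bsub>dual X M$U\<^esub> \<theta>"
    by (rule dual_eqI[of _ U]) (use U \<theta> \<eta> cl v in \<open>simp_all add: R_ac del: dual_sec\<close>)
  { fix r assume r: "r \<in> \<O> U"
    show "r \<odot>\<^bsub>dual X M$U\<^esub> (\<theta> \<oplus>\<^bsub>dual X M$U\<^esub> \<eta>) =
        r \<odot>\<^bsub>dual X M$U\<^esub> \<theta> \<oplus>\<^bsub>dual X M$U\<^esub> r \<odot>\<^bsub>dual X M$U\<^esub> \<eta>"
      by (rule dual_eqI[of _ U]) (use U \<theta> \<eta> r cl v in \<open>simp_all add: R_distr del: dual_sec\<close>) }
  fix \<zeta> assume \<zeta>: "\<zeta> \<in> sec (dual X M) U"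
  show "\<theta> \<oplus>\<^bsub>dual X M$U\<^esub> \<eta> \<oplus>\<^bsub>dual X M$U\<^esub> \<zeta> =
      \<theta> \<oplus>\<^bsub>dual X M$U\<^esub> (\<eta> \<oplus>\<^bsub>dual X M$U\<^esub> \<zeta>)"
    by (rule dual_eqI[of _ U]) (use U \<theta> \<eta> \<zeta> cl v in \<open>simp_all add: R_ac del: dual_sec\<close>)
qed

lemma dual_presheaf: "is_presheaf X (dual X M)"
proof (rule is_presheafI)
  fix U V \<theta> assume "V \<subseteq> U" "\<theta> \<in> sec (dual X M) U"
  then show "restr (dual X M) U V \<theta> \<in> sec (dual X M) V"
    by (simp add: dual_restr hom_restrict)
next
  fix U \<theta> assume "\<theta> \<in> sec (dual X M) U"
  then show "restr (dual X M) U U \<theta> = \<theta>"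
    by (simp add: dual_restr hom_iff extensional_restrict)
next
  fix U V W :: "'a set" and \<theta> assume "W \<subseteq> V"
  then have "opens X V \<inter> opens X W = opens X W" by (auto simp: opens_def)
  then show "restr (dual X M) V W (restr (dual X M) U V \<theta>) = restr (dual X M) U W \<theta>"
    by (simp add: dual_restr)
qed

text \<open>Sections of the dual are morphisms, so that existence is \<open>hom_glue\<close>.
  Uniqueness compares values locally in the structure sheaf.\<close>

lemma is_sheaf_dual: "is_sheaf X (dual X M)"
  unfolding is_sheaf_def
proof (intro conjI dual_presheaf allI impI ballI)
  fix \<V> \<theta> \<eta> assume \<V>: "\<V> \<subseteq> opens X (pts X)"
    and \<theta>: "\<theta> \<in> sec (dual X M) (\<Union>\<V>)" and \<eta>: "\<eta> \<in> sec (dual X M) (\<Union>\<V>)"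
    and eq: "\<forall>V\<in>\<V>. restr (dual X M) (\<Union>\<V>) V \<theta> = restr (dual X M) (\<Union>\<V>) V \<eta>"
  have opV: "opn V" if "V \<in> \<V>" for V using subsetD[OF \<V> that] by simp
  show "\<theta> = \<eta>"
  proof (rule dual_eqI[OF \<theta> \<eta>])
    fix W x assume W: "opn W" "W \<subseteq> \<Union>\<V>" and x: "x \<in> sec M W"
    note h = hom_simps[OF \<theta> [unfolded dual_sec] W x] hom_simps[OF \<eta> [unfolded dual_sec] W x]
    show "\<theta> W x = \<eta> W x"
    proof (rule sheaf_eqI[OF sheaf_R W(1)])
      fix p assume p: "p \<in> W"
      then obtain V where V: "V \<in> \<V>" "p \<in> V" using W(2) by blast
      have Z: "opn (V \<inter> W)" "V \<inter> W \<subseteq> V" "V \<inter> W \<subseteq> W" using opV[OF V(1)] W by auto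
      have "restr (dual X M) (\<Union>\<V>) V \<theta> (V \<inter> W) = restr (dual X M) (\<Union>\<V>) V \<eta> (V \<inter> W)"
        using eq V(1) by simp
      then have "\<theta> (V \<inter> W) = \<eta> (V \<inter> W)" using Z by simp
      then have "rr W (V \<inter> W) (\<theta> W x) = rr W (V \<inter> W) (\<eta> W x)"
        using h(4)[OF Z(1,3)] h(8)[OF Z(1,3)] by simp
      then show "\<exists>V. opn V \<and> p \<in> V \<and> V \<subseteq> W \<and> rr W V (\<theta> W x) = rr W V (\<eta> W x)"
        using Z V(2) p by blast
    qed (use h in simp_all)
  qed
next
  fix \<V> \<sigma> assume \<V>: "\<V> \<subseteq> opens X (pts X)"
    and *: "(\<forall>V\<in>\<V>. \<sigma> V \<in> sec (dual X M) V) \<and>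
      (\<forall>V\<in>\<V>. \<forall>W\<in>\<V>. restr (dual X M) V (V \<inter> W) (\<sigma> V) = restr (dual X M) W (V \<inter> W) (\<sigma> W))"
  have opV: "opn V" if "V \<in> \<V>" for V using subsetD[OF \<V> that] by simp
  have \<sigma>: "\<sigma> V \<in> mod_homs X V M OX" if "V \<in> \<V>" for V using conjunct1[OF *] that by simp
  obtain h where h: "h \<in> mod_homs X (\<Union>\<V>) M OX"
    "\<And>V Z x. \<lbrakk>V \<in> \<V>; opn Z; Z \<subseteq> V; x \<in> sec M Z\<rbrakk> \<Longrightarrow> h Z x = \<sigma> V Z x"
  proof (rule hom_glue[OF M struct_sheaf opV \<sigma>])
    fix V W Z x assume "V \<in> \<V>" "W \<in> \<V>" "opn Z" "Z \<subseteq> V" "Z \<subseteq> W"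
    then show "\<sigma> V Z x = \<sigma> W Z x"
      using fun_cong[OF conjunct2[OF *, rule_format, of V W], of Z] by simp
  qed blast+
  have "restr (dual X M) (\<Union>\<V>) V h = \<sigma> V" if V: "V \<in> \<V>" for V
  proof (rule hom_eqI[OF _ \<sigma> [OF V]])
    have VU: "V \<subseteq> \<Union>\<V>" using V by blast
    show "restr (dual X M) (\<Union>\<V>) V h \<in> mod_homs X V M OX"
      unfolding dual_restr by (rule hom_restrict[OF h(1) VU])
    fix W x assume "opn W" "W \<subseteq> V" "x \<in> sec M W"
    then show "restr (dual X M) (\<Union>\<V>) V h W x = \<sigma> V W x" using h(2)[OF V] by simp
  qed
  then show "\<exists>s\<in>sec (dual X M) (\<Union>\<V>). \<forall>V\<in>\<V>. restr (dual X M) (\<Union>\<V>) V s = \<sigma> V"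
    using h(1) by (intro bexI[of _ h] ballI) simp_all
qed

lemma dual_sheaf [simp]: "module_sheaf X (dual X M)"
  unfolding module_sheaf_iff
proof (intro conjI is_sheaf_dual mod_preI dual_presheaf module_dual)
  fix U V \<theta> \<eta> assume U: "opn U" "opn V" "V \<subseteq> U"
    and \<theta>: "\<theta> \<in> sec (dual X M) U" and \<eta>: "\<eta> \<in> sec (dual X M) U"
  note res = pre_closed[OF dual_presheaf U]
  show "restr (dual X M) U V (\<theta> \<oplus>\<^bsub>dual X M$U\<^esub> \<eta>) =
      restr (dual X M) U V \<theta> \<oplus>\<^bsub>dual X M$V\<^esub> restr (dual X M) U V \<eta>"
  proof (rule dual_eqI[of _ V])
    fix W x assume W: "opn W" "W \<subseteq> V" "x \<in> sec M W"
    moreover from this U have "W \<subseteq> U" by order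
    ultimately show "restr (dual X M) U V (\<theta> \<oplus>\<^bsub>dual X M$U\<^esub> \<eta>) W x =
      (restr (dual X M) U V \<theta> \<oplus>\<^bsub>dual X M$V\<^esub> restr (dual X M) U V \<eta>) W x" by simp
  qed (intro res dual_ops_closed \<theta> \<eta> U)+
next
  fix U V \<theta> r assume U: "opn U" "opn V" "V \<subseteq> U"
    and \<theta>: "\<theta> \<in> sec (dual X M) U" and r: "r \<in> \<O> U"
  note res = pre_closed[OF dual_presheaf U]
  show "restr (dual X M) U V (r \<odot>\<^bsub>dual X M$U\<^esub> \<theta>) =
      rr U V r \<odot>\<^bsub>dual X M$V\<^esub> restr (dual X M) U V \<theta>"
  proof (rule dual_eqI[of _ V])
    fix W x assume W: "opn W" "W \<subseteq> V" "x \<in> sec M W"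
    moreover from this U have "W \<subseteq> U" by order
    ultimately show "restr (dual X M) U V (r \<odot>\<^bsub>dual X M$U\<^esub> \<theta>) W x =
      (rr U V r \<odot>\<^bsub>dual X M$V\<^esub> restr (dual X M) U V \<theta>) W x" using U r by simp
  qed (intro res dual_ops_closed \<theta> U r rr_closed)+
qed

end

end

section \<open>Frames of rank one and two\<close>

context ringed
begin

text \<open>A basis together with its coordinate as a morphism, whereas \<open>basis_on\<close>
  asserts coefficients section by section. The value 1 of the coordinate at \<open>e\<close> makes
  coefficients unique.\<close>

definition frame1 :: "'a set \<Rightarrow> ('a, 'r, 'm) mod_presheaf \<Rightarrow> 'm \<Rightarrow> ('a set \<Rightarrow> 'm \<Rightarrow> 'r) \<Rightarrow> bool" where
  "frame1 U M e c \<longleftrightarrow> e \<in> sec M U \<and> c \<in> mod_homs X U M OX \<and>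
    (\<forall>V\<in>opens X U. \<forall>x\<in>sec M V. x = c V x \<odot>\<^bsub>M$V\<^esub> restr M U V e) \<and> c U e = \<one>\<^bsub>R U\<^esub>"

text \<open>The functionals \<open>c\<close> and \<open>d\<close> are the dual basis. Having them as
  part of the frame is what lets frames pass to duals and to exterior squares.\<close>

definition frame2 :: "'a set \<Rightarrow> ('a, 'r, 'm) mod_presheaf \<Rightarrow> 'm \<Rightarrow> 'm
    \<Rightarrow> ('a set \<Rightarrow> 'm \<Rightarrow> 'r) \<Rightarrow> ('a set \<Rightarrow> 'm \<Rightarrow> 'r) \<Rightarrow> bool" where
  "frame2 U M e f c d \<longleftrightarrow> e \<in> sec M U \<and> f \<in> sec M U \<and>
    c \<in> mod_homs X U M OX \<and> d \<in> mod_homs X U M OX \<and>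
    (\<forall>V\<in>opens X U. \<forall>x\<in>sec M V.
      x = lc M V (c V x) (restr M U V e) (d V x) (restr M U V f)) \<and>
    c U e = \<one>\<^bsub>R U\<^esub> \<and> c U f = \<zero>\<^bsub>R U\<^esub> \<and> d U e = \<zero>\<^bsub>R U\<^esub> \<and> d U f = \<one>\<^bsub>R U\<^esub>"

context
  fixes M :: "('a, 'r, 'm) mod_presheaf"
  assumes M [simp]: "mod_pre X M"
begin

lemma frame1D:
  assumes fr: "frame1 U M e c" and U: "opn U"
  shows "e \<in> sec M U" "c \<in> mod_homs X U M OX"
    "\<lbrakk>opn V; V \<subseteq> U; x \<in> sec M V\<rbrakk> \<Longrightarrow> c V x \<odot>\<^bsub>M$V\<^esub> restr M U V e = x"
    "opn V \<Longrightarrow> V \<subseteq> U \<Longrightarrow> c V (restr M U V e) = \<one>\<^bsub>R V\<^esub>"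
proof -
  show e: "e \<in> sec M U" and c: "c \<in> mod_homs X U M OX" using fr by (simp_all add: frame1_def)
  show "\<lbrakk>opn V; V \<subseteq> U; x \<in> sec M V\<rbrakk> \<Longrightarrow> c V x \<odot>\<^bsub>M$V\<^esub> restr M U V e = x"
    using fr by (simp add: frame1_def)
  show "opn V \<Longrightarrow> V \<subseteq> U \<Longrightarrow> c V (restr M U V e) = \<one>\<^bsub>R V\<^esub>"
    using fr hom_res[OF c U order_refl e] U by (simp add: frame1_def)
qed

lemma frame2D:
  assumes fr: "frame2 U M e f c d" and U: "opn U"
  shows "e \<in> sec M U" "f \<in> sec M U"
    "c \<in> mod_homs X U M OX" "d \<in> mod_homs X U M OX"
    "\<lbrakk>opn V; V \<subseteq> U; x \<in> sec M V\<rbrakk> \<Longrightarrow>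
      lc M V (c V x) (restr M U V e) (d V x) (restr M U V f) = x"
    "opn V \<Longrightarrow> V \<subseteq> U \<Longrightarrow> c V (restr M U V e) = \<one>\<^bsub>R V\<^esub>"
    "opn V \<Longrightarrow> V \<subseteq> U \<Longrightarrow> c V (restr M U V f) = \<zero>\<^bsub>R V\<^esub>"
    "opn V \<Longrightarrow> V \<subseteq> U \<Longrightarrow> d V (restr M U V e) = \<zero>\<^bsub>R V\<^esub>"
    "opn V \<Longrightarrow> V \<subseteq> U \<Longrightarrow> d V (restr M U V f) = \<one>\<^bsub>R V\<^esub>"
proof -
  show e: "e \<in> sec M U" "f \<in> sec M U" and c: "c \<in> mod_homs X U M OX" "d \<in> mod_homs X U M OX"
    using fr by (simp_all add: frame2_def)
  show "\<lbrakk>opn V; V \<subseteq> U; x \<in> sec M V\<rbrakk> \<Longrightarrow>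
      lc M V (c V x) (restr M U V e) (d V x) (restr M U V f) = x"
    using fr by (simp add: frame2_def)
  show "opn V \<Longrightarrow> V \<subseteq> U \<Longrightarrow> c V (restr M U V e) = \<one>\<^bsub>R V\<^esub>"
    "opn V \<Longrightarrow> V \<subseteq> U \<Longrightarrow> c V (restr M U V f) = \<zero>\<^bsub>R V\<^esub>"
    "opn V \<Longrightarrow> V \<subseteq> U \<Longrightarrow> d V (restr M U V e) = \<zero>\<^bsub>R V\<^esub>"
    "opn V \<Longrightarrow> V \<subseteq> U \<Longrightarrow> d V (restr M U V f) = \<one>\<^bsub>R V\<^esub>"
    using fr hom_res[OF c(1) U order_refl e(1)] hom_res[OF c(1) U order_refl e(2)]
      hom_res[OF c(2) U order_refl e(1)] hom_res[OF c(2) U order_refl e(2)] U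
    by (simp_all add: frame2_def)
qed

lemma frame1_restrict:
  assumes fr: "frame1 U M e c" and U: "opn U" and V: "opn V" "V \<subseteq> U"
  shows "frame1 V M (restr M U V e) (restrict c (opens X V))"
proof -
  note f = frame1D[OF fr U]
  show ?thesis unfolding frame1_def
  proof (intro conjI ballI)
    fix W x assume W: "W \<in> opens X V" and x: "x \<in> sec M W"
    have "W \<subseteq> U" "opn W" "W \<subseteq> V" using W V by auto
    then show "x = restrict c (opens X V) W x \<odot>\<^bsub>M$W\<^esub> restr M V W (restr M U V e)"
      using f(1) f(3)[of W x] x U V by simp
  qed (use f V U hom_restrict[OF f(2) V(2)] in simp_all)
qed

lemma frame2_restrict:
  assumes fr: "frame2 U M e f c d" and U: "opn U" and V: "opn V" "V \<subseteq> U"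
  shows "frame2 V M (restr M U V e) (restr M U V f) (restrict c (opens X V)) (restrict d (opens X V))"
proof -
  note f = frame2D[OF fr U]
  show ?thesis unfolding frame2_def
  proof (intro conjI ballI)
    fix W x assume W: "W \<in> opens X V" and x: "x \<in> sec M W"
    have "W \<subseteq> U" "opn W" "W \<subseteq> V" using W V by auto
    then show "x = lc M W (restrict c (opens X V) W x) (restr M V W (restr M U V e)) (restrict d (opens X V) W x) (restr M V W (restr M U V f))"
      using f(1,2) f(5)[of W x] x U V by simp
  qed (use f V U hom_restrict[OF f(3) V(2)] hom_restrict[OF f(4) V(2)] in simp_all)
qed

lemma frame2_coord:
  assumes fr: "frame2 U M e f c d" and U: "opn U" and V: "opn V" "V \<subseteq> U"
    and a: "a \<in> \<O> V" and b: "b \<in> \<O> V"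
  defines "x \<equiv> a \<odot>\<^bsub>M$V\<^esub> restr M U V e \<oplus>\<^bsub>M$V\<^esub> b \<odot>\<^bsub>M$V\<^esub> restr M U V f"
  shows "c V x = a" "d V x = b"
proof -
  note f = frame2D[OF fr U]
  show "c V x = a" unfolding x_def
    using f(1,2) f(6-9)[OF V] U V a b by (simp add: hom_add[OF f(3) V] hom_smult[OF f(3) V])
  show "d V x = b" unfolding x_def
    using f(1,2) f(6-9)[OF V] U V a b by (simp add: hom_add[OF f(4) V] hom_smult[OF f(4) V])
qed

lemma basis1_sum:
  assumes "opn V" "c 0 \<in> \<O> V" "e0 \<in> sec M V" "g 0 = e0"
  shows "(\<Oplus>\<^bsub>M$V\<^esub>i\<in>{..<1}. c i \<odot>\<^bsub>M$V\<^esub> g (i::nat)) = c 0 \<odot>\<^bsub>M$V\<^esub> e0"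
proof -
  interpret module "R V" "M$V" using pre_module[OF M assms(1)] .
  have "{..<1::nat} = {0}" by auto
  then show ?thesis using assms by (simp add: M.finsum_insert)
qed

lemma basis2_sum:
  assumes "opn V" "c 0 \<in> \<O> V" "c 1 \<in> \<O> V" "e0 \<in> sec M V" "e1 \<in> sec M V" "g 0 = e0" "g 1 = e1"
  shows "(\<Oplus>\<^bsub>M$V\<^esub>i\<in>{..<2}. c i \<odot>\<^bsub>M$V\<^esub> g (i::nat)) =
    lc M V (c 0) e0 (c 1) e1"
proof -
  interpret module "R V" "M$V" using pre_module[OF M assms(1)] .
  have "{..<2::nat} = {0, 1}" by auto
  then show ?thesis using assms by (simp add: M.finsum_insert)
qed

lemma frame1_basis:
  assumes fr: "frame1 U M e c" and U: "opn U"
  shows "basis_on X U M 1 (\<lambda>_. e)"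
  unfolding basis_on_def
proof (intro conjI ballI allI impI)
  note f = frame1D[OF fr U]
  show "e \<in> sec M U" by (rule f)
  fix V x assume "V \<in> opens X U" and x: "x \<in> sec M V"
  then have V: "opn V" "V \<subseteq> U" by auto
  have cx: "c V x \<in> \<O> V" using hom_closed[OF f(2) V x] by simp
  have eV: "restr M U V e \<in> sec M V" using f(1) U V by simp
  show "\<exists>!a. a \<in> {..<1::nat} \<rightarrow>\<^sub>E \<O> V \<and>
      x = (\<Oplus>\<^bsub>M$V\<^esub>i\<in>{..<1}. a i \<odot>\<^bsub>M$V\<^esub> restr M U V e)"
  proof -
    define a where "a = (\<lambda>i\<in>{..<1::nat}. c V x)"
    have a: "a \<in> {..<1} \<rightarrow>\<^sub>E \<O> V" "a 0 = c V x" using cx by (auto simp: a_def)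
    have ax: "x = (\<Oplus>\<^bsub>M$V\<^esub>i\<in>{..<1}. a i \<odot>\<^bsub>M$V\<^esub> restr M U V e)"
      using basis1_sum[of V a "restr M U V e" "\<lambda>_. restr M U V e"] a(2) cx eV V x f(3)[OF V x] by metis
    have ba: "b = a" if b: "b \<in> {..<1::nat} \<rightarrow>\<^sub>E \<O> V \<and>
        x = (\<Oplus>\<^bsub>M$V\<^esub>i\<in>{..<1}. b i \<odot>\<^bsub>M$V\<^esub> restr M U V e)" for b
    proof -
      have b0: "b 0 \<in> \<O> V" using b by (auto simp: PiE_iff)
      have "c V x = b 0"
        using conjunct2[OF b] V f(4)[OF V] eV hom_smult[OF f(2) V eV b0] b0
          basis1_sum[of V b "restr M U V e" "\<lambda>_. restr M U V e"] by simp
      then show ?thesis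
        using conjunct1[OF b] a by (intro extensionalityI[of _ "{..<1}"]) (auto simp: PiE_iff)
    qed
    show ?thesis by (rule ex1I[of _ a], rule conjI[OF a(1) ax], rule ba)
  qed
qed

text \<open>The functionals supply the coefficients, and their values at the two basis sections
  force any other coefficients to coincide with these.\<close>

lemma frame2_basis:
  assumes fr: "frame2 U M (e 0) (e 1) c d" and U: "opn U"
  shows "basis_on X U M 2 e"
  unfolding basis_on_def
proof (intro conjI ballI allI impI)
  note f = frame2D[OF fr U]
  have two: "i = 0 \<or> i = 1" if "i < 2" for i :: nat using that by auto
  show "e i \<in> sec M U" if "i < 2" for i using f(1,2) two[OF that] by auto
  fix V x assume "V \<in> opens X U" and x: "x \<in> sec M V"
  then have V: "opn V" "V \<subseteq> U" by auto
  have cx: "c V x \<in> \<O> V" "d V x \<in> \<O> V"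
    using hom_closed[OF f(3) V x] hom_closed[OF f(4) V x] by simp_all
  have eV: "restr M U V (e 0) \<in> sec M V" "restr M U V (e 1) \<in> sec M V" using f(1,2) U V by simp_all
  show "\<exists>!a. a \<in> {..<2} \<rightarrow>\<^sub>E \<O> V \<and>
      x = (\<Oplus>\<^bsub>M$V\<^esub>i\<in>{..<2}. a i \<odot>\<^bsub>M$V\<^esub> restr M U V (e i))"
  proof -
    define a where "a = (\<lambda>i\<in>{..<2::nat}. if i = 0 then c V x else d V x)"
    have a: "a \<in> {..<2} \<rightarrow>\<^sub>E \<O> V" "a 0 = c V x" "a 1 = d V x" using cx by (auto simp: a_def)
    have ax: "x = (\<Oplus>\<^bsub>M$V\<^esub>i\<in>{..<2}. a i \<odot>\<^bsub>M$V\<^esub> restr M U V (e i))"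
      using basis2_sum[of V a "restr M U V (e 0)" "restr M U V (e 1)" "\<lambda>i. restr M U V (e i)"]
        a(2,3) cx eV V x f(5)[OF V x] by metis
    have ba: "b = a" if b: "b \<in> {..<2::nat} \<rightarrow>\<^sub>E \<O> V \<and>
        x = (\<Oplus>\<^bsub>M$V\<^esub>i\<in>{..<2}. b i \<odot>\<^bsub>M$V\<^esub> restr M U V (e i))" for b
    proof -
      have b0: "b 0 \<in> \<O> V" "b 1 \<in> \<O> V" using b by (auto simp: PiE_iff)
      have "x = lc M V (b 0) (restr M U V (e 0)) (b 1) (restr M U V (e 1))"
        using conjunct2[OF b] basis2_sum[of V b "restr M U V (e 0)" "restr M U V (e 1)" "\<lambda>i. restr M U V (e i)"] V b0 eV by simp
      then have "c V x = b 0" "d V x = b 1"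
        using frame2_coord[OF fr U V b0] by simp_all
      then have "b i = a i" if "i < 2" for i using two[OF that] a(2,3) by metis
      then show ?thesis
        using conjunct1[OF b] a(1) unfolding PiE_iff by (intro extensionalityI[of _ "{..<2}"]) simp_all
    qed
    show ?thesis by (rule ex1I[of _ a], rule conjI[OF a(1) ax], rule ba)
  qed
qed

text \<open>Uniqueness of the coefficients is what makes them linear and compatible with
  restriction, hence morphisms.\<close>

lemma frame2I:
  assumes U: "opn U" and e: "e \<in> sec M U" "f \<in> sec M U"
    and ex: "\<And>V x. \<lbrakk>opn V; V \<subseteq> U; x \<in> sec M V\<rbrakk> \<Longrightarrow> \<exists>a\<in>\<O> V. \<exists>b\<in>\<O> V.
      x = lc M V a (restr M U V e) b (restr M U V f)"
    and uniq: "\<And>V a b a' b'. \<lbrakk>opn V; V \<subseteq> U; a \<in> \<O> V; b \<in> \<O> V;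
      a' \<in> \<O> V; b' \<in> \<O> V;
      lc M V a (restr M U V e) b (restr M U V f) =
      a' \<odot>\<^bsub>M$V\<^esub> restr M U V e \<oplus>\<^bsub>M$V\<^esub> b' \<odot>\<^bsub>M$V\<^esub> restr M U V f\<rbrakk> \<Longrightarrow> a = a' \<and> b = b'"
  obtains c d where "frame2 U M e f c d"
proof -
  define Q where "Q V x p \<longleftrightarrow> fst p \<in> \<O> V \<and> snd p \<in> \<O> V \<and>
    x = lc M V (fst p) (restr M U V e) (snd p) (restr M U V f)" for V x p
  define p where "p V x = (SOME p. Q V x p)" for V x
  have p: "Q V x (p V x)" if "opn V" "V \<subseteq> U" "x \<in> sec M V" for V x
  proof -
    have "\<exists>p. Q V x p" using ex[OF that] by (auto simp: Q_def)
    then show ?thesis unfolding p_def by (rule someI_ex)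
  qed
  have p_eq: "fst (p V x) = a \<and> snd (p V x) = b" if V: "opn V" "V \<subseteq> U" and x: "x \<in> sec M V"
    and ab: "a \<in> \<O> V" "b \<in> \<O> V"
      "x = lc M V a (restr M U V e) b (restr M U V f)" for V x a b
    using p[OF V x] ab unfolding Q_def by (intro uniq[OF V]) auto
  note pD = p[unfolded Q_def, THEN conjunct1] p[unfolded Q_def, THEN conjunct2, THEN conjunct1]
    p[unfolded Q_def, THEN conjunct2, THEN conjunct2]
  have ops: "fst (p V (x \<oplus>\<^bsub>M$V\<^esub> y)) = fst (p V x) \<oplus>\<^bsub>R V\<^esub> fst (p V y) \<and>
      snd (p V (x \<oplus>\<^bsub>M$V\<^esub> y)) = snd (p V x) \<oplus>\<^bsub>R V\<^esub> snd (p V y)"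
    if V: "opn V" "V \<subseteq> U" and x: "x \<in> sec M V" and y: "y \<in> sec M V" for V x y
  proof (rule p_eq[OF V])
    interpret module "R V" "M$V" using pre_module[OF M V(1)] .
    show "x \<oplus>\<^bsub>M$V\<^esub> y = lc M V (fst (p V x) \<oplus>\<^bsub>R V\<^esub> fst (p V y)) (restr M U V e) (snd (p V x) \<oplus>\<^bsub>R V\<^esub> snd (p V y)) (restr M U V f)"
      using U V e pD(1,2)[OF V x] pD(1,2)[OF V y]
      by (subst pD(3)[OF V x], subst pD(3)[OF V y]) (simp add: smult_l_distr M.a_ac)
  qed (use V x y pD in simp_all)
  have sm: "fst (p V (r \<odot>\<^bsub>M$V\<^esub> x)) = r \<otimes>\<^bsub>R V\<^esub> fst (p V x) \<and>
      snd (p V (r \<odot>\<^bsub>M$V\<^esub> x)) = r \<otimes>\<^bsub>R V\<^esub> snd (p V x)"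
    if V: "opn V" "V \<subseteq> U" and x: "x \<in> sec M V" and r: "r \<in> \<O> V" for V x r
  proof (rule p_eq[OF V])
    interpret module "R V" "M$V" using pre_module[OF M V(1)] .
    show "r \<odot>\<^bsub>M$V\<^esub> x = lc M V (r \<otimes>\<^bsub>R V\<^esub> fst (p V x)) (restr M U V e) (r \<otimes>\<^bsub>R V\<^esub> snd (p V x)) (restr M U V f)"
      using U V e pD(1,2)[OF V x] r
      by (subst pD(3)[OF V x]) (simp add: smult_r_distr smult_assoc1)
  qed (use V x r pD in simp_all)
  have res: "fst (p W (restr M V W x)) = rr V W (fst (p V x)) \<and> snd (p W (restr M V W x)) = rr V W (snd (p V x))"
    if V: "opn V" "V \<subseteq> U" and x: "x \<in> sec M V" and W: "opn W" "W \<subseteq> V" for V x W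
  proof (rule p_eq)
    show WU: "W \<subseteq> U" using V W by order
    show "restr M V W x = lc M W (rr V W (fst (p V x))) (restr M U W e) (rr V W (snd (p V x))) (restr M U W f)"
      using U V W e pD(1,2)[OF V x]
      by (subst pD(3)[OF V x]) simp
  qed (use V W x pD in simp_all)
  have gen: "fst (p U e) = \<one>\<^bsub>R U\<^esub> \<and> snd (p U e) = \<zero>\<^bsub>R U\<^esub>" "fst (p U f) = \<zero>\<^bsub>R U\<^esub> \<and> snd (p U f) = \<one>\<^bsub>R U\<^esub>"
    using e U by (intro p_eq; simp)+
  have "mkhom X U M (\<lambda>V x. fst (p V x)) \<in> mod_homs X U M OX"
    "mkhom X U M (\<lambda>V x. snd (p V x)) \<in> mod_homs X U M OX"
    by (intro mkhomI; simp add: ops sm res pD)+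
  then have "frame2 U M e f (mkhom X U M (\<lambda>V x. fst (p V x))) (mkhom X U M (\<lambda>V x. snd (p V x)))"
    using e U gen unfolding frame2_def by (simp add: pD(3)[symmetric])
  then show ?thesis using that by blast
qed

lemma basis2_frame:
  assumes U: "opn U" and b: "basis_on X U M 2 e"
  obtains c d where "frame2 U M (e 0) (e 1) c d"
proof -
  have e: "e 0 \<in> sec M U" "e 1 \<in> sec M U" using b by (auto simp: basis_on_def)
  have *: "\<exists>!a. a \<in> {..<2::nat} \<rightarrow>\<^sub>E \<O> V \<and>
      x = (\<Oplus>\<^bsub>M$V\<^esub>i\<in>{..<2}. a i \<odot>\<^bsub>M$V\<^esub> restr M U V (e i))"
    if "opn V" "V \<subseteq> U" "x \<in> sec M V" for V x
    using b that unfolding basis_on_def by simp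
  have sum: "(\<Oplus>\<^bsub>M$V\<^esub>i\<in>{..<2}. a i \<odot>\<^bsub>M$V\<^esub> restr M U V (e i)) =
      lc M V (a 0) (restr M U V (e 0)) (a 1) (restr M U V (e 1))"
    if "opn V" "V \<subseteq> U" "a 0 \<in> \<O> V" "a 1 \<in> \<O> V" for V a
    using that e U by (intro basis2_sum) simp_all
  show ?thesis
  proof (rule frame2I[OF U e])
    fix V x assume V: "opn V" "V \<subseteq> U" and x: "x \<in> sec M V"
    obtain a where a: "a \<in> {..<2::nat} \<rightarrow>\<^sub>E \<O> V"
      "x = (\<Oplus>\<^bsub>M$V\<^esub>i\<in>{..<2}. a i \<odot>\<^bsub>M$V\<^esub> restr M U V (e i))"
      using * [OF V x] by blast
    then have "a 0 \<in> \<O> V" "a 1 \<in> \<O> V" by (auto simp: PiE_iff)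
    then show "\<exists>a\<in>\<O> V. \<exists>b\<in>\<O> V.
      x = lc M V a (restr M U V (e 0)) b (restr M U V (e 1))"
      using a(2) sum[OF V, of a] by auto
  next
    fix V a b a' b' assume V: "opn V" "V \<subseteq> U" and ab: "a \<in> \<O> V" "b \<in> \<O> V"
      "a' \<in> \<O> V" "b' \<in> \<O> V"
      and eq: "lc M V a (restr M U V (e 0)) b (restr M U V (e 1)) =
      lc M V a' (restr M U V (e 0)) b' (restr M U V (e 1))"
    \<comment> \<open>A pair of coefficients as an extensional function on two indices, the form in
      which \<open>basis_on\<close> states uniqueness.\<close>
    define v where "v a b = (\<lambda>i\<in>{..<2::nat}. if i = 0 then a else b)" for a b :: 'r
    have v: "v a b \<in> {..<2::nat} \<rightarrow>\<^sub>E \<O> V \<and>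
       lc M V a (restr M U V (e 0)) b (restr M U V (e 1)) =
       (\<Oplus>\<^bsub>M$V\<^esub>i\<in>{..<2}. v a b i \<odot>\<^bsub>M$V\<^esub> restr M U V (e i))"
      if "a \<in> \<O> V" "b \<in> \<O> V" for a b
      using that sum[OF V, of "v a b"] by (auto simp: v_def)
    have "a \<odot>\<^bsub>M$V\<^esub> restr M U V (e 0) \<oplus>\<^bsub>M$V\<^esub> b \<odot>\<^bsub>M$V\<^esub> restr M U V (e 1) \<in> sec M V"
      using V U e ab by simp
    from * [OF V this] v[OF ab(1,2)] v[OF ab(3,4)] have "v a b = v a' b'" unfolding eq by blast
    from fun_cong[OF this, of 0] fun_cong[OF this, of 1] show "a = a' \<and> b = b'" by (simp add: v_def)
  qed (use that in blast)
qed

end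

lemma locally_free2_frame:
  assumes M: "locally_free X 2 M" and U: "opn U" and x: "x \<in> U"
  obtains V e f c d where "opn V" "x \<in> V" "V \<subseteq> U" "frame2 V M e f c d"
proof -
  have ms: "module_sheaf X M" using M by (simp add: locally_free_def)
  have "x \<in> pts X" using opn_pts[OF U] x by blast
  then obtain V e where V: "opn V" "x \<in> V" "basis_on X V M 2 e"
    using M unfolding locally_free_def Bex_def opens_iff by blast
  obtain c d where fr: "frame2 V M (e 0) (e 1) c d"
    by (rule basis2_frame[OF module_sheaf_pre[OF ms] V(1,3)])
  have "opn (V \<inter> U)" "V \<inter> U \<subseteq> V" "V \<inter> U \<subseteq> U" "x \<in> V \<inter> U" using V U x by auto
  then show ?thesis using that frame2_restrict[OF module_sheaf_pre[OF ms] fr V(1)] by blast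
qed

lemma locally_free2I:
  assumes "module_sheaf X M"
    and "\<And>x. x \<in> pts X \<Longrightarrow> \<exists>U e f c d. opn U \<and> x \<in> U \<and> frame2 U M e f c d"
  shows "locally_free X 2 M"
  unfolding locally_free_def
proof (intro conjI assms(1) ballI)
  fix x assume "x \<in> pts X"
  from assms(2)[OF this] obtain U e f c d where U: "opn U" "x \<in> U" "frame2 U M e f c d" by blast
  have "basis_on X U M 2 (\<lambda>i. if i = 0 then e else f)"
    by (rule frame2_basis) (use U assms(1) in simp_all)
  then have "\<exists>e. basis_on X U M 2 e" by (rule exI[of "basis_on X U M 2"])
  then show "\<exists>U\<in>opens X (pts X). x \<in> U \<and> (\<exists>e. basis_on X U M 2 e)"
    using U(1,2) by (intro bexI[of _ U] conjI) simp_all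
qed

text \<open>Local freeness of rank 1 with frames over arbitrarily small neighbourhoods, so that
  frames of several sheaves can be taken over the same open set.\<close>

definition line_bundle :: "('a, 'r, 'm) mod_presheaf \<Rightarrow> bool" where
  "line_bundle L \<longleftrightarrow> module_sheaf X L \<and>
    (\<forall>U x. opn U \<longrightarrow> x \<in> U \<longrightarrow> (\<exists>V e c. opn V \<and> x \<in> V \<and> V \<subseteq> U \<and> frame1 V L e c))"

lemma line_bundle_sheaf: "line_bundle L \<Longrightarrow> module_sheaf X L"
  by (simp add: line_bundle_def)

lemma line_bundle_frame:
  assumes "line_bundle L" "opn U" "x \<in> U"
  obtains V e c where "opn V" "x \<in> V" "V \<subseteq> U" "frame1 V L e c"
  using assms unfolding line_bundle_def by blast

lemma line_bundleI:
  assumes ms: "module_sheaf X L"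
    and ex: "\<And>x. x \<in> pts X \<Longrightarrow> \<exists>U e c. opn U \<and> x \<in> U \<and> frame1 U L e c"
  shows "line_bundle L"
  unfolding line_bundle_def
proof (intro conjI ms allI impI)
  fix U x assume U: "opn U" "x \<in> U"
  then obtain V e c where V: "opn V" "x \<in> V" "frame1 V L e c" using ex[of x] opn_pts[OF U(1)] by blast
  have "opn (V \<inter> U)" "V \<inter> U \<subseteq> V" "V \<inter> U \<subseteq> U" "x \<in> V \<inter> U" using V U by auto
  then show "\<exists>V e c. opn V \<and> x \<in> V \<and> V \<subseteq> U \<and> frame1 V L e c"
    using frame1_restrict[OF module_sheaf_pre[OF ms] V(3,1)] by blast
qed

lemma line_bundle_locally_free:
  assumes L: "line_bundle L" shows "locally_free X 1 L"
  unfolding locally_free_def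
proof (intro conjI line_bundle_sheaf[OF L] ballI)
  fix x assume x: "x \<in> pts X"
  obtain U e c where U: "opn U" "x \<in> U" "frame1 U L e c" by (rule line_bundle_frame[OF L opn_top x])
  have "basis_on X U L 1 (\<lambda>_. e)"
    by (rule frame1_basis[OF module_sheaf_pre[OF line_bundle_sheaf[OF L]] U(3,1)])
  then have "\<exists>e. basis_on X U L 1 e" by (rule exI[of "basis_on X U L 1"])
  then show "\<exists>U\<in>opens X (pts X). x \<in> U \<and> (\<exists>e. basis_on X U L 1 e)"
    using U(1,2) by (intro bexI[of _ U] conjI) simp_all
qed

text \<open>If \<open>h\<close> takes a generator \<open>e\<close> to a generator, then its inverse
  sends a section to the coordinate along \<open>h U e\<close> times \<open>e\<close>. This works
  over every smaller open set, so that \<open>isoI_local\<close> applies.\<close>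

lemma line_bundle_isoI:
  assumes h: "h \<in> mod_homs X (pts X) L K" and L: "module_sheaf X L" and K: "module_sheaf X K"
    and loc: "\<And>x. x \<in> pts X \<Longrightarrow> \<exists>U e c d. opn U \<and> x \<in> U \<and> frame1 U L e c \<and> frame1 U K (h U e) d"
  shows "h \<in> mod_isos X L K"
proof (rule isoI_local[OF h L K])
  fix x assume "x \<in> pts X"
  then obtain U e c d where U: "opn U" "x \<in> U" "frame1 U L e c" "frame1 U K (h U e) d" using loc by blast
  note L' = module_sheaf_pre[OF L] and K' = module_sheaf_pre[OF K]
  note f = frame1D[OF L' U(3,1)] and g = frame1D[OF K' U(4,1)]
  have "bij_betw (h V) (sec L V) (sec K V)" if V: "opn V" "V \<subseteq> U" for V
  proof (rule bij_betw_byWitness[where f' = "\<lambda>y. d V y \<odot>\<^bsub>L$V\<^esub> restr L U V e"])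
    have eV: "restr L U V e \<in> sec L V" using f(1) U V L' by simp
    have heV: "h V (restr L U V e) = restr K U V (h U e)"
      using hom_res[OF h U(1) opn_pts[OF U(1)] f(1) V] .
    have dy: "d V y \<in> \<O> V" if "y \<in> sec K V" for y using hom_closed[OF g(2) V that] by simp
    have cx: "c V y \<in> \<O> V" if "y \<in> sec L V" for y using hom_closed[OF f(2) V that] by simp
    have hx: "h V y \<in> sec K V" if "y \<in> sec L V" for y using hom_closed[OF h V(1) opn_pts[OF V(1)] that] .
    show "\<forall>y\<in>sec K V. h V (d V y \<odot>\<^bsub>L$V\<^esub> restr L U V e) = y"
    proof
      fix y assume y: "y \<in> sec K V"
      show "h V (d V y \<odot>\<^bsub>L$V\<^esub> restr L U V e) = y"
        using hom_smult[OF h V(1) opn_pts[OF V(1)] eV dy[OF y]] g(3)[OF V y] heV by simp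
    qed
    show "\<forall>x\<in>sec L V. d V (h V x) \<odot>\<^bsub>L$V\<^esub> restr L U V e = x"
    proof
      fix y assume y: "y \<in> sec L V"
      have "h V y = h V (c V y \<odot>\<^bsub>L$V\<^esub> restr L U V e)" using f(3)[OF V y] by simp
      also have "\<dots> = c V y \<odot>\<^bsub>K$V\<^esub> restr K U V (h U e)"
        using hom_smult[OF h V(1) opn_pts[OF V(1)] eV cx[OF y]] heV by simp
      finally have "d V (h V y) = d V (c V y \<odot>\<^bsub>K$V\<^esub> restr K U V (h U e))" by simp
      also have "\<dots> = c V y"
        using hom_smult[OF g(2) V _ cx[OF y], of "restr K U V (h U e)"] g(1,4) U V K' cx[OF y] by simp
      finally show "d V (h V y) \<odot>\<^bsub>L$V\<^esub> restr L U V e = y" using f(3)[OF V y] by simp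
    qed
    show "h V ` sec L V \<subseteq> sec K V" using hx by blast
    show "(\<lambda>y. d V y \<odot>\<^bsub>L$V\<^esub> restr L U V e) ` sec K V \<subseteq> sec L V"
      using dy eV L' V by (auto simp: image_subset_iff)
  qed
  then show "\<exists>U. opn U \<and> x \<in> U \<and>
      (\<forall>V. opn V \<longrightarrow> V \<subseteq> U \<longrightarrow> bij_betw (h V) (sec L V) (sec K V))" using U by blast
qed

end

section \<open>Frames of dual, exterior and tensor sheaves\<close>

context ringed
begin

lemma hom_idI: "mod_pre X M \<Longrightarrow> mkhom X U M (\<lambda>V x. x) \<in> mod_homs X U M M"
  by (rule mkhomI) simp_all

text \<open>Such a morphism, compared with the identity on pure sections of a sheaf, shows that
  \<open>s\<close> generates with coordinate \<open>c\<close>. It also builds the local determinant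
  morphism.\<close>

lemma hom_scaled:
  assumes M: "mod_pre X M" and L: "mod_pre X L" and U: "opn U" and c: "c \<in> mod_homs X U M OX"
    and s: "s \<in> sec L U"
  shows "mkhom X U M (\<lambda>V x. c V x \<odot>\<^bsub>L$V\<^esub> restr L U V s) \<in> mod_homs X U M L"
proof (rule mkhomI[OF M])
  note h = hom_simps[OF c, simplified]
  fix V x assume V: "opn V" "V \<subseteq> U" and x: "x \<in> sec M V"
  interpret module "R V" "L$V" using pre_module[OF L V(1)] .
  show "c V x \<odot>\<^bsub>L$V\<^esub> restr L U V s \<in> sec L V" using h V x U s L by simp
  show "c V (x \<oplus>\<^bsub>M$V\<^esub> y) \<odot>\<^bsub>L$V\<^esub> restr L U V s =
      c V x \<odot>\<^bsub>L$V\<^esub> restr L U V s \<oplus>\<^bsub>L$V\<^esub> c V y \<odot>\<^bsub>L$V\<^esub> restr L U V s"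
    if "y \<in> sec M V" for y using that h V x U s L by (simp add: smult_l_distr)
  show "c V (r \<odot>\<^bsub>M$V\<^esub> x) \<odot>\<^bsub>L$V\<^esub> restr L U V s =
      r \<odot>\<^bsub>L$V\<^esub> (c V x \<odot>\<^bsub>L$V\<^esub> restr L U V s)"
    if "r \<in> \<O> V" for r using that h V x U s L by (simp add: smult_assoc1)
  show "c W (restr M V W x) \<odot>\<^bsub>L$W\<^esub> restr L U W s =
      restr L V W (c V x \<odot>\<^bsub>L$V\<^esub> restr L U V s)"
    if "opn W" "W \<subseteq> V" for W using that h V x U s L by simp
qed

text \<open>Evaluation at \<open>e\<close> as a functional on the dual. It serves both as a
  coordinate of the dual frame and as the image of \<open>e\<close> in the bidual.\<close>

definition ev :: "'a set \<Rightarrow> ('a, 'r, 'm) mod_presheaf \<Rightarrow> 'm \<Rightarrow> 'a set \<Rightarrow> ('a set \<Rightarrow> 'm \<Rightarrow> 'r) \<Rightarrow> 'r" where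
  "ev U M e = mkhom X U (dual X M) (\<lambda>V \<theta>. \<theta> V (restr M U V e))"

lemma ev_apply [simp]:
  "\<lbrakk>opn V; V \<subseteq> U; \<theta> \<in> mod_homs X V M OX\<rbrakk> \<Longrightarrow> ev U M e V \<theta> = \<theta> V (restr M U V e)"
  by (simp add: ev_def)

lemma ev_hom:
  assumes M: "mod_pre X M" and U: "opn U" and e: "e \<in> sec M U"
  shows "ev U M e \<in> mod_homs X U (dual X M) OX"
  unfolding ev_def
proof (rule mkhomI)
  show "mod_pre X (dual X M)" using dual_sheaf[OF M] by simp
  fix V W \<theta> assume V: "opn V" "V \<subseteq> U" "opn W" "W \<subseteq> V" and \<theta>: "\<theta> \<in> sec (dual X M) V"
  show "restr (dual X M) V W \<theta> W (restr M U W e) = restr OX V W (\<theta> V (restr M U V e))"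
    using hom_res[OF \<theta> [unfolded dual_sec] V(1) order_refl, of "restr M U V e" W] V U e M by simp
qed (use M U e in simp_all)

text \<open>By linearity, a functional is its value at the generator times the coordinate.\<close>

lemma dual_frame1:
  assumes M: "mod_pre X M" and fr: "frame1 U M e c" and U: "opn U"
  shows "frame1 U (dual X M) c (ev U M e)"
proof -
  note f = frame1D[OF M fr U] and D = module_sheaf_pre[OF dual_sheaf[OF M]]
  show ?thesis unfolding frame1_def
  proof (intro conjI ballI)
    show "c \<in> sec (dual X M) U" using f(2) by simp
    show "ev U M e \<in> mod_homs X U (dual X M) OX" by (rule ev_hom[OF M U f(1)])
    show "ev U M e U c = \<one>\<^bsub>R U\<^esub>" using f(2) f(4)[OF U order_refl] U by simp
    fix V \<theta> assume "V \<in> opens X U" and \<theta>: "\<theta> \<in> sec (dual X M) V"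
    then have V: "opn V" "V \<subseteq> U" by auto
    note h = hom_simps[OF \<theta> [unfolded dual_sec], simplified]
    have eV: "restr M U V e \<in> sec M V" using f(1) U V M by simp
    have cV: "restr (dual X M) U V c \<in> sec (dual X M) V" using U V f(2) by (intro res_closed[OF D]) simp_all
    have tV: "\<theta> V (restr M U V e) \<in> \<O> V" using h(1)[OF V(1) order_refl eV] .
    show "\<theta> = ev U M e V \<theta> \<odot>\<^bsub>dual X M$V\<^esub> restr (dual X M) U V c"
    proof (rule dual_eqI[OF M \<theta>])
      show "ev U M e V \<theta> \<odot>\<^bsub>dual X M$V\<^esub> restr (dual X M) U V c \<in> sec (dual X M) V"
        using mod_closed(5)[OF D V(1) tV cV] V \<theta> by simp
      fix W x assume W: "opn W" "W \<subseteq> V" and x: "x \<in> sec M W"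
      have WU: "W \<subseteq> U" using V W by order
      have cx: "c W x \<in> \<O> W" using hom_closed[OF f(2) W(1) WU x] by simp
      have "\<theta> W x = \<theta> W (c W x \<odot>\<^bsub>M$W\<^esub> restr M U W e)" using f(3)[OF W(1) WU x] by simp
      also have "\<dots> = c W x \<otimes>\<^bsub>R W\<^esub> rr V W (\<theta> V (restr M U V e))"
        using h(3)[OF W _ cx, of "restr M U W e"] h(4)[OF V(1) order_refl eV W] f(1) U W WU V M by simp
      finally show "\<theta> W x = (ev U M e V \<theta> \<odot>\<^bsub>dual X M$V\<^esub> restr (dual X M) U V c) W x"
        using W WU V x cx tV \<theta> by (simp add: R_ac)
    qed
  qed
qed

lemma dual_frame2:
  assumes M: "mod_pre X M" and fr: "frame2 U M e f c d" and U: "opn U"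
  shows "frame2 U (dual X M) c d (ev U M e) (ev U M f)"
proof -
  note f = frame2D[OF M fr U] and D = module_sheaf_pre[OF dual_sheaf[OF M]]
  show ?thesis unfolding frame2_def
  proof (intro conjI ballI)
    show "c \<in> sec (dual X M) U" "d \<in> sec (dual X M) U" using f(3,4) by simp_all
    show "ev U M e \<in> mod_homs X U (dual X M) OX" "ev U M f \<in> mod_homs X U (dual X M) OX"
      by (rule ev_hom[OF M U f(1)], rule ev_hom[OF M U f(2)])
    show "ev U M e U c = \<one>\<^bsub>R U\<^esub>" "ev U M e U d = \<zero>\<^bsub>R U\<^esub>" "ev U M f U c = \<zero>\<^bsub>R U\<^esub>" "ev U M f U d = \<one>\<^bsub>R U\<^esub>"
      using f(3,4) f(6-9)[OF U order_refl] U by simp_all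
    fix V \<theta> assume "V \<in> opens X U" and \<theta>: "\<theta> \<in> sec (dual X M) V"
    then have V: "opn V" "V \<subseteq> U" by auto
    note h = hom_simps[OF \<theta> [unfolded dual_sec], simplified]
    have eV: "restr M U V e \<in> sec M V" "restr M U V f \<in> sec M V" using f(1,2) U V M by simp_all
    have cV: "restr (dual X M) U V c \<in> sec (dual X M) V" "restr (dual X M) U V d \<in> sec (dual X M) V"
      using U V f(3,4) by (simp_all only: res_closed[OF D] dual_sec[symmetric])
    have tV: "\<theta> V (restr M U V e) \<in> \<O> V" "\<theta> V (restr M U V f) \<in> \<O> V"
      using h(1)[OF V(1) order_refl] eV by simp_all
    show "\<theta> = lc (dual X M) V (ev U M e V \<theta>) (restr (dual X M) U V c) (ev U M f V \<theta>) (restr (dual X M) U V d)"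
    proof (rule dual_eqI[OF M \<theta>])
      show "ev U M e V \<theta> \<odot>\<^bsub>dual X M$V\<^esub> restr (dual X M) U V c
        \<oplus>\<^bsub>dual X M$V\<^esub> ev U M f V \<theta> \<odot>\<^bsub>dual X M$V\<^esub> restr (dual X M) U V d \<in> sec (dual X M) V"
        using V tV cV \<theta> by (intro mod_closed(2,5)[OF D V(1)]) simp_all
      fix W x assume W: "opn W" "W \<subseteq> V" and x: "x \<in> sec M W"
      have WU: "W \<subseteq> U" using V W by order
      have cx: "c W x \<in> \<O> W" "d W x \<in> \<O> W"
        using hom_closed[OF f(3) W(1) WU x] hom_closed[OF f(4) W(1) WU x] by simp_all
      have eW: "restr M U W e \<in> sec M W" "restr M U W f \<in> sec M W" using f(1,2) U W WU M by simp_all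
      have "\<theta> W x = \<theta> W (lc M W (c W x) (restr M U W e) (d W x) (restr M U W f))"
        using f(5)[OF W(1) WU x] by simp
      also have "\<dots> = dot W (c W x) (rr V W (\<theta> V (restr M U V e))) (d W x) (rr V W (\<theta> V (restr M U V f)))"
        using h(2)[OF W] h(3)[OF W] h(4)[OF V(1) order_refl eV(1) W] h(4)[OF V(1) order_refl eV(2) W]
          f(1,2) U W WU V M cx eW by simp
      finally show "\<theta> W x = (lc (dual X M) V (ev U M e V \<theta>) (restr (dual X M) U V c) (ev U M f V \<theta>) (restr (dual X M) U V d)) W x"
        using W WU V x cx tV \<theta> by (simp add: R_ac)
    qed
  qed
qed

text \<open>The coordinate is the determinant of the coordinates of the two factors. It is
  alternating and bilinear, so the universal property turns it into a functional.\<close>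

lemma ext2_frame:
  assumes M: "mod_pre X M" and fr: "frame2 U M e f c d" and U: "opn U"
  obtains k where "frame1 U (ext2 X M) (wedge X M U e f) k"
    "\<And>V x y. \<lbrakk>opn V; V \<subseteq> U; x \<in> sec M V; y \<in> sec M V\<rbrakk> \<Longrightarrow>
      k V (wedge X M V x y) = cross V (c V x) (d V y) (d V x) (c V y)"
proof -
  note f = frame2D[OF M fr U] and ES [simp] = ext2_sheaf[OF M]
  note E = module_sheaf_pre[OF ES]
  note hc = hom_simps[OF f(3), simplified] and hd = hom_simps[OF f(4), simplified]
  have bil: "bilin X U M M OX (\<lambda>V x y. cross V (c V x) (d V y) (d V x) (c V y))"
  proof (rule bilinI)
    fix V x y assume V: "opn V" "V \<subseteq> U" and x: "x \<in> sec M V" and y: "y \<in> sec M V"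
    interpret cring "R V" using cring_R[OF V(1)] .
    note in_R = hc(1)[OF V x] hd(1)[OF V x] hc(1)[OF V y] hd(1)[OF V y]
    show "c V x \<otimes>\<^bsub>R V\<^esub> d V y \<ominus>\<^bsub>R V\<^esub> d V x \<otimes>\<^bsub>R V\<^esub> c V y \<in> sec OX V" using in_R by simp
    { fix z assume z: "z \<in> sec M V"
      note in_R = in_R hc(1)[OF V z] hd(1)[OF V z]
      show "cross V (c V (x \<oplus>\<^bsub>M$V\<^esub> z)) (d V y) (d V (x \<oplus>\<^bsub>M$V\<^esub> z)) (c V y) =
        cross V (c V x) (d V y) (d V x) (c V y) \<oplus>\<^bsub>OX$V\<^esub>
        cross V (c V z) (d V y) (d V z) (c V y)"
        "cross V (c V x) (d V (y \<oplus>\<^bsub>M$V\<^esub> z)) (d V x) (c V (y \<oplus>\<^bsub>M$V\<^esub> z)) =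
        cross V (c V x) (d V y) (d V x) (c V y) \<oplus>\<^bsub>OX$V\<^esub>
        cross V (c V x) (d V z) (d V x) (c V z)"
        unfolding struct_simps hc(2)[OF V x z] hd(2)[OF V x z] hc(2)[OF V y z] hd(2)[OF V y z]
        using in_R by algebra+ }
    { fix r assume r: "r \<in> \<O> V"
      show "cross V (c V (r \<odot>\<^bsub>M$V\<^esub> x)) (d V y) (d V (r \<odot>\<^bsub>M$V\<^esub> x)) (c V y) =
        r \<odot>\<^bsub>OX$V\<^esub> cross V (c V x) (d V y) (d V x) (c V y)"
        "cross V (c V x) (d V (r \<odot>\<^bsub>M$V\<^esub> y)) (d V x) (c V (r \<odot>\<^bsub>M$V\<^esub> y)) =
        r \<odot>\<^bsub>OX$V\<^esub> cross V (c V x) (d V y) (d V x) (c V y)"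
        unfolding struct_simps hc(3)[OF V x r] hd(3)[OF V x r] hc(3)[OF V y r] hd(3)[OF V y r]
        using in_R r by algebra+ }
    fix W assume W: "opn W" "W \<subseteq> V"
    show "cross W (c W (restr M V W x)) (d W (restr M V W y)) (d W (restr M V W x)) (c W (restr M V W y)) =
        restr OX V W (cross V (c V x) (d V y) (d V x) (c V y))"
      using in_R V W by (simp add: hc(4)[OF V x W] hd(4)[OF V x W] hc(4)[OF V y W] hd(4)[OF V y W])
  qed
  have alt: "cross V (c V x) (d V x) (d V x) (c V x) = \<zero>\<^bsub>OX$V\<^esub>"
    if V: "opn V" "V \<subseteq> U" and x: "x \<in> sec M V" for V x
  proof -
    interpret cring "R V" using cring_R[OF V(1)] .
    show ?thesis using hc(1)[OF V x] hd(1)[OF V x] unfolding struct_simps by algebra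
  qed
  obtain k where k: "k \<in> mod_homs X U (ext2 X M) OX"
    "\<And>V x y. \<lbrakk>opn V; V \<subseteq> U; x \<in> sec M V; y \<in> sec M V\<rbrakk> \<Longrightarrow>
      k V (wedge X M V x y) = cross V (c V x) (d V y) (d V x) (c V y)"
    by (rule ext2_lift[OF M struct_sheaf bil U alt], assumption+, blast)
  have w: "wedge X M U e f \<in> sec (ext2 X M) U" using M U f(1,2) by simp
  \<comment> \<open>A section need not be a sum of wedges. The expansion along the generator is
    therefore stated as an equality with the identity morphism, which only has to be checked on
    wedges.\<close>
  have id: "mkhom X U (ext2 X M) (\<lambda>V x. x) = mkhom X U (ext2 X M) (\<lambda>V x. k V x \<odot>\<^bsub>ext2 X M$V\<^esub> restr (ext2 X M) U V (wedge X M U e f))"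
  proof (rule ext2_hom_eqI[OF M hom_idI[OF E] hom_scaled[OF E E U k(1) w] ES])
    fix V x y assume V: "opn V" "V \<subseteq> U" and x: "x \<in> sec M V" and y: "y \<in> sec M V"
    interpret module "R V" "ext2 X M$V" using pre_module[OF E V(1)] .
    define e' f' where "e' = restr M U V e" "f' = restr M U V f"
    have ef: "e' \<in> sec M V" "f' \<in> sec M V" using f(1,2) U V M by (simp_all add: e'_f'_def)
    note in_R = hc(1)[OF V x] hd(1)[OF V x] hc(1)[OF V y] hd(1)[OF V y]
    have xe: "x = lc M V (c V x) e' (d V x) f'"
      "y = lc M V (c V y) e' (d V y) f'"
      using f(5)[OF V x] f(5)[OF V y] by (simp_all add: e'_f'_def)
    have wV: "wedge X M V e' f' \<in> sec (ext2 X M) V" using M V ef by simp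
    \<comment> \<open>In the expansion the two squares vanish, and swapping the factors of one mixed
      term produces the sign of the determinant.\<close>
    have gen: "wedge X M V (lc M V a e' b f')
        (lc M V a' e' b' f') =
        cross V a b' b a' \<odot>\<^bsub>ext2 X M$V\<^esub> wedge X M V e' f'"
      if ab: "a \<in> \<O> V" "b \<in> \<O> V" "a' \<in> \<O> V" "b' \<in> \<O> V" for a b a' b'
      using M V ef ab wV
      by (simp add: wedge_swap[OF M V(1) ef] smult_assoc1[symmetric] smult_l_distr[symmetric] a_minus_def)
        (rule arg_cong[where f = "\<lambda>t. t \<odot>\<^bsub>ext2 X M$V\<^esub> _"], use ab in algebra)
    have "wedge X M V x y = k V (wedge X M V x y) \<odot>\<^bsub>ext2 X M$V\<^esub> wedge X M V e' f'"
      unfolding k(2)[OF V x y] by (subst xe(1), subst xe(2), rule gen[OF in_R])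
    then show "mkhom X U (ext2 X M) (\<lambda>V x. x) V (wedge X M V x y) =
      mkhom X U (ext2 X M) (\<lambda>V x. k V x \<odot>\<^bsub>ext2 X M$V\<^esub> restr (ext2 X M) U V (wedge X M U e f)) V (wedge X M V x y)"
      using M V U x y f(1,2) bilinD(6)[OF wedge_bilin[OF M] U opn_pts[OF U] f(1,2) V] by (simp add: e'_f'_def)
  qed
  have "frame1 U (ext2 X M) (wedge X M U e f) k"
    unfolding frame1_def
  proof (intro conjI ballI w k(1))
    fix V \<omega> assume "V \<in> opens X U" and \<omega>: "\<omega> \<in> sec (ext2 X M) V"
    then show "\<omega> = k V \<omega> \<odot>\<^bsub>ext2 X M$V\<^esub> restr (ext2 X M) U V (wedge X M U e f)"
      using fun_cong[OF fun_cong[OF id, of V], of \<omega>] by simp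
  next
    show "k U (wedge X M U e f) = \<one>\<^bsub>R U\<^esub>"
    proof -
      interpret cring "R U" using cring_R[OF U] .
      show ?thesis using k(2)[OF U order_refl f(1,2)] f(1,2) f(6-9)[OF U order_refl] U M
        by (simp add: a_minus_def)
    qed
  qed
  then show ?thesis using k(2) that by blast
qed

text \<open>The argument for exterior squares again, with the product of the two coordinates in
  place of the determinant.\<close>

lemma tensor_frame:
  assumes M: "mod_pre X M" and N: "mod_pre X N" and fr: "frame1 U M e c" "frame1 U N f d" and U: "opn U"
  obtains k where "frame1 U (tensor X M N) (tens X M N U e f) k"
    "\<And>V x y. \<lbrakk>opn V; V \<subseteq> U; x \<in> sec M V; y \<in> sec N V\<rbrakk> \<Longrightarrow>
      k V (tens X M N V x y) = c V x \<otimes>\<^bsub>R V\<^esub> d V y"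
proof -
  note f = frame1D[OF M fr(1) U] and g = frame1D[OF N fr(2) U] and TS [simp] = tensor_sheaf[OF M N]
  note T = module_sheaf_pre[OF TS]
  note hc = hom_simps[OF f(2), simplified] and hd = hom_simps[OF g(2), simplified]
  have bil: "bilin X U M N OX (\<lambda>V x y. c V x \<otimes>\<^bsub>R V\<^esub> d V y)"
    by (rule bilinI) (simp_all add: hc hd R_distr R_ac)
  obtain k where k: "k \<in> mod_homs X U (tensor X M N) OX"
    "\<And>V x y. \<lbrakk>opn V; V \<subseteq> U; x \<in> sec M V; y \<in> sec N V\<rbrakk> \<Longrightarrow>
      k V (tens X M N V x y) = c V x \<otimes>\<^bsub>R V\<^esub> d V y"
    by (rule tensor_lift[OF M N struct_sheaf bil U], blast)
  have w: "tens X M N U e f \<in> sec (tensor X M N) U" using M N U f(1) g(1) by simp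
  have id: "mkhom X U (tensor X M N) (\<lambda>V x. x) = mkhom X U (tensor X M N) (\<lambda>V x. k V x \<odot>\<^bsub>tensor X M N$V\<^esub> restr (tensor X M N) U V (tens X M N U e f))"
  proof (rule tensor_hom_eqI[OF M N hom_idI[OF T] hom_scaled[OF T T U k(1) w] TS])
    fix V x y assume V: "opn V" "V \<subseteq> U" and x: "x \<in> sec M V" and y: "y \<in> sec N V"
    interpret module "R V" "tensor X M N$V" using pre_module[OF T V(1)] .
    have ef: "restr M U V e \<in> sec M V" "restr N U V f \<in> sec N V" using f(1) g(1) U V M N by simp_all
    have "tens X M N V (c V x \<odot>\<^bsub>M$V\<^esub> restr M U V e) (d V y \<odot>\<^bsub>N$V\<^esub> restr N U V f) =
        (c V x \<otimes>\<^bsub>R V\<^esub> d V y) \<odot>\<^bsub>tensor X M N$V\<^esub> tens X M N V (restr M U V e) (restr N U V f)"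
      using M N V ef hc(1)[OF V x] hd(1)[OF V y] by (simp add: smult_assoc1[symmetric] m_comm)
    then have "tens X M N V x y = k V (tens X M N V x y) \<odot>\<^bsub>tensor X M N$V\<^esub> tens X M N V (restr M U V e) (restr N U V f)"
      using f(3)[OF V x] g(3)[OF V y] k(2)[OF V x y] by simp
    then show "mkhom X U (tensor X M N) (\<lambda>V x. x) V (tens X M N V x y) =
      mkhom X U (tensor X M N) (\<lambda>V x. k V x \<odot>\<^bsub>tensor X M N$V\<^esub> restr (tensor X M N) U V (tens X M N U e f)) V (tens X M N V x y)"
      using M N V U x y bilinD(6)[OF tens_bilin[OF M N] U opn_pts[OF U] f(1) g(1) V] by simp
  qed
  have "frame1 U (tensor X M N) (tens X M N U e f) k"
    unfolding frame1_def
  proof (intro conjI ballI w k(1))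
    fix V \<omega> assume "V \<in> opens X U" and \<omega>: "\<omega> \<in> sec (tensor X M N) V"
    then show "\<omega> = k V \<omega> \<odot>\<^bsub>tensor X M N$V\<^esub> restr (tensor X M N) U V (tens X M N U e f)"
      using fun_cong[OF fun_cong[OF id, of V], of \<omega>] by simp
  next
    show "k U (tens X M N U e f) = \<one>\<^bsub>R U\<^esub>"
      using k(2)[OF U order_refl f(1) g(1)] f(1) g(1) f(4)[OF U order_refl] g(4)[OF U order_refl] U M N by simp
  qed
  then show ?thesis using k(2) that by blast
qed

lemma line_bundle_frame2:
  assumes "line_bundle L" "line_bundle K" "opn U" "x \<in> U"
  obtains V e c f d where "opn V" "x \<in> V" "V \<subseteq> U" "frame1 V L e c" "frame1 V K f d"
proof -
  obtain V e c where V: "opn V" "x \<in> V" "V \<subseteq> U" "frame1 V L e c" by (rule line_bundle_frame[OF assms(1,3,4)])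
  obtain W f d where W: "opn W" "x \<in> W" "W \<subseteq> V" "frame1 W K f d" by (rule line_bundle_frame[OF assms(2) V(1,2)])
  have "W \<subseteq> U" using V W by order
  then show ?thesis
    using that W frame1_restrict[OF module_sheaf_pre[OF line_bundle_sheaf[OF assms(1)]] V(4,1) W(1,3)] by blast
qed

lemma line_bundle_dual: assumes L: "line_bundle L" shows "line_bundle (dual X L)"
proof (rule line_bundleI)
  note L' = module_sheaf_pre[OF line_bundle_sheaf[OF L]]
  show "module_sheaf X (dual X L)" by (rule dual_sheaf[OF L'])
  fix x assume x: "x \<in> pts X"
  obtain U e c where "opn U" "x \<in> U" "frame1 U L e c" by (rule line_bundle_frame[OF L opn_top x])
  then show "\<exists>U e c. opn U \<and> x \<in> U \<and> frame1 U (dual X L) e c" using dual_frame1[OF L'] by blast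
qed

lemma line_bundle_tensor:
  assumes L: "line_bundle L" and K: "line_bundle K" shows "line_bundle (tensor X L K)"
proof (rule line_bundleI)
  note L' = module_sheaf_pre[OF line_bundle_sheaf[OF L]] and K' = module_sheaf_pre[OF line_bundle_sheaf[OF K]]
  show "module_sheaf X (tensor X L K)" by (rule tensor_sheaf[OF L' K'])
  fix x assume x: "x \<in> pts X"
  obtain U e c f d where U: "opn U" "x \<in> U" "frame1 U L e c" "frame1 U K f d"
    by (rule line_bundle_frame2[OF L K opn_top x])
  obtain k where "frame1 U (tensor X L K) (tens X L K U e f) k" by (rule tensor_frame[OF L' K' U(3,4,1)])
  then show "\<exists>U e c. opn U \<and> x \<in> U \<and> frame1 U (tensor X L K) e c" using U by blast
qed

lemma line_bundle_ext2: assumes M: "locally_free X 2 M" shows "line_bundle (ext2 X M)"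
proof (rule line_bundleI)
  have M': "mod_pre X M" using M by (simp add: locally_free_def)
  show "module_sheaf X (ext2 X M)" by (rule ext2_sheaf[OF M'])
  fix x assume x: "x \<in> pts X"
  obtain U e f c d where U: "opn U" "x \<in> U" "frame2 U M e f c d" by (rule locally_free2_frame[OF M opn_top x])
  obtain k where "frame1 U (ext2 X M) (wedge X M U e f) k" by (rule ext2_frame[OF M' U(3,1)])
  then show "\<exists>U e c. opn U \<and> x \<in> U \<and> frame1 U (ext2 X M) e c" using U by blast
qed

lemma locally_free2_dual: assumes M: "locally_free X 2 M" shows "locally_free X 2 (dual X M)"
proof (rule locally_free2I)
  have M': "mod_pre X M" using M by (simp add: locally_free_def)
  show "module_sheaf X (dual X M)" by (rule dual_sheaf[OF M'])
  fix x assume x: "x \<in> pts X"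
  obtain U e f c d where U: "opn U" "x \<in> U" "frame2 U M e f c d" by (rule locally_free2_frame[OF M opn_top x])
  then show "\<exists>U e f c d. opn U \<and> x \<in> U \<and> frame2 U (dual X M) e f c d" using dual_frame2[OF M' U(3,1)] by blast
qed

text \<open>Locally a section is a multiple of the generator \<open>e\<close>, and \<open>L\<close>
  is separated.\<close>

lemma line_hom_eqI:
  assumes h: "h \<in> mod_homs X U T L" and k: "k \<in> mod_homs X U T L" and T: "mod_pre X T" and L: "module_sheaf X L"
    and loc: "\<And>x. x \<in> U \<Longrightarrow> \<exists>V e c. opn V \<and> x \<in> V \<and> V \<subseteq> U \<and> frame1 V T e c \<and> h V e = k V e"
  shows "h = k"
proof (rule hom_eqI[OF h k])
  fix V t assume V: "opn V" "V \<subseteq> U" and t: "t \<in> sec T V"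
  show "h V t = k V t"
  proof (rule sheaf_eqI[OF module_sheaf_sheaf[OF L] V(1)])
    fix x assume x: "x \<in> V"
    then have "x \<in> U" using V(2) by blast
    from loc[OF this] obtain W e c where W: "opn W" "x \<in> W" "W \<subseteq> U" "frame1 W T e c" "h W e = k W e" by blast
    have Z: "opn (V \<inter> W)" "V \<inter> W \<subseteq> V" "V \<inter> W \<subseteq> W" "V \<inter> W \<subseteq> U" "x \<in> V \<inter> W" using V W x by auto
    note f = frame1D[OF T W(4,1)]
    have tZ: "restr T V (V \<inter> W) t \<in> sec T (V \<inter> W)" using T V Z t by simp
    have eZ: "restr T W (V \<inter> W) e \<in> sec T (V \<inter> W)" using T W Z f(1) by simp
    have "h (V \<inter> W) (restr T W (V \<inter> W) e) = k (V \<inter> W) (restr T W (V \<inter> W) e)"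
      using hom_res[OF h W(1,3) f(1) Z(1,3)] hom_res[OF k W(1,3) f(1) Z(1,3)] W(5) by simp
    moreover have "c (V \<inter> W) (restr T V (V \<inter> W) t) \<in> \<O> (V \<inter> W)"
      using hom_closed[OF f(2) Z(1,3) tZ] by simp
    note hom_smult[OF h Z(1,4) eZ this] hom_smult[OF k Z(1,4) eZ this]
    ultimately have "h (V \<inter> W) (restr T V (V \<inter> W) t) = k (V \<inter> W) (restr T V (V \<inter> W) t)"
      unfolding f(3)[OF Z(1,3) tZ] by simp
    then have "restr L V (V \<inter> W) (h V t) = restr L V (V \<inter> W) (k V t)"
      using hom_res[OF h V t Z(1,2)] hom_res[OF k V t Z(1,2)] by simp
    then show "\<exists>W. opn W \<and> x \<in> W \<and> W \<subseteq> V \<and> restr L V W (h V t) = restr L V W (k V t)" using Z by blast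
  qed (rule hom_closed[OF h V t], rule hom_closed[OF k V t])
qed

end

section \<open>Induced morphisms\<close>

context ringed
begin

context
  fixes M :: "('a, 'r, 'm) mod_presheaf" and N :: "('a, 'r, 'n) mod_presheaf"
    and M' :: "('a, 'r, 'm2) mod_presheaf" and N' :: "('a, 'r, 'n2) mod_presheaf"
  assumes M: "mod_pre X M" and N: "mod_pre X N" and M': "mod_pre X M'" and N': "mod_pre X N'"
begin

context
  fixes f g
  assumes f: "f \<in> mod_homs X (pts X) M M'" and g: "g \<in> mod_homs X (pts X) N N'"
begin

text \<open>Pure tensors determine a morphism, so any candidate with the right values on them is the
  one described.\<close>

lemma tensor_map_unique:
  assumes h: "h \<in> mod_homs X (pts X) (tensor X M N) (tensor X M' N')"
    and eq: "\<And>U x y. \<lbrakk>opn U; x \<in> sec M U; y \<in> sec N U\<rbrakk> \<Longrightarrow>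
      h U (tens X M N U x y) = tens X M' N' U (f U x) (g U y)"
  shows "tensor_map X M N M' N' f g = h"
  unfolding tensor_map_def
proof (rule the_equality)
  show "h \<in> mod_homs X (pts X) (tensor X M N) (tensor X M' N') \<and>
     (\<forall>U\<in>opens X (pts X). \<forall>x\<in>sec M U. \<forall>y\<in>sec N U.
       h U (tens X M N U x y) = tens X M' N' U (f U x) (g U y))"
    using h eq by simp
  fix h' assume h': "h' \<in> mod_homs X (pts X) (tensor X M N) (tensor X M' N') \<and>
     (\<forall>U\<in>opens X (pts X). \<forall>x\<in>sec M U. \<forall>y\<in>sec N U.
       h' U (tens X M N U x y) = tens X M' N' U (f U x) (g U y))"
  show "h' = h"
    by (rule tensor_hom_eqI[OF M N conjunct1[OF h'] h tensor_sheaf[OF M' N']])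
      (use conjunct2[OF h'] eq in simp)
qed

lemma tensor_map_exists:
  obtains h where "h \<in> mod_homs X (pts X) (tensor X M N) (tensor X M' N')"
    "\<And>U x y. \<lbrakk>opn U; x \<in> sec M U; y \<in> sec N U\<rbrakk> \<Longrightarrow>
      h U (tens X M N U x y) = tens X M' N' U (f U x) (g U y)"
proof -
  have bil: "bilin X (pts X) M N (tensor X M' N') (\<lambda>V x y. tens X M' N' V (f V x) (g V y))"
    by (rule bilinI) (simp_all add: M' N' hom_simps[OF f] hom_simps[OF g])
  obtain h where h: "h \<in> mod_homs X (pts X) (tensor X M N) (tensor X M' N')"
    "\<And>V x y. \<lbrakk>opn V; V \<subseteq> pts X; x \<in> sec M V; y \<in> sec N V\<rbrakk> \<Longrightarrow> h V (tens X M N V x y) = tens X M' N' V (f V x) (g V y)"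
    by (rule tensor_lift[OF M N tensor_sheaf[OF M' N'] bil opn_top], blast)
  show ?thesis by (rule that[OF h(1)]) (simp add: h(2))
qed

lemma tensor_map_hom: "tensor_map X M N M' N' f g \<in> mod_homs X (pts X) (tensor X M N) (tensor X M' N')"
  by (rule tensor_map_exists) (simp add: tensor_map_unique)

lemma tensor_map_tens:
  assumes "opn U" "x \<in> sec M U" "y \<in> sec N U"
  shows "tensor_map X M N M' N' f g U (tens X M N U x y) = tens X M' N' U (f U x) (g U y)"
  by (rule tensor_map_exists) (use assms in \<open>simp add: tensor_map_unique\<close>)

end

end

context
  fixes M :: "('a, 'r, 'm) mod_presheaf" and N :: "('a, 'r, 'n) mod_presheaf" and f
  assumes M: "mod_pre X M" and N: "mod_pre X N" and f: "f \<in> mod_homs X (pts X) M N"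
begin

lemma ext2_map_unique:
  assumes h: "h \<in> mod_homs X (pts X) (ext2 X M) (ext2 X N)"
    and eq: "\<And>U x y. \<lbrakk>opn U; x \<in> sec M U; y \<in> sec M U\<rbrakk> \<Longrightarrow>
      h U (wedge X M U x y) = wedge X N U (f U x) (f U y)"
  shows "ext2_map X M N f = h"
  unfolding ext2_map_def
proof (rule the_equality)
  show "h \<in> mod_homs X (pts X) (ext2 X M) (ext2 X N) \<and>
     (\<forall>U\<in>opens X (pts X). \<forall>x\<in>sec M U. \<forall>y\<in>sec M U.
       h U (wedge X M U x y) = wedge X N U (f U x) (f U y))"
    using h eq by simp
  fix h' assume h': "h' \<in> mod_homs X (pts X) (ext2 X M) (ext2 X N) \<and>
     (\<forall>U\<in>opens X (pts X). \<forall>x\<in>sec M U. \<forall>y\<in>sec M U.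
       h' U (wedge X M U x y) = wedge X N U (f U x) (f U y))"
  show "h' = h"
    by (rule ext2_hom_eqI[OF M conjunct1[OF h'] h ext2_sheaf[OF N]])
      (use conjunct2[OF h'] eq in simp)
qed

lemma ext2_map_exists:
  obtains h where "h \<in> mod_homs X (pts X) (ext2 X M) (ext2 X N)"
    "\<And>U x y. \<lbrakk>opn U; x \<in> sec M U; y \<in> sec M U\<rbrakk> \<Longrightarrow>
      h U (wedge X M U x y) = wedge X N U (f U x) (f U y)"
proof -
  have bil: "bilin X (pts X) M M (ext2 X N) (\<lambda>V x y. wedge X N V (f V x) (f V y))"
    by (rule bilinI) (simp_all add: N hom_simps[OF f])
  obtain h where h: "h \<in> mod_homs X (pts X) (ext2 X M) (ext2 X N)"
    "\<And>V x y. \<lbrakk>opn V; V \<subseteq> pts X; x \<in> sec M V; y \<in> sec M V\<rbrakk> \<Longrightarrow> h V (wedge X M V x y) = wedge X N V (f V x) (f V y)"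
    by (rule ext2_lift[OF M ext2_sheaf[OF N] bil opn_top]) (simp add: N hom_closed[OF f], blast)
  show ?thesis by (rule that[OF h(1)]) (simp add: h(2))
qed

lemma ext2_map_hom: "ext2_map X M N f \<in> mod_homs X (pts X) (ext2 X M) (ext2 X N)"
  by (rule ext2_map_exists) (simp add: ext2_map_unique)

lemma ext2_map_wedge:
  assumes "opn U" "x \<in> sec M U" "y \<in> sec M U"
  shows "ext2_map X M N f U (wedge X M U x y) = wedge X N U (f U x) (f U y)"
  by (rule ext2_map_exists) (use assms in \<open>simp add: ext2_map_unique\<close>)

lemma dual_map_apply:
  "\<lbrakk>opn U; \<theta> \<in> mod_homs X U N OX; opn V; V \<subseteq> U; x \<in> sec M V\<rbrakk> \<Longrightarrow>
    dual_map X M N f U \<theta> V x = \<theta> V (f V x)"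
  by (simp add: dual_map_def)

lemma dual_map_closed:
  assumes U: "opn U" and \<theta>: "\<theta> \<in> sec (dual X N) U"
  shows "dual_map X M N f U \<theta> \<in> sec (dual X M) U"
proof -
  have "mkhom X U M (\<lambda>V x. \<theta> V (f V x)) \<in> mod_homs X U M OX"
    by (rule mkhomI[OF M]) (simp_all add: hom_simps[OF f] hom_simps[OF \<theta> [unfolded dual_sec], simplified])
  then show ?thesis using U \<theta> by (simp add: dual_map_def mkhom_def)
qed

lemma dual_map_hom: "dual_map X M N f \<in> mod_homs X (pts X) (dual X N) (dual X M)"
proof -
  note DN = module_sheaf_pre[OF dual_sheaf[OF N]] and DM = module_sheaf_pre[OF dual_sheaf[OF M]]
  have "mkhom X (pts X) (dual X N) (dual_map X M N f) \<in> mod_homs X (pts X) (dual X N) (dual X M)"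
  proof (rule mkhomI[OF DN])
    show "dual_map X M N f V \<theta> \<in> sec (dual X M) V" if "opn V" "\<theta> \<in> sec (dual X N) V" for V \<theta>
      using that by (rule dual_map_closed)
    fix V \<theta> assume V: "opn V" and \<theta>: "\<theta> \<in> sec (dual X N) V"
    note c = dual_map_closed[OF V]
    note [simp] = dual_map_apply hom_simps[OF f]
    show "dual_map X M N f V (\<theta> \<oplus>\<^bsub>dual X N$V\<^esub> \<eta>) =
        dual_map X M N f V \<theta> \<oplus>\<^bsub>dual X M$V\<^esub> dual_map X M N f V \<eta>"
      if \<eta>: "\<eta> \<in> sec (dual X N) V" for \<eta>
    proof (rule dual_eqI[OF M])
      show "dual_map X M N f V (\<theta> \<oplus>\<^bsub>dual X N$V\<^esub> \<eta>) \<in> sec (dual X M) V"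
        using c mod_closed(2)[OF DN V \<theta> \<eta>] by blast
      show "dual_map X M N f V \<theta> \<oplus>\<^bsub>dual X M$V\<^esub> dual_map X M N f V \<eta> \<in> sec (dual X M) V"
        by (intro mod_closed(2)[OF DM V] c \<theta> \<eta>)
    qed (use V \<theta> \<eta> mod_closed(2)[OF DN V \<theta> \<eta>] in simp)
    show "dual_map X M N f V (r \<odot>\<^bsub>dual X N$V\<^esub> \<theta>) =
        r \<odot>\<^bsub>dual X M$V\<^esub> dual_map X M N f V \<theta>"
      if r: "r \<in> \<O> V" for r
    proof (rule dual_eqI[OF M])
      show "dual_map X M N f V (r \<odot>\<^bsub>dual X N$V\<^esub> \<theta>) \<in> sec (dual X M) V"
        using c mod_closed(5)[OF DN V r \<theta>] by blast
      show "r \<odot>\<^bsub>dual X M$V\<^esub> dual_map X M N f V \<theta> \<in> sec (dual X M) V"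
        by (intro mod_closed(5)[OF DM V] c \<theta> r)
    qed (use V \<theta> r mod_closed(5)[OF DN V r \<theta>] in simp)
    fix W assume W: "opn W" "W \<subseteq> V"
    show "dual_map X M N f W (restr (dual X N) V W \<theta>) = restr (dual X M) V W (dual_map X M N f V \<theta>)"
    proof (rule dual_eqI[OF M])
      show "dual_map X M N f W (restr (dual X N) V W \<theta>) \<in> sec (dual X M) W"
        using W by (intro dual_map_closed res_closed[OF DN V] \<theta>)
      show "restr (dual X M) V W (dual_map X M N f V \<theta>) \<in> sec (dual X M) W"
        using W by (intro c res_closed[OF DM V] \<theta>)
      fix Z x assume Z: "opn Z" "Z \<subseteq> W" "x \<in> sec M Z"
      moreover from Z W have "Z \<subseteq> V" by order
      ultimately show "dual_map X M N f W (restr (dual X N) V W \<theta>) Z x = restr (dual X M) V W (dual_map X M N f V \<theta>) Z x"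
        using V W \<theta> res_closed[OF DN V W \<theta>] by simp
    qed
  qed
  moreover have "mkhom X (pts X) (dual X N) (dual_map X M N f) = dual_map X M N f"
    by (auto simp: mkhom_def dual_map_def fun_eq_iff)
  ultimately show ?thesis by simp
qed

end

text \<open>The inverses of \<open>f\<close> and \<open>g\<close> induce the inverse, since both
  composites fix pure tensors.\<close>

lemma tensor_map_iso:
  assumes pre: "mod_pre X M" "mod_pre X N" "mod_pre X M'" "mod_pre X N'"
    and f: "f \<in> mod_isos X M M'" and g: "g \<in> mod_isos X N N'"
  shows "tensor_map X M N M' N' f g \<in> mod_isos X (tensor X M N) (tensor X M' N')"
proof -
  note fh = iso_hom[OF f] iso_hom[OF g] mod_inv_hom[OF f pre(1,3)] mod_inv_hom[OF g pre(2,4)]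
  note T = tensor_sheaf[OF pre(1,2)] tensor_sheaf[OF pre(3,4)]
  let ?h = "tensor_map X M N M' N' f g" and ?k = "tensor_map X M' N' M N (mod_inv X M M' f) (mod_inv X N N' g)"
  note hh = tensor_map_hom[OF pre fh(1,2)] and kh = tensor_map_hom[OF pre(3,4,1,2) fh(3,4)]
  note ht = tensor_map_tens[OF pre fh(1,2)] and kt = tensor_map_tens[OF pre(3,4,1,2) fh(3,4)]
  note [simp] = hom_closed[OF fh(1)] hom_closed[OF fh(2)] hom_closed[OF fh(3)] hom_closed[OF fh(4)]
    mod_inv_left[OF f] mod_inv_left[OF g] mod_inv_right[OF f] mod_inv_right[OF g] ht kt pre T
  have "mod_comp X (tensor X M N) ?k ?h = mod_id X (tensor X M N)"
    by (rule tensor_hom_eqI[OF pre(1,2) mod_comp_hom[OF _ hh kh] mod_id_hom T(1)]) simp_all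
  moreover have "mod_comp X (tensor X M' N') ?h ?k = mod_id X (tensor X M' N')"
    by (rule tensor_hom_eqI[OF pre(3,4) mod_comp_hom[OF _ kh hh] mod_id_hom T(2)]) simp_all
  ultimately show ?thesis
    by (intro isoI_inverse[OF hh kh]) (metis mod_comp_apply mod_id_apply)+
qed

lemma ext2_map_iso:
  assumes pre: "mod_pre X M" "mod_pre X N" and f: "f \<in> mod_isos X M N"
  shows "ext2_map X M N f \<in> mod_isos X (ext2 X M) (ext2 X N)"
proof -
  note fh = iso_hom[OF f] mod_inv_hom[OF f pre]
  note T = ext2_sheaf[OF pre(1)] ext2_sheaf[OF pre(2)]
  let ?h = "ext2_map X M N f" and ?k = "ext2_map X N M (mod_inv X M N f)"
  note hh = ext2_map_hom[OF pre fh(1)] and kh = ext2_map_hom[OF pre(2,1) fh(2)]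
  note ht = ext2_map_wedge[OF pre fh(1)] and kt = ext2_map_wedge[OF pre(2,1) fh(2)]
  note [simp] = hom_closed[OF fh(1)] hom_closed[OF fh(2)]
    mod_inv_left[OF f] mod_inv_right[OF f] ht kt pre T
  have "mod_comp X (ext2 X M) ?k ?h = mod_id X (ext2 X M)"
    by (rule ext2_hom_eqI[OF pre(1) mod_comp_hom[OF _ hh kh] mod_id_hom T(1)]) simp_all
  moreover have "mod_comp X (ext2 X N) ?h ?k = mod_id X (ext2 X N)"
    by (rule ext2_hom_eqI[OF pre(2) mod_comp_hom[OF _ kh hh] mod_id_hom T(2)]) simp_all
  ultimately show ?thesis
    by (intro isoI_inverse[OF hh kh]) (metis mod_comp_apply mod_id_apply)+
qed

lemma dual_map_iso:
  assumes pre: "mod_pre X M" "mod_pre X N" and f: "f \<in> mod_isos X M N"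
  shows "dual_map X M N f \<in> mod_isos X (dual X N) (dual X M)"
proof -
  note fh = iso_hom[OF f] mod_inv_hom[OF f pre]
  note [simp] = hom_closed[OF fh(1)] hom_closed[OF fh(2)]
    mod_inv_left[OF f] mod_inv_right[OF f]
    dual_map_apply[OF pre fh(1)] dual_map_apply[OF pre(2,1) fh(2)]
    dual_map_closed[OF pre fh(1), unfolded dual_sec] dual_map_closed[OF pre(2,1) fh(2), unfolded dual_sec]
  show ?thesis
  proof (rule isoI_inverse[OF dual_map_hom[OF pre fh(1)] dual_map_hom[OF pre(2,1) fh(2)]])
    fix V \<theta> assume V: "opn V" and \<theta>: "\<theta> \<in> sec (dual X N) V"
    show "dual_map X N M (mod_inv X M N f) V (dual_map X M N f V \<theta>) = \<theta>"
      by (rule dual_eqI[OF pre(2) _ \<theta>]) (use V \<theta> in simp_all)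
  next
    fix V \<theta> assume V: "opn V" and \<theta>: "\<theta> \<in> sec (dual X M) V"
    show "dual_map X M N f V (dual_map X N M (mod_inv X M N f) V \<theta>) = \<theta>"
      by (rule dual_eqI[OF pre(1) _ \<theta>]) (use V \<theta> in simp_all)
  qed
qed

section \<open>Biduality\<close>

lemma eval_bidual_eq:
  "opn U \<Longrightarrow> x \<in> sec M U \<Longrightarrow> eval_bidual X M U x = ev U M x"
  by (simp add: eval_bidual_def ev_def mkhom_def)

lemma eval_bidual_hom:
  assumes M: "mod_pre X M"
  shows "eval_bidual X M \<in> mod_homs X (pts X) M (dual X (dual X M))"
proof -
  note D = dual_sheaf[OF M] and D' = module_sheaf_pre[OF dual_sheaf[OF M]]
    and DD = module_sheaf_pre[OF dual_sheaf[OF module_sheaf_pre[OF dual_sheaf[OF M]]]]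
  have evc: "ev U M x \<in> sec (dual X (dual X M)) U" if "opn U" "x \<in> sec M U" for U x
    unfolding dual_sec by (rule ev_hom[OF M that])
  have "mkhom X (pts X) M (\<lambda>U x. ev U M x) \<in> mod_homs X (pts X) M (dual X (dual X M))"
  proof (rule mkhomI[OF M])
    fix V x assume V: "opn V" and x: "x \<in> sec M V"
    show "ev V M x \<in> sec (dual X (dual X M)) V" using V x by (rule evc)
    { fix y assume y: "y \<in> sec M V"
      show "ev V M (x \<oplus>\<^bsub>M$V\<^esub> y) = ev V M x \<oplus>\<^bsub>dual X (dual X M)$V\<^esub> ev V M y"
      proof (rule dual_eqI[OF D'])
        show "ev V M (x \<oplus>\<^bsub>M$V\<^esub> y) \<in> sec (dual X (dual X M)) V"
          using V x y M by (intro evc) simp_all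
        show "ev V M x \<oplus>\<^bsub>dual X (dual X M)$V\<^esub> ev V M y \<in> sec (dual X (dual X M)) V"
          using V x y by (intro mod_closed(2)[OF DD V] evc)
        fix W \<theta> assume W: "opn W" "W \<subseteq> V" "\<theta> \<in> sec (dual X M) W"
        then show "ev V M (x \<oplus>\<^bsub>M$V\<^esub> y) W \<theta> = (ev V M x \<oplus>\<^bsub>dual X (dual X M)$V\<^esub> ev V M y) W \<theta>"
          using V x y M by (simp add: hom_add[OF W(3)[unfolded dual_sec]])
      qed }
    { fix r assume r: "r \<in> \<O> V"
      show "ev V M (r \<odot>\<^bsub>M$V\<^esub> x) = r \<odot>\<^bsub>dual X (dual X M)$V\<^esub> ev V M x"
      proof (rule dual_eqI[OF D'])
        show "ev V M (r \<odot>\<^bsub>M$V\<^esub> x) \<in> sec (dual X (dual X M)) V"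
          using V x r M by (intro evc) simp_all
        show "r \<odot>\<^bsub>dual X (dual X M)$V\<^esub> ev V M x \<in> sec (dual X (dual X M)) V"
          using V x r by (intro mod_closed(5)[OF DD V] evc)
        fix W \<theta> assume W: "opn W" "W \<subseteq> V" "\<theta> \<in> sec (dual X M) W"
        then show "ev V M (r \<odot>\<^bsub>M$V\<^esub> x) W \<theta> = (r \<odot>\<^bsub>dual X (dual X M)$V\<^esub> ev V M x) W \<theta>"
          using V x r M by (simp add: hom_smult[OF W(3)[unfolded dual_sec]])
      qed }
    fix W assume W: "opn W" "W \<subseteq> V"
    show "ev W M (restr M V W x) = restr (dual X (dual X M)) V W (ev V M x)"
    proof (rule dual_eqI[OF D'])
      show "ev W M (restr M V W x) \<in> sec (dual X (dual X M)) W"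
        using V x W M by (intro evc) simp_all
      show "restr (dual X (dual X M)) V W (ev V M x) \<in> sec (dual X (dual X M)) W"
        using V x W by (intro res_closed[OF DD V] evc)
      fix Z \<theta> assume Z: "opn Z" "Z \<subseteq> W" "\<theta> \<in> sec (dual X M) Z"
      moreover from Z W have "Z \<subseteq> V" by order
      ultimately show "ev W M (restr M V W x) Z \<theta> = restr (dual X (dual X M)) V W (ev V M x) Z \<theta>"
        using V x W M by simp
    qed
  qed
  moreover have "mkhom X (pts X) M (\<lambda>U x. ev U M x) = eval_bidual X M"
    by (auto simp: mkhom_def eval_bidual_def ev_def fun_eq_iff)
  ultimately show ?thesis by simp
qed

text \<open>Passing twice to the dual frame turns a generator into evaluation at it, which is its
  image under the map to the bidual.\<close>

lemma eval_bidual_iso: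
  assumes L: "line_bundle L"
  shows "eval_bidual X L \<in> mod_isos X L (dual X (dual X L))"
proof (rule line_bundle_isoI)
  note LS = line_bundle_sheaf[OF L]
  note L' = module_sheaf_pre[OF LS]
  note D' = module_sheaf_pre[OF dual_sheaf[OF L']]
  show "eval_bidual X L \<in> mod_homs X (pts X) L (dual X (dual X L))" by (rule eval_bidual_hom[OF L'])
  show "module_sheaf X L" by (rule LS)
  show "module_sheaf X (dual X (dual X L))" by (rule dual_sheaf[OF D'])
  fix x assume x: "x \<in> pts X"
  obtain U e c where U: "opn U" "x \<in> U" "frame1 U L e c" by (rule line_bundle_frame[OF L opn_top x])
  have "frame1 U (dual X (dual X L)) (eval_bidual X L U e) (ev U (dual X L) c)"
    using dual_frame1[OF D' dual_frame1[OF L' U(3,1)] U(1)] frame1D(1)[OF L' U(3,1)] U(1) by (simp add: eval_bidual_eq)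
  then show "\<exists>U e c d. opn U \<and> x \<in> U \<and> frame1 U L e c \<and> frame1 U (dual X (dual X L)) (eval_bidual X L U e) d"
    using U by blast
qed

section \<open>Canonical pairings of tensor products\<close>

context
  fixes M :: "('a, 'r, 'm) mod_presheaf" and N :: "('a, 'r, 'n) mod_presheaf"
  assumes M: "mod_pre X M" and N: "mod_pre X N"
begin

text \<open>Common source of the two canonical maps from a tensor product to the dual of a tensor
  product. For fixed \<open>a\<close> and \<open>b\<close> the form induces a functional by
  \<open>in1\<close>. By \<open>in2\<close> and \<open>in3\<close> this functional depends
  bilinearly on \<open>a\<close> and \<open>b\<close>, compatibly with restriction, and hence
  induces the morphism. The uniqueness clause serves to evaluate definite descriptions.\<close>

lemma pairing_exists:
  fixes \<beta> :: "'a set \<Rightarrow> 'a set \<Rightarrow> 'p \<Rightarrow> 'q \<Rightarrow> 'm \<Rightarrow> 'n \<Rightarrow> 'r"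
    and A :: "('a, 'r, 'p) mod_presheaf" and B :: "('a, 'r, 'q) mod_presheaf"
  assumes A: "mod_pre X A" and B: "mod_pre X B"
    and in1: "\<And>U a b. \<lbrakk>opn U; a \<in> sec A U; b \<in> sec B U\<rbrakk> \<Longrightarrow> bilin X U M N OX (\<lambda>V. \<beta> U V a b)"
    and in2: "\<And>U V x y. \<lbrakk>opn U; opn V; V \<subseteq> U; x \<in> sec M V; y \<in> sec N V\<rbrakk> \<Longrightarrow>
      (\<forall>a\<in>sec A U. \<forall>b\<in>sec B U.
        (\<forall>a'\<in>sec A U. \<beta> U V (a \<oplus>\<^bsub>A$U\<^esub> a') b x y = \<beta> U V a b x y \<oplus>\<^bsub>R V\<^esub> \<beta> U V a' b x y) \<and>
        (\<forall>b'\<in>sec B U. \<beta> U V a (b \<oplus>\<^bsub>B$U\<^esub> b') x y = \<beta> U V a b x y \<oplus>\<^bsub>R V\<^esub> \<beta> U V a b' x y) \<and>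
        (\<forall>r\<in>\<O> U. \<beta> U V (r \<odot>\<^bsub>A$U\<^esub> a) b x y = rr U V r \<otimes>\<^bsub>R V\<^esub> \<beta> U V a b x y \<and>
          \<beta> U V a (r \<odot>\<^bsub>B$U\<^esub> b) x y = rr U V r \<otimes>\<^bsub>R V\<^esub> \<beta> U V a b x y))"
    and in3: "\<And>U V W a b x y. \<lbrakk>opn U; opn V; V \<subseteq> U; opn W; W \<subseteq> V; a \<in> sec A U; b \<in> sec B U;
      x \<in> sec M W; y \<in> sec N W\<rbrakk> \<Longrightarrow> \<beta> V W (restr A U V a) (restr B U V b) x y = \<beta> U W a b x y"
  obtains h where "h \<in> mod_homs X (pts X) (tensor X A B) (dual X (tensor X M N))"
    "\<And>U V a b x y. \<lbrakk>opn U; opn V; V \<subseteq> U; a \<in> sec A U; b \<in> sec B U; x \<in> sec M V; y \<in> sec N V\<rbrakk> \<Longrightarrow>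
      h U (tens X A B U a b) V (tens X M N V x y) = \<beta> U V a b x y"
    "\<And>h'. h' \<in> mod_homs X (pts X) (tensor X A B) (dual X (tensor X M N)) \<Longrightarrow>
      (\<And>U V a b x y. opn U \<Longrightarrow> opn V \<Longrightarrow> V \<subseteq> U \<Longrightarrow> a \<in> sec A U \<Longrightarrow> b \<in> sec B U \<Longrightarrow> x \<in> sec M V \<Longrightarrow> y \<in> sec N V \<Longrightarrow>
      h' U (tens X A B U a b) V (tens X M N V x y) = \<beta> U V a b x y) \<Longrightarrow> h' = h"
proof -
  note T = tensor_sheaf[OF M N] and T' = module_sheaf_pre[OF tensor_sheaf[OF M N]]
  note D = dual_sheaf[OF T'] and D' = module_sheaf_pre[OF dual_sheaf[OF T']]
  define \<phi> where "\<phi> U a b = (SOME k. k \<in> sec (dual X (tensor X M N)) U \<and>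
    (\<forall>V x y. opn V \<longrightarrow> V \<subseteq> U \<longrightarrow> x \<in> sec M V \<longrightarrow> y \<in> sec N V \<longrightarrow> k V (tens X M N V x y) = \<beta> U V a b x y))" for U a b
  have \<phi>: "\<phi> U a b \<in> sec (dual X (tensor X M N)) U \<and>
    (\<forall>V x y. opn V \<longrightarrow> V \<subseteq> U \<longrightarrow> x \<in> sec M V \<longrightarrow> y \<in> sec N V \<longrightarrow> \<phi> U a b V (tens X M N V x y) = \<beta> U V a b x y)"
    if U: "opn U" and a: "a \<in> sec A U" "b \<in> sec B U" for U a b
  proof -
    obtain k where "k \<in> mod_homs X U (tensor X M N) OX"
      "\<And>V x y. \<lbrakk>opn V; V \<subseteq> U; x \<in> sec M V; y \<in> sec N V\<rbrakk> \<Longrightarrow> k V (tens X M N V x y) = \<beta> U V a b x y"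
      by (rule tensor_lift[OF M N struct_sheaf in1[OF U a] U], blast)
    then have "\<exists>k. k \<in> sec (dual X (tensor X M N)) U \<and>
      (\<forall>V x y. opn V \<longrightarrow> V \<subseteq> U \<longrightarrow> x \<in> sec M V \<longrightarrow> y \<in> sec N V \<longrightarrow> k V (tens X M N V x y) = \<beta> U V a b x y)"
      by (intro exI[of _ k]) simp
    then show ?thesis unfolding \<phi>_def by (rule someI_ex)
  qed
  have \<phi>1: "\<phi> U a b \<in> sec (dual X (tensor X M N)) U" if "opn U" "a \<in> sec A U" "b \<in> sec B U" for U a b
    using \<phi> [OF that] by simp
  have \<phi>2: "\<phi> U a b V (tens X M N V x y) = \<beta> U V a b x y"
    if "opn U" "a \<in> sec A U" "b \<in> sec B U" "opn V" "V \<subseteq> U" "x \<in> sec M V" "y \<in> sec N V" for U a b V x y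
    using \<phi> [OF that(1-3)] that(4-) by simp
  \<comment> \<open>Functionals on the tensor product are compared on pure tensors, where they are
    given by \<open>\<beta>\<close>; all laws for \<open>\<phi>\<close> follow from those of
    \<open>\<beta>\<close>.\<close>
  have eqI: "k = k'" if "k \<in> sec (dual X (tensor X M N)) U" "k' \<in> sec (dual X (tensor X M N)) U"
    "\<And>V x y. \<lbrakk>opn V; V \<subseteq> U; x \<in> sec M V; y \<in> sec N V\<rbrakk> \<Longrightarrow> k V (tens X M N V x y) = k' V (tens X M N V x y)" for U k k'
    using that unfolding dual_sec by (intro tensor_hom_eqI[OF M N _ _ struct_sheaf, of k U k'])
  have bil: "bilin X (pts X) A B (dual X (tensor X M N)) \<phi>"
  proof (rule bilinI)
    fix U a b assume U: "opn U" and a: "a \<in> sec A U" and b: "b \<in> sec B U"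
    note cl = mod_closed[OF D' U]
    show "\<phi> U a b \<in> sec (dual X (tensor X M N)) U" using U a b by (rule \<phi>1)
    have tin: "tens X M N V x y \<in> sec (tensor X M N) V" if "opn V" "x \<in> sec M V" "y \<in> sec N V" for V x y
      using that M N by simp
    { fix a' assume a': "a' \<in> sec A U"
      show "\<phi> U (a \<oplus>\<^bsub>A$U\<^esub> a') b = \<phi> U a b \<oplus>\<^bsub>dual X (tensor X M N)$U\<^esub> \<phi> U a' b"
        by (rule eqI[of _ U]) (use U a b a' A B in2 in \<open>simp_all add: \<phi>1 cl \<phi>2 tin del: dual_sec\<close>) }
    { fix b' assume b': "b' \<in> sec B U"
      show "\<phi> U a (b \<oplus>\<^bsub>B$U\<^esub> b') = \<phi> U a b \<oplus>\<^bsub>dual X (tensor X M N)$U\<^esub> \<phi> U a b'"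
        by (rule eqI[of _ U]) (use U a b b' A B in2 in \<open>simp_all add: \<phi>1 cl \<phi>2 tin del: dual_sec\<close>) }
    { fix r assume r: "r \<in> \<O> U"
      show "\<phi> U (r \<odot>\<^bsub>A$U\<^esub> a) b = r \<odot>\<^bsub>dual X (tensor X M N)$U\<^esub> \<phi> U a b"
        by (rule eqI[of _ U]) (use U a b r A B in2 in \<open>simp_all add: \<phi>1 cl \<phi>2 tin del: dual_sec\<close>)
      show "\<phi> U a (r \<odot>\<^bsub>B$U\<^esub> b) = r \<odot>\<^bsub>dual X (tensor X M N)$U\<^esub> \<phi> U a b"
        by (rule eqI[of _ U]) (use U a b r A B in2 in \<open>simp_all add: \<phi>1 cl \<phi>2 tin del: dual_sec\<close>) }
    fix V assume V: "opn V" "V \<subseteq> U"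
    show "\<phi> V (restr A U V a) (restr B U V b) = restr (dual X (tensor X M N)) U V (\<phi> U a b)"
    proof (rule eqI)
      show "\<phi> V (restr A U V a) (restr B U V b) \<in> sec (dual X (tensor X M N)) V" using U V a b A B by (intro \<phi>1) simp_all
      show "restr (dual X (tensor X M N)) U V (\<phi> U a b) \<in> sec (dual X (tensor X M N)) V"
        by (intro res_closed[OF D' U V] \<phi>1 U a b)
      fix W x y assume W: "opn W" "W \<subseteq> V" and x: "x \<in> sec M W" and y: "y \<in> sec N W"
      moreover from W V have "W \<subseteq> U" by order
      ultimately show "\<phi> V (restr A U V a) (restr B U V b) W (tens X M N W x y) =
          restr (dual X (tensor X M N)) U V (\<phi> U a b) W (tens X M N W x y)"
        using U V a b A B in3[OF U V W a b x y] by (simp add: \<phi>2)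
    qed
  qed
  obtain h where h: "h \<in> mod_homs X (pts X) (tensor X A B) (dual X (tensor X M N))"
    "\<And>V a b. \<lbrakk>opn V; V \<subseteq> pts X; a \<in> sec A V; b \<in> sec B V\<rbrakk> \<Longrightarrow> h V (tens X A B V a b) = \<phi> V a b"
    by (rule tensor_lift[OF A B D bil opn_top], blast)
  show ?thesis
  proof (rule that[OF h(1)])
    show "h U (tens X A B U a b) V (tens X M N V x y) = \<beta> U V a b x y"
      if "opn U" "opn V" "V \<subseteq> U" "a \<in> sec A U" "b \<in> sec B U" "x \<in> sec M V" "y \<in> sec N V" for U V a b x y
      using that by (simp add: h(2) \<phi>2)
    fix h' assume h': "h' \<in> mod_homs X (pts X) (tensor X A B) (dual X (tensor X M N))"
      and eq: "\<And>U V a b x y. \<lbrakk>opn U; opn V; V \<subseteq> U; a \<in> sec A U; b \<in> sec B U; x \<in> sec M V; y \<in> sec N V\<rbrakk> \<Longrightarrow>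
        h' U (tens X A B U a b) V (tens X M N V x y) = \<beta> U V a b x y"
    show "h' = h"
    proof (rule tensor_hom_eqI[OF A B h' h(1) D])
      fix U a b assume U: "opn U" and a: "a \<in> sec A U" and b: "b \<in> sec B U"
      have t: "tens X A B U a b \<in> sec (tensor X A B) U" using U a b A B by simp
      show "h' U (tens X A B U a b) = h U (tens X A B U a b)"
        by (rule eqI[OF hom_closed[OF h' U opn_pts[OF U] t] hom_closed[OF h(1) U opn_pts[OF U] t]])
          (use U a b in \<open>simp add: h(2) \<phi>2 eq\<close>)
    qed
  qed
qed

end

context
  fixes M :: "('a, 'r, 'm) mod_presheaf" and N :: "('a, 'r, 'n) mod_presheaf"
  assumes M: "mod_pre X M" and N: "mod_pre X N"
begin

lemma tensor_of_duals_facts: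
  shows tensor_of_duals_hom: "tensor_of_duals X M N \<in> mod_homs X (pts X) (tensor X (dual X M) (dual X N)) (dual X (tensor X M N))"
    and tensor_of_duals_tens: "\<And>U V \<theta> \<eta> x y. \<lbrakk>opn U; opn V; V \<subseteq> U; \<theta> \<in> sec (dual X M) U; \<eta> \<in> sec (dual X N) U;
      x \<in> sec M V; y \<in> sec N V\<rbrakk> \<Longrightarrow>
      tensor_of_duals X M N U (tens X (dual X M) (dual X N) U \<theta> \<eta>) V (tens X M N V x y) = \<theta> V x \<otimes>\<^bsub>R V\<^esub> \<eta> V y"
proof -
  note DM = module_sheaf_pre[OF dual_sheaf[OF M]] and DN = module_sheaf_pre[OF dual_sheaf[OF N]]
  obtain h where h: "h \<in> mod_homs X (pts X) (tensor X (dual X M) (dual X N)) (dual X (tensor X M N))"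
    "\<And>U V a b x y. \<lbrakk>opn U; opn V; V \<subseteq> U; a \<in> sec (dual X M) U; b \<in> sec (dual X N) U; x \<in> sec M V; y \<in> sec N V\<rbrakk> \<Longrightarrow>
      h U (tens X (dual X M) (dual X N) U a b) V (tens X M N V x y) = a V x \<otimes>\<^bsub>R V\<^esub> b V y"
    and uniq: "\<And>h'. h' \<in> mod_homs X (pts X) (tensor X (dual X M) (dual X N)) (dual X (tensor X M N)) \<Longrightarrow>
      (\<And>U V a b x y. opn U \<Longrightarrow> opn V \<Longrightarrow> V \<subseteq> U \<Longrightarrow> a \<in> sec (dual X M) U \<Longrightarrow> b \<in> sec (dual X N) U \<Longrightarrow> x \<in> sec M V \<Longrightarrow> y \<in> sec N V \<Longrightarrow>
      h' U (tens X (dual X M) (dual X N) U a b) V (tens X M N V x y) = a V x \<otimes>\<^bsub>R V\<^esub> b V y) \<Longrightarrow> h' = h"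
  proof (rule pairing_exists[OF M N DM DN, where \<beta> = "\<lambda>U V a b x y. a V x \<otimes>\<^bsub>R V\<^esub> b V y"])
    fix U a b assume U: "opn U" and a: "a \<in> sec (dual X M) U" and b: "b \<in> sec (dual X N) U"
    show "bilin X U M N OX (\<lambda>V x y. a V x \<otimes>\<^bsub>R V\<^esub> b V y)"
      by (rule bilinI)
        (simp_all add: hom_simps[OF a[unfolded dual_sec], simplified] hom_simps[OF b[unfolded dual_sec], simplified] R_distr R_ac)
  next
    fix U V x y assume U: "opn U" "opn V" "V \<subseteq> U" and x: "x \<in> sec M V" "y \<in> sec N V"
    have v: "a V x \<in> \<O> V" if "a \<in> mod_homs X U M OX" for a using dual_closed[OF U(1) that U(2,3) x(1)] .
    have w: "a V y \<in> \<O> V" if "a \<in> mod_homs X U N OX" for a using dual_closed[OF U(1) that U(2,3) x(2)] .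
    show "\<forall>a\<in>sec (dual X M) U. \<forall>b\<in>sec (dual X N) U.
        (\<forall>a'\<in>sec (dual X M) U. (a \<oplus>\<^bsub>dual X M$U\<^esub> a') V x \<otimes>\<^bsub>R V\<^esub> b V y =
          a V x \<otimes>\<^bsub>R V\<^esub> b V y \<oplus>\<^bsub>R V\<^esub> a' V x \<otimes>\<^bsub>R V\<^esub> b V y) \<and>
        (\<forall>b'\<in>sec (dual X N) U. a V x \<otimes>\<^bsub>R V\<^esub> (b \<oplus>\<^bsub>dual X N$U\<^esub> b') V y =
          a V x \<otimes>\<^bsub>R V\<^esub> b V y \<oplus>\<^bsub>R V\<^esub> a V x \<otimes>\<^bsub>R V\<^esub> b' V y) \<and>
        (\<forall>r\<in>\<O> U. (r \<odot>\<^bsub>dual X M$U\<^esub> a) V x \<otimes>\<^bsub>R V\<^esub> b V y =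
          rr U V r \<otimes>\<^bsub>R V\<^esub> (a V x \<otimes>\<^bsub>R V\<^esub> b V y) \<and>
          a V x \<otimes>\<^bsub>R V\<^esub> (r \<odot>\<^bsub>dual X N$U\<^esub> b) V y = rr U V r \<otimes>\<^bsub>R V\<^esub> (a V x \<otimes>\<^bsub>R V\<^esub> b V y))"
      using U x by (simp add: v w R_distr R_ac)
  next
    fix U V W a b x y assume "opn W" "W \<subseteq> V"
    then show "restr (dual X M) U V a W x \<otimes>\<^bsub>R W\<^esub> restr (dual X N) U V b W y = a W x \<otimes>\<^bsub>R W\<^esub> b W y" by simp
  qed blast
  have "tensor_of_duals X M N = h"
    unfolding tensor_of_duals_def by (rule the_equality, intro conjI h(1) ballI h(2), simp_all only: opens_iff, erule conjE, rule uniq, assumption, simp)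
  then show "tensor_of_duals X M N \<in> mod_homs X (pts X) (tensor X (dual X M) (dual X N)) (dual X (tensor X M N))"
    "\<And>U V \<theta> \<eta> x y. \<lbrakk>opn U; opn V; V \<subseteq> U; \<theta> \<in> sec (dual X M) U; \<eta> \<in> sec (dual X N) U;
      x \<in> sec M V; y \<in> sec N V\<rbrakk> \<Longrightarrow>
      tensor_of_duals X M N U (tens X (dual X M) (dual X N) U \<theta> \<eta>) V (tens X M N V x y) = \<theta> V x \<otimes>\<^bsub>R V\<^esub> \<eta> V y"
    using h by simp_all
qed

lemma tensor_to_dual_facts:
  shows tensor_to_dual_hom: "tensor_to_dual X M N \<in> mod_homs X (pts X) (tensor X M N) (dual X (tensor X (dual X M) (dual X N)))"
    and tensor_to_dual_tens: "\<And>U V \<theta> \<eta> x y. \<lbrakk>opn U; opn V; V \<subseteq> U; x \<in> sec M U; y \<in> sec N U;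
      \<theta> \<in> sec (dual X M) V; \<eta> \<in> sec (dual X N) V\<rbrakk> \<Longrightarrow>
      tensor_to_dual X M N U (tens X M N U x y) V (tens X (dual X M) (dual X N) V \<theta> \<eta>) =
        \<theta> V (restr M U V x) \<otimes>\<^bsub>R V\<^esub> \<eta> V (restr N U V y)"
proof -
  note DM = module_sheaf_pre[OF dual_sheaf[OF M]] and DN = module_sheaf_pre[OF dual_sheaf[OF N]]
  obtain h where h: "h \<in> mod_homs X (pts X) (tensor X M N) (dual X (tensor X (dual X M) (dual X N)))"
    "\<And>U V a b x y. \<lbrakk>opn U; opn V; V \<subseteq> U; a \<in> sec M U; b \<in> sec N U; x \<in> sec (dual X M) V; y \<in> sec (dual X N) V\<rbrakk> \<Longrightarrow>
      h U (tens X M N U a b) V (tens X (dual X M) (dual X N) V x y) = x V (restr M U V a) \<otimes>\<^bsub>R V\<^esub> y V (restr N U V b)"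
    and uniq: "\<And>h'. h' \<in> mod_homs X (pts X) (tensor X M N) (dual X (tensor X (dual X M) (dual X N))) \<Longrightarrow>
      (\<And>U V a b x y. opn U \<Longrightarrow> opn V \<Longrightarrow> V \<subseteq> U \<Longrightarrow> a \<in> sec M U \<Longrightarrow> b \<in> sec N U \<Longrightarrow> x \<in> sec (dual X M) V \<Longrightarrow> y \<in> sec (dual X N) V \<Longrightarrow>
      h' U (tens X M N U a b) V (tens X (dual X M) (dual X N) V x y) = x V (restr M U V a) \<otimes>\<^bsub>R V\<^esub> y V (restr N U V b)) \<Longrightarrow> h' = h"
  proof (rule pairing_exists[OF DM DN M N, where \<beta> = "\<lambda>U V a b x y. x V (restr M U V a) \<otimes>\<^bsub>R V\<^esub> y V (restr N U V b)"])
    fix U a b assume U: "opn U" and a: "a \<in> sec M U" and b: "b \<in> sec N U"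
    note e = hom_simps[OF ev_hom[OF M U a], simplified] hom_simps[OF ev_hom[OF N U b], simplified]
    show "bilin X U (dual X M) (dual X N) OX (\<lambda>V x y. x V (restr M U V a) \<otimes>\<^bsub>R V\<^esub> y V (restr N U V b))"
    proof (rule bilinI)
      fix V x y W assume V: "opn V" "V \<subseteq> U" "opn W" "W \<subseteq> V" and x: "x \<in> sec (dual X M) V" and y: "y \<in> sec (dual X N) V"
      show "restr (dual X M) V W x W (restr M U W a) \<otimes>\<^bsub>R W\<^esub> restr (dual X N) V W y W (restr N U W b) =
          restr OX V W (x V (restr M U V a) \<otimes>\<^bsub>R V\<^esub> y V (restr N U V b))"
        using U V a b x y M N hom_res[OF x[unfolded dual_sec] V(1) order_refl _ V(3,4), of "restr M U V a"]
          hom_res[OF y[unfolded dual_sec] V(1) order_refl _ V(3,4), of "restr N U V b"] by simp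
    qed (use U a b M N in \<open>simp_all add: R_distr R_ac\<close>)
  next
    fix U V x y assume U: "opn U" "opn V" "V \<subseteq> U" and x: "x \<in> sec (dual X M) V" and y: "y \<in> sec (dual X N) V"
    note hx = hom_simps[OF x[unfolded dual_sec] U(2) order_refl, simplified]
      hom_simps[OF y[unfolded dual_sec] U(2) order_refl, simplified]
    show "\<forall>a\<in>sec M U. \<forall>b\<in>sec N U.
        (\<forall>a'\<in>sec M U. x V (restr M U V (a \<oplus>\<^bsub>M$U\<^esub> a')) \<otimes>\<^bsub>R V\<^esub> y V (restr N U V b) =
          x V (restr M U V a) \<otimes>\<^bsub>R V\<^esub> y V (restr N U V b) \<oplus>\<^bsub>R V\<^esub> x V (restr M U V a') \<otimes>\<^bsub>R V\<^esub> y V (restr N U V b)) \<and>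
        (\<forall>b'\<in>sec N U. x V (restr M U V a) \<otimes>\<^bsub>R V\<^esub> y V (restr N U V (b \<oplus>\<^bsub>N$U\<^esub> b')) =
          x V (restr M U V a) \<otimes>\<^bsub>R V\<^esub> y V (restr N U V b) \<oplus>\<^bsub>R V\<^esub> x V (restr M U V a) \<otimes>\<^bsub>R V\<^esub> y V (restr N U V b')) \<and>
        (\<forall>r\<in>\<O> U. x V (restr M U V (r \<odot>\<^bsub>M$U\<^esub> a)) \<otimes>\<^bsub>R V\<^esub> y V (restr N U V b) =
          rr U V r \<otimes>\<^bsub>R V\<^esub> (x V (restr M U V a) \<otimes>\<^bsub>R V\<^esub> y V (restr N U V b)) \<and>
          x V (restr M U V a) \<otimes>\<^bsub>R V\<^esub> y V (restr N U V (r \<odot>\<^bsub>N$U\<^esub> b)) =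
          rr U V r \<otimes>\<^bsub>R V\<^esub> (x V (restr M U V a) \<otimes>\<^bsub>R V\<^esub> y V (restr N U V b)))"
      using U M N by (simp add: hx R_distr R_ac)
  next
    fix U V W a b x y assume "opn U" "opn V" "V \<subseteq> U" "opn W" "W \<subseteq> V" "a \<in> sec M U" "b \<in> sec N U"
    then show "x W (restr M V W (restr M U V a)) \<otimes>\<^bsub>R W\<^esub> y W (restr N V W (restr N U V b)) =
        x W (restr M U W a) \<otimes>\<^bsub>R W\<^esub> y W (restr N U W b)"
      using M N by simp
  qed blast
  have "tensor_to_dual X M N = h"
    unfolding tensor_to_dual_def by (rule the_equality, intro conjI h(1) ballI h(2), simp_all only: opens_iff, erule conjE, rule uniq, assumption, simp)
  then show "tensor_to_dual X M N \<in> mod_homs X (pts X) (tensor X M N) (dual X (tensor X (dual X M) (dual X N)))"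
    "\<And>U V \<theta> \<eta> x y. \<lbrakk>opn U; opn V; V \<subseteq> U; x \<in> sec M U; y \<in> sec N U;
      \<theta> \<in> sec (dual X M) V; \<eta> \<in> sec (dual X N) V\<rbrakk> \<Longrightarrow>
      tensor_to_dual X M N U (tens X M N U x y) V (tens X (dual X M) (dual X N) V \<theta> \<eta>) =
        \<theta> V (restr M U V x) \<otimes>\<^bsub>R V\<^esub> \<eta> V (restr N U V y)"
    using h by simp_all
qed

end

text \<open>For generators e and f with coordinates c and d, the image of e \<otimes> f is the
  coordinate along c \<otimes> d, so a generator goes to a generator.\<close>

lemma tensor_to_dual_iso:
  assumes L: "line_bundle L" and K: "line_bundle K"
  shows "tensor_to_dual X L K \<in> mod_isos X (tensor X L K) (dual X (tensor X (dual X L) (dual X K)))"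
proof (rule line_bundle_isoI)
  note L' = module_sheaf_pre[OF line_bundle_sheaf[OF L]] and K' = module_sheaf_pre[OF line_bundle_sheaf[OF K]]
  note DL = module_sheaf_pre[OF dual_sheaf[OF L']] and DK = module_sheaf_pre[OF dual_sheaf[OF K']]
  note TD = tensor_sheaf[OF DL DK] and TD' = module_sheaf_pre[OF tensor_sheaf[OF DL DK]]
  note hom = tensor_to_dual_hom[OF L' K']
  show "tensor_to_dual X L K \<in> mod_homs X (pts X) (tensor X L K) (dual X (tensor X (dual X L) (dual X K)))"
    by (rule hom)
  show "module_sheaf X (tensor X L K)" by (rule tensor_sheaf[OF L' K'])
  show "module_sheaf X (dual X (tensor X (dual X L) (dual X K)))" by (rule dual_sheaf[OF TD'])
  fix x assume x: "x \<in> pts X"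
  obtain U e c f d where U: "opn U" "x \<in> U" and fr: "frame1 U L e c" "frame1 U K f d"
    by (rule line_bundle_frame2[OF L K opn_top x])
  obtain k where k: "frame1 U (tensor X L K) (tens X L K U e f) k" by (rule tensor_frame[OF L' K' fr U(1)])
  obtain l where l: "frame1 U (tensor X (dual X L) (dual X K)) (tens X (dual X L) (dual X K) U c d) l"
    "\<And>V x y. \<lbrakk>opn V; V \<subseteq> U; x \<in> sec (dual X L) V; y \<in> sec (dual X K) V\<rbrakk> \<Longrightarrow>
      l V (tens X (dual X L) (dual X K) V x y) = ev U L e V x \<otimes>\<^bsub>R V\<^esub> ev U K f V y"
    by (rule tensor_frame[OF DL DK dual_frame1[OF L' fr(1) U(1)] dual_frame1[OF K' fr(2) U(1)] U(1)], blast)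
  note e = frame1D(1)[OF L' fr(1) U(1)] frame1D(1)[OF K' fr(2) U(1)]
  have t: "tens X L K U e f \<in> sec (tensor X L K) U" using e U L' K' by simp
  have "tensor_to_dual X L K U (tens X L K U e f) = l"
  proof (rule tensor_hom_eqI[OF DL DK _ frame1D(2)[OF TD' l(1) U(1)] struct_sheaf])
    show "tensor_to_dual X L K U (tens X L K U e f) \<in> mod_homs X U (tensor X (dual X L) (dual X K)) OX"
      using hom_closed[OF hom U(1) opn_pts[OF U(1)] t] by simp
    fix V \<theta> \<eta> assume V: "opn V" "V \<subseteq> U" and \<theta>: "\<theta> \<in> sec (dual X L) V" "\<eta> \<in> sec (dual X K) V"
    show "tensor_to_dual X L K U (tens X L K U e f) V (tens X (dual X L) (dual X K) V \<theta> \<eta>) =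
        l V (tens X (dual X L) (dual X K) V \<theta> \<eta>)"
      unfolding tensor_to_dual_tens[OF L' K' U(1) V e \<theta>] l(2)[OF V \<theta>] using V \<theta> by simp
  qed
  then have "frame1 U (dual X (tensor X (dual X L) (dual X K))) (tensor_to_dual X L K U (tens X L K U e f))
      (ev U (tensor X (dual X L) (dual X K)) (tens X (dual X L) (dual X K) U c d))"
    using dual_frame1[OF TD' l(1) U(1)] by simp
  then show "\<exists>U e c d. opn U \<and> x \<in> U \<and> frame1 U (tensor X L K) e c \<and>
      frame1 U (dual X (tensor X (dual X L) (dual X K))) (tensor_to_dual X L K U e) d"
    using U k by blast
qed

end

section \<open>Gluing morphisms given by local conditions, and changing frames\<close>

context ringed
begin

text \<open>The analogue of \<open>sheaf_glue\<close> for morphisms: local morphisms agree on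
  overlaps because each is determined by the condition \<open>P\<close>. The condition is returned
  only locally, since it need not pass from the members of a cover to their union.\<close>

lemma hom_glue_spec:
  assumes T: "mod_pre X T" and S: "module_sheaf X S"
    and loc: "\<And>x. x \<in> pts X \<Longrightarrow> \<exists>U h. opn U \<and> x \<in> U \<and> h \<in> mod_homs X U T S \<and> P U h"
    and uniq: "\<And>U h k. \<lbrakk>opn U; h \<in> mod_homs X U T S; k \<in> mod_homs X U T S; P U h; P U k\<rbrakk> \<Longrightarrow> h = k"
    and res: "\<And>U V h. \<lbrakk>opn U; opn V; V \<subseteq> U; h \<in> mod_homs X U T S; P U h\<rbrakk> \<Longrightarrow> P V (restrict h (opens X V))"
  obtains h where "h \<in> mod_homs X (pts X) T S"
    "\<And>x. x \<in> pts X \<Longrightarrow> \<exists>U. opn U \<and> x \<in> U \<and> P U (restrict h (opens X U))"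
proof -
  define \<V> where "\<V> = {U. opn U \<and> (\<exists>h\<in>mod_homs X U T S. P U h)}"
  define \<sigma> where "\<sigma> U = (SOME h. h \<in> mod_homs X U T S \<and> P U h)" for U
  have \<sigma>: "\<sigma> U \<in> mod_homs X U T S \<and> P U (\<sigma> U)" if "U \<in> \<V>" for U
  proof -
    have "\<exists>h. h \<in> mod_homs X U T S \<and> P U h" using that by (auto simp only: \<V>_def)
    then show ?thesis unfolding \<sigma>_def by (rule someI_ex)
  qed
  have op: "opn U" if "U \<in> \<V>" for U using that by (simp add: \<V>_def)
  have un: "\<Union>\<V> = pts X"
  proof
    show "\<Union>\<V> \<subseteq> pts X" using op opn_pts by blast
    show "pts X \<subseteq> \<Union>\<V>"
    proof
      fix x assume "x \<in> pts X"
      from loc[OF this] obtain U h where "opn U" "x \<in> U" "h \<in> mod_homs X U T S" "P U h" by blast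
      then have "U \<in> \<V>" unfolding \<V>_def by blast
      then show "x \<in> \<Union>\<V>" using \<open>x \<in> U\<close> by blast
    qed
  qed
  obtain h where h: "h \<in> mod_homs X (\<Union>\<V>) T S"
    "\<And>V Z x. \<lbrakk>V \<in> \<V>; opn Z; Z \<subseteq> V; x \<in> sec T Z\<rbrakk> \<Longrightarrow> h Z x = \<sigma> V Z x"
  proof (rule hom_glue[OF T S op, of \<V> \<sigma>])
    fix V W Z x assume V: "V \<in> \<V>" "W \<in> \<V>" and Z: "opn Z" "Z \<subseteq> V" "Z \<subseteq> W" and x: "x \<in> sec T Z"
    have "restrict (\<sigma> V) (opens X Z) = restrict (\<sigma> W) (opens X Z)"
      using \<sigma> [OF V(1)] \<sigma> [OF V(2)]
      by (intro uniq[OF Z(1)] hom_restrict[OF _ Z(2)] hom_restrict[OF _ Z(3)]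
          res[OF op[OF V(1)] Z(1,2)] res[OF op[OF V(2)] Z(1,3)]) simp_all
    from fun_cong[OF this, of Z] show "\<sigma> V Z x = \<sigma> W Z x" using Z by simp
  qed (use \<sigma> in blast)+
  show ?thesis
  proof (rule that)
    show hh: "h \<in> mod_homs X (pts X) T S" using h(1) unfolding un .
    fix x assume "x \<in> pts X"
    then obtain U where U: "U \<in> \<V>" "x \<in> U" using un by blast
    have "restrict h (opens X U) = \<sigma> U"
    proof (rule hom_eqI[OF hom_restrict[OF hh]])
      show "U \<subseteq> pts X" using op[OF U(1)] by simp
      show "\<sigma> U \<in> mod_homs X U T S" using \<sigma> [OF U(1)] by blast
    qed (use h(2)[OF U(1)] in simp)
    then show "\<exists>U. opn U \<and> x \<in> U \<and> P U (restrict h (opens X U))"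
      using U op[OF U(1)] \<sigma> [OF U(1)] by (intro exI[of _ U]) simp
  qed
qed

text \<open>The vectors (a, b) and (-q, p) are the rows of a matrix of determinant a p + b q = 1, so
  that its adjugate is its inverse. This completes a unimodular vector to a basis.\<close>

lemma frame2_change:
  assumes M: "mod_pre X M" and fr: "frame2 U M e f c d" and U: "opn U"
    and ab: "a \<in> \<O> U" "b \<in> \<O> U" "p \<in> \<O> U" "q \<in> \<O> U"
    and det: "dot U a p b q = \<one>\<^bsub>R U\<^esub>"
  obtains c' d' where "frame2 U M (lc M U a e b f)
    (\<ominus>\<^bsub>R U\<^esub> q \<odot>\<^bsub>M$U\<^esub> e \<oplus>\<^bsub>M$U\<^esub> p \<odot>\<^bsub>M$U\<^esub> f) c' d'"
proof -
  note fD = frame2D[OF M fr U]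
  define e' where "e' = lc M U a e b f"
  define f' where "f' = \<ominus>\<^bsub>R U\<^esub> q \<odot>\<^bsub>M$U\<^esub> e \<oplus>\<^bsub>M$U\<^esub> p \<odot>\<^bsub>M$U\<^esub> f"
  have ef: "e' \<in> sec M U" "f' \<in> sec M U" using fD(1,2) ab M U by (simp_all add: e'_def f'_def)
  have expand: "lc M V s (restr M U V e') t (restr M U V f') =
      lc M V (cross V (rr U V a) s (rr U V q) t) (restr M U V e) (dot V (rr U V b) s (rr U V p) t) (restr M U V f)"
    if V: "opn V" "V \<subseteq> U" and st: "s \<in> \<O> V" "t \<in> \<O> V" for V s t
  proof -
    interpret module "R V" "M$V" using pre_module[OF M V(1)] .
    define eV fV where "eV = restr M U V e" and "fV = restr M U V f"
    define aV bV pV qV where "aV = rr U V a" and "bV = rr U V b" and "pV = rr U V p" and "qV = rr U V q"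
    have in_M: "eV \<in> sec M V" "fV \<in> sec M V" "aV \<in> \<O> V" "bV \<in> \<O> V" "pV \<in> \<O> V" "qV \<in> \<O> V"
      using fD(1,2) U V M ab by (simp_all add: eV_def fV_def aV_def bV_def pV_def qV_def)
    have "restr M U V e' = lc M V aV eV bV fV"
      "restr M U V f' = \<ominus>\<^bsub>R V\<^esub> qV \<odot>\<^bsub>M$V\<^esub> eV \<oplus>\<^bsub>M$V\<^esub> pV \<odot>\<^bsub>M$V\<^esub> fV"
      using fD(1,2) U V M ab by (simp_all add: e'_def f'_def eV_def fV_def aV_def bV_def pV_def qV_def)
    then show ?thesis
      unfolding aV_def[symmetric] bV_def[symmetric] pV_def[symmetric] qV_def[symmetric] eV_def[symmetric] fV_def[symmetric]
      using in_M st
      by (simp add: smult_r_distr smult_l_distr smult_assoc1[symmetric] a_minus_def M.a_ac m_comm l_minus r_minus)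
  qed
  have detV: "dot V (rr U V a) (rr U V p) (rr U V b) (rr U V q) = \<one>\<^bsub>R V\<^esub>" if V: "opn V" "V \<subseteq> U" for V
    using arg_cong[OF det, of "rr U V"] U V ab by simp
  obtain c' d' where "frame2 U M e' f' c' d'"
  proof (rule frame2I[OF M U ef])
    fix V x assume V: "opn V" "V \<subseteq> U" and x: "x \<in> sec M V"
    interpret cring "R V" using cring_R[OF V(1)] .
    have cx: "c V x \<in> \<O> V" "d V x \<in> \<O> V"
      using hom_closed[OF fD(3) V x] hom_closed[OF fD(4) V x] by simp_all
    have ab': "rr U V a \<in> \<O> V" "rr U V b \<in> \<O> V" "rr U V p \<in> \<O> V" "rr U V q \<in> \<O> V"
      using ab U V by simp_all
    \<comment> \<open>The coordinates in the new basis, obtained from the old ones by the adjugate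
      matrix.\<close>
    define s t where "s = dot V (rr U V p) (c V x) (rr U V q) (d V x)"
      and "t = cross V (rr U V a) (d V x) (rr U V b) (c V x)"
    have st: "s \<in> \<O> V" "t \<in> \<O> V" using cx ab' by (simp_all add: s_def t_def)
    have "cross V (rr U V a) s (rr U V q) t =
        dot V (rr U V a) (rr U V p) (rr U V b) (rr U V q) \<otimes>\<^bsub>R V\<^esub> c V x"
      "dot V (rr U V b) s (rr U V p) t =
        dot V (rr U V a) (rr U V p) (rr U V b) (rr U V q) \<otimes>\<^bsub>R V\<^esub> d V x"
      unfolding s_def t_def using cx ab' by algebra+
    then have "x = lc M V s (restr M U V e') t (restr M U V f')"
      using expand[OF V st] detV[OF V] cx fD(5)[OF V x] by simp
    then show "\<exists>a\<in>\<O> V. \<exists>b\<in>\<O> V.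
      x = lc M V a (restr M U V e') b (restr M U V f')" using st by blast
  next
    fix V s t s' t' assume V: "opn V" "V \<subseteq> U" and st: "s \<in> \<O> V" "t \<in> \<O> V" "s' \<in> \<O> V" "t' \<in> \<O> V"
      and eq: "lc M V s (restr M U V e') t (restr M U V f') =
      lc M V s' (restr M U V e') t' (restr M U V f')"
    interpret cring "R V" using cring_R[OF V(1)] .
    define aV bV pV qV where "aV = rr U V a" and "bV = rr U V b" and "pV = rr U V p" and "qV = rr U V q"
    have ab': "aV \<in> \<O> V" "bV \<in> \<O> V" "pV \<in> \<O> V" "qV \<in> \<O> V"
      using ab U V by (simp_all add: aV_def bV_def pV_def qV_def)
    have co: "c V (lc M V s (restr M U V e') t (restr M U V f')) = cross V aV s qV t"
      "d V (lc M V s (restr M U V e') t (restr M U V f')) = dot V bV s pV t"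
      if "s \<in> \<O> V" "t \<in> \<O> V" for s t
      unfolding expand[OF V that] aV_def[symmetric] bV_def[symmetric] pV_def[symmetric] qV_def[symmetric]
      by (rule frame2_coord[OF M fr U V]; use ab' that in simp)+
    have 1: "cross V aV s qV t = cross V aV s' qV t'"
      using co(1)[OF st(1,2)] co(1)[OF st(3,4)] eq by simp
    have 2: "dot V bV s pV t = dot V bV s' pV t'"
      using co(2)[OF st(1,2)] co(2)[OF st(3,4)] eq by simp
    \<comment> \<open>Applying the adjugate to the old coordinates recovers the determinant times
      \<open>s\<close> and times \<open>t\<close>, whence injectivity.\<close>
    have inv: "dot V aV pV bV qV \<otimes>\<^bsub>R V\<^esub> s =
        dot V pV (cross V aV s qV t) qV (dot V bV s pV t)"
      "dot V aV pV bV qV \<otimes>\<^bsub>R V\<^esub> t =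
        cross V aV (dot V bV s pV t) bV (cross V aV s qV t)"
      if "s \<in> \<O> V" "t \<in> \<O> V" for s t
      using ab' that by algebra+
    have det': "dot V aV pV bV qV = \<one>\<^bsub>R V\<^esub>"
      using detV[OF V] by (simp add: aV_def bV_def pV_def qV_def)
    show "s = s' \<and> t = t'"
      using inv(1)[OF st(1,2)] inv(1)[OF st(3,4)] inv(2)[OF st(1,2)] inv(2)[OF st(3,4)] 1 2 st
      unfolding det' by simp
  qed blast
  then show ?thesis using that unfolding e'_def f'_def by blast
qed

end

section \<open>The quotient of a quadratic algebra by its base\<close>

locale quad = ringed X for X :: "('a, 'r) r_space" +
  fixes Y :: "('a, 'r, 'b) mod_presheaf"
  assumes qa: "quadratic_algebra X Y"
begin

abbreviation (input) "yone U \<equiv> \<one>\<^bsub>Y$U\<^esub>"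
abbreviation (input) "B \<equiv> alg_quot X Y"
abbreviation (input) "acl \<equiv> alg_class X Y"

lemma Y_rank: "locally_free X 2 Y"
  and Y_sheaf: "module_sheaf X Y"
  and Y_ring: "ring_sheaf X Y"
  and Y_algebra: "opn U \<Longrightarrow> algebra (R U) (Y$U)"
  using qa by (simp_all add: quadratic_algebra_def algebra_sheaf_def)

lemma Y_pre [simp]: "mod_pre X Y"
  using Y_sheaf by simp

lemma Y_cring: "opn U \<Longrightarrow> cring (Y$U)"
  using Y_ring by (simp add: ring_sheaf_def)

lemma over_simps [simp]: "top_of (over X Y) = top_of X" "str (over X Y) = Y" "pts (over X Y) = pts X" "opens (over X Y) = opens X"
  by (simp_all add: over_def pts_def opens_def fun_eq_iff)

text \<open>With \<open>Y\<close> as the structure sheaf, everything proved about modules and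
  morphisms also applies to \<open>Y\<close>-modules.\<close>

lemma ringed_over: "ringed (over X Y)"
proof
  show "ringed_space (over X Y)"
    using Y_ring unfolding ringed_space_def ring_sheaf_def is_sheaf_def is_presheaf_def over_simps .
qed

sublocale YR: ringed "over X Y" by (rule ringed_over)

lemma Y_one [simp]: "opn U \<Longrightarrow> yone U \<in> sec Y U"
  and Y_mult [simp]: "\<lbrakk>opn U; \<gamma> \<in> sec Y U; \<alpha> \<in> sec Y U\<rbrakk> \<Longrightarrow> \<gamma> \<otimes>\<^bsub>Y$U\<^esub> \<alpha> \<in> sec Y U"
  and Y_res_one [simp]: "\<lbrakk>opn U; opn V; V \<subseteq> U\<rbrakk> \<Longrightarrow> restr Y U V (yone U) = yone V"
  and Y_res_mult [simp]: "\<lbrakk>opn U; opn V; V \<subseteq> U; \<gamma> \<in> sec Y U; \<alpha> \<in> sec Y U\<rbrakk> \<Longrightarrow>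
    restr Y U V (\<gamma> \<otimes>\<^bsub>Y$U\<^esub> \<alpha>) = restr Y U V \<gamma> \<otimes>\<^bsub>Y$V\<^esub> restr Y U V \<alpha>"
  using YR.R_closed[of U] YR.rr_simps[of U V] by simp_all

lemma base_submodule:
  assumes U: "opn U" shows "submodule (base_image X Y U) (R U) (Y$U)"
proof -
  interpret algebra "R U" "Y$U" using Y_algebra[OF U] .
  show ?thesis
  proof (rule submoduleI)
    show "base_image X Y U \<subseteq> sec Y U" using U by (auto simp: base_image_def)
    show "\<zero>\<^bsub>Y$U\<^esub> \<in> base_image X Y U"
      using U unfolding base_image_def by (auto intro!: exI[of _ "\<zero>\<^bsub>R U\<^esub>"])
    fix a assume "a \<in> base_image X Y U"
    then obtain r where r: "r \<in> \<O> U" "a = r \<odot>\<^bsub>Y$U\<^esub> yone U" by (auto simp: base_image_def)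
    then show "\<ominus>\<^bsub>Y$U\<^esub> a \<in> base_image X Y U"
      using U unfolding base_image_def by (auto intro!: exI[of _ "\<ominus>\<^bsub>R U\<^esub> r"] simp: smult_l_minus)
    { fix b assume "b \<in> base_image X Y U"
      then obtain s where s: "s \<in> \<O> U" "b = s \<odot>\<^bsub>Y$U\<^esub> yone U" by (auto simp: base_image_def)
      then show "a \<oplus>\<^bsub>Y$U\<^esub> b \<in> base_image X Y U"
        using r U unfolding base_image_def by (auto intro!: exI[of _ "r \<oplus>\<^bsub>R U\<^esub> s"] simp: smult_l_distr) }
    fix s assume s: "s \<in> \<O> U"
    then show "s \<odot>\<^bsub>Y$U\<^esub> a \<in> base_image X Y U"
      using r U unfolding base_image_def by (auto intro!: exI[of _ "s \<otimes>\<^bsub>R U\<^esub> r"] simp: smult_assoc1)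
  qed
qed

lemma base_res:
  assumes U: "opn U" "opn V" "V \<subseteq> U" and x: "x \<in> base_image X Y U"
  shows "restr Y U V x \<in> base_image X Y V"
proof -
  obtain r where "r \<in> \<O> U" "x = r \<odot>\<^bsub>Y$U\<^esub> yone U" using x by (auto simp: base_image_def)
  then have "restr Y U V x = rr U V r \<odot>\<^bsub>Y$V\<^esub> yone V" "rr U V r \<in> \<O> V" using U by simp_all
  then show ?thesis unfolding base_image_def by blast
qed

abbreviation (input) "QY \<equiv> quot_presheaf Y (base_image X Y)"

lemma QY_facts:
  "mod_pre X QY"
  "lin X U Y QY (\<lambda>U x. base_image X Y U +>\<^bsub>Y$U\<^esub> x)"
  "opn U \<Longrightarrow> x \<in> base_image X Y U \<Longrightarrow> base_image X Y U +>\<^bsub>Y$U\<^esub> x = \<zero>\<^bsub>QY$U\<^esub>"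
  "sec QY U = {base_image X Y U +>\<^bsub>Y$U\<^esub> x | x. x \<in> sec Y U}"
  by (rule quot_pre quot_class_lin quot_class_zero quot_simps(1); simp add: base_submodule base_res)+

lemma B_sheaf [simp]: "module_sheaf X B"
  unfolding alg_quot_def by (rule sheafify_sheaf[OF QY_facts(1)])

lemma acl_lin: "lin X U Y B acl"
  using ss_lin[OF QY_facts(1), of U] QY_facts(2)[of U]
  unfolding lin_def alg_quot_def alg_class_def by simp

lemma acl_simps [simp]:
  assumes "opn U" "\<gamma> \<in> sec Y U"
  shows "acl U \<gamma> \<in> sec B U"
    "\<gamma>' \<in> sec Y U \<Longrightarrow> acl U (\<gamma> \<oplus>\<^bsub>Y$U\<^esub> \<gamma>') = acl U \<gamma> \<oplus>\<^bsub>B$U\<^esub> acl U \<gamma>'"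
    "r \<in> \<O> U \<Longrightarrow> acl U (r \<odot>\<^bsub>Y$U\<^esub> \<gamma>) = r \<odot>\<^bsub>B$U\<^esub> acl U \<gamma>"
    "opn V \<Longrightarrow> V \<subseteq> U \<Longrightarrow> acl V (restr Y U V \<gamma>) = restr B U V (acl U \<gamma>)"
  using acl_lin[of U] assms by (simp_all add: lin_def)

lemma acl_one [simp]: "opn U \<Longrightarrow> acl U (yone U) = \<zero>\<^bsub>B$U\<^esub>"
proof -
  assume U: "opn U"
  have "yone U \<in> base_image X Y U"
    using U unfolding base_image_def by (auto intro!: exI[of _ "\<one>\<^bsub>R U\<^esub>"])
  then show ?thesis unfolding alg_class_def alg_quot_def
    by (simp only: QY_facts(3)[OF U] ss_zero[OF QY_facts(1)])
qed

lemma B_hom_eqI: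
  assumes h: "h \<in> mod_homs X U B L" "k \<in> mod_homs X U B L" and L: "module_sheaf X L"
    and eq: "\<And>V \<gamma>. \<lbrakk>opn V; V \<subseteq> U; \<gamma> \<in> sec Y V\<rbrakk> \<Longrightarrow> h V (acl V \<gamma>) = k V (acl V \<gamma>)"
  shows "h = k"
proof (rule sheafify_hom_eqI[OF QY_facts(1) h[unfolded alg_quot_def] L])
  fix V s assume "opn V" "V \<subseteq> U" "s \<in> sec QY V"
  then show "h V (sheaf_section X QY V s) = k V (sheaf_section X QY V s)"
    using eq unfolding alg_class_def by (auto simp: QY_facts(4))
qed

text \<open>The image of the base in \<open>Y\<close> is spanned by 1, so it is enough that
  \<open>\<phi>\<close> vanishes there. The rest is the universal property of the quotient followed
  by that of sheafification.\<close>

lemma B_lift: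
  assumes \<phi>: "\<phi> \<in> mod_homs X U Y L" and L: "module_sheaf X L" and U: "opn U"
    and one: "\<And>V. opn V \<Longrightarrow> V \<subseteq> U \<Longrightarrow> \<phi> V (yone V) = \<zero>\<^bsub>L$V\<^esub>"
  obtains h where "h \<in> mod_homs X U B L"
    "\<And>V \<gamma>. \<lbrakk>opn V; V \<subseteq> U; \<gamma> \<in> sec Y V\<rbrakk> \<Longrightarrow> h V (acl V \<gamma>) = \<phi> V \<gamma>"
proof -
  have lin: "lin X U Y L \<phi>" using \<phi> by (simp add: hom_iff)
  have ker: "\<phi> V x = \<zero>\<^bsub>L$V\<^esub>" if V: "opn V" "V \<subseteq> U" and x: "x \<in> base_image X Y V" for V x
  proof -
    obtain r where "r \<in> \<O> V" "x = r \<odot>\<^bsub>Y$V\<^esub> yone V" using x by (auto simp: base_image_def)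
    then show ?thesis using V L one[OF V] hom_smult[OF \<phi> V] by simp
  qed
  obtain g where g: "lin X U QY L g"
    "\<And>V x. \<lbrakk>opn V; V \<subseteq> U; x \<in> sec Y V\<rbrakk> \<Longrightarrow> g V (base_image X Y V +>\<^bsub>Y$V\<^esub> x) = \<phi> V x"
    using quot_lift[OF Y_pre _ _ lin module_sheaf_pre[OF L] ker, of "base_image X Y"] base_submodule base_res by blast
  obtain h where h: "h \<in> mod_homs X U (sheafify X QY) L"
    "\<And>V s. \<lbrakk>opn V; V \<subseteq> U; s \<in> sec QY V\<rbrakk> \<Longrightarrow> h V (sheaf_section X QY V s) = g V s"
    by (rule sheafify_lift[OF QY_facts(1) L g(1) U]) blast
  show ?thesis
  proof (rule that)
    show "h \<in> mod_homs X U B L" using h(1) by (simp add: alg_quot_def)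
    fix V \<gamma> assume "opn V" "V \<subseteq> U" "\<gamma> \<in> sec Y V"
    then show "h V (acl V \<gamma>) = \<phi> V \<gamma>"
      unfolding alg_class_def using QY_facts(2)[of V] by (simp add: h(2) g(2) lin_def)
  qed
qed

text \<open>The coordinate \<open>d\<close> vanishes at 1 and so descends to the quotient, where it
  is the coordinate along the class of \<open>\<alpha>\<close>.\<close>

lemma B_frame:
  assumes fr: "frame2 U Y (yone U) \<alpha> c d" and U: "opn U"
  obtains \<kappa> where "frame1 U B (acl U \<alpha>) \<kappa>"
    "\<And>V \<gamma>. \<lbrakk>opn V; V \<subseteq> U; \<gamma> \<in> sec Y V\<rbrakk> \<Longrightarrow> \<kappa> V (acl V \<gamma>) = d V \<gamma>"
proof -
  note f = frame2D[OF Y_pre fr U]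
  have "d V (yone V) = \<zero>\<^bsub>OX$V\<^esub>" if "opn V" "V \<subseteq> U" for V
    using f(8)[OF that] that U by simp
  then obtain \<kappa> where \<kappa>: "\<kappa> \<in> mod_homs X U B OX"
    "\<And>V \<gamma>. \<lbrakk>opn V; V \<subseteq> U; \<gamma> \<in> sec Y V\<rbrakk> \<Longrightarrow> \<kappa> V (acl V \<gamma>) = d V \<gamma>"
    using B_lift[OF f(4) struct_sheaf U] by blast
  note BP = module_sheaf_pre[OF B_sheaf]
  have a: "acl U \<alpha> \<in> sec B U" using U f(2) by simp
  have id: "mkhom X U B (\<lambda>V x. x) = mkhom X U B (\<lambda>V x. \<kappa> V x \<odot>\<^bsub>B$V\<^esub> restr B U V (acl U \<alpha>))"
  proof (rule B_hom_eqI[OF hom_idI[OF BP] hom_scaled[OF BP BP U \<kappa>(1) a] B_sheaf])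
    fix V \<gamma> assume V: "opn V" "V \<subseteq> U" and \<gamma>: "\<gamma> \<in> sec Y V"
    have cd: "c V \<gamma> \<in> \<O> V" "d V \<gamma> \<in> \<O> V"
      using hom_closed[OF f(3) V \<gamma>] hom_closed[OF f(4) V \<gamma>] by simp_all
    have \<alpha>V: "restr Y U V \<alpha> \<in> sec Y V" using f(2) U V by simp
    have "acl V \<gamma> = acl V (lc Y V (c V \<gamma>) (yone V) (d V \<gamma>) (restr Y U V \<alpha>))"
      using f(5)[OF V \<gamma>] U V by simp
    also have "\<dots> = d V \<gamma> \<odot>\<^bsub>B$V\<^esub> restr B U V (acl U \<alpha>)"
      using V U cd \<alpha>V f(2) a by (simp add: BP)
    finally show "mkhom X U B (\<lambda>V x. x) V (acl V \<gamma>) =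
        mkhom X U B (\<lambda>V x. \<kappa> V x \<odot>\<^bsub>B$V\<^esub> restr B U V (acl U \<alpha>)) V (acl V \<gamma>)"
      unfolding mkhom_apply[OF V acl_simps(1)[OF V(1) \<gamma>]] \<kappa>(2)[OF V \<gamma>] .
  qed
  have "frame1 U B (acl U \<alpha>) \<kappa>"
    unfolding frame1_def
  proof (intro conjI ballI a \<kappa>(1))
    fix V \<omega> assume "V \<in> opens X U" and \<omega>: "\<omega> \<in> sec B V"
    then show "\<omega> = \<kappa> V \<omega> \<odot>\<^bsub>B$V\<^esub> restr B U V (acl U \<alpha>)"
      using fun_cong[OF fun_cong[OF id, of V], of \<omega>] by simp
  next
    show "\<kappa> U (acl U \<alpha>) = \<one>\<^bsub>R U\<^esub>" using \<kappa>(2)[OF U order_refl f(2)] f(9)[OF U order_refl] f(2) U by simp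
  qed
  then show ?thesis using that \<kappa>(2) by blast
qed

text \<open>If \<open>1 = a e + b f\<close> in a frame \<open>(e, f)\<close>, comparing the coefficients of \<open>e\<close> in
  \<open>e = 1 e = a e\<^sup>2 + b f e\<close> shows that \<open>(a, b)\<close> is unimodular, so that \<open>1\<close> extends to a frame.\<close>

lemma unit_frame:
  assumes U: "opn U" and x: "x \<in> U"
  obtains V \<alpha> c d where "opn V" "x \<in> V" "V \<subseteq> U" "frame2 V Y (yone V) \<alpha> c d"
proof -
  obtain V e f c d where V: "opn V" "x \<in> V" "V \<subseteq> U" and fr: "frame2 V Y e f c d"
    by (rule locally_free2_frame[OF Y_rank U x])
  note D = frame2D[OF Y_pre fr V(1)]
  interpret YV: cring "Y$V" using Y_cring[OF V(1)] .
  interpret algebra "R V" "Y$V" using Y_algebra[OF V(1)] .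
  define a b where "a = c V (yone V)" and "b = d V (yone V)"
  define p q where "p = c V (e \<otimes>\<^bsub>Y$V\<^esub> e)" and "q = c V (f \<otimes>\<^bsub>Y$V\<^esub> e)"
  have ab: "a \<in> \<O> V" "b \<in> \<O> V" "p \<in> \<O> V" "q \<in> \<O> V"
    unfolding a_def b_def p_def q_def
    using hom_closed[OF D(3) V(1) order_refl] hom_closed[OF D(4) V(1) order_refl] V(1) D(1,2) by simp_all
  have one: "lc Y V a e b f = yone V"
    using D(5)[OF V(1) order_refl, of "yone V"] V(1) D(1,2) by (simp add: a_def b_def)
  have "e = (lc Y V a e b f) \<otimes>\<^bsub>Y$V\<^esub> e"
    unfolding one using D(1) by simp
  also have "\<dots> = lc Y V a (e \<otimes>\<^bsub>Y$V\<^esub> e) b (f \<otimes>\<^bsub>Y$V\<^esub> e)"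
    using D(1,2) ab by (simp add: YV.l_distr smult_assoc2)
  finally have e_eq: "e = lc Y V a (e \<otimes>\<^bsub>Y$V\<^esub> e) b (f \<otimes>\<^bsub>Y$V\<^esub> e)" .
  have "c V e = dot V a p b q"
    by (subst e_eq) (use D(1,2) ab V(1) in \<open>simp add: p_def q_def hom_add[OF D(3) V(1) order_refl] hom_smult[OF D(3) V(1) order_refl]\<close>)
  then have det: "dot V a p b q = \<one>\<^bsub>R V\<^esub>"
    using D(6)[OF V(1) order_refl] D(1) V(1) by simp
  obtain c' d' where "frame2 V Y (yone V) (\<ominus>\<^bsub>R V\<^esub> q \<odot>\<^bsub>Y$V\<^esub> e \<oplus>\<^bsub>Y$V\<^esub> p \<odot>\<^bsub>Y$V\<^esub> f) c' d'"
    using frame2_change[OF Y_pre fr V(1) ab det] unfolding one by blast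
  then show ?thesis using that V by blast
qed

lemma B_line: "line_bundle B"
proof (rule line_bundleI[OF B_sheaf])
  fix x assume "x \<in> pts X"
  then obtain V \<alpha> c d where V: "opn V" "x \<in> V" "frame2 V Y (yone V) \<alpha> c d"
    using unit_frame[OF opn_top] by metis
  obtain \<kappa> where "frame1 V B (acl V \<alpha>) \<kappa>" by (rule B_frame[OF V(3,1)])
  then show "\<exists>U e c. opn U \<and> x \<in> U \<and> frame1 U B e c" using V by blast
qed

end

section \<open>Wood's quadratic map\<close>

context ringed
begin

lemma mod_diff_simps:
  assumes M: "mod_pre X M" and U: "opn U" and x: "a \<in> sec M U" "b \<in> sec M U" "c \<in> sec M U" "d \<in> sec M U"
  shows "(a \<oplus>\<^bsub>M$U\<^esub> b) \<ominus>\<^bsub>M$U\<^esub> (c \<oplus>\<^bsub>M$U\<^esub> d) =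
      (a \<ominus>\<^bsub>M$U\<^esub> c) \<oplus>\<^bsub>M$U\<^esub> (b \<ominus>\<^bsub>M$U\<^esub> d)"
    and "r \<in> \<O> U \<Longrightarrow> r \<odot>\<^bsub>M$U\<^esub> (a \<ominus>\<^bsub>M$U\<^esub> c) =
      r \<odot>\<^bsub>M$U\<^esub> a \<ominus>\<^bsub>M$U\<^esub> r \<odot>\<^bsub>M$U\<^esub> c"
proof -
  interpret module "R U" "M$U" using pre_module[OF M U] .
  show "(a \<oplus>\<^bsub>M$U\<^esub> b) \<ominus>\<^bsub>M$U\<^esub> (c \<oplus>\<^bsub>M$U\<^esub> d) =
      (a \<ominus>\<^bsub>M$U\<^esub> c) \<oplus>\<^bsub>M$U\<^esub> (b \<ominus>\<^bsub>M$U\<^esub> d)"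
    using x by (simp add: a_minus_def M.minus_add M.a_ac)
  show "r \<in> \<O> U \<Longrightarrow> r \<odot>\<^bsub>M$U\<^esub> (a \<ominus>\<^bsub>M$U\<^esub> c) =
      r \<odot>\<^bsub>M$U\<^esub> a \<ominus>\<^bsub>M$U\<^esub> r \<odot>\<^bsub>M$U\<^esub> c"
    using x by (simp add: a_minus_def smult_r_distr smult_r_minus)
qed

end

lemma rs_simps:
  "sec (restr_scalars Y I) U = sec I U"
  "x \<oplus>\<^bsub>restr_scalars Y I$U\<^esub> y = x \<oplus>\<^bsub>I$U\<^esub> y"
  "\<zero>\<^bsub>restr_scalars Y I$U\<^esub> = \<zero>\<^bsub>I$U\<^esub>"
  "r \<odot>\<^bsub>restr_scalars Y I$U\<^esub> x = (r \<odot>\<^bsub>Y$U\<^esub> \<one>\<^bsub>Y$U\<^esub>) \<odot>\<^bsub>I$U\<^esub> x"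
  "restr (restr_scalars Y I) = restr I"
  by (simp_all add: restr_scalars_def)

locale quad_mod = quad X Y for X :: "('a, 'r) r_space" and Y :: "('a, 'r, 'b) mod_presheaf" +
  fixes I :: "('a, 'b, 'm) mod_presheaf"
  assumes I_sheaf: "module_sheaf (over X Y) I" and M_rank: "locally_free X 2 (restr_scalars Y I)"
begin

abbreviation (input) "M \<equiv> restr_scalars Y I"
abbreviation (input) "E \<equiv> ext2 X M"
abbreviation (input) "S \<equiv> sym2 X M"
abbreviation (input) "T \<equiv> tensor X E B"
abbreviation (input) "L \<equiv> tensor X (dual X E) (dual X B)"
abbreviation (input) "tod \<equiv> tensor_to_dual X E B"

lemma M_sheaf: "module_sheaf X M"
  using M_rank by (simp add: locally_free_def)

lemma pres [simp]: "mod_pre X M" "mod_pre X E" "mod_pre X S" "mod_pre X B" "mod_pre X T"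
    "mod_pre X (dual X M)" "mod_pre X (dual X E)" "mod_pre X (dual X B)" "mod_pre X L"
    "mod_pre X (dual X L)" "mod_pre X (dual X S)" "mod_pre X (dual X (dual X L))"
proof -
  show M: "mod_pre X M" using M_sheaf by simp
  show E: "mod_pre X E" "mod_pre X S" "mod_pre X (dual X M)" and B: "mod_pre X B"
    using ext2_sheaf[OF M] sym2_sheaf[OF M] dual_sheaf[OF M] by simp_all
  show "mod_pre X T" "mod_pre X (dual X S)" using tensor_sheaf[OF E(1) B] dual_sheaf[OF E(2)] by simp_all
  show D: "mod_pre X (dual X E)" "mod_pre X (dual X B)" using dual_sheaf[OF E(1)] dual_sheaf[OF B] by simp_all
  show "mod_pre X L" using tensor_sheaf[OF D] by simp
  then show "mod_pre X (dual X L)" using dual_sheaf by blast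
  then show "mod_pre X (dual X (dual X L))" using dual_sheaf by blast
qed

lemma E_line: "line_bundle E" and L_line: "line_bundle L"
  using line_bundle_ext2[OF M_rank] B_line by (simp_all add: line_bundle_tensor line_bundle_dual)

lemma L_sheaf [simp]: "module_sheaf X L" by (rule line_bundle_sheaf[OF L_line])

text \<open>The action of \<open>Y\<close> expressed on \<open>M\<close>, on which a scalar r of
  \<open>X\<close> acts as r 1. Commutativity of \<open>Y\<close> makes the action linear over the
  structure sheaf of \<open>X\<close>.\<close>

lemma act_simps [simp]:
  assumes U: "opn U" and \<gamma>: "\<gamma> \<in> sec Y U" and x: "x \<in> sec M U"
  shows "\<gamma> \<odot>\<^bsub>I$U\<^esub> x \<in> sec M U"
    "y \<in> sec M U \<Longrightarrow> \<gamma> \<odot>\<^bsub>I$U\<^esub> (x \<oplus>\<^bsub>M$U\<^esub> y) = \<gamma> \<odot>\<^bsub>I$U\<^esub> x \<oplus>\<^bsub>M$U\<^esub> \<gamma> \<odot>\<^bsub>I$U\<^esub> y"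
    "\<gamma>' \<in> sec Y U \<Longrightarrow> (\<gamma> \<oplus>\<^bsub>Y$U\<^esub> \<gamma>') \<odot>\<^bsub>I$U\<^esub> x = \<gamma> \<odot>\<^bsub>I$U\<^esub> x \<oplus>\<^bsub>M$U\<^esub> \<gamma>' \<odot>\<^bsub>I$U\<^esub> x"
    "yone U \<odot>\<^bsub>I$U\<^esub> x = x"
    "r \<in> \<O> U \<Longrightarrow> \<gamma> \<odot>\<^bsub>I$U\<^esub> (r \<odot>\<^bsub>M$U\<^esub> x) = r \<odot>\<^bsub>M$U\<^esub> (\<gamma> \<odot>\<^bsub>I$U\<^esub> x)"
    "r \<in> \<O> U \<Longrightarrow> (r \<odot>\<^bsub>Y$U\<^esub> \<gamma>) \<odot>\<^bsub>I$U\<^esub> x = r \<odot>\<^bsub>M$U\<^esub> (\<gamma> \<odot>\<^bsub>I$U\<^esub> x)"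
    "opn V \<Longrightarrow> V \<subseteq> U \<Longrightarrow> restr M U V (\<gamma> \<odot>\<^bsub>I$U\<^esub> x) = restr Y U V \<gamma> \<odot>\<^bsub>I$V\<^esub> restr M U V x"
proof -
  note IP = module_sheaf_pre[OF I_sheaf]
  interpret module "Y$U" "I$U" using YR.pre_module[OF IP] U by simp
  interpret A: algebra "R U" "Y$U" using Y_algebra[OF U] .
  have x': "x \<in> sec I U" using x by (simp add: rs_simps)
  have base: "r \<odot>\<^bsub>Y$U\<^esub> \<gamma> = (r \<odot>\<^bsub>Y$U\<^esub> yone U) \<otimes>\<^bsub>Y$U\<^esub> \<gamma>" if "r \<in> \<O> U" for r
    using A.smult_assoc2[OF that, of "yone U" \<gamma>] \<gamma> U by (simp add: R.l_one)
  show "\<gamma> \<odot>\<^bsub>I$U\<^esub> x \<in> sec M U" using x' \<gamma> by (simp add: rs_simps)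
  show "y \<in> sec M U \<Longrightarrow> \<gamma> \<odot>\<^bsub>I$U\<^esub> (x \<oplus>\<^bsub>M$U\<^esub> y) = \<gamma> \<odot>\<^bsub>I$U\<^esub> x \<oplus>\<^bsub>M$U\<^esub> \<gamma> \<odot>\<^bsub>I$U\<^esub> y"
    using x' \<gamma> by (simp add: rs_simps smult_r_distr)
  show "\<gamma>' \<in> sec Y U \<Longrightarrow> (\<gamma> \<oplus>\<^bsub>Y$U\<^esub> \<gamma>') \<odot>\<^bsub>I$U\<^esub> x = \<gamma> \<odot>\<^bsub>I$U\<^esub> x \<oplus>\<^bsub>M$U\<^esub> \<gamma>' \<odot>\<^bsub>I$U\<^esub> x"
    using x' \<gamma> by (simp add: rs_simps smult_l_distr)
  show "yone U \<odot>\<^bsub>I$U\<^esub> x = x" using x' by simp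
  show "(r \<odot>\<^bsub>Y$U\<^esub> \<gamma>) \<odot>\<^bsub>I$U\<^esub> x = r \<odot>\<^bsub>M$U\<^esub> (\<gamma> \<odot>\<^bsub>I$U\<^esub> x)" if r: "r \<in> \<O> U"
    using x' \<gamma> r U by (simp add: rs_simps base smult_assoc1)
  show "\<gamma> \<odot>\<^bsub>I$U\<^esub> (r \<odot>\<^bsub>M$U\<^esub> x) = r \<odot>\<^bsub>M$U\<^esub> (\<gamma> \<odot>\<^bsub>I$U\<^esub> x)" if r: "r \<in> \<O> U"
    using x' \<gamma> r U by (simp add: rs_simps smult_assoc1[symmetric] R.m_comm)
  show "opn V \<Longrightarrow> V \<subseteq> U \<Longrightarrow> restr M U V (\<gamma> \<odot>\<^bsub>I$U\<^esub> x) = restr Y U V \<gamma> \<odot>\<^bsub>I$V\<^esub> restr M U V x"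
    using YR.res_simps(2)[OF IP, of U V x \<gamma>] x' \<gamma> U by (simp add: rs_simps)
qed

lemma act_one [simp]: "opn U \<Longrightarrow> x \<in> sec M U \<Longrightarrow> yone U \<odot>\<^bsub>I$U\<^esub> x = x"
  by (rule act_simps(4)[OF _ Y_one])

text \<open>The value prescribed for Wood's map at (x \<and> y) \<otimes> \<gamma>, as a function of
  a section of \<open>Y\<close> rather than of its class.\<close>

definition w :: "'a set \<Rightarrow> 'b \<Rightarrow> 'm \<Rightarrow> 'm \<Rightarrow> 'a \<Rightarrow> ('a set \<times> ('m \<times> 'm \<Rightarrow> 'r) set) set" where
  "w V \<gamma> x y = sprod X M V (\<gamma> \<odot>\<^bsub>I$V\<^esub> y) x \<ominus>\<^bsub>S$V\<^esub> sprod X M V (\<gamma> \<odot>\<^bsub>I$V\<^esub> x) y"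

text \<open>Commutativity of the symmetric square makes the two terms cancel at \<gamma> = 1.
  Together with linearity in \<gamma> this lets the value descend to classes modulo the
  base.\<close>

lemma w_simps:
  assumes U: "opn U" and \<gamma>: "\<gamma> \<in> sec Y U" and xy: "x \<in> sec M U" "y \<in> sec M U"
  shows "w U \<gamma> x y \<in> sec S U"
    "\<gamma>' \<in> sec Y U \<Longrightarrow> w U (\<gamma> \<oplus>\<^bsub>Y$U\<^esub> \<gamma>') x y = w U \<gamma> x y \<oplus>\<^bsub>S$U\<^esub> w U \<gamma>' x y"
    "r \<in> \<O> U \<Longrightarrow> w U (r \<odot>\<^bsub>Y$U\<^esub> \<gamma>) x y = r \<odot>\<^bsub>S$U\<^esub> w U \<gamma> x y"
    "w U (yone U) x y = \<zero>\<^bsub>S$U\<^esub>"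
    "opn V \<Longrightarrow> V \<subseteq> U \<Longrightarrow> w V (restr Y U V \<gamma>) (restr M U V x) (restr M U V y) = restr S U V (w U \<gamma> x y)"
proof -
  show "w U \<gamma> x y \<in> sec S U" using assms by (simp add: w_def)
  show "\<gamma>' \<in> sec Y U \<Longrightarrow> w U (\<gamma> \<oplus>\<^bsub>Y$U\<^esub> \<gamma>') x y = w U \<gamma> x y \<oplus>\<^bsub>S$U\<^esub> w U \<gamma>' x y"
    using assms by (simp add: w_def mod_diff_simps)
  show "r \<in> \<O> U \<Longrightarrow> w U (r \<odot>\<^bsub>Y$U\<^esub> \<gamma>) x y = r \<odot>\<^bsub>S$U\<^esub> w U \<gamma> x y"
    using assms by (simp add: w_def mod_diff_simps(2)[where b = "\<zero>\<^bsub>S$U\<^esub>" and d = "\<zero>\<^bsub>S$U\<^esub>"])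
  show "w U (yone U) x y = \<zero>\<^bsub>S$U\<^esub>"
    using U xy by (simp add: w_def mod_diff_zero sprod_comm[of M U y x])
  show "opn V \<Longrightarrow> V \<subseteq> U \<Longrightarrow> w V (restr Y U V \<gamma>) (restr M U V x) (restr M U V y) = restr S U V (w U \<gamma> x y)"
    using assms by (simp add: w_def act_simps(7)[symmetric] del: act_simps(7))
qed

text \<open>For x = y the two terms coincide, so for fixed \<open>\<alpha>\<close> the value is
  alternating in x and y.\<close>

lemma w_hom:
  assumes U: "opn U" and \<alpha>: "\<alpha> \<in> sec Y U"
  obtains \<phi> where "\<phi> \<in> mod_homs X U E S"
    "\<And>V x y. \<lbrakk>opn V; V \<subseteq> U; x \<in> sec M V; y \<in> sec M V\<rbrakk> \<Longrightarrow>
      \<phi> V (wedge X M V x y) = w V (restr Y U V \<alpha>) x y"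
proof -
  have bil: "bilin X U M M S (\<lambda>V. w V (restr Y U V \<alpha>))"
  proof (rule bilinI)
    fix V x y assume V: "opn V" "V \<subseteq> U" and x: "x \<in> sec M V" and y: "y \<in> sec M V"
    have a: "restr Y U V \<alpha> \<in> sec Y V" using U V \<alpha> by simp
    show "w V (restr Y U V \<alpha>) x y \<in> sec S V" using V x y a by (simp add: w_simps)
    { fix z assume z: "z \<in> sec M V"
      show "w V (restr Y U V \<alpha>) (x \<oplus>\<^bsub>M$V\<^esub> z) y = w V (restr Y U V \<alpha>) x y \<oplus>\<^bsub>S$V\<^esub> w V (restr Y U V \<alpha>) z y"
        "w V (restr Y U V \<alpha>) x (y \<oplus>\<^bsub>M$V\<^esub> z) = w V (restr Y U V \<alpha>) x y \<oplus>\<^bsub>S$V\<^esub> w V (restr Y U V \<alpha>) x z"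
        using V x y z a by (simp_all add: w_def mod_diff_simps) }
    { fix r assume r: "r \<in> \<O> V"
      show "w V (restr Y U V \<alpha>) (r \<odot>\<^bsub>M$V\<^esub> x) y = r \<odot>\<^bsub>S$V\<^esub> w V (restr Y U V \<alpha>) x y"
        "w V (restr Y U V \<alpha>) x (r \<odot>\<^bsub>M$V\<^esub> y) = r \<odot>\<^bsub>S$V\<^esub> w V (restr Y U V \<alpha>) x y"
        using V x y r a
        by (simp_all add: w_def mod_diff_simps(2)[where b = "\<zero>\<^bsub>S$V\<^esub>" and d = "\<zero>\<^bsub>S$V\<^esub>"]) }
    fix W assume W: "opn W" "W \<subseteq> V"
    show "w W (restr Y U W \<alpha>) (restr M V W x) (restr M V W y) = restr S V W (w V (restr Y U V \<alpha>) x y)"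
      using w_simps(5)[OF V(1) a x y W] U V W \<alpha> by simp
  qed
  have alt: "w V (restr Y U V \<alpha>) x x = \<zero>\<^bsub>S$V\<^esub>" if V: "opn V" "V \<subseteq> U" "x \<in> sec M V" for V x
    using U V \<alpha> by (simp add: w_def mod_diff_zero)
  show ?thesis by (rule ext2_lift[OF pres(1) sym2_sheaf[OF pres(1)] bil U alt], assumption+, rule that)
qed

lemma T_frame:
  assumes U: "opn U" and x: "x \<in> U"
  obtains V e f c d \<alpha> c' d' k where "opn V" "x \<in> V" "V \<subseteq> U" "frame2 V M e f c d" "frame2 V Y (yone V) \<alpha> c' d'"
    "frame1 V T (tens X E B V (wedge X M V e f) (acl V \<alpha>)) k"
proof -
  obtain V e f c d where V: "opn V" "x \<in> V" "V \<subseteq> U" and fr: "frame2 V M e f c d"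
    by (rule locally_free2_frame[OF M_rank U x])
  obtain W \<alpha> c' d' where W: "opn W" "x \<in> W" "W \<subseteq> V" and fr': "frame2 W Y (yone W) \<alpha> c' d'"
    by (rule unit_frame[OF V(1,2)])
  note frW = frame2_restrict[OF pres(1) fr V(1) W(1,3)]
  obtain k where k: "frame1 W E (wedge X M W (restr M V W e) (restr M V W f)) k"
    by (rule ext2_frame[OF pres(1) frW W(1)])
  obtain \<kappa> where \<kappa>: "frame1 W B (acl W \<alpha>) \<kappa>" by (rule B_frame[OF fr' W(1)])
  obtain l where "frame1 W T (tens X E B W (wedge X M W (restr M V W e) (restr M V W f)) (acl W \<alpha>)) l"
    by (rule tensor_frame[OF pres(2,4) k \<kappa> W(1)])
  moreover have "W \<subseteq> U" using W V by order
  ultimately show ?thesis using that W frW fr' by blast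
qed

text \<open>The tensors (x \<and> y) \<otimes> \<gamma> with \<gamma> a section of \<open>Y\<close>
  need not include all pure tensors, since a section of the quotient sheaf lifts to \<open>Y\<close>
  only locally. Near each point, however, one of them generates \<open>T\<close>.\<close>

lemma T_eqI:
  assumes h: "h \<in> mod_homs X U T K" "k \<in> mod_homs X U T K" and K: "module_sheaf X K" and U: "opn U"
    and eq: "\<And>V x y \<gamma>. \<lbrakk>opn V; V \<subseteq> U; x \<in> sec M V; y \<in> sec M V; \<gamma> \<in> sec Y V\<rbrakk> \<Longrightarrow>
      h V (tens X E B V (wedge X M V x y) (acl V \<gamma>)) = k V (tens X E B V (wedge X M V x y) (acl V \<gamma>))"
  shows "h = k"
proof (rule line_hom_eqI[OF h pres(5) K])
  fix x assume x: "x \<in> U"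
  obtain V e f c d \<alpha> c' d' l where V: "opn V" "x \<in> V" "V \<subseteq> U" and fr: "frame2 V M e f c d" "frame2 V Y (yone V) \<alpha> c' d'"
    "frame1 V T (tens X E B V (wedge X M V e f) (acl V \<alpha>)) l"
    by (rule T_frame[OF U x])
  have "h V (tens X E B V (wedge X M V e f) (acl V \<alpha>)) = k V (tens X E B V (wedge X M V e f) (acl V \<alpha>))"
    by (rule eq[OF V(1,3) frame2D(1,2)[OF pres(1) fr(1) V(1)] frame2D(2)[OF Y_pre fr(2) V(1)]])
  then show "\<exists>V e c. opn V \<and> x \<in> V \<and> V \<subseteq> U \<and> frame1 V T e c \<and> h V e = k V e"
    using V fr(3) by blast
qed

lemma tw_in [simp]: "\<lbrakk>opn V; x \<in> sec M V; y \<in> sec M V; \<gamma> \<in> sec Y V\<rbrakk> \<Longrightarrow>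
    tens X E B V (wedge X M V x y) (acl V \<gamma>) \<in> sec T V"
  by simp

lemma tw_res: "\<lbrakk>opn V; x \<in> sec M V; y \<in> sec M V; \<gamma> \<in> sec Y V; opn W; W \<subseteq> V\<rbrakk> \<Longrightarrow>
    restr T V W (tens X E B V (wedge X M V x y) (acl V \<gamma>)) =
      tens X E B W (wedge X M W (restr M V W x) (restr M V W y)) (acl W (restr Y V W \<gamma>))"
  by simp

text \<open>If \<gamma> = c + d \<alpha>, the value at \<gamma> is d times the value at \<alpha>,
  and d depends only on the class of \<gamma>. So the map is built from the functional
  \<open>\<kappa>\<close> on the quotient and the morphism \<open>\<phi>\<close> belonging to
  \<alpha>, without lifting sections of the quotient.\<close>

lemma wood_tensor_map_local:
  assumes fr: "frame2 U Y (yone U) \<alpha> c d" and U: "opn U"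
  obtains h where "h \<in> mod_homs X U T S"
    "\<And>V x y \<gamma>. \<lbrakk>opn V; V \<subseteq> U; x \<in> sec M V; y \<in> sec M V; \<gamma> \<in> sec Y V\<rbrakk> \<Longrightarrow>
      h V (tens X E B V (wedge X M V x y) (acl V \<gamma>)) = w V \<gamma> x y"
proof -
  note f = frame2D[OF Y_pre fr U]
  obtain \<kappa> where fr\<kappa>: "frame1 U B (acl U \<alpha>) \<kappa>" and \<kappa>: "\<And>V \<gamma>. \<lbrakk>opn V; V \<subseteq> U; \<gamma> \<in> sec Y V\<rbrakk> \<Longrightarrow> \<kappa> V (acl V \<gamma>) = d V \<gamma>"
    by (rule B_frame[OF fr U], blast)
  obtain \<phi> where \<phi>: "\<phi> \<in> mod_homs X U E S" "\<And>V x y. \<lbrakk>opn V; V \<subseteq> U; x \<in> sec M V; y \<in> sec M V\<rbrakk> \<Longrightarrow>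
      \<phi> V (wedge X M V x y) = w V (restr Y U V \<alpha>) x y"
    by (rule w_hom[OF U f(2)], blast)
  note hk = hom_simps[OF frame1D(2)[OF pres(4) fr\<kappa> U], simplified] and hp = hom_simps[OF \<phi>(1)]
  have bil: "bilin X U E B S (\<lambda>V \<omega> b. \<kappa> V b \<odot>\<^bsub>S$V\<^esub> \<phi> V \<omega>)"
  proof (rule bilinI)
    fix V \<omega> b assume V: "opn V" "V \<subseteq> U" and \<omega>: "\<omega> \<in> sec E V" and b: "b \<in> sec B V"
    interpret module "R V" "S$V" using pre_module[OF pres(3) V(1)] .
    note c = hk(1)[OF V b] hp(1)[OF V \<omega>]
    show "\<kappa> V b \<odot>\<^bsub>S$V\<^esub> \<phi> V \<omega> \<in> sec S V" using c by simp
    show "\<kappa> V b \<odot>\<^bsub>S$V\<^esub> \<phi> V (\<omega> \<oplus>\<^bsub>E$V\<^esub> \<omega>') = \<kappa> V b \<odot>\<^bsub>S$V\<^esub> \<phi> V \<omega> \<oplus>\<^bsub>S$V\<^esub> \<kappa> V b \<odot>\<^bsub>S$V\<^esub> \<phi> V \<omega>'"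
      if "\<omega>' \<in> sec E V" for \<omega>' using c hp(1)[OF V that] by (simp add: hp(2)[OF V \<omega> that] smult_r_distr)
    show "\<kappa> V (b \<oplus>\<^bsub>B$V\<^esub> b') \<odot>\<^bsub>S$V\<^esub> \<phi> V \<omega> = \<kappa> V b \<odot>\<^bsub>S$V\<^esub> \<phi> V \<omega> \<oplus>\<^bsub>S$V\<^esub> \<kappa> V b' \<odot>\<^bsub>S$V\<^esub> \<phi> V \<omega>"
      if "b' \<in> sec B V" for b' using c hk(1)[OF V that] by (simp add: hk(2)[OF V b that] smult_l_distr)
    { fix r assume r: "r \<in> \<O> V"
      show "\<kappa> V b \<odot>\<^bsub>S$V\<^esub> \<phi> V (r \<odot>\<^bsub>E$V\<^esub> \<omega>) = r \<odot>\<^bsub>S$V\<^esub> (\<kappa> V b \<odot>\<^bsub>S$V\<^esub> \<phi> V \<omega>)"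
        using c r by (simp add: hp(3)[OF V \<omega> r] smult_assoc1[symmetric] m_comm)
      show "\<kappa> V (r \<odot>\<^bsub>B$V\<^esub> b) \<odot>\<^bsub>S$V\<^esub> \<phi> V \<omega> = r \<odot>\<^bsub>S$V\<^esub> (\<kappa> V b \<odot>\<^bsub>S$V\<^esub> \<phi> V \<omega>)"
        using c r by (simp add: hk(3)[OF V b r] smult_assoc1) }
    show "\<kappa> W (restr B V W b) \<odot>\<^bsub>S$W\<^esub> \<phi> W (restr E V W \<omega>) = restr S V W (\<kappa> V b \<odot>\<^bsub>S$V\<^esub> \<phi> V \<omega>)"
      if W: "opn W" "W \<subseteq> V" for W using c V W by (simp add: hk(4)[OF V b W] hp(4)[OF V \<omega> W])
  qed
  obtain h where h: "h \<in> mod_homs X U T S"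
    "\<And>V \<omega> b. \<lbrakk>opn V; V \<subseteq> U; \<omega> \<in> sec E V; b \<in> sec B V\<rbrakk> \<Longrightarrow> h V (tens X E B V \<omega> b) = \<kappa> V b \<odot>\<^bsub>S$V\<^esub> \<phi> V \<omega>"
    by (rule tensor_lift[OF pres(2,4) sym2_sheaf[OF pres(1)] bil U], blast)
  show ?thesis
  proof (rule that[OF h(1)])
    fix V x y \<gamma> assume V: "opn V" "V \<subseteq> U" and x: "x \<in> sec M V" and y: "y \<in> sec M V" and \<gamma>: "\<gamma> \<in> sec Y V"
    have cd: "c V \<gamma> \<in> \<O> V" "d V \<gamma> \<in> \<O> V"
      using hom_closed[OF f(3) V \<gamma>] hom_closed[OF f(4) V \<gamma>] by simp_all
    have a: "restr Y U V \<alpha> \<in> sec Y V" using f(2) U V by simp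
    have "w V \<gamma> x y = w V (lc Y V (c V \<gamma>) (yone V) (d V \<gamma>) (restr Y U V \<alpha>)) x y"
      using f(5)[OF V \<gamma>] U V by simp
    also have "\<dots> = d V \<gamma> \<odot>\<^bsub>S$V\<^esub> w V (restr Y U V \<alpha>) x y"
      using V x y cd a by (simp add: w_simps)
    finally show "h V (tens X E B V (wedge X M V x y) (acl V \<gamma>)) = w V \<gamma> x y"
      using V x y \<gamma> by (simp add: h(2) \<kappa> \<phi>(2))
  qed
qed

text \<open>The local maps are built with a choice of \<alpha>, but their values at (x \<and> y)
  \<otimes> \<gamma> do not mention it. By \<open>T_eqI\<close> these values determine a morphism,
  so that the local maps glue.\<close>

lemma wood_tensor_map_exists:
  obtains h where "h \<in> mod_homs X (pts X) T S"
    "\<And>V x y \<gamma>. \<lbrakk>opn V; x \<in> sec M V; y \<in> sec M V; \<gamma> \<in> sec Y V\<rbrakk> \<Longrightarrow>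
      h V (tens X E B V (wedge X M V x y) (acl V \<gamma>)) = w V \<gamma> x y"
proof -
  define P where "P U h \<longleftrightarrow> (\<forall>V x y \<gamma>. opn V \<longrightarrow> V \<subseteq> U \<longrightarrow> x \<in> sec M V \<longrightarrow> y \<in> sec M V \<longrightarrow> \<gamma> \<in> sec Y V \<longrightarrow>
      h V (tens X E B V (wedge X M V x y) (acl V \<gamma>)) = w V \<gamma> x y)" for U h
  have PD: "h V (tens X E B V (wedge X M V x y) (acl V \<gamma>)) = w V \<gamma> x y"
    if "P U h" "opn V" "V \<subseteq> U" "x \<in> sec M V" "y \<in> sec M V" "\<gamma> \<in> sec Y V" for U h V x y \<gamma>
    using that unfolding P_def by blast
  have SS: "module_sheaf X S" by (rule sym2_sheaf[OF pres(1)])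
  obtain h where h: "h \<in> mod_homs X (pts X) T S" "\<And>x. x \<in> pts X \<Longrightarrow> \<exists>U. opn U \<and> x \<in> U \<and> P U (restrict h (opens X U))"
  proof (rule hom_glue_spec[OF pres(5) SS, of P])
    fix x assume "x \<in> pts X"
    then obtain U \<alpha> c d where U: "opn U" "x \<in> U" "frame2 U Y (yone U) \<alpha> c d"
      using unit_frame[OF opn_top] by metis
    obtain h where "h \<in> mod_homs X U T S"
      "\<And>V x y \<gamma>. \<lbrakk>opn V; V \<subseteq> U; x \<in> sec M V; y \<in> sec M V; \<gamma> \<in> sec Y V\<rbrakk> \<Longrightarrow>
      h V (tens X E B V (wedge X M V x y) (acl V \<gamma>)) = w V \<gamma> x y"
      by (rule wood_tensor_map_local[OF U(3,1)], blast)
    then show "\<exists>U h. opn U \<and> x \<in> U \<and> h \<in> mod_homs X U T S \<and> P U h"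
      using U unfolding P_def by blast
  next
    fix U h k assume U: "opn U" and h: "h \<in> mod_homs X U T S" "k \<in> mod_homs X U T S" "P U h" "P U k"
    show "h = k" by (rule T_eqI[OF h(1,2) SS U]) (simp add: PD[OF h(3)] PD[OF h(4)])
  next
    fix U V h assume V: "opn U" "opn V" "V \<subseteq> U" and h: "P U h"
    show "P V (restrict h (opens X V))"
      unfolding P_def
    proof (intro allI impI)
      fix W x y \<gamma> assume W: "opn W" "W \<subseteq> V" "x \<in> sec M W" "y \<in> sec M W" "\<gamma> \<in> sec Y W"
      moreover from W V have "W \<subseteq> U" by order
      ultimately show "restrict h (opens X V) W (tens X E B W (wedge X M W x y) (acl W \<gamma>)) = w W \<gamma> x y"
        using PD[OF h] by simp
    qed
  qed blast
  show ?thesis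
  proof (rule that[OF h(1)])
    fix V x y \<gamma> assume V: "opn V" and x: "x \<in> sec M V" and y: "y \<in> sec M V" and \<gamma>: "\<gamma> \<in> sec Y V"
    let ?t = "tens X E B V (wedge X M V x y) (acl V \<gamma>)"
    have t: "?t \<in> sec T V" using V x y \<gamma> by (rule tw_in)
    \<comment> \<open>The glued morphism is known to have the right values only near each point, so
      the equality over \<open>V\<close> is checked locally.\<close>
    show "h V ?t = w V \<gamma> x y"
    proof (rule sheaf_eqI[OF module_sheaf_sheaf[OF SS] V])
      show "h V ?t \<in> sec S V" by (rule hom_closed[OF h(1) V opn_pts[OF V] t])
      show "w V \<gamma> x y \<in> sec S V" using V x y \<gamma> by (simp add: w_simps)
      fix p assume p: "p \<in> V"
      then have "p \<in> pts X" using opn_pts[OF V] by blast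
      from h(2)[OF this] obtain U where U: "opn U" "p \<in> U" "P U (restrict h (opens X U))" by blast
      have Z: "opn (U \<inter> V)" "U \<inter> V \<subseteq> U" "U \<inter> V \<subseteq> V" using U V by auto
      have "restr S V (U \<inter> V) (h V ?t) = h (U \<inter> V) (restr T V (U \<inter> V) ?t)"
        using hom_res[OF h(1) V opn_pts[OF V] t Z(1,3)] by simp
      also have "\<dots> = w (U \<inter> V) (restr Y V (U \<inter> V) \<gamma>) (restr M V (U \<inter> V) x) (restr M V (U \<inter> V) y)"
        using PD[OF U(3) Z(1,2), of "restr M V (U \<inter> V) x" "restr M V (U \<inter> V) y" "restr Y V (U \<inter> V) \<gamma>"] V x y \<gamma> Z
        by (simp add: tw_res del: tens_simps wedge_simps acl_simps)
      also have "\<dots> = restr S V (U \<inter> V) (w V \<gamma> x y)" by (rule w_simps(5)[OF V \<gamma> x y Z(1,3)])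
      finally show "\<exists>W. opn W \<and> p \<in> W \<and> W \<subseteq> V \<and> restr S V W (h V ?t) = restr S V W (w V \<gamma> x y)"
        using Z U(2) p by blast
    qed
  qed
qed

lemma wood_tensor_map_facts:
  shows wood_tensor_map_hom: "wood_tensor_map X Y I \<in> mod_homs X (pts X) T S"
    and wood_tensor_map_tens: "\<And>V x y \<gamma>. \<lbrakk>opn V; x \<in> sec M V; y \<in> sec M V; \<gamma> \<in> sec Y V\<rbrakk> \<Longrightarrow>
      wood_tensor_map X Y I V (tens X E B V (wedge X M V x y) (acl V \<gamma>)) = w V \<gamma> x y"
proof -
  obtain h where h: "h \<in> mod_homs X (pts X) T S"
    "\<And>V x y \<gamma>. \<lbrakk>opn V; x \<in> sec M V; y \<in> sec M V; \<gamma> \<in> sec Y V\<rbrakk> \<Longrightarrow>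
      h V (tens X E B V (wedge X M V x y) (acl V \<gamma>)) = w V \<gamma> x y"
    by (rule wood_tensor_map_exists, blast)
  have "wood_tensor_map X Y I = h"
    unfolding wood_tensor_map_def Let_def w_def[symmetric]
  proof (rule the_equality)
    show "h \<in> mod_homs X (pts X) T S \<and> (\<forall>U\<in>opens X (pts X). \<forall>x\<in>sec I U. \<forall>y\<in>sec I U. \<forall>\<gamma>\<in>sec Y U.
       h U (tens X E B U (wedge X M U x y) (acl U \<gamma>)) = w U \<gamma> x y)"
      using h by (simp add: rs_simps(1))
    fix k assume k: "k \<in> mod_homs X (pts X) T S \<and> (\<forall>U\<in>opens X (pts X). \<forall>x\<in>sec I U. \<forall>y\<in>sec I U. \<forall>\<gamma>\<in>sec Y U.
       k U (tens X E B U (wedge X M U x y) (acl U \<gamma>)) = w U \<gamma> x y)"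
    show "k = h"
      by (rule T_eqI[OF conjunct1[OF k] h(1) sym2_sheaf[OF pres(1)] opn_top])
        (use conjunct2[OF k] h(2) in \<open>simp add: rs_simps(1)\<close>)
  qed
  then show "wood_tensor_map X Y I \<in> mod_homs X (pts X) T S"
    "\<And>V x y \<gamma>. \<lbrakk>opn V; x \<in> sec M V; y \<in> sec M V; \<gamma> \<in> sec Y V\<rbrakk> \<Longrightarrow>
      wood_tensor_map X Y I V (tens X E B V (wedge X M V x y) (acl V \<gamma>)) = w V \<gamma> x y"
    using h by simp_all
qed

end

section \<open>Pairing sections of the target with (x \<and> y) \<otimes> \<gamma>\<close>

context quad_mod
begin

text \<open>The value of a section of \<open>L\<close> against (x \<and> y) \<otimes> \<gamma>.
  Identities between values of Wood's map are verified on these scalars.\<close>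

definition wp :: "'a set \<Rightarrow> 'm \<Rightarrow> 'm \<Rightarrow> 'b \<Rightarrow> _ \<Rightarrow> 'r" where
  "wp V x y \<gamma> s = tod V (tens X E B V (wedge X M V x y) (acl V \<gamma>)) V s"

lemma tod_iso: "tod \<in> mod_isos X T (dual X L)"
  by (rule tensor_to_dual_iso[OF E_line B_line])

lemma tod_in: "opn V \<Longrightarrow> t \<in> sec T V \<Longrightarrow> tod V t \<in> mod_homs X V L OX"
  using hom_closed[OF iso_hom[OF tod_iso] _ opn_pts] by simp

lemma wp_simps:
  assumes V: "opn V" and xy: "x \<in> sec M V" "y \<in> sec M V" and \<gamma>: "\<gamma> \<in> sec Y V" and s: "s \<in> sec L V"
  shows "wp V x y \<gamma> s \<in> \<O> V"
    "s' \<in> sec L V \<Longrightarrow> wp V x y \<gamma> (s \<oplus>\<^bsub>L$V\<^esub> s') = wp V x y \<gamma> s \<oplus>\<^bsub>R V\<^esub> wp V x y \<gamma> s'"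
    "s' \<in> sec L V \<Longrightarrow> wp V x y \<gamma> (s \<ominus>\<^bsub>L$V\<^esub> s') = wp V x y \<gamma> s \<ominus>\<^bsub>R V\<^esub> wp V x y \<gamma> s'"
    "r \<in> \<O> V \<Longrightarrow> wp V x y \<gamma> (r \<odot>\<^bsub>L$V\<^esub> s) = r \<otimes>\<^bsub>R V\<^esub> wp V x y \<gamma> s"
proof -
  note h = tod_in[OF V tw_in[OF V xy \<gamma>]]
  note hs = hom_simps[OF h V order_refl s, simplified]
  show "wp V x y \<gamma> s \<in> \<O> V"
    "s' \<in> sec L V \<Longrightarrow> wp V x y \<gamma> (s \<oplus>\<^bsub>L$V\<^esub> s') = wp V x y \<gamma> s \<oplus>\<^bsub>R V\<^esub> wp V x y \<gamma> s'"
    "r \<in> \<O> V \<Longrightarrow> wp V x y \<gamma> (r \<odot>\<^bsub>L$V\<^esub> s) = r \<otimes>\<^bsub>R V\<^esub> wp V x y \<gamma> s"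
    unfolding wp_def using hs by simp_all
  have hn: "tod V (tens X E B V (wedge X M V x y) (acl V \<gamma>)) V (\<ominus>\<^bsub>L$V\<^esub> s') =
      \<ominus>\<^bsub>R V\<^esub> tod V (tens X E B V (wedge X M V x y) (acl V \<gamma>)) V s'" if s': "s' \<in> sec L V" for s'
  proof -
    interpret cring "R V" using cring_R[OF V] .
    note hs' = hom_simps[OF h V order_refl s', simplified]
    show ?thesis using hs'(3)[of "\<ominus>\<^bsub>R V\<^esub> \<one>\<^bsub>R V\<^esub>"] hs'(1) s' V by (simp add: mod_minus l_minus)
  qed
  show "s' \<in> sec L V \<Longrightarrow> wp V x y \<gamma> (s \<ominus>\<^bsub>L$V\<^esub> s') = wp V x y \<gamma> s \<ominus>\<^bsub>R V\<^esub> wp V x y \<gamma> s'"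
    unfolding wp_def a_minus_def using hs(2)[of "\<ominus>\<^bsub>L$V\<^esub> s'"] hn V by simp
qed

lemma wp_tens:
  assumes V: "opn V" and xy: "x \<in> sec M V" "y \<in> sec M V" and \<gamma>: "\<gamma> \<in> sec Y V"
    and \<xi>: "\<xi> \<in> sec (dual X E) V" and \<delta>: "\<delta> \<in> sec (dual X B) V"
  shows "wp V x y \<gamma> (tens X (dual X E) (dual X B) V \<xi> \<delta>) = \<xi> V (wedge X M V x y) \<otimes>\<^bsub>R V\<^esub> \<delta> V (acl V \<gamma>)"
  unfolding wp_def
  using tensor_to_dual_tens[OF pres(2,4) V V order_refl, of "wedge X M V x y" "acl V \<gamma>" \<xi> \<delta>] V xy \<gamma> \<xi> \<delta> by simp

text \<open>For fixed \<open>s\<close> the pairing is a functional on \<open>T\<close>, so that two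
  sections of \<open>L\<close> can be compared by \<open>T_eqI\<close>.\<close>

lemma wp_hom:
  assumes U: "opn U" and s: "s \<in> sec L U"
  shows "mkhom X U T (\<lambda>V t. tod V t V (restr L U V s)) \<in> mod_homs X U T OX"
proof (rule mkhomI[OF pres(5)])
  note h = hom_simps[OF iso_hom[OF tod_iso] _ opn_pts]
  fix V t assume V: "opn V" "V \<subseteq> U" and t: "t \<in> sec T V"
  have sV: "restr L U V s \<in> sec L V" using U V s by simp
  note ht = hom_simps[OF tod_in[OF V(1) t] V(1) order_refl sV, simplified]
  show "tod V t V (restr L U V s) \<in> sec OX V" using ht(1) by simp
  show "tod V (t \<oplus>\<^bsub>T$V\<^esub> t') V (restr L U V s) =
      tod V t V (restr L U V s) \<oplus>\<^bsub>OX$V\<^esub> tod V t' V (restr L U V s)"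
    if "t' \<in> sec T V" for t' using h(2)[OF V(1) V(1) t that] V sV by simp
  show "tod V (r \<odot>\<^bsub>T$V\<^esub> t) V (restr L U V s) = r \<odot>\<^bsub>OX$V\<^esub> tod V t V (restr L U V s)"
    if "r \<in> \<O> V" for r using h(3)[OF V(1) V(1) t that] V sV that by simp
  show "tod W (restr T V W t) W (restr L U W s) = restr OX V W (tod V t V (restr L U V s))"
    if W: "opn W" "W \<subseteq> V" for W
    using h(4)[OF V(1) V(1) t W] ht(4)[OF W] U V s W by simp
qed

text \<open>By \<open>T_eqI\<close> the two sections pair equally with all of \<open>T\<close>,
  which is the dual of \<open>L\<close> through \<open>tod\<close>. As a line bundle,
  \<open>L\<close> embeds in its bidual.\<close>

lemma wood_eqI:
  assumes U: "opn U" and s: "s \<in> sec L U" "s' \<in> sec L U"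
    and eq: "\<And>V x y \<gamma>. \<lbrakk>opn V; V \<subseteq> U; x \<in> sec M V; y \<in> sec M V; \<gamma> \<in> sec Y V\<rbrakk> \<Longrightarrow>
      wp V x y \<gamma> (restr L U V s) = wp V x y \<gamma> (restr L U V s')"
  shows "s = s'"
proof -
  have pair_eq: "mkhom X U T (\<lambda>V t. tod V t V (restr L U V s)) = mkhom X U T (\<lambda>V t. tod V t V (restr L U V s'))"
  proof (rule T_eqI[OF wp_hom[OF U s(1)] wp_hom[OF U s(2)] struct_sheaf U])
    fix V x y \<gamma> assume V: "opn V" "V \<subseteq> U" and xy: "x \<in> sec M V" "y \<in> sec M V" "\<gamma> \<in> sec Y V"
    show "mkhom X U T (\<lambda>V t. tod V t V (restr L U V s)) V (tens X E B V (wedge X M V x y) (acl V \<gamma>)) =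
      mkhom X U T (\<lambda>V t. tod V t V (restr L U V s')) V (tens X E B V (wedge X M V x y) (acl V \<gamma>))"
      unfolding mkhom_apply[OF V tw_in[OF V(1) xy]] wp_def[symmetric] by (rule eq[OF V xy])
  qed
  have "ev U L s = ev U L s'"
  proof (rule hom_eqI[OF ev_hom[OF pres(9) U s(1)] ev_hom[OF pres(9) U s(2)]])
    fix V \<xi> assume V: "opn V" "V \<subseteq> U" and \<xi>: "\<xi> \<in> sec (dual X L) V"
    define t where "t = mod_inv X T (dual X L) tod V \<xi>"
    have t: "t \<in> sec T V" "tod V t = \<xi>"
      using mod_inv_closed[OF tod_iso V(1) \<xi>] mod_inv_right[OF tod_iso V(1) \<xi>] by (simp_all add: t_def)
    have "mkhom X U T (\<lambda>V t. tod V t V (restr L U V s)) V t = mkhom X U T (\<lambda>V t. tod V t V (restr L U V s')) V t"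
      unfolding pair_eq ..
    then have "\<xi> V (restr L U V s) = \<xi> V (restr L U V s')"
      unfolding mkhom_apply[OF V t(1)] t(2) .
    then show "ev U L s V \<xi> = ev U L s' V \<xi>" using V \<xi> by simp
  qed
  then show ?thesis
    using iso_inj[OF eval_bidual_iso[OF L_line] U s] eval_bidual_eq[OF U s(1)] eval_bidual_eq[OF U s(2)] by simp
qed

section \<open>The quadratic map\<close>

context
  fixes U \<theta>
  assumes U: "opn U" and \<theta>: "\<theta> \<in> sec (dual X M) U"
begin

text \<open>The form \<theta>(x) \<theta>(y) is symmetric and so factors through the symmetric
  square. It belongs to \<theta> \<otimes> \<theta> because it has the values that
  \<open>tensor_of_duals\<close> gives on pure tensors, and such a functional is unique.\<close>

lemma square_functional:
  defines "f \<equiv> functional_of_symmetric_tensor X M U (tens X (dual X M) (dual X M) U \<theta> \<theta>)"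
  shows "f \<in> mod_homs X U S OX"
    and "\<And>V x y. \<lbrakk>opn V; V \<subseteq> U; x \<in> sec M V; y \<in> sec M V\<rbrakk> \<Longrightarrow> f V (sprod X M V x y) = \<theta> V x \<otimes>\<^bsub>R V\<^esub> \<theta> V y"
proof -
  note h = hom_simps[OF \<theta> [unfolded dual_sec], simplified]
  have bil: "bilin X U M M OX (\<lambda>V x y. \<theta> V x \<otimes>\<^bsub>R V\<^esub> \<theta> V y)"
    by (rule bilinI) (simp_all add: h R_distr R_ac)
  have sym: "\<theta> V x \<otimes>\<^bsub>R V\<^esub> \<theta> V y = \<theta> V y \<otimes>\<^bsub>R V\<^esub> \<theta> V x"
    if "opn V" "V \<subseteq> U" "x \<in> sec M V" "y \<in> sec M V" for V x y
    using that h(1) by (simp add: R_ac)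
  obtain g where g: "g \<in> mod_homs X U S OX"
    "\<And>V x y. \<lbrakk>opn V; V \<subseteq> U; x \<in> sec M V; y \<in> sec M V\<rbrakk> \<Longrightarrow> g V (sprod X M V x y) = \<theta> V x \<otimes>\<^bsub>R V\<^esub> \<theta> V y"
    by (rule sym2_lift[OF pres(1) struct_sheaf bil U sym], assumption+, blast)
  have tt: "tensor_of_duals X M M U (tens X (dual X M) (dual X M) U \<theta> \<theta>) V (tens X M M V x y) = \<theta> V x \<otimes>\<^bsub>R V\<^esub> \<theta> V y"
    if "opn V" "V \<subseteq> U" "x \<in> sec M V" "y \<in> sec M V" for V x y
    using tensor_of_duals_tens[OF pres(1,1) U that(1,2) \<theta> \<theta> that(3,4)] .
  have "f = g"
    unfolding f_def functional_of_symmetric_tensor_def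
  proof (rule the_equality)
    show "g \<in> sec (dual X S) U \<and> (\<forall>V\<in>opens X U. \<forall>x\<in>sec M V. \<forall>y\<in>sec M V.
       g V (sprod X M V x y) = tensor_of_duals X M M U (tens X (dual X M) (dual X M) U \<theta> \<theta>) V (tens X M M V x y))"
      using g tt by simp
    fix k assume k: "k \<in> sec (dual X S) U \<and> (\<forall>V\<in>opens X U. \<forall>x\<in>sec M V. \<forall>y\<in>sec M V.
       k V (sprod X M V x y) = tensor_of_duals X M M U (tens X (dual X M) (dual X M) U \<theta> \<theta>) V (tens X M M V x y))"
    show "k = g"
      by (rule sym2_hom_eqI[OF pres(1) _ g(1) struct_sheaf]) (use k g(2) tt in simp_all)
  qed
  then show "f \<in> mod_homs X U S OX"
    "\<And>V x y. \<lbrakk>opn V; V \<subseteq> U; x \<in> sec M V; y \<in> sec M V\<rbrakk> \<Longrightarrow> f V (sprod X M V x y) = \<theta> V x \<otimes>\<^bsub>R V\<^esub> \<theta> V y"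
    using g by simp_all
qed

text \<open>Wood's map is defined through two inverses, and evaluating at \<open>tod V t\<close>
  cancels both: the inverse of \<open>eval_bidual\<close> turns into evaluation, and the inverse of
  \<open>tod\<close> inside \<open>\<Psi>\<close> returns \<open>t\<close>.\<close>

lemma wood_map_facts:
  shows wood_map_in: "wood_map X Y I U \<theta> \<in> sec L U"
    and wood_map_wp: "\<And>V x y \<gamma>. \<lbrakk>opn V; V \<subseteq> U; x \<in> sec M V; y \<in> sec M V; \<gamma> \<in> sec Y V\<rbrakk> \<Longrightarrow>
      wp V x y \<gamma> (restr L U V (wood_map X Y I U \<theta>)) =
        cross V (\<theta> V (\<gamma> \<odot>\<^bsub>I$V\<^esub> y)) (\<theta> V x) (\<theta> V (\<gamma> \<odot>\<^bsub>I$V\<^esub> x)) (\<theta> V y)"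
proof -
  define f where "f = functional_of_symmetric_tensor X M U (tens X (dual X M) (dual X M) U \<theta> \<theta>)"
  note f = square_functional[folded f_def]
  define \<Psi> where "\<Psi> = mod_comp X (dual X L) (wood_tensor_map X Y I) (mod_inv X T (dual X L) tod)"
  have \<Psi>: "\<Psi> \<in> mod_homs X (pts X) (dual X L) S" unfolding \<Psi>_def
    by (rule mod_comp_hom[OF pres(10) mod_inv_hom[OF tod_iso pres(5,10)] wood_tensor_map_hom])
  define g where "g = dual_map X (dual X L) S \<Psi> U f"
  have g: "g \<in> sec (dual X (dual X L)) U"
    unfolding g_def by (rule dual_map_closed[OF pres(10) pres(3) \<Psi> U]) (simp add: f(1))
  have q: "wood_map X Y I U \<theta> = mod_inv X L (dual X (dual X L)) (eval_bidual X L) U g"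
    using U \<theta> by (simp add: wood_map_def Let_def wood_target_def wood_Psi_def g_def \<Psi>_def f_def)
  note eb = eval_bidual_iso[OF L_line]
  show q_in: "wood_map X Y I U \<theta> \<in> sec L U" unfolding q by (rule mod_inv_closed[OF eb U g])
  \<comment> \<open>The value of Wood's map is by definition the preimage of \<open>g\<close> under
    biduality, so evaluation at it is \<open>g\<close>.\<close>
  have evq: "ev U L (wood_map X Y I U \<theta>) = g"
    using mod_inv_right[OF eb U g] eval_bidual_eq[OF U q_in] unfolding q by simp
  fix V x y \<gamma> assume V: "opn V" "V \<subseteq> U" and xy: "x \<in> sec M V" "y \<in> sec M V" and \<gamma>: "\<gamma> \<in> sec Y V"
  define t where "t = tens X E B V (wedge X M V x y) (acl V \<gamma>)"
  have t: "t \<in> sec T V" unfolding t_def by (rule tw_in[OF V(1) xy \<gamma>])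
  have \<xi>: "tod V t \<in> sec (dual X L) V" using tod_in[OF V(1) t] by simp
  have "wp V x y \<gamma> (restr L U V (wood_map X Y I U \<theta>)) = ev U L (wood_map X Y I U \<theta>) V (tod V t)"
    using V \<xi> by (simp add: wp_def t_def)
  also have "\<dots> = f V (\<Psi> V (tod V t))"
    unfolding evq g_def by (rule dual_map_apply[OF pres(10,3) \<Psi> U f(1) V \<xi>])
  also have "\<Psi> V (tod V t) = w V \<gamma> x y"
    unfolding \<Psi>_def mod_comp_apply[OF V(1) \<xi>] mod_inv_left[OF tod_iso V(1) t]
    unfolding t_def by (rule wood_tensor_map_tens[OF V(1) xy \<gamma>])
  also have "f V (w V \<gamma> x y) = cross V (\<theta> V (\<gamma> \<odot>\<^bsub>I$V\<^esub> y)) (\<theta> V x) (\<theta> V (\<gamma> \<odot>\<^bsub>I$V\<^esub> x)) (\<theta> V y)"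
  proof -
    interpret cring "R V" using cring_R[OF V(1)] .
    have th: "\<theta> V z \<in> \<O> V" if "z \<in> sec M V" for z
      using dual_closed[OF U \<theta> [unfolded dual_sec] V that] .
    have in_S: "sprod X M V (\<gamma> \<odot>\<^bsub>I$V\<^esub> y) x \<in> sec S V" "sprod X M V (\<gamma> \<odot>\<^bsub>I$V\<^esub> x) y \<in> sec S V"
      using V xy \<gamma> by simp_all
    show ?thesis unfolding w_def mod_diff[OF pres(3) V(1) in_S]
      using V xy \<gamma> in_S th f(2)[OF V] by (simp add: hom_add[OF f(1) V] hom_smult[OF f(1) V] a_minus_def l_minus)
  qed
  finally show "wp V x y \<gamma> (restr L U V (wood_map X Y I U \<theta>)) =
        cross V (\<theta> V (\<gamma> \<odot>\<^bsub>I$V\<^esub> y)) (\<theta> V x) (\<theta> V (\<gamma> \<odot>\<^bsub>I$V\<^esub> x)) (\<theta> V y)" .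
qed

end

text \<open>Polarizing the expression that is quadratic in \<theta> leaves its mixed terms, in which
  the linearity of the polar form is visible.\<close>

lemma wood_polar_wp:
  assumes U: "opn U" and \<theta>: "\<theta> \<in> sec (dual X M) U" "\<eta> \<in> sec (dual X M) U"
  defines "b \<equiv> polar (dual X M$U) (L$U) (wood_map X Y I U)"
  shows "b \<theta> \<eta> \<in> sec L U"
    and "\<And>V x y \<gamma>. \<lbrakk>opn V; V \<subseteq> U; x \<in> sec M V; y \<in> sec M V; \<gamma> \<in> sec Y V\<rbrakk> \<Longrightarrow>
      wp V x y \<gamma> (restr L U V (b \<theta> \<eta>)) =
        dot V (\<theta> V (\<gamma> \<odot>\<^bsub>I$V\<^esub> y)) (\<eta> V x) (\<eta> V (\<gamma> \<odot>\<^bsub>I$V\<^esub> y)) (\<theta> V x) \<ominus>\<^bsub>R V\<^esub>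
        dot V (\<theta> V (\<gamma> \<odot>\<^bsub>I$V\<^esub> x)) (\<eta> V y) (\<eta> V (\<gamma> \<odot>\<^bsub>I$V\<^esub> x)) (\<theta> V y)"
proof -
  define s where "s = \<theta> \<oplus>\<^bsub>dual X M$U\<^esub> \<eta>"
  have s: "s \<in> sec (dual X M) U" unfolding s_def by (rule mod_closed(2)[OF pres(6) U \<theta>])
  note qs = wood_map_in[OF U s] wood_map_in[OF U \<theta>(1)] wood_map_in[OF U \<theta>(2)]
  have b: "b \<theta> \<eta> = (wood_map X Y I U s \<ominus>\<^bsub>L$U\<^esub> wood_map X Y I U \<theta>) \<ominus>\<^bsub>L$U\<^esub> wood_map X Y I U \<eta>"
    by (simp add: b_def polar_def s_def)
  show "b \<theta> \<eta> \<in> sec L U" unfolding b using U qs by simp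
  fix V x y \<gamma> assume V: "opn V" "V \<subseteq> U" and xy: "x \<in> sec M V" "y \<in> sec M V" and \<gamma>: "\<gamma> \<in> sec Y V"
  interpret cring "R V" using cring_R[OF V(1)] .
  have act: "\<gamma> \<odot>\<^bsub>I$V\<^esub> x \<in> sec M V" "\<gamma> \<odot>\<^bsub>I$V\<^esub> y \<in> sec M V" using V xy \<gamma> by simp_all
  note th = dual_closed[OF U \<theta>(1)[unfolded dual_sec] V] dual_closed[OF U \<theta>(2)[unfolded dual_sec] V]
  \<comment> \<open>Abstracting the values of the functionals to ring elements leaves a polynomial
    identity for \<open>algebra\<close>.\<close>
  define t1 t2 t3 t4 where "t1 = \<theta> V x" and "t2 = \<theta> V y" and "t3 = \<theta> V (\<gamma> \<odot>\<^bsub>I$V\<^esub> x)" and "t4 = \<theta> V (\<gamma> \<odot>\<^bsub>I$V\<^esub> y)"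
  define e1 e2 e3 e4 where "e1 = \<eta> V x" and "e2 = \<eta> V y" and "e3 = \<eta> V (\<gamma> \<odot>\<^bsub>I$V\<^esub> x)" and "e4 = \<eta> V (\<gamma> \<odot>\<^bsub>I$V\<^esub> y)"
  have in_R: "t1 \<in> \<O> V" "t2 \<in> \<O> V" "t3 \<in> \<O> V" "t4 \<in> \<O> V"
    "e1 \<in> \<O> V" "e2 \<in> \<O> V" "e3 \<in> \<O> V" "e4 \<in> \<O> V"
    using th xy act by (simp_all add: t1_def t2_def t3_def t4_def e1_def e2_def e3_def e4_def)
  have sv: "s V x = t1 \<oplus>\<^bsub>R V\<^esub> e1" "s V y = t2 \<oplus>\<^bsub>R V\<^esub> e2" "s V (\<gamma> \<odot>\<^bsub>I$V\<^esub> x) = t3 \<oplus>\<^bsub>R V\<^esub> e3" "s V (\<gamma> \<odot>\<^bsub>I$V\<^esub> y) = t4 \<oplus>\<^bsub>R V\<^esub> e4"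
    using V xy act by (simp_all add: s_def t1_def t2_def t3_def t4_def e1_def e2_def e3_def e4_def)
  have rq: "restr L U V (wood_map X Y I U s) \<in> sec L V" "restr L U V (wood_map X Y I U \<theta>) \<in> sec L V" "restr L U V (wood_map X Y I U \<eta>) \<in> sec L V"
    using U V qs by simp_all
  have "wp V x y \<gamma> (restr L U V (b \<theta> \<eta>)) = cross V (t4 \<oplus>\<^bsub>R V\<^esub> e4) (t1 \<oplus>\<^bsub>R V\<^esub> e1) (t3 \<oplus>\<^bsub>R V\<^esub> e3) (t2 \<oplus>\<^bsub>R V\<^esub> e2)
      \<ominus>\<^bsub>R V\<^esub> cross V t4 t1 t3 t2 \<ominus>\<^bsub>R V\<^esub> cross V e4 e1 e3 e2"
    unfolding b using U V qs rq xy \<gamma> wood_map_wp[OF U s V xy \<gamma>] wood_map_wp[OF U \<theta>(1) V xy \<gamma>] wood_map_wp[OF U \<theta>(2) V xy \<gamma>]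
    by (simp add: wp_simps sv t1_def[symmetric] t2_def[symmetric] t3_def[symmetric] t4_def[symmetric]
        e1_def[symmetric] e2_def[symmetric] e3_def[symmetric] e4_def[symmetric])
  also have "\<dots> = dot V t4 e1 e4 t1 \<ominus>\<^bsub>R V\<^esub> dot V t3 e2 e3 t2"
    using in_R by algebra
  finally show "wp V x y \<gamma> (restr L U V (b \<theta> \<eta>)) =
        dot V (\<theta> V (\<gamma> \<odot>\<^bsub>I$V\<^esub> y)) (\<eta> V x) (\<eta> V (\<gamma> \<odot>\<^bsub>I$V\<^esub> y)) (\<theta> V x) \<ominus>\<^bsub>R V\<^esub>
        dot V (\<theta> V (\<gamma> \<odot>\<^bsub>I$V\<^esub> x)) (\<eta> V y) (\<eta> V (\<gamma> \<odot>\<^bsub>I$V\<^esub> x)) (\<theta> V y)"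
    by (simp add: t1_def t2_def t3_def t4_def e1_def e2_def e3_def e4_def)
qed

text \<open>By \<open>wood_eqI\<close> each law becomes an identity between polynomials in the
  values of the functionals at x, y, \<gamma> x and \<gamma> y.\<close>

lemma wood_quadratic: "quadratic_map X (dual X M) L (wood_map X Y I)"
  unfolding quadratic_map_def
proof (intro ballI conjI)
  fix U \<theta> assume "U \<in> opens X (pts X)" and \<theta>: "\<theta> \<in> sec (dual X M) U"
  then have U: "opn U" by simp
  note D = pres(6)
  let ?b = "polar (dual X M$U) (L$U) (wood_map X Y I U)"
  show "wood_map X Y I U \<theta> \<in> sec L U" by (rule wood_map_in[OF U \<theta>])
  note th = dual_closed[OF U \<theta> [unfolded dual_sec]]
  { fix V assume "V \<in> opens X U"
    then have V: "opn V" "V \<subseteq> U" by auto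
    have \<theta>V: "restr (dual X M) U V \<theta> \<in> sec (dual X M) V" by (rule res_closed[OF D U V \<theta>])
    show "wood_map X Y I V (restr (dual X M) U V \<theta>) = restr L U V (wood_map X Y I U \<theta>)"
    proof (rule wood_eqI[OF V(1) wood_map_in[OF V(1) \<theta>V]])
      show "restr L U V (wood_map X Y I U \<theta>) \<in> sec L V" using U V wood_map_in[OF U \<theta>] by simp
      fix W x y \<gamma> assume W: "opn W" "W \<subseteq> V" and xy: "x \<in> sec M W" "y \<in> sec M W" "\<gamma> \<in> sec Y W"
      have WU: "W \<subseteq> U" using W V by order
      show "wp W x y \<gamma> (restr L V W (wood_map X Y I V (restr (dual X M) U V \<theta>))) =
          wp W x y \<gamma> (restr L V W (restr L U V (wood_map X Y I U \<theta>)))"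
        using wood_map_wp[OF V(1) \<theta>V W xy] wood_map_wp[OF U \<theta> W(1) WU xy] U V W wood_map_in[OF U \<theta>] by simp
    qed }
  { fix r assume r: "r \<in> \<O> U"
    have r\<theta>: "r \<odot>\<^bsub>dual X M$U\<^esub> \<theta> \<in> sec (dual X M) U" by (rule mod_closed(5)[OF D U r \<theta>])
    show "wood_map X Y I U (r \<odot>\<^bsub>dual X M$U\<^esub> \<theta>) = (r \<otimes>\<^bsub>R U\<^esub> r) \<odot>\<^bsub>L$U\<^esub> wood_map X Y I U \<theta>"
    proof (rule wood_eqI[OF U wood_map_in[OF U r\<theta>]])
      show "(r \<otimes>\<^bsub>R U\<^esub> r) \<odot>\<^bsub>L$U\<^esub> wood_map X Y I U \<theta> \<in> sec L U" using U r wood_map_in[OF U \<theta>] by simp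
      fix V x y \<gamma> assume V: "opn V" "V \<subseteq> U" and xy: "x \<in> sec M V" "y \<in> sec M V" and \<gamma>: "\<gamma> \<in> sec Y V"
      interpret cring "R V" using cring_R[OF V(1)] .
      have act: "\<gamma> \<odot>\<^bsub>I$V\<^esub> x \<in> sec M V" "\<gamma> \<odot>\<^bsub>I$V\<^esub> y \<in> sec M V" using V xy \<gamma> by simp_all
      define t1 t2 t3 t4 where "t1 = \<theta> V x" and "t2 = \<theta> V y" and "t3 = \<theta> V (\<gamma> \<odot>\<^bsub>I$V\<^esub> x)" and "t4 = \<theta> V (\<gamma> \<odot>\<^bsub>I$V\<^esub> y)"
      define r' where "r' = rr U V r"
      have in_R: "t1 \<in> \<O> V" "t2 \<in> \<O> V" "t3 \<in> \<O> V" "t4 \<in> \<O> V" "r' \<in> \<O> V"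
        using th[OF V] xy act U V r by (simp_all add: t1_def t2_def t3_def t4_def r'_def)
      have "wp V x y \<gamma> (restr L U V (wood_map X Y I U (r \<odot>\<^bsub>dual X M$U\<^esub> \<theta>))) =
          cross V (r' \<otimes>\<^bsub>R V\<^esub> t4) (r' \<otimes>\<^bsub>R V\<^esub> t1) (r' \<otimes>\<^bsub>R V\<^esub> t3) (r' \<otimes>\<^bsub>R V\<^esub> t2)"
        using wood_map_wp[OF U r\<theta> V xy \<gamma>] V xy act by (simp add: t1_def t2_def t3_def t4_def r'_def)
      also have "\<dots> = (r' \<otimes>\<^bsub>R V\<^esub> r') \<otimes>\<^bsub>R V\<^esub> cross V t4 t1 t3 t2"
        using in_R by algebra
      also have "\<dots> = wp V x y \<gamma> (restr L U V ((r \<otimes>\<^bsub>R U\<^esub> r) \<odot>\<^bsub>L$U\<^esub> wood_map X Y I U \<theta>))"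
        using wood_map_wp[OF U \<theta> V xy \<gamma>] U V xy \<gamma> r wood_map_in[OF U \<theta>]
        by (simp add: wp_simps t1_def t2_def t3_def t4_def r'_def)
      finally show "wp V x y \<gamma> (restr L U V (wood_map X Y I U (r \<odot>\<^bsub>dual X M$U\<^esub> \<theta>))) =
          wp V x y \<gamma> (restr L U V ((r \<otimes>\<^bsub>R U\<^esub> r) \<odot>\<^bsub>L$U\<^esub> wood_map X Y I U \<theta>))" .
    qed }
  fix \<eta> assume \<eta>: "\<eta> \<in> sec (dual X M) U"
  note et = dual_closed[OF U \<eta> [unfolded dual_sec]]
  { fix \<zeta> assume \<zeta>: "\<zeta> \<in> sec (dual X M) U"
    note ze = dual_closed[OF U \<zeta> [unfolded dual_sec]]
    have s: "\<theta> \<oplus>\<^bsub>dual X M$U\<^esub> \<eta> \<in> sec (dual X M) U" by (rule mod_closed(2)[OF D U \<theta> \<eta>])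
    note p = wood_polar_wp[OF U s \<zeta>] wood_polar_wp[OF U \<theta> \<zeta>] wood_polar_wp[OF U \<eta> \<zeta>]
    show "?b (\<theta> \<oplus>\<^bsub>dual X M$U\<^esub> \<eta>) \<zeta> = ?b \<theta> \<zeta> \<oplus>\<^bsub>L$U\<^esub> ?b \<eta> \<zeta>"
    proof (rule wood_eqI[OF U p(1)])
      show "?b \<theta> \<zeta> \<oplus>\<^bsub>L$U\<^esub> ?b \<eta> \<zeta> \<in> sec L U" using U p(3,5) by simp
      fix V x y \<gamma> assume V: "opn V" "V \<subseteq> U" and xy: "x \<in> sec M V" "y \<in> sec M V" and \<gamma>: "\<gamma> \<in> sec Y V"
      interpret cring "R V" using cring_R[OF V(1)] .
      have act: "\<gamma> \<odot>\<^bsub>I$V\<^esub> x \<in> sec M V" "\<gamma> \<odot>\<^bsub>I$V\<^esub> y \<in> sec M V" using V xy \<gamma> by simp_all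
      note in_R = th[OF V xy(1)] th[OF V xy(2)] th[OF V act(1)] th[OF V act(2)]
        et[OF V xy(1)] et[OF V xy(2)] et[OF V act(1)] et[OF V act(2)]
        ze[OF V xy(1)] ze[OF V xy(2)] ze[OF V act(1)] ze[OF V act(2)]
      have rp: "restr L U V (?b \<theta> \<zeta>) \<in> sec L V" "restr L U V (?b \<eta> \<zeta>) \<in> sec L V" using U V p(3,5) by simp_all
      have sum: "wp V x y \<gamma> (restr L U V (?b \<theta> \<zeta> \<oplus>\<^bsub>L$U\<^esub> ?b \<eta> \<zeta>)) =
          wp V x y \<gamma> (restr L U V (?b \<theta> \<zeta>)) \<oplus>\<^bsub>R V\<^esub> wp V x y \<gamma> (restr L U V (?b \<eta> \<zeta>))"
        using U V p(3,5) rp xy \<gamma> by (simp add: wp_simps)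
      show "wp V x y \<gamma> (restr L U V (?b (\<theta> \<oplus>\<^bsub>dual X M$U\<^esub> \<eta>) \<zeta>)) =
          wp V x y \<gamma> (restr L U V (?b \<theta> \<zeta> \<oplus>\<^bsub>L$U\<^esub> ?b \<eta> \<zeta>))"
        unfolding sum p(2)[OF V xy \<gamma>] p(4)[OF V xy \<gamma>] p(6)[OF V xy \<gamma>] dual_apply(2)[OF V xy(1)] dual_apply(2)[OF V xy(2)]
          dual_apply(2)[OF V act(1)] dual_apply(2)[OF V act(2)]
        using in_R by algebra
    qed }
  fix r assume r: "r \<in> \<O> U"
  have s: "r \<odot>\<^bsub>dual X M$U\<^esub> \<theta> \<in> sec (dual X M) U" by (rule mod_closed(5)[OF D U r \<theta>])
  note p = wood_polar_wp[OF U s \<eta>] wood_polar_wp[OF U \<theta> \<eta>]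
  show "?b (r \<odot>\<^bsub>dual X M$U\<^esub> \<theta>) \<eta> = r \<odot>\<^bsub>L$U\<^esub> ?b \<theta> \<eta>"
  proof (rule wood_eqI[OF U p(1)])
    show "r \<odot>\<^bsub>L$U\<^esub> ?b \<theta> \<eta> \<in> sec L U" using U p(3) r by simp
    fix V x y \<gamma> assume V: "opn V" "V \<subseteq> U" and xy: "x \<in> sec M V" "y \<in> sec M V" and \<gamma>: "\<gamma> \<in> sec Y V"
    interpret cring "R V" using cring_R[OF V(1)] .
    have act: "\<gamma> \<odot>\<^bsub>I$V\<^esub> x \<in> sec M V" "\<gamma> \<odot>\<^bsub>I$V\<^esub> y \<in> sec M V" using V xy \<gamma> by simp_all
    have r': "rr U V r \<in> \<O> V" using U V r by simp
    note in_R = th[OF V xy(1)] th[OF V xy(2)] th[OF V act(1)] th[OF V act(2)]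
      et[OF V xy(1)] et[OF V xy(2)] et[OF V act(1)] et[OF V act(2)] r'
    have rp: "restr L U V (?b \<theta> \<eta>) \<in> sec L V" using U V p(3) by simp
    have sum: "wp V x y \<gamma> (restr L U V (r \<odot>\<^bsub>L$U\<^esub> ?b \<theta> \<eta>)) = rr U V r \<otimes>\<^bsub>R V\<^esub> wp V x y \<gamma> (restr L U V (?b \<theta> \<eta>))"
      using U V p(3) rp xy \<gamma> r by (simp add: wp_simps)
    show "wp V x y \<gamma> (restr L U V (?b (r \<odot>\<^bsub>dual X M$U\<^esub> \<theta>) \<eta>)) =
        wp V x y \<gamma> (restr L U V (r \<odot>\<^bsub>L$U\<^esub> ?b \<theta> \<eta>))"
      unfolding sum p(2)[OF V xy \<gamma>] p(4)[OF V xy \<gamma>] dual_apply(3)[OF V xy(1)] dual_apply(3)[OF V xy(2)]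
        dual_apply(3)[OF V act(1)] dual_apply(3)[OF V act(2)]
      using in_R by algebra
  qed
qed

lemma wood_bqm: "binary_quadratic_module X (wood_obj X Y I)"
  using locally_free2_dual[OF M_rank] line_bundle_locally_free[OF L_line] wood_quadratic
  by (simp add: binary_quadratic_module_def wood_obj_def wood_target_def)

end

section \<open>Functoriality\<close>

context ringed
begin

lemma dual_map_id:
  assumes M: "mod_pre X M" shows "dual_map X M M (mod_id X M) = mod_id X (dual X M)"
proof (rule hom_eqI[OF dual_map_hom[OF M M mod_id_hom[OF M]] mod_id_hom])
  show "mod_pre X (dual X M)" using dual_sheaf[OF M] by simp
  fix U \<theta> assume U: "opn U" and \<theta>: "\<theta> \<in> sec (dual X M) U"
  show "dual_map X M M (mod_id X M) U \<theta> = mod_id X (dual X M) U \<theta>"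
    unfolding mod_id_apply[OF U \<theta>]
    by (rule dual_eqI[OF M dual_map_closed[OF M M mod_id_hom[OF M] U \<theta>] \<theta>])
      (use U \<theta> in \<open>simp add: dual_map_apply[OF M M mod_id_hom[OF M]]\<close>)
qed

lemma dual_map_comp:
  assumes pre: "mod_pre X M" "mod_pre X N" "mod_pre X K"
    and f: "f \<in> mod_homs X (pts X) M N" and g: "g \<in> mod_homs X (pts X) N K"
  shows "dual_map X M K (mod_comp X M g f) = mod_comp X (dual X K) (dual_map X M N f) (dual_map X N K g)"
proof -
  note gf = mod_comp_hom[OF pre(1) f g]
  have DK: "mod_pre X (dual X K)" using dual_sheaf[OF pre(3)] by simp
  note df = dual_map_hom[OF pre(1,2) f] and dg = dual_map_hom[OF pre(2,3) g]
  show ?thesis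
  proof (rule hom_eqI[OF dual_map_hom[OF pre(1,3) gf] mod_comp_hom[OF DK dg df]])
    fix U \<theta> assume U: "opn U" and \<theta>: "\<theta> \<in> sec (dual X K) U"
    have g\<theta>: "dual_map X N K g U \<theta> \<in> sec (dual X N) U" by (rule dual_map_closed[OF pre(2,3) g U \<theta>])
    show "dual_map X M K (mod_comp X M g f) U \<theta> = mod_comp X (dual X K) (dual_map X M N f) (dual_map X N K g) U \<theta>"
      unfolding mod_comp_apply[OF U \<theta>]
      by (rule dual_eqI[OF pre(1) dual_map_closed[OF pre(1,3) gf U \<theta>] dual_map_closed[OF pre(1,2) f U g\<theta>]])
        (use U \<theta> g\<theta> in \<open>simp add: dual_map_apply[OF pre(1,3) gf] dual_map_apply[OF pre(1,2) f]
          dual_map_apply[OF pre(2,3) g] hom_closed[OF f]\<close>)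
  qed
qed

lemma ext2_map_id:
  assumes M: "mod_pre X M" shows "ext2_map X M M (mod_id X M) = mod_id X (ext2 X M)"
  using ext2_sheaf[OF M] M
  by (intro ext2_map_unique[OF M M mod_id_hom[OF M]] mod_id_hom) simp_all

lemma ext2_map_comp:
  assumes pre: "mod_pre X M" "mod_pre X N" "mod_pre X K"
    and f: "f \<in> mod_homs X (pts X) M N" and g: "g \<in> mod_homs X (pts X) N K"
  shows "ext2_map X M K (mod_comp X M g f) = mod_comp X (ext2 X M) (ext2_map X N K g) (ext2_map X M N f)"
proof (rule ext2_map_unique[OF pre(1,3) mod_comp_hom[OF pre(1) f g]])
  show "mod_comp X (ext2 X M) (ext2_map X N K g) (ext2_map X M N f) \<in> mod_homs X (pts X) (ext2 X M) (ext2 X K)"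
    using ext2_sheaf[OF pre(1)] ext2_map_hom[OF pre(1,2) f] ext2_map_hom[OF pre(2,3) g]
    by (intro mod_comp_hom) simp_all
qed (simp add: pre ext2_map_wedge[OF pre(1,2) f] ext2_map_wedge[OF pre(2,3) g] hom_closed[OF f])

lemma tensor_map_id:
  assumes M: "mod_pre X M" and N: "mod_pre X N"
  shows "tensor_map X M N M N (mod_id X M) (mod_id X N) = mod_id X (tensor X M N)"
  using tensor_sheaf[OF M N] M N
  by (intro tensor_map_unique[OF M N M N mod_id_hom[OF M] mod_id_hom[OF N]] mod_id_hom) simp_all

text \<open>Stated for the left factor, as the right one is the dual of Y/X in both functors and is
  never changed.\<close>

lemma tensor_map_comp_left:
  assumes pre: "mod_pre X M" "mod_pre X M'" "mod_pre X M''" "mod_pre X N"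
    and f: "f \<in> mod_homs X (pts X) M M'" and g: "g \<in> mod_homs X (pts X) M' M''"
  shows "tensor_map X M N M'' N (mod_comp X M g f) (mod_id X N) =
    mod_comp X (tensor X M N) (tensor_map X M' N M'' N g (mod_id X N)) (tensor_map X M N M' N f (mod_id X N))"
proof (rule tensor_map_unique[OF pre(1,4,3,4) mod_comp_hom[OF pre(1) f g] mod_id_hom[OF pre(4)]])
  note i = mod_id_hom[OF pre(4)]
  show "mod_comp X (tensor X M N) (tensor_map X M' N M'' N g (mod_id X N)) (tensor_map X M N M' N f (mod_id X N))
      \<in> mod_homs X (pts X) (tensor X M N) (tensor X M'' N)"
    using tensor_sheaf[OF pre(1,4)] tensor_map_hom[OF pre(1,4,2,4) f i] tensor_map_hom[OF pre(2,4,3,4) g i]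
    by (intro mod_comp_hom) simp_all
  fix U x y assume "opn U" "x \<in> sec M U" "y \<in> sec N U"
  then show "mod_comp X (tensor X M N) (tensor_map X M' N M'' N g (mod_id X N)) (tensor_map X M N M' N f (mod_id X N)) U
      (tens X M N U x y) = tens X M'' N U (mod_comp X M g f U x) (mod_id X N U y)"
    using pre by (simp add: tensor_map_tens[OF pre(1,4,2,4) f i] tensor_map_tens[OF pre(2,4,3,4) g i] hom_closed[OF f])
qed

text \<open>Agreement of modules over open sets and on carriers. It relates the
  \<open>Y\<close>-module dual of \<open>I\<close>, with scalars restricted to \<open>X\<close>, to
  the dual over \<open>X\<close>: the records differ, as their scalars act by different
  formulas.\<close>

definition mod_eq :: "('a, 'r, 'm) mod_presheaf \<Rightarrow> ('a, 'r, 'm) mod_presheaf \<Rightarrow> bool" where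
  "mod_eq A C \<longleftrightarrow> restr A = restr C \<and> (\<forall>U. opn U \<longrightarrow> sec A U = sec C U \<and> \<zero>\<^bsub>A$U\<^esub> = \<zero>\<^bsub>C$U\<^esub> \<and>
    (\<forall>x\<in>sec C U. (\<forall>y\<in>sec C U. x \<oplus>\<^bsub>A$U\<^esub> y = x \<oplus>\<^bsub>C$U\<^esub> y) \<and>
      (\<forall>r\<in>\<O> U. r \<odot>\<^bsub>A$U\<^esub> x = r \<odot>\<^bsub>C$U\<^esub> x)))"

context
  fixes A C :: "('a, 'r, 'm) mod_presheaf"
  assumes eq: "mod_eq A C" and C: "module_sheaf X C"
begin

lemma mod_eq_simps:
  "restr A = restr C" "opn U \<Longrightarrow> sec A U = sec C U" "opn U \<Longrightarrow> \<zero>\<^bsub>A$U\<^esub> = \<zero>\<^bsub>C$U\<^esub>"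
  "\<lbrakk>opn U; x \<in> sec C U; y \<in> sec C U\<rbrakk> \<Longrightarrow> x \<oplus>\<^bsub>A$U\<^esub> y = x \<oplus>\<^bsub>C$U\<^esub> y"
  "\<lbrakk>opn U; x \<in> sec C U; r \<in> \<O> U\<rbrakk> \<Longrightarrow> r \<odot>\<^bsub>A$U\<^esub> x = r \<odot>\<^bsub>C$U\<^esub> x"
  using eq by (simp_all add: mod_eq_def)

text \<open>The union of a cover is open, so that the sheaf condition, too, involves only sections
  over open sets.\<close>

lemma mod_eq_sheaf: "module_sheaf X A"
proof -
  note CP [simp] = module_sheaf_pre[OF C]
  note CS = module_sheaf_sheaf[OF C]
  have CPP: "is_presheaf X C" using CS by (simp add: is_sheaf_def)
  have un: "opn (\<Union>\<V>)" if "\<V> \<subseteq> opens X (pts X)" for \<V>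
    using subsetD[OF that] by (intro openin_Union) simp
  have AP: "is_presheaf X A"
    by (rule is_presheafI) (simp_all add: mod_eq_simps)
  have "is_sheaf X A"
    unfolding is_sheaf_def
  proof (intro conjI AP allI impI)
    fix \<V> assume V: "\<V> \<subseteq> opens X (pts X)"
    have op: "opn V" if "V \<in> \<V>" for V using subsetD[OF V that] by simp
    have sV: "sec A V = sec C V" if "V \<in> \<V>" for V by (rule mod_eq_simps(2)[OF op[OF that]])
    note CS' = CS[unfolded is_sheaf_def, THEN conjunct2, THEN spec, THEN mp, OF V]
    show "\<forall>s\<in>sec A (\<Union>\<V>). \<forall>t\<in>sec A (\<Union>\<V>). (\<forall>V\<in>\<V>. restr A (\<Union>\<V>) V s = restr A (\<Union>\<V>) V t) \<longrightarrow> s = t"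
      unfolding mod_eq_simps(1) mod_eq_simps(2)[OF un[OF V]] by (rule conjunct1[OF CS'])
    fix \<sigma> assume *: "(\<forall>V\<in>\<V>. \<sigma> V \<in> sec A V) \<and> (\<forall>V\<in>\<V>. \<forall>W\<in>\<V>. restr A V (V \<inter> W) (\<sigma> V) = restr A W (V \<inter> W) (\<sigma> W))"
    have 1: "\<forall>V\<in>\<V>. \<sigma> V \<in> sec C V" using conjunct1[OF *] sV by blast
    show "\<exists>s\<in>sec A (\<Union>\<V>). \<forall>V\<in>\<V>. restr A (\<Union>\<V>) V s = \<sigma> V"
      unfolding mod_eq_simps(1) mod_eq_simps(2)[OF un[OF V]]
      by (rule conjunct2[OF CS', THEN spec, THEN mp, OF conjI[OF 1 conjunct2[OF *, unfolded mod_eq_simps(1)]]])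
  qed
  moreover have "mod_pre X A"
  proof (rule mod_preI[OF AP])
    fix U assume U: "opn U"
    note s = mod_eq_simps(1) mod_eq_simps(2-5)[OF U]
    interpret module "R U" "C$U" using pre_module[OF CP U] .
    show "module (R U) (A$U)"
      by (rule moduleI_sub[OF U]) (simp_all add: s U mod_smult[OF CP] mod_assoc[OF CP] mod_ac[OF CP])
  qed (simp_all add: mod_eq_simps)
  ultimately show ?thesis by (simp add: module_sheaf_iff)
qed

text \<open>Morphisms see only the sections over open sets and the operations on them.\<close>

lemma mod_eq_homs:
  shows "mod_homs X U A N = mod_homs X U C N" "mod_homs X U N A = mod_homs X U N C"
proof -
  note CP = module_sheaf_pre[OF C] and AP = module_sheaf_pre[OF mod_eq_sheaf]
  show "mod_homs X U A N = mod_homs X U C N"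
    unfolding hom_iff[THEN iffD1] set_eq_iff hom_iff lin_def by (simp add: mod_eq_simps cong: conj_cong)
  show "mod_homs X U N A = mod_homs X U N C"
    unfolding set_eq_iff hom_iff lin_def by (auto simp add: mod_eq_simps)
qed

lemma mod_eq_frame2:
  assumes U: "opn U" and fr: "frame2 U C e f c d" shows "frame2 U A e f c d"
proof -
  note CP [simp] = module_sheaf_pre[OF C]
  note D = frame2D[OF CP fr U]
  have "x = lc A V (c V x) (restr A U V e) (d V x) (restr A U V f)"
    if V: "opn V" "V \<subseteq> U" and x: "x \<in> sec C V" for V x
  proof -
    have "c V x \<in> \<O> V" "d V x \<in> \<O> V" "restr C U V e \<in> sec C V" "restr C U V f \<in> sec C V"
      using hom_closed[OF D(3) V x] hom_closed[OF D(4) V x] D(1,2) U V by simp_all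
    then show ?thesis using D(5)[OF V x] V by (simp add: mod_eq_simps)
  qed
  then show ?thesis using fr U unfolding frame2_def by (simp add: mod_eq_simps mod_eq_homs)
qed

lemma mod_eq_locally_free2: assumes "locally_free X 2 C" shows "locally_free X 2 A"
proof (rule locally_free2I[OF mod_eq_sheaf])
  fix x assume x: "x \<in> pts X"
  obtain U e f c d where "opn U" "x \<in> U" "frame2 U C e f c d" by (rule locally_free2_frame[OF assms opn_top x])
  then show "\<exists>U e f c d. opn U \<and> x \<in> U \<and> frame2 U A e f c d" using mod_eq_frame2 by blast
qed

text \<open>This identity is the comparison on the sources of the two quadratic maps.\<close>

lemma mod_eq_id_iso: "mod_id X A \<in> mod_isos X A C"
proof -
  have "mod_id X A = mod_id X C" by (simp add: mod_id_def mod_eq_simps cong: restrict_cong)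
  then show ?thesis
    using mod_id_iso[OF module_sheaf_pre[OF C]] by (simp add: mod_isos_def mod_eq_homs mod_eq_simps)
qed

end

lemma frame2_swap:
  assumes M: "mod_pre X M" and fr: "frame2 U M e f c d" and U: "opn U" shows "frame2 U M f e d c"
proof -
  note D = frame2D[OF M fr U]
  have "x = lc M V (d V x) (restr M U V f) (c V x) (restr M U V e)"
    if V: "opn V" "V \<subseteq> U" and x: "x \<in> sec M V" for V x
  proof -
    have "c V x \<in> \<O> V" "d V x \<in> \<O> V" "restr M U V e \<in> sec M V" "restr M U V f \<in> sec M V"
      using hom_closed[OF D(3) V x] hom_closed[OF D(4) V x] D(1,2) U V M by simp_all
    then show ?thesis using D(5)[OF V x] V M by (simp add: mod_ac)
  qed
  then show ?thesis using fr unfolding frame2_def by simp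
qed

end

section \<open>Wood's construction on morphisms\<close>

context quad
begin

lemma over_mod:
  "mod_id (over X Y) I = mod_id X (restr_scalars Y I)"
  "mod_comp (over X Y) I g f = mod_comp X (restr_scalars Y I) g f"
  by (simp_all add: mod_id_def mod_comp_def rs_simps)

context
  fixes I :: "('a, 'b, 'm) mod_presheaf" and J :: "('a, 'b, 'n) mod_presheaf" and \<psi>
  assumes I: "quad_mod X Y I" and J: "quad_mod X Y J" and \<psi>: "\<psi> \<in> mod_isos (over X Y) I J"
begin

interpretation I: quad_mod X Y I by (rule I)
interpretation J: quad_mod X Y J by (rule J)

lemma iso_act:
  "\<lbrakk>opn V; \<gamma> \<in> sec Y V; x \<in> sec (restr_scalars Y I) V\<rbrakk> \<Longrightarrow> \<psi> V (\<gamma> \<odot>\<^bsub>I$V\<^esub> x) = \<gamma> \<odot>\<^bsub>J$V\<^esub> \<psi> V x"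
  using YR.hom_smult[OF YR.iso_hom[OF \<psi>], of V x \<gamma>] by (simp add: rs_simps)

text \<open>Scalars of \<open>X\<close> act through \<open>Y\<close>, so linearity over
  \<open>Y\<close> implies linearity over \<open>X\<close>.\<close>

lemma iso_restr_scalars: "\<psi> \<in> mod_isos X (restr_scalars Y I) (restr_scalars Y J)"
proof -
  note H = YR.iso_hom[OF \<psi>, unfolded over_simps]
  note H' = H[unfolded hom_iff over_simps]
  have "lin X (pts X) (restr_scalars Y I) (restr_scalars Y J) \<psi>"
  proof (rule linI)
    fix V x assume V: "opn V" "V \<subseteq> pts X" and x: "x \<in> sec (restr_scalars Y I) V"
    have V': "openin (top_of (over X Y)) V" using V by simp
    note h = YR.hom_simps[OF H V' V(2) x[unfolded rs_simps], unfolded over_simps]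
    show "\<psi> V x \<in> sec (restr_scalars Y J) V" unfolding rs_simps by (rule h(1))
    show "y \<in> sec (restr_scalars Y I) V \<Longrightarrow>
      \<psi> V (x \<oplus>\<^bsub>restr_scalars Y I$V\<^esub> y) = \<psi> V x \<oplus>\<^bsub>restr_scalars Y J$V\<^esub> \<psi> V y" for y
      unfolding rs_simps by (rule h(2))
    show "r \<in> \<O> V \<Longrightarrow>
      \<psi> V (r \<odot>\<^bsub>restr_scalars Y I$V\<^esub> x) = r \<odot>\<^bsub>restr_scalars Y J$V\<^esub> \<psi> V x" for r
      unfolding rs_simps using V(1) by (intro h(3)) simp
    show "opn W \<Longrightarrow> W \<subseteq> V \<Longrightarrow> \<psi> W (restr (restr_scalars Y I) V W x) = restr (restr_scalars Y J) V W (\<psi> V x)" for W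
      unfolding rs_simps by (rule h(4))
  qed
  then have "\<psi> \<in> mod_homs X (pts X) (restr_scalars Y I) (restr_scalars Y J)"
    using H' unfolding hom_iff rs_simps by (intro conjI) (rule conjunct1, assumption, rule conjunct1, rule conjunct2)
  then show ?thesis using \<psi> by (simp add: mod_isos_def rs_simps)
qed

abbreviation (input) "\<psi>L \<equiv> snd (wood_mor X Y I J \<psi>)"

lemma wood_mor_parts:
  "fst (wood_mor X Y I J \<psi>) \<in> mod_isos X (dual X J.M) (dual X I.M)"
  "\<psi>L \<in> mod_isos X J.L I.L"
proof -
  note p = iso_restr_scalars
  show "fst (wood_mor X Y I J \<psi>) \<in> mod_isos X (dual X J.M) (dual X I.M)"
    unfolding wood_mor_def dual_mor_def Let_def fst_conv by (rule dual_map_iso[OF I.pres(1) J.pres(1) p])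
  show "\<psi>L \<in> mod_isos X J.L I.L"
    unfolding wood_mor_def Let_def snd_conv
    by (intro tensor_map_iso I.pres J.pres dual_map_iso ext2_map_iso p mod_id_iso)
qed

lemma wood_mor_tens:
  assumes "opn V" "\<xi> \<in> sec (dual X J.E) V" "\<delta> \<in> sec (dual X B) V"
  shows "\<psi>L V (tens X (dual X J.E) (dual X B) V \<xi> \<delta>) =
    tens X (dual X I.E) (dual X B) V (dual_map X I.E J.E (ext2_map X I.M J.M \<psi>) V \<xi>) \<delta>"
proof -
  note e = iso_hom[OF ext2_map_iso[OF I.pres(1) J.pres(1) iso_restr_scalars]]
  show ?thesis unfolding wood_mor_def Let_def snd_conv
    using tensor_map_tens[OF J.pres(7,8) I.pres(7,8) dual_map_hom[OF I.pres(2) J.pres(2) e] mod_id_hom[OF I.pres(8)] assms] assms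
    by simp
qed

text \<open>Adjointness of \<open>\<psi>\<close> and the induced map of targets. On a pure tensor
  \<xi> \<otimes> \<delta> both sides are the product of \<xi> at \<psi> x \<and> \<psi> y and of
  \<delta> at the class of \<gamma>, and pure tensors determine functionals on the target.\<close>

lemma wood_natural:
  assumes V: "opn V" and xy: "x \<in> sec I.M V" "y \<in> sec I.M V" and \<gamma>: "\<gamma> \<in> sec Y V" and s: "s \<in> sec J.L V"
  shows "I.wp V x y \<gamma> (\<psi>L V s) = J.wp V (\<psi> V x) (\<psi> V y) \<gamma> s"
proof -
  note p = iso_hom[OF iso_restr_scalars]
  note e = ext2_map_hom[OF I.pres(1) J.pres(1) p]
  note pV = hom_closed[OF p V opn_pts[OF V] xy(1)] hom_closed[OF p V opn_pts[OF V] xy(2)]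
  define t where "t = tens X I.E B V (wedge X I.M V x y) (acl V \<gamma>)"
  define t' where "t' = tens X J.E B V (wedge X J.M V (\<psi> V x) (\<psi> V y)) (acl V \<gamma>)"
  have tI: "I.tod V t \<in> mod_homs X V I.L OX" unfolding t_def by (rule I.tod_in[OF V I.tw_in[OF V xy \<gamma>]])
  have tJ: "J.tod V t' \<in> mod_homs X V J.L OX" unfolding t'_def by (rule J.tod_in[OF V J.tw_in[OF V pV \<gamma>]])
  note L = hom_simps[OF iso_hom[OF wood_mor_parts(2)] _ opn_pts] and tIs = hom_simps[OF tI]
  \<comment> \<open>The left side is extended to a functional over all open sets below
    \<open>V\<close>, so that the two sides can be compared as morphisms.\<close>
  have comp: "mkhom X V J.L (\<lambda>W s. I.tod V t W (\<psi>L W s)) \<in> mod_homs X V J.L OX"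
    by (rule mkhomI[OF J.pres(9)]) (simp_all only: L tIs)
  have "mkhom X V J.L (\<lambda>W s. I.tod V t W (\<psi>L W s)) = J.tod V t'"
  proof (rule tensor_hom_eqI[OF J.pres(7,8) comp tJ struct_sheaf])
    fix W \<xi> \<delta> assume W: "opn W" "W \<subseteq> V" and \<xi>: "\<xi> \<in> sec (dual X J.E) W" and \<delta>: "\<delta> \<in> sec (dual X B) W"
    have tin: "tens X (dual X J.E) (dual X B) W \<xi> \<delta> \<in> sec J.L W" using W \<xi> \<delta> by simp
    have \<xi>': "dual_map X I.E J.E (ext2_map X I.M J.M \<psi>) W \<xi> \<in> sec (dual X I.E) W"
      by (rule dual_map_closed[OF I.pres(2) J.pres(2) e W(1) \<xi>])
    have xyW: "restr I.M V W x \<in> sec I.M W" "restr I.M V W y \<in> sec I.M W" using V W xy by simp_all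
    have "I.tod V t W (\<psi>L W (tens X (dual X J.E) (dual X B) W \<xi> \<delta>)) =
        dual_map X I.E J.E (ext2_map X I.M J.M \<psi>) W \<xi> W (restr I.E V W (wedge X I.M V x y)) \<otimes>\<^bsub>R W\<^esub> \<delta> W (restr B V W (acl V \<gamma>))"
      unfolding wood_mor_tens[OF W(1) \<xi> \<delta>] t_def
      by (rule tensor_to_dual_tens[OF I.pres(2,4) V W _ _ \<xi>' \<delta>]) (use V xy \<gamma> in simp_all)
    also have "dual_map X I.E J.E (ext2_map X I.M J.M \<psi>) W \<xi> W (restr I.E V W (wedge X I.M V x y)) =
        \<xi> W (wedge X J.M W (\<psi> W (restr I.M V W x)) (\<psi> W (restr I.M V W y)))"
    proof -
      have wI: "wedge X I.M W (restr I.M V W x) (restr I.M V W y) \<in> sec I.E W" using W xyW by simp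
      have r: "restr I.E V W (wedge X I.M V x y) = wedge X I.M W (restr I.M V W x) (restr I.M V W y)"
        using V W xy by simp
      show ?thesis
        unfolding r dual_map_apply[OF I.pres(2) J.pres(2) e W(1) \<xi> [unfolded dual_sec] W(1) order_refl wI]
        by (rule arg_cong[OF ext2_map_wedge[OF I.pres(1) J.pres(1) p W(1) xyW]])
    qed
    also have "wedge X J.M W (\<psi> W (restr I.M V W x)) (\<psi> W (restr I.M V W y)) = restr J.E V W (wedge X J.M V (\<psi> V x) (\<psi> V y))"
      using bilinD(6)[OF wedge_bilin[OF J.pres(1)] V opn_pts[OF V] pV W]
        hom_res[OF p V opn_pts[OF V] xy(1) W] hom_res[OF p V opn_pts[OF V] xy(2) W] by simp
    also have "\<xi> W (restr J.E V W (wedge X J.M V (\<psi> V x) (\<psi> V y))) \<otimes>\<^bsub>R W\<^esub> \<delta> W (restr B V W (acl V \<gamma>)) =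
        J.tod V t' W (tens X (dual X J.E) (dual X B) W \<xi> \<delta>)"
      unfolding t'_def
      by (rule tensor_to_dual_tens[OF J.pres(2,4) V W _ _ \<xi> \<delta>, symmetric]) (use V pV \<gamma> in simp_all)
    finally show "mkhom X V J.L (\<lambda>W s. I.tod V t W (\<psi>L W s)) W (tens X (dual X J.E) (dual X B) W \<xi> \<delta>) =
        J.tod V t' W (tens X (dual X J.E) (dual X B) W \<xi> \<delta>)"
      unfolding mkhom_apply[OF W tin] .
  qed
  from fun_cong[OF fun_cong[OF this, of V], of s] show ?thesis
    unfolding mkhom_apply[OF V order_refl s] I.wp_def J.wp_def t_def t'_def .
qed

text \<open>After pairing with (x \<and> y) \<otimes> \<gamma>, one side contains \<theta> at
  \<psi>(\<gamma> x) and the other \<theta> at \<gamma> \<psi>(x), and likewise for y. Linearity of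
  \<open>\<psi>\<close> over \<open>Y\<close> equates them.\<close>

lemma wood_mor_sim: "wood_mor X Y I J \<psi> \<in> similarities X (wood_obj X Y J) (wood_obj X Y I)"
proof -
  note p = iso_hom[OF iso_restr_scalars]
  have "wood_map X Y I U (fst (wood_mor X Y I J \<psi>) U \<theta>) = \<psi>L U (wood_map X Y J U \<theta>)"
    if U: "opn U" and \<theta>: "\<theta> \<in> sec (dual X J.M) U" for U \<theta>
  proof -
    define \<eta> where "\<eta> = dual_map X I.M J.M \<psi> U \<theta>"
    have \<eta>: "\<eta> \<in> sec (dual X I.M) U" unfolding \<eta>_def by (rule dual_map_closed[OF I.pres(1) J.pres(1) p U \<theta>])
    note L = hom_simps[OF iso_hom[OF wood_mor_parts(2)] _ opn_pts]
    have "wood_map X Y I U \<eta> = \<psi>L U (wood_map X Y J U \<theta>)"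
    proof (rule I.wood_eqI[OF U I.wood_map_in[OF U \<eta>]])
      note q = J.wood_map_in[OF U \<theta>]
      show "\<psi>L U (wood_map X Y J U \<theta>) \<in> sec I.L U" by (rule L(1)[OF U U q])
      fix V x y \<gamma> assume V: "opn V" "V \<subseteq> U" and xy: "x \<in> sec I.M V" "y \<in> sec I.M V" and \<gamma>: "\<gamma> \<in> sec Y V"
      note pV = hom_closed[OF p V(1) opn_pts[OF V(1)] xy(1)] hom_closed[OF p V(1) opn_pts[OF V(1)] xy(2)]
      have rq: "restr J.L U V (wood_map X Y J U \<theta>) \<in> sec J.L V" using q U V by simp
      have "I.wp V x y \<gamma> (restr I.L U V (\<psi>L U (wood_map X Y J U \<theta>))) = J.wp V (\<psi> V x) (\<psi> V y) \<gamma> (restr J.L U V (wood_map X Y J U \<theta>))"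
        using L(4)[OF U U q V] wood_natural[OF V(1) xy \<gamma> rq] by simp
      then show "I.wp V x y \<gamma> (restr I.L U V (wood_map X Y I U \<eta>)) = I.wp V x y \<gamma> (restr I.L U V (\<psi>L U (wood_map X Y J U \<theta>)))"
        using I.wood_map_wp[OF U \<eta> V xy \<gamma>] J.wood_map_wp[OF U \<theta> V pV \<gamma>] V xy \<gamma> U \<theta>
        by (simp add: \<eta>_def dual_map_apply[OF I.pres(1) J.pres(1) p] iso_act)
    qed
    then show ?thesis by (simp add: \<eta>_def wood_mor_def dual_mor_def Let_def)
  qed
  then show ?thesis
    using wood_mor_parts by (cases "wood_mor X Y I J \<psi>") (simp add: similarities_def wood_obj_def wood_target_def)
qed

end

lemma wood_functor:
  assumes good: "\<And>I. pseudoregular X Y I \<Longrightarrow> quad_mod X Y (I :: ('a, 'b, 'm) mod_presheaf)"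
  shows "contravariant_functor X Y (wood_obj X Y :: ('a, 'b, 'm) mod_presheaf \<Rightarrow> _) (wood_mor X Y)"
  unfolding contravariant_functor_def
proof (intro conjI allI impI)
  fix I :: "('a, 'b, 'm) mod_presheaf" assume "pseudoregular X Y I"
  then interpret I: quad_mod X Y I by (rule good)
  show "binary_quadratic_module X (wood_obj X Y I)" by (rule I.wood_bqm)
  show "wood_mor X Y I I (mod_id (over X Y) I) = sim_id X (wood_obj X Y I)"
    by (simp add: wood_mor_def dual_mor_def over_mod sim_id_def wood_obj_def wood_target_def Let_def
        dual_map_id ext2_map_id tensor_map_id)
next
  fix I J :: "('a, 'b, 'm) mod_presheaf" and \<psi>
  assume "pseudoregular X Y I \<and> pseudoregular X Y J \<and> \<psi> \<in> mod_isos (over X Y) I J"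
  then show "wood_mor X Y I J \<psi> \<in> similarities X (wood_obj X Y J) (wood_obj X Y I)"
    using wood_mor_sim good by blast
next
  fix I J K :: "('a, 'b, 'm) mod_presheaf" and \<psi> \<chi>
  assume *: "pseudoregular X Y I \<and> pseudoregular X Y J \<and> pseudoregular X Y K \<and>
      \<psi> \<in> mod_isos (over X Y) I J \<and> \<chi> \<in> mod_isos (over X Y) J K"
  interpret I: quad_mod X Y I using * good by blast
  interpret J: quad_mod X Y J using * good by blast
  interpret K: quad_mod X Y K using * good by blast
  have p: "\<psi> \<in> mod_homs X (pts X) I.M J.M" and c: "\<chi> \<in> mod_homs X (pts X) J.M K.M"
    using * iso_hom[OF iso_restr_scalars[OF I.quad_mod_axioms J.quad_mod_axioms]]
      iso_hom[OF iso_restr_scalars[OF J.quad_mod_axioms K.quad_mod_axioms]] by blast+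
  note ep = ext2_map_hom[OF I.pres(1) J.pres(1) p] and ec = ext2_map_hom[OF J.pres(1) K.pres(1) c]
  show "wood_mor X Y I K (mod_comp (over X Y) I \<chi> \<psi>) = sim_comp X (wood_obj X Y K) (wood_mor X Y I J \<psi>) (wood_mor X Y J K \<chi>)"
    by (simp add: wood_mor_def dual_mor_def over_mod sim_comp_def wood_obj_def wood_target_def Let_def
        dual_map_comp[OF I.pres(1) J.pres(1) K.pres(1) p c]
        ext2_map_comp[OF I.pres(1) J.pres(1) K.pres(1) p c]
        dual_map_comp[OF I.pres(2) J.pres(2) K.pres(2) ep ec]
        tensor_map_comp_left[OF K.pres(7) J.pres(7) I.pres(7) I.pres(8) dual_map_hom[OF J.pres(2) K.pres(2) ec] dual_map_hom[OF I.pres(2) J.pres(2) ep]])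
qed

end

section \<open>The norm of the dual\<close>

context ringed
begin

text \<open>A functional over \<open>V\<close> evaluated over a smaller \<open>W\<close> is its own
  restriction, which the morphism computes from the restricted argument.\<close>

lemma dual_hom_res:
  assumes h: "h \<in> mod_homs X U A (dual X C)" and V: "opn V" "V \<subseteq> U" and W: "opn W" "W \<subseteq> V" and t: "t \<in> sec A V"
  shows "h V t W s = h W (restr A V W t) W s"
  using hom_res[OF h V t W] W by simp

lemma mod_eq_maps:
  assumes eq: "mod_eq A C"
  shows "mod_id X A = mod_id X C" "mod_comp X A g f = mod_comp X C g f"
  using eq by (simp_all add: mod_id_def mod_comp_def mod_eq_def cong: restrict_cong)

end

context quad
begin

text \<open>The source changes along \<open>mod_eq\<close> and the target along the morphism
  \<open>\<nu>\<close>. The polar form of \<open>Q'\<close> is the image under \<open>\<nu>\<close>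
  of that of \<open>Q\<close>, hence linear.\<close>

lemma quadratic_map_transfer:
  assumes eq: "mod_eq A C" and C: "mod_pre X C" and L: "mod_pre X L" and N: "mod_pre X N"
    and Q: "quadratic_map X C L Q" and \<nu>: "\<nu> \<in> mod_homs X (pts X) L N"
    and Q': "\<And>U x. opn U \<Longrightarrow> x \<in> sec C U \<Longrightarrow> Q' U x = \<nu> U (Q U x)"
  shows "quadratic_map X A N Q'"
  unfolding quadratic_map_def
proof (intro ballI conjI)
  fix U x assume U0: "U \<in> opens X (pts X)" and x0: "x \<in> sec A U"
  have U: "opn U" using U0 by simp
  note es = eq[unfolded mod_eq_def, THEN conjunct2, THEN spec, THEN mp, OF U]
  have sec: "sec A U = sec C U" by (rule conjunct1[OF es])
  have x: "x \<in> sec C U" using x0 sec by simp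
  have add: "a \<oplus>\<^bsub>A$U\<^esub> b = a \<oplus>\<^bsub>C$U\<^esub> b" if "a \<in> sec C U" "b \<in> sec C U" for a b
    using es that by blast
  have sm: "r \<odot>\<^bsub>A$U\<^esub> a = r \<odot>\<^bsub>C$U\<^esub> a" if "a \<in> sec C U" "r \<in> \<O> U" for a r
    using es that by blast
  note q = Q[unfolded quadratic_map_def, rule_format, OF U0]
  have Qin: "Q U a \<in> sec L U" if "a \<in> sec C U" for a using q[OF that] by blast
  note hs = hom_simps[OF \<nu> U opn_pts[OF U]] hom_more[OF \<nu> L N U opn_pts[OF U]]
  have cl: "a \<oplus>\<^bsub>C$U\<^esub> b \<in> sec C U" if "a \<in> sec C U" "b \<in> sec C U" for a b by (rule mod_closed(2)[OF C U that])
  have scl: "r \<odot>\<^bsub>C$U\<^esub> a \<in> sec C U" if "a \<in> sec C U" "r \<in> \<O> U" for a r by (rule mod_closed(5)[OF C U that(2,1)])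
  let ?b = "polar (C$U) (L$U) (Q U)" and ?b' = "polar (A$U) (N$U) (Q' U)"
  have b_in: "?b a b \<in> sec L U" if "a \<in> sec C U" "b \<in> sec C U" for a b
    using L U that by (simp add: polar_def Qin cl)
  have b': "?b' a b = \<nu> U (?b a b)" if "a \<in> sec C U" "b \<in> sec C U" for a b
    using L U that by (simp add: polar_def add Q' Qin cl hs)
  show "Q' U x \<in> sec N U" using Q'[OF U x] Qin[OF x] by (simp add: hs)
  show "Q' U (r \<odot>\<^bsub>A$U\<^esub> x) = (r \<otimes>\<^bsub>R U\<^esub> r) \<odot>\<^bsub>N$U\<^esub> Q' U x" if r: "r \<in> \<O> U" for r
  proof -
    have "Q U (r \<odot>\<^bsub>C$U\<^esub> x) = (r \<otimes>\<^bsub>R U\<^esub> r) \<odot>\<^bsub>L$U\<^esub> Q U x" using q[OF x] r by blast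
    then show ?thesis using x r U by (simp add: sm Q' scl hs Qin)
  qed
  show "Q' V (restr A U V x) = restr N U V (Q' U x)" if V0: "V \<in> opens X U" for V
  proof -
    have V: "opn V" "V \<subseteq> U" using V0 by auto
    have "Q V (restr C U V x) = restr L U V (Q U x)" using q[OF x] V0 by blast
    moreover have "restr A = restr C" using eq by (simp add: mod_eq_def)
    moreover have "restr C U V x \<in> sec C V" by (rule res_closed[OF C U V x])
    ultimately show ?thesis using Q'[OF V(1)] Q'[OF U x] hs(4)[OF Qin[OF x] V] by simp
  qed
  fix y assume "y \<in> sec A U"
  then have y: "y \<in> sec C U" using sec by simp
  show "?b' (x \<oplus>\<^bsub>A$U\<^esub> y) z = ?b' x z \<oplus>\<^bsub>N$U\<^esub> ?b' y z" if "z \<in> sec A U" for z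
  proof -
    have z: "z \<in> sec C U" using that sec by simp
    have "?b (x \<oplus>\<^bsub>C$U\<^esub> y) z = ?b x z \<oplus>\<^bsub>L$U\<^esub> ?b y z" using q[OF x] y z by blast
    then show ?thesis using x y z by (simp add: add b' cl hs b_in)
  qed
  show "?b' (r \<odot>\<^bsub>A$U\<^esub> x) y = r \<odot>\<^bsub>N$U\<^esub> ?b' x y" if r: "r \<in> \<O> U" for r
  proof -
    have "?b (r \<odot>\<^bsub>C$U\<^esub> x) y = r \<odot>\<^bsub>L$U\<^esub> ?b x y" using q[OF x] y r by blast
    then show ?thesis using x y r by (simp add: sm b' scl hs b_in)
  qed
qed

end

section \<open>The dual module and the determinant pairing\<close>

context quad_mod
begin

abbreviation (input) "D \<equiv> restr_scalars Y (dual_obj X Y I)"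
abbreviation (input) "N \<equiv> tensor X (ext2 X D) (dual X B)"

lemma D_simps [simp]: "sec D U = mod_homs X U M OX" "restr D = restr (dual X M)"
  by (simp_all add: dual_obj_def rs_simps Let_def)

text \<open>The action on functionals is precomposition, so its properties come from the linearity
  of the action on \<open>M\<close>.\<close>

lemma D_act:
  assumes U: "opn U" and \<gamma>: "\<gamma> \<in> sec Y U" and \<theta>: "\<theta> \<in> sec (dual X M) U"
  shows "\<gamma> \<odot>\<^bsub>dual_obj X Y I$U\<^esub> \<theta> \<in> sec (dual X M) U"
    and "\<lbrakk>opn V; V \<subseteq> U; x \<in> sec M V\<rbrakk> \<Longrightarrow>
      (\<gamma> \<odot>\<^bsub>dual_obj X Y I$U\<^esub> \<theta>) V x = \<theta> V (restr Y U V \<gamma> \<odot>\<^bsub>I$V\<^esub> x)"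
proof -
  note h = hom_simps[OF \<theta> [unfolded dual_sec]]
  have eq: "\<gamma> \<odot>\<^bsub>dual_obj X Y I$U\<^esub> \<theta> = mkhom X U M (\<lambda>V x. \<theta> V (restr Y U V \<gamma> \<odot>\<^bsub>I$V\<^esub> x))"
    by (simp add: dual_obj_def mkhom_def rs_simps Let_def)
  have "mkhom X U M (\<lambda>V x. \<theta> V (restr Y U V \<gamma> \<odot>\<^bsub>I$V\<^esub> x)) \<in> mod_homs X U M OX"
  proof (rule mkhomI[OF pres(1)])
    fix V x assume V: "opn V" "V \<subseteq> U" and x: "x \<in> sec M V"
    have g: "restr Y U V \<gamma> \<in> sec Y V" using U V \<gamma> by simp
    note a = act_simps[OF V(1) g x]
    show "\<theta> V (restr Y U V \<gamma> \<odot>\<^bsub>I$V\<^esub> x) \<in> sec OX V" by (rule h(1)[OF V a(1)])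
    show "\<theta> V (restr Y U V \<gamma> \<odot>\<^bsub>I$V\<^esub> (x \<oplus>\<^bsub>M$V\<^esub> y)) =
        \<theta> V (restr Y U V \<gamma> \<odot>\<^bsub>I$V\<^esub> x) \<oplus>\<^bsub>OX$V\<^esub> \<theta> V (restr Y U V \<gamma> \<odot>\<^bsub>I$V\<^esub> y)"
      if y: "y \<in> sec M V" for y
      unfolding a(2)[OF y] by (rule h(2)[OF V a(1) act_simps(1)[OF V(1) g y]])
    show "\<theta> V (restr Y U V \<gamma> \<odot>\<^bsub>I$V\<^esub> (r \<odot>\<^bsub>M$V\<^esub> x)) =
        r \<odot>\<^bsub>OX$V\<^esub> \<theta> V (restr Y U V \<gamma> \<odot>\<^bsub>I$V\<^esub> x)"
      if r: "r \<in> \<O> V" for r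
      unfolding a(5)[OF r] by (rule h(3)[OF V a(1) r])
    show "\<theta> W (restr Y U W \<gamma> \<odot>\<^bsub>I$W\<^esub> restr M V W x) =
        restr OX V W (\<theta> V (restr Y U V \<gamma> \<odot>\<^bsub>I$V\<^esub> x))"
      if W: "opn W" "W \<subseteq> V" for W
      using h(4)[OF V a(1) W] a(7)[OF W] U V W \<gamma> by simp
  qed
  then show "\<gamma> \<odot>\<^bsub>dual_obj X Y I$U\<^esub> \<theta> \<in> sec (dual X M) U" unfolding eq dual_sec .
  show "\<lbrakk>opn V; V \<subseteq> U; x \<in> sec M V\<rbrakk> \<Longrightarrow>
      (\<gamma> \<odot>\<^bsub>dual_obj X Y I$U\<^esub> \<theta>) V x = \<theta> V (restr Y U V \<gamma> \<odot>\<^bsub>I$V\<^esub> x)"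
    unfolding eq by (rule mkhom_apply)
qed

text \<open>In the \<open>Y\<close>-module dual a scalar r acts through r 1 on the argument, in the
  dual over \<open>X\<close> it multiplies the value. Linearity of functionals equates the
  two.\<close>

lemma D_eq: "mod_eq D (dual X M)"
  unfolding mod_eq_def
proof (intro conjI allI impI ballI)
  fix U assume U: "opn U"
  show "\<zero>\<^bsub>D$U\<^esub> = \<zero>\<^bsub>dual X M$U\<^esub>" by (simp add: dual_obj_def rs_simps Let_def)
  fix \<theta> assume \<theta>: "\<theta> \<in> sec (dual X M) U"
  show "\<theta> \<oplus>\<^bsub>D$U\<^esub> \<eta> = \<theta> \<oplus>\<^bsub>dual X M$U\<^esub> \<eta>" for \<eta> by (simp add: dual_obj_def rs_simps Let_def)
  fix r assume r: "r \<in> \<O> U"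
  have r1: "r \<odot>\<^bsub>Y$U\<^esub> yone U \<in> sec Y U" using U r by simp
  have "(r \<odot>\<^bsub>Y$U\<^esub> yone U) \<odot>\<^bsub>dual_obj X Y I$U\<^esub> \<theta> = r \<odot>\<^bsub>dual X M$U\<^esub> \<theta>"
  proof (rule dual_eqI[OF pres(1) D_act(1)[OF U r1 \<theta>] mod_closed(5)[OF pres(6) U r \<theta>]])
    fix V x assume V: "opn V" "V \<subseteq> U" and x: "x \<in> sec M V"
    have rV: "rr U V r \<in> \<O> V" using U V r by simp
    have "restr Y U V (r \<odot>\<^bsub>Y$U\<^esub> yone U) \<odot>\<^bsub>I$V\<^esub> x = rr U V r \<odot>\<^bsub>M$V\<^esub> x"
      using U V r by (simp add: rs_simps)
    then show "((r \<odot>\<^bsub>Y$U\<^esub> yone U) \<odot>\<^bsub>dual_obj X Y I$U\<^esub> \<theta>) V x = (r \<odot>\<^bsub>dual X M$U\<^esub> \<theta>) V x"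
      using D_act(2)[OF U r1 \<theta> V x] hom_smult[OF \<theta> [unfolded dual_sec] V x rV] V x by simp
  qed
  then show "r \<odot>\<^bsub>D$U\<^esub> \<theta> = r \<odot>\<^bsub>dual X M$U\<^esub> \<theta>" unfolding rs_simps(4) .
qed simp_all

lemma D_sheaf: "module_sheaf X D"
  by (rule mod_eq_sheaf[OF D_eq dual_sheaf[OF pres(1)]])

lemma D_rank: "locally_free X 2 D"
  by (rule mod_eq_locally_free2[OF D_eq dual_sheaf[OF pres(1)] locally_free2_dual[OF M_rank]])

lemma D_pres: "mod_pre X D" "mod_pre X (ext2 X D)" "mod_pre X N"
proof -
  show D: "mod_pre X D" by (rule module_sheaf_pre[OF D_sheaf])
  show E: "mod_pre X (ext2 X D)" by (rule module_sheaf_pre[OF ext2_sheaf[OF D]])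
  show "mod_pre X N" by (rule module_sheaf_pre[OF tensor_sheaf[OF E pres(8)]])
qed

lemma N_line: "line_bundle N" and N_sheaf: "module_sheaf X N"
proof -
  show "line_bundle N"
    by (intro line_bundle_tensor line_bundle_ext2 line_bundle_dual D_rank B_line)
  then show "module_sheaf X N" by (rule line_bundle_sheaf)
qed

text \<open>Taken in the order (\<open>d\<close>, \<open>c\<close>), because under
  \<open>det_pair\<close> the wedge of \<open>d\<close> and \<open>c\<close> pairs to 1 with that of
  \<open>e\<close> and \<open>f\<close>.\<close>

lemma D_frame:
  assumes fr: "frame2 U M e f c d" and U: "opn U"
  shows "frame2 U D d c (ev U M f) (ev U M e)"
  by (rule frame2_swap[OF D_pres(1) mod_eq_frame2[OF D_eq dual_sheaf[OF pres(1)] U dual_frame2[OF pres(1) fr U]] U])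

text \<open>The order of \<open>x\<close> and \<open>y\<close> is the sign for which the norm corresponds to Wood's quadratic map.\<close>

definition det_pair :: "'a set \<Rightarrow> ('a set \<Rightarrow> 'm \<Rightarrow> 'r) \<Rightarrow> ('a set \<Rightarrow> 'm \<Rightarrow> 'r) \<Rightarrow> 'm \<Rightarrow> 'm \<Rightarrow> 'r" where
  "det_pair V \<theta> \<eta> x y = cross V (\<theta> V y) (\<eta> V x) (\<theta> V x) (\<eta> V y)"

lemma det_pair_simps:
  assumes V: "opn V" and \<theta>: "\<theta> \<in> mod_homs X V M OX" "\<eta> \<in> mod_homs X V M OX"
    and xy: "x \<in> sec M V" "y \<in> sec M V"
  shows "det_pair V \<theta> \<eta> x y \<in> \<O> V"
    and "opn W \<Longrightarrow> W \<subseteq> V \<Longrightarrow> rr V W (det_pair V \<theta> \<eta> x y) =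
      det_pair W (restr (dual X M) V W \<theta>) (restr (dual X M) V W \<eta>) (restr M V W x) (restr M V W y)"
proof -
  note c = dual_closed[OF V \<theta>(1) V order_refl] dual_closed[OF V \<theta>(2) V order_refl]
  show "det_pair V \<theta> \<eta> x y \<in> \<O> V" using V xy by (simp add: det_pair_def c)
  show "opn W \<Longrightarrow> W \<subseteq> V \<Longrightarrow> rr V W (det_pair V \<theta> \<eta> x y) =
      det_pair W (restr (dual X M) V W \<theta>) (restr (dual X M) V W \<eta>) (restr M V W x) (restr M V W y)"
    using V xy hom_res[OF \<theta>(1) V order_refl xy(1)] hom_res[OF \<theta>(1) V order_refl xy(2)]
      hom_res[OF \<theta>(2) V order_refl xy(1)] hom_res[OF \<theta>(2) V order_refl xy(2)]
    by (simp add: det_pair_def c)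
qed

text \<open>Functionals and arguments are taken over the same open set, which keeps the condition
  local; \<open>pairs_detD\<close> extends it to arguments over smaller open sets.\<close>

definition pairs_det :: "'a set \<Rightarrow> _ \<Rightarrow> bool" where
  "pairs_det U h \<longleftrightarrow> (\<forall>V \<theta> \<eta> x y. opn V \<and> V \<subseteq> U \<and> \<theta> \<in> sec D V \<and> \<eta> \<in> sec D V \<and> x \<in> sec M V \<and> y \<in> sec M V \<longrightarrow>
    h V (wedge X D V \<theta> \<eta>) V (wedge X M V x y) = det_pair V \<theta> \<eta> x y)"

lemma pairs_detD:
  assumes P: "pairs_det U h" and h: "h \<in> mod_homs X U (ext2 X D) (dual X E)" and V: "opn V" "V \<subseteq> U" and W: "opn W" "W \<subseteq> V"
    and \<theta>: "\<theta> \<in> sec D V" "\<eta> \<in> sec D V" and xy: "x \<in> sec M W" "y \<in> sec M W"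
  shows "h V (wedge X D V \<theta> \<eta>) W (wedge X M W x y) = det_pair W \<theta> \<eta> x y"
proof -
  have WU: "W \<subseteq> U" using V W by order
  have r: "restr D V W \<theta> \<in> sec D W" "restr D V W \<eta> \<in> sec D W" by (rule res_closed[OF D_pres(1) V(1) W \<theta>(1)], rule res_closed[OF D_pres(1) V(1) W \<theta>(2)])
  have w: "wedge X D V \<theta> \<eta> \<in> sec (ext2 X D) V" by (rule bilinD(1)[OF wedge_bilin[OF D_pres(1)] V(1) opn_pts[OF V(1)] \<theta>])
  have rw: "restr (ext2 X D) V W (wedge X D V \<theta> \<eta>) = wedge X D W (restr D V W \<theta>) (restr D V W \<eta>)"
    using bilinD(6)[OF wedge_bilin[OF D_pres(1)] V(1) opn_pts[OF V(1)] \<theta> W] by simp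
  have "h V (wedge X D V \<theta> \<eta>) W (wedge X M W x y) = det_pair W (restr D V W \<theta>) (restr D V W \<eta>) x y"
    unfolding dual_hom_res[OF h V W w] rw using P[unfolded pairs_det_def] W(1) WU r xy by blast
  then show ?thesis using W by (simp add: det_pair_def)
qed

text \<open>A morphism out of an exterior square is determined on wedges, and so is each of its
  values, a functional on an exterior square. The condition fixes both.\<close>

lemma pairs_det_unique:
  assumes U: "opn U" and h: "h \<in> mod_homs X U (ext2 X D) (dual X E)" "k \<in> mod_homs X U (ext2 X D) (dual X E)"
    and P: "pairs_det U h" "pairs_det U k"
  shows "h = k"
proof (rule ext2_hom_eqI[OF D_pres(1) h dual_sheaf[OF pres(2)]])
  fix V \<theta> \<eta> assume V: "opn V" "V \<subseteq> U" and \<theta>: "\<theta> \<in> sec D V" "\<eta> \<in> sec D V"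
  have w: "wedge X D V \<theta> \<eta> \<in> sec (ext2 X D) V" by (rule bilinD(1)[OF wedge_bilin[OF D_pres(1)] V(1) opn_pts[OF V(1)] \<theta>])
  note hk = hom_closed[OF h(1) V w] hom_closed[OF h(2) V w]
  show "h V (wedge X D V \<theta> \<eta>) = k V (wedge X D V \<theta> \<eta>)"
    by (rule ext2_hom_eqI[OF pres(1) hk[unfolded dual_sec] struct_sheaf])
      (simp only: pairs_detD[OF P(1) h(1) V _ _ \<theta>] pairs_detD[OF P(2) h(2) V _ _ \<theta>])
qed

text \<open>In a frame the pairing is a product of two determinants, one formed from the values of
  \<theta> and \<eta> at e and f, the other from the coordinates of x and y. So the coordinate
  \<open>k\<close> times the functional \<open>k0\<close> works, and it takes the generator d \<and>
  c to the generator \<open>k0\<close>.\<close>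

lemma pairs_det_local:
  assumes fr: "frame2 U M e f c d" and U: "opn U"
  obtains h k l where "h \<in> mod_homs X U (ext2 X D) (dual X E)" "pairs_det U h"
    "frame1 U (ext2 X D) (wedge X D U d c) k" "frame1 U (dual X E) (h U (wedge X D U d c)) l"
proof -
  note F = frame2D[OF pres(1) fr U]
  obtain k0 where k0: "frame1 U E (wedge X M U e f) k0"
    "\<And>V x y. \<lbrakk>opn V; V \<subseteq> U; x \<in> sec M V; y \<in> sec M V\<rbrakk> \<Longrightarrow>
      k0 V (wedge X M V x y) = cross V (c V x) (d V y) (d V x) (c V y)"
    by (rule ext2_frame[OF pres(1) fr U], blast)
  obtain k where k: "frame1 U (ext2 X D) (wedge X D U d c) k"
    "\<And>V \<theta> \<eta>. \<lbrakk>opn V; V \<subseteq> U; \<theta> \<in> sec D V; \<eta> \<in> sec D V\<rbrakk> \<Longrightarrow>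
      k V (wedge X D V \<theta> \<eta>) = cross V (ev U M f V \<theta>) (ev U M e V \<eta>) (ev U M e V \<theta>) (ev U M f V \<eta>)"
    by (rule ext2_frame[OF D_pres(1) D_frame[OF fr U] U], blast)
  note K0 = frame1D[OF pres(2) k0(1) U] and K = frame1D[OF D_pres(2) k(1) U]
  have k0_in: "k0 \<in> sec (dual X E) U" using K0(2) by simp
  define h where "h = mkhom X U (ext2 X D) (\<lambda>V t. k V t \<odot>\<^bsub>dual X E$V\<^esub> restr (dual X E) U V k0)"
  have h: "h \<in> mod_homs X U (ext2 X D) (dual X E)"
    unfolding h_def by (rule hom_scaled[OF D_pres(2) pres(7) U K(2) k0_in])
  have w_in: "wedge X D V \<theta> \<eta> \<in> sec (ext2 X D) V" if "opn V" "\<theta> \<in> sec D V" "\<eta> \<in> sec D V" for V \<theta> \<eta>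
    by (rule bilinD(1)[OF wedge_bilin[OF D_pres(1)] that(1) opn_pts[OF that(1)] that(2,3)])
  have "pairs_det U h"
    unfolding pairs_det_def
  proof (intro allI impI)
    fix V \<theta> \<eta> x y assume *: "opn V \<and> V \<subseteq> U \<and> \<theta> \<in> sec D V \<and> \<eta> \<in> sec D V \<and> x \<in> sec M V \<and> y \<in> sec M V"
    then have V: "opn V" "V \<subseteq> U" and \<theta>: "\<theta> \<in> sec D V" "\<eta> \<in> sec D V" and xy: "x \<in> sec M V" "y \<in> sec M V" by blast+
    interpret cring "R V" using cring_R[OF V(1)] .
    define e' f' where "e' = restr M U V e" and "f' = restr M U V f"
    have ef: "e' \<in> sec M V" "f' \<in> sec M V" using F(1,2) U V by (simp_all add: e'_def f'_def)
    note \<theta>' = \<theta> [unfolded D_simps]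
    note cl = dual_closed[OF V(1) \<theta>'(1) V(1) order_refl] dual_closed[OF V(1) \<theta>'(2) V(1) order_refl]
    note cx = dual_closed[OF U F(3) V xy(1)] dual_closed[OF U F(4) V xy(1)] dual_closed[OF U F(3) V xy(2)] dual_closed[OF U F(4) V xy(2)]
    \<comment> \<open>A functional is determined by its values at the frame, so that the pairing can
      be expressed by two matrices.\<close>
    have expand: "\<zeta> V z = dot V (c V z) (\<zeta> V e') (d V z) (\<zeta> V f')"
      if \<zeta>: "\<zeta> \<in> mod_homs X V M OX" and z: "z \<in> sec M V" for \<zeta> z
    proof -
      note cz = dual_closed[OF U F(3) V z] dual_closed[OF U F(4) V z]
      have in_M: "c V z \<odot>\<^bsub>M$V\<^esub> e' \<in> sec M V" "d V z \<odot>\<^bsub>M$V\<^esub> f' \<in> sec M V"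
        by (rule mod_closed(5)[OF pres(1) V(1) cz(1) ef(1)], rule mod_closed(5)[OF pres(1) V(1) cz(2) ef(2)])
      have "\<zeta> V z = \<zeta> V (lc M V (c V z) e' (d V z) f')"
        unfolding e'_def f'_def F(5)[OF V z] ..
      then show ?thesis
        using hom_add[OF \<zeta> V(1) order_refl in_M] hom_smult[OF \<zeta> V(1) order_refl ef(1) cz(1)]
          hom_smult[OF \<zeta> V(1) order_refl ef(2) cz(2)] by simp
    qed
    define a1 a2 b1 b2 where "a1 = \<theta> V e'" and "a2 = \<theta> V f'" and "b1 = \<eta> V e'" and "b2 = \<eta> V f'"
    define c1 d1 c2 d2 where "c1 = c V x" and "d1 = d V x" and "c2 = c V y" and "d2 = d V y"
    have in_R: "a1 \<in> \<O> V" "a2 \<in> \<O> V" "b1 \<in> \<O> V" "b2 \<in> \<O> V"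
      "c1 \<in> \<O> V" "d1 \<in> \<O> V" "c2 \<in> \<O> V" "d2 \<in> \<O> V"
      unfolding a1_def a2_def b1_def b2_def c1_def d1_def c2_def d2_def by (simp_all only: cl cx ef)
    have wM: "wedge X M V x y \<in> sec E V" using V xy by simp
    have "h V (wedge X D V \<theta> \<eta>) V (wedge X M V x y) = k V (wedge X D V \<theta> \<eta>) \<otimes>\<^bsub>R V\<^esub> k0 V (wedge X M V x y)"
      unfolding h_def mkhom_apply[OF V w_in[OF V(1) \<theta>]] dual_apply(3)[OF V(1) order_refl wM]
      using V hom_closed[OF K(2) V w_in[OF V(1) \<theta>]] by simp
    also have "\<dots> = cross V a2 b1 a1 b2 \<otimes>\<^bsub>R V\<^esub> cross V c1 d2 d1 c2"
      unfolding k(2)[OF V \<theta>] k0(2)[OF V xy] ev_apply[OF V \<theta>'(1)] ev_apply[OF V \<theta>'(2)]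
      unfolding a1_def a2_def b1_def b2_def c1_def d1_def c2_def d2_def e'_def f'_def ..
    \<comment> \<open>Multiplicativity of 2 by 2 determinants.\<close>
    also have "\<dots> = cross V (dot V c2 a1 d2 a2) (dot V c1 b1 d1 b2) (dot V c1 a1 d1 a2) (dot V c2 b1 d2 b2)"
      using in_R by algebra
    also have "\<dots> = det_pair V \<theta> \<eta> x y"
      unfolding det_pair_def expand[OF \<theta>'(1) xy(1)] expand[OF \<theta>'(1) xy(2)] expand[OF \<theta>'(2) xy(1)] expand[OF \<theta>'(2) xy(2)]
      unfolding a1_def a2_def b1_def b2_def c1_def d1_def c2_def d2_def ..
    finally show "h V (wedge X D V \<theta> \<eta>) V (wedge X M V x y) = det_pair V \<theta> \<eta> x y" .
  qed
  moreover have "h U (wedge X D U d c) = k0"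
  proof -
    have "k U (wedge X D U d c) = \<one>\<^bsub>R U\<^esub>" using k(1) by (simp add: frame1_def)
    moreover have "restr (dual X E) U U k0 = k0" using res_id[OF pres(7) U k0_in] .
    moreover have "\<one>\<^bsub>R U\<^esub> \<odot>\<^bsub>dual X E$U\<^esub> k0 = k0"
      using module.smult_one[OF pre_module[OF pres(7) U] k0_in] .
    ultimately show ?thesis unfolding h_def by (simp add: mkhom_apply[OF U order_refl K(1)])
  qed
  ultimately show ?thesis using that[OF h _ k(1)] dual_frame1[OF pres(2) k0(1) U] by simp
qed

end

section \<open>The global determinant isomorphism\<close>

context quad_mod
begin

text \<open>The condition does not mention the frame, so morphisms built from different frames agree
  on overlaps and glue.\<close>

lemma pairs_det_exists: "\<exists>h. h \<in> mod_homs X (pts X) (ext2 X D) (dual X E) \<and> pairs_det (pts X) h"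
proof -
  have loc: "\<exists>U h. opn U \<and> x \<in> U \<and> h \<in> mod_homs X U (ext2 X D) (dual X E) \<and> pairs_det U h" if x: "x \<in> pts X" for x
  proof -
    obtain U e f c d where U: "opn U" "x \<in> U" and fr: "frame2 U M e f c d"
      by (rule locally_free2_frame[OF M_rank opn_top x])
    obtain h k l where "h \<in> mod_homs X U (ext2 X D) (dual X E)" "pairs_det U h"
      by (rule pairs_det_local[OF fr U(1)])
    then show ?thesis using U by blast
  qed
  have res: "pairs_det V (restrict h (opens X V))"
    if "opn U" "opn V" "V \<subseteq> U" "h \<in> mod_homs X U (ext2 X D) (dual X E)" "pairs_det U h" for U V h
    unfolding pairs_det_def
  proof (intro allI impI)
    fix W \<theta> \<eta> x y assume *: "opn W \<and> W \<subseteq> V \<and> \<theta> \<in> sec D W \<and> \<eta> \<in> sec D W \<and> x \<in> sec M W \<and> y \<in> sec M W"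
    then have "restrict h (opens X V) W = h W" by simp
    moreover have "W \<subseteq> U" using * that(3) by blast
    ultimately show "restrict h (opens X V) W (wedge X D W \<theta> \<eta>) W (wedge X M W x y) = det_pair W \<theta> \<eta> x y"
      using * that(5)[unfolded pairs_det_def] by metis
  qed
  obtain h where h: "h \<in> mod_homs X (pts X) (ext2 X D) (dual X E)"
    and hl: "\<And>x. x \<in> pts X \<Longrightarrow> \<exists>U. opn U \<and> x \<in> U \<and> pairs_det U (restrict h (opens X U))"
    by (rule hom_glue_spec[where P = pairs_det, OF D_pres(2) dual_sheaf[OF pres(2)] loc pairs_det_unique res], assumption+, blast)
  have "pairs_det (pts X) h"
    unfolding pairs_det_def
  proof (intro allI impI)
    fix V \<theta> \<eta> x y assume *: "opn V \<and> V \<subseteq> pts X \<and> \<theta> \<in> sec D V \<and> \<eta> \<in> sec D V \<and> x \<in> sec M V \<and> y \<in> sec M V"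
    then have V: "opn V" and \<theta>: "\<theta> \<in> sec D V" "\<eta> \<in> sec D V" and xy: "x \<in> sec M V" "y \<in> sec M V" by blast+
    note \<theta>' = \<theta> [unfolded D_simps]
    have w: "wedge X D V \<theta> \<eta> \<in> sec (ext2 X D) V" by (rule bilinD(1)[OF wedge_bilin[OF D_pres(1)] V opn_pts[OF V] \<theta>])
    have m: "wedge X M V x y \<in> sec E V" by (rule bilinD(1)[OF wedge_bilin[OF pres(1)] V opn_pts[OF V] xy])
    have hV: "h V (wedge X D V \<theta> \<eta>) \<in> mod_homs X V E OX" using hom_closed[OF h V opn_pts[OF V] w] by simp
    \<comment> \<open>Gluing gives the condition only near each point; separatedness of the
      structure sheaf extends it to \<open>V\<close>.\<close>
    show "h V (wedge X D V \<theta> \<eta>) V (wedge X M V x y) = det_pair V \<theta> \<eta> x y"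
    proof (rule sheaf_eqI[OF sheaf_R V dual_closed[OF V hV V order_refl m] det_pair_simps(1)[OF V \<theta>' xy]])
      fix z assume z: "z \<in> V"
      have "z \<in> pts X" using z opn_pts[OF V] by blast
      from hl[OF this] obtain U where U: "opn U" "z \<in> U" "pairs_det U (restrict h (opens X U))" by blast
      define W where "W = V \<inter> U"
      have W: "opn W" "z \<in> W" "W \<subseteq> V" "W \<subseteq> U" using V U z by (auto simp: W_def)
      have r: "restr D V W \<theta> \<in> sec D W" "restr D V W \<eta> \<in> sec D W"
        by (rule res_closed[OF D_pres(1) V W(1,3) \<theta>(1)], rule res_closed[OF D_pres(1) V W(1,3) \<theta>(2)])
      have rx: "restr M V W x \<in> sec M W" "restr M V W y \<in> sec M W"
        by (rule res_closed[OF pres(1) V W(1,3) xy(1)], rule res_closed[OF pres(1) V W(1,3) xy(2)])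
      have rw: "restr (ext2 X D) V W (wedge X D V \<theta> \<eta>) = wedge X D W (restr D V W \<theta>) (restr D V W \<eta>)"
        using bilinD(6)[OF wedge_bilin[OF D_pres(1)] V opn_pts[OF V] \<theta> W(1,3)] by simp
      have rm: "restr E V W (wedge X M V x y) = wedge X M W (restr M V W x) (restr M V W y)"
        using bilinD(6)[OF wedge_bilin[OF pres(1)] V opn_pts[OF V] xy W(1,3)] by simp
      have hW: "restrict h (opens X U) W = h W" using W by simp
      have "rr V W (h V (wedge X D V \<theta> \<eta>) V (wedge X M V x y)) = h V (wedge X D V \<theta> \<eta>) W (restr E V W (wedge X M V x y))"
        using hom_res[OF hV V order_refl m W(1,3)] by simp
      also have "\<dots> = h W (wedge X D W (restr D V W \<theta>) (restr D V W \<eta>)) W (wedge X M W (restr M V W x) (restr M V W y))"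
        unfolding dual_hom_res[OF h V opn_pts[OF V] W(1,3) w] rw rm ..
      also have "\<dots> = det_pair W (restr D V W \<theta>) (restr D V W \<eta>) (restr M V W x) (restr M V W y)"
        using U(3)[unfolded pairs_det_def] W(1,4) r rx hW by metis
      also have "\<dots> = rr V W (det_pair V \<theta> \<eta> x y)"
        using det_pair_simps(2)[OF V \<theta>' xy W(1,3)] by simp
      finally show "\<exists>W. opn W \<and> z \<in> W \<and> W \<subseteq> V \<and>
          rr V W (h V (wedge X D V \<theta> \<eta>) V (wedge X M V x y)) = rr V W (det_pair V \<theta> \<eta> x y)" using W by blast
    qed
  qed
  then show ?thesis using h by blast
qed

text \<open>By \<open>pairs_det_unique\<close> there is exactly one such morphism, so the choice is
  canonical.\<close>

definition dual_wedge where
  "dual_wedge = (SOME h. h \<in> mod_homs X (pts X) (ext2 X D) (dual X E) \<and> pairs_det (pts X) h)"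

lemma dual_wedge_spec: "dual_wedge \<in> mod_homs X (pts X) (ext2 X D) (dual X E)" "pairs_det (pts X) dual_wedge"
  using someI_ex[OF pairs_det_exists] by (simp_all add: dual_wedge_def)

lemma dual_wedge_apply:
  assumes V: "opn V" and W: "opn W" "W \<subseteq> V" and \<theta>: "\<theta> \<in> sec D V" "\<eta> \<in> sec D V" and xy: "x \<in> sec M W" "y \<in> sec M W"
  shows "dual_wedge V (wedge X D V \<theta> \<eta>) W (wedge X M W x y) = det_pair W \<theta> \<eta> x y"
  by (rule pairs_detD[OF dual_wedge_spec(2,1) V opn_pts[OF V] W \<theta> xy])

text \<open>Near each point uniqueness identifies it with a morphism built from a frame, which takes
  a generator to a generator.\<close>

lemma dual_wedge_iso: "dual_wedge \<in> mod_isos X (ext2 X D) (dual X E)"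
proof (rule line_bundle_isoI[OF dual_wedge_spec(1) ext2_sheaf[OF D_pres(1)] dual_sheaf[OF pres(2)]])
  fix x assume x: "x \<in> pts X"
  obtain U e f c d where U: "opn U" "x \<in> U" and fr: "frame2 U M e f c d"
    by (rule locally_free2_frame[OF M_rank opn_top x])
  obtain h k l where h: "h \<in> mod_homs X U (ext2 X D) (dual X E)" "pairs_det U h"
    "frame1 U (ext2 X D) (wedge X D U d c) k" "frame1 U (dual X E) (h U (wedge X D U d c)) l"
    by (rule pairs_det_local[OF fr U(1)])
  have dw: "restrict dual_wedge (opens X U) \<in> mod_homs X U (ext2 X D) (dual X E)"
    by (rule hom_restrict[OF dual_wedge_spec(1) opn_pts[OF U(1)]])
  have "pairs_det U (restrict dual_wedge (opens X U))"
    unfolding pairs_det_def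
  proof (intro allI impI)
    fix W \<theta> \<eta> x y assume *: "opn W \<and> W \<subseteq> U \<and> \<theta> \<in> sec D W \<and> \<eta> \<in> sec D W \<and> x \<in> sec M W \<and> y \<in> sec M W"
    then have "restrict dual_wedge (opens X U) W = dual_wedge W" by simp
    then show "restrict dual_wedge (opens X U) W (wedge X D W \<theta> \<eta>) W (wedge X M W x y) = det_pair W \<theta> \<eta> x y"
      using * dual_wedge_apply[of W W \<theta> \<eta> x y] by simp
  qed
  from pairs_det_unique[OF U(1) dw h(1) this h(2)] have "dual_wedge U = h U" using U by auto
  then show "\<exists>U e c d. opn U \<and> x \<in> U \<and> frame1 U (ext2 X D) e c \<and> frame1 U (dual X E) (dual_wedge U e) d"
    using U h(3,4) by metis
qed

section \<open>The comparison of the targets and of the quadratic maps\<close>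

definition to_wood where
  "to_wood = tensor_map X (ext2 X D) (dual X B) (dual X E) (dual X B) dual_wedge (mod_id X (dual X B))"

lemma to_wood_iso: "to_wood \<in> mod_isos X N L"
  unfolding to_wood_def by (intro tensor_map_iso D_pres pres dual_wedge_iso mod_id_iso)

lemma to_wood_tens:
  assumes V: "opn V" and t: "t \<in> sec (ext2 X D) V" and \<delta>: "\<delta> \<in> sec (dual X B) V"
  shows "to_wood V (tens X (ext2 X D) (dual X B) V t \<delta>) = tens X (dual X E) (dual X B) V (dual_wedge V t) \<delta>"
  unfolding to_wood_def
    tensor_map_tens[OF D_pres(2) pres(8) pres(7,8) dual_wedge_spec(1) mod_id_hom[OF pres(8)] V t \<delta>] mod_id_apply[OF V \<delta>] ..

text \<open>The local formula for the norm is moved to Wood's target and compared there by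
  \<open>wood_eqI\<close>. As \<open>\<alpha>\<close> acts on \<theta> through the argument, the
  determinant pairing of \<alpha> \<theta> and \<theta> has the shape of Wood's expression at
  \<alpha>.\<close>

lemma norm_local:
  assumes U: "opn U" and \<theta>: "\<theta> \<in> sec D U" and \<alpha>: "\<alpha> \<in> sec Y U" and \<delta>: "\<delta> \<in> sec (dual X B) U"
    and b: "basis_on X U Y 2 (\<lambda>i. if i = 0 then yone U else \<alpha>)" and d1: "\<delta> U (acl U \<alpha>) = \<one>\<^bsub>R U\<^esub>"
  shows "to_wood U (tens X (ext2 X D) (dual X B) U (wedge X D U (\<alpha> \<odot>\<^bsub>dual_obj X Y I$U\<^esub> \<theta>) \<theta>) \<delta>) = wood_map X Y I U \<theta>"
proof -
  have \<theta>': "\<theta> \<in> sec (dual X M) U" using \<theta> by simp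
  define \<theta>\<alpha> where "\<theta>\<alpha> = \<alpha> \<odot>\<^bsub>dual_obj X Y I$U\<^esub> \<theta>"
  have \<theta>\<alpha>: "\<theta>\<alpha> \<in> sec D U" using D_act(1)[OF U \<alpha> \<theta>'] by (simp add: \<theta>\<alpha>_def)
  define w where "w = wedge X D U \<theta>\<alpha> \<theta>"
  have w: "w \<in> sec (ext2 X D) U" unfolding w_def by (rule bilinD(1)[OF wedge_bilin[OF D_pres(1)] U opn_pts[OF U] \<theta>\<alpha> \<theta>])
  obtain c d where fr: "frame2 U Y (yone U) \<alpha> c d"
    by (rule basis2_frame[OF Y_pre U b]) simp
  note F = frame2D[OF Y_pre fr U]
  have tin: "tens X (ext2 X D) (dual X B) U w \<delta> \<in> sec N U"
    by (rule bilinD(1)[OF tens_bilin[OF D_pres(2) pres(8)] U opn_pts[OF U] w \<delta>])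
  have dw: "dual_wedge U w \<in> sec (dual X E) U" by (rule hom_closed[OF dual_wedge_spec(1) U opn_pts[OF U] w])
  have "tens X (dual X E) (dual X B) U (dual_wedge U w) \<delta> = wood_map X Y I U \<theta>"
  proof (rule wood_eqI[OF U _ wood_map_in[OF U \<theta>']])
    show "tens X (dual X E) (dual X B) U (dual_wedge U w) \<delta> \<in> sec L U"
      by (rule bilinD(1)[OF tens_bilin[OF pres(7,8)] U opn_pts[OF U] dw \<delta>])
    fix V x y \<gamma> assume V: "opn V" "V \<subseteq> U" and xy: "x \<in> sec M V" "y \<in> sec M V" and \<gamma>: "\<gamma> \<in> sec Y V"
    interpret cring "R V" using cring_R[OF V(1)] .
    have rdw: "restr (dual X E) U V (dual_wedge U w) \<in> sec (dual X E) V" and rd: "restr (dual X B) U V \<delta> \<in> sec (dual X B) V"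
      by (rule res_closed[OF pres(7) U V dw], rule res_closed[OF pres(8) U V \<delta>])
    define \<alpha>V where "\<alpha>V = restr Y U V \<alpha>"
    have aV: "\<alpha>V \<in> sec Y V" unfolding \<alpha>V_def by (rule res_closed[OF Y_pre U V \<alpha>])
    define r s where "r = c V \<gamma>" and "s = d V \<gamma>"
    have rs: "r \<in> \<O> V" "s \<in> \<O> V" unfolding r_def s_def
      by (rule dual_closed[OF U F(3) V \<gamma>], rule dual_closed[OF U F(4) V \<gamma>])
    have \<gamma>e: "\<gamma> = lc Y V r (yone V) s \<alpha>V"
      using F(5)[OF V \<gamma>] U V by (simp add: r_def s_def \<alpha>V_def)
    have d1V: "\<delta> V (acl V \<alpha>V) = \<one>\<^bsub>R V\<^esub>"
      using hom_res[OF \<delta> [unfolded dual_sec] U order_refl acl_simps(1)[OF U \<alpha>] V] U V \<alpha> d1 by (simp add: \<alpha>V_def)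
    have "\<delta> V (acl V \<gamma>) = s"
    proof -
      note dl = hom_simps[OF \<delta> [unfolded dual_sec] V acl_simps(1)[OF V(1) aV]]
      have "acl V \<gamma> = s \<odot>\<^bsub>B$V\<^esub> acl V \<alpha>V"
        unfolding \<gamma>e using V rs aV by simp
      then show ?thesis using dl(3)[OF rs(2)] d1V rs by simp
    qed
    define ax ay where "ax = \<alpha>V \<odot>\<^bsub>I$V\<^esub> x" and "ay = \<alpha>V \<odot>\<^bsub>I$V\<^esub> y"
    have axy: "ax \<in> sec M V" "ay \<in> sec M V" unfolding ax_def ay_def by (rule act_simps(1)[OF V(1) aV], rule xy)+
    note th = dual_closed[OF U \<theta>'[unfolded dual_sec] V]
    define t1 t2 t3 t4 where "t1 = \<theta> V x" and "t2 = \<theta> V y" and "t3 = \<theta> V ax" and "t4 = \<theta> V ay"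
    have t: "t1 \<in> \<O> V" "t2 \<in> \<O> V" "t3 \<in> \<O> V" "t4 \<in> \<O> V"
      unfolding t1_def t2_def t3_def t4_def by (rule th, rule xy axy)+
    have gz: "\<theta> V (\<gamma> \<odot>\<^bsub>I$V\<^esub> z) = dot V r (\<theta> V z) s (\<theta> V (\<alpha>V \<odot>\<^bsub>I$V\<^esub> z))"
      if z: "z \<in> sec M V" for z
    proof -
      have az: "\<alpha>V \<odot>\<^bsub>I$V\<^esub> z \<in> sec M V" by (rule act_simps(1)[OF V(1) aV z])
      have "\<gamma> \<odot>\<^bsub>I$V\<^esub> z = lc M V r z s (\<alpha>V \<odot>\<^bsub>I$V\<^esub> z)"
        unfolding \<gamma>e using V rs aV z by simp
      then show ?thesis
        using hom_add[OF \<theta>'[unfolded dual_sec] V mod_closed(5)[OF pres(1) V(1) rs(1) z] mod_closed(5)[OF pres(1) V(1) rs(2) az]]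
          hom_smult[OF \<theta>'[unfolded dual_sec] V z rs(1)] hom_smult[OF \<theta>'[unfolded dual_sec] V az rs(2)] by simp
    qed
    have rt: "restr L U V (tens X (dual X E) (dual X B) U (dual_wedge U w) \<delta>) =
        tens X (dual X E) (dual X B) V (restr (dual X E) U V (dual_wedge U w)) (restr (dual X B) U V \<delta>)"
      using bilinD(6)[OF tens_bilin[OF pres(7,8)] U opn_pts[OF U] dw \<delta> V] by simp
    have "wp V x y \<gamma> (restr L U V (tens X (dual X E) (dual X B) U (dual_wedge U w) \<delta>)) =
        dual_wedge U w V (wedge X M V x y) \<otimes>\<^bsub>R V\<^esub> \<delta> V (acl V \<gamma>)"
      unfolding rt wp_tens[OF V(1) xy \<gamma> rdw rd] dual_restr_apply[OF V(1) order_refl] ..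
    also have "dual_wedge U w V (wedge X M V x y) = cross V t4 t1 t3 t2"
      unfolding w_def dual_wedge_apply[OF U V \<theta>\<alpha> \<theta> xy] det_pair_def
      unfolding \<theta>\<alpha>_def D_act(2)[OF U \<alpha> \<theta>' V xy(1)] D_act(2)[OF U \<alpha> \<theta>' V xy(2)]
      unfolding t1_def t2_def t3_def t4_def ax_def ay_def \<alpha>V_def ..
    also have "\<delta> V (acl V \<gamma>) = s" by fact
    \<comment> \<open>The terms with \<open>r\<close>, which come from the part of \<gamma> in the
      base, cancel.\<close>
    also have "cross V t4 t1 t3 t2 \<otimes>\<^bsub>R V\<^esub> s =
        cross V (dot V r t2 s t4) t1 (dot V r t1 s t3) t2"
      using t rs by algebra
    also have "\<dots> = wp V x y \<gamma> (restr L U V (wood_map X Y I U \<theta>))"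
      unfolding wood_map_wp[OF U \<theta>' V xy \<gamma>] gz[OF xy(1)] gz[OF xy(2)]
      unfolding t1_def t2_def t3_def t4_def ax_def ay_def ..
    finally show "wp V x y \<gamma> (restr L U V (tens X (dual X E) (dual X B) U (dual_wedge U w) \<delta>)) =
        wp V x y \<gamma> (restr L U V (wood_map X Y I U \<theta>))" .
  qed
  then show ?thesis unfolding to_wood_tens[OF U w \<delta>, symmetric] unfolding w_def \<theta>\<alpha>_def .
qed

text \<open>Wood's map carried back along the comparison satisfies the local formula for all
  admissible \<alpha> and \<delta>. Such pairs exist near each point, so no other section does, and
  the definite description of the norm picks it out.\<close>

lemma norm_wood:
  assumes U: "opn U" and \<theta>: "\<theta> \<in> sec (dual X M) U"
  shows "norm_map X Y (dual_obj X Y I) U \<theta> = mod_inv X N L to_wood U (wood_map X Y I U \<theta>)"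
proof -
  define s where "s = mod_inv X N L to_wood U (wood_map X Y I U \<theta>)"
  have s: "s \<in> sec N U" "to_wood U s = wood_map X Y I U \<theta>"
    unfolding s_def by (rule mod_inv_closed[OF to_wood_iso U wood_map_in[OF U \<theta>]], rule mod_inv_right[OF to_wood_iso U wood_map_in[OF U \<theta>]])
  let ?n = "\<lambda>V \<alpha> \<delta>. tens X (ext2 X D) (dual X B) V
    (wedge X D V (\<alpha> \<odot>\<^bsub>dual_obj X Y I$V\<^esub> restr (dual_obj X Y I) U V \<theta>) (restr (dual_obj X Y I) U V \<theta>)) \<delta>"
  have rd: "restr (dual_obj X Y I) = restr (dual X M)" by (simp add: dual_obj_def Let_def)
  have sat: "restr N U V s = ?n V \<alpha> \<delta>"
    if V: "opn V" "V \<subseteq> U" and \<alpha>: "\<alpha> \<in> sec Y V" and \<delta>: "\<delta> \<in> sec (dual X B) V"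
      and b: "basis_on X V Y 2 (\<lambda>i. if i = 0 then yone V else \<alpha>)" and d1: "\<delta> V (acl V \<alpha>) = \<one>\<^bsub>R V\<^esub>" for V \<alpha> \<delta>
  proof -
    have \<theta>V: "restr (dual X M) U V \<theta> \<in> sec (dual X M) V" by (rule res_closed[OF pres(6) U V \<theta>])
    then have \<theta>D: "restr (dual X M) U V \<theta> \<in> sec D V" by simp
    have "\<alpha> \<odot>\<^bsub>dual_obj X Y I$V\<^esub> restr (dual X M) U V \<theta> \<in> sec D V"
      using D_act(1)[OF V(1) \<alpha> \<theta>V] by simp
    from bilinD(1)[OF wedge_bilin[OF D_pres(1)] V(1) opn_pts[OF V(1)] this \<theta>D]
    have n: "?n V \<alpha> \<delta> \<in> sec N V"
      unfolding rd by (rule bilinD(1)[OF tens_bilin[OF D_pres(2) pres(8)] V(1) opn_pts[OF V(1)] _ \<delta>])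
    \<comment> \<open>The comparison is injective, so the formula may be checked after applying it.
      There both sides are Wood's map at the restriction of \<theta>.\<close>
    have "to_wood V (restr N U V s) = restr L U V (wood_map X Y I U \<theta>)"
      using hom_res[OF iso_hom[OF to_wood_iso] U opn_pts[OF U] s(1) V] s(2) by simp
    also have "\<dots> = wood_map X Y I V (restr (dual X M) U V \<theta>)"
    proof -
      have "U \<in> opens X (pts X)" "V \<in> opens X U" using U V by simp_all
      then show ?thesis using wood_quadratic \<theta> unfolding quadratic_map_def by metis
    qed
    also have "\<dots> = to_wood V (?n V \<alpha> \<delta>)"
      unfolding rd by (rule norm_local[OF V(1) \<theta>D \<alpha> \<delta> b d1, symmetric])
    finally show ?thesis by (rule iso_inj[OF to_wood_iso V(1) res_closed[OF D_pres(3) U V s(1)] n])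
  qed
  have "(THE s. s \<in> sec N U \<and> (\<forall>V\<in>opens X U. \<forall>\<alpha>\<in>sec Y V. \<forall>\<delta>\<in>sec (dual X B) V.
     basis_on X V Y 2 (\<lambda>i. if i = 0 then yone V else \<alpha>) \<and> \<delta> V (acl V \<alpha>) = \<one>\<^bsub>R V\<^esub> \<longrightarrow>
     restr N U V s = ?n V \<alpha> \<delta>)) = s"
  proof (rule the_equality)
    show "s \<in> sec N U \<and> (\<forall>V\<in>opens X U. \<forall>\<alpha>\<in>sec Y V. \<forall>\<delta>\<in>sec (dual X B) V.
      basis_on X V Y 2 (\<lambda>i. if i = 0 then yone V else \<alpha>) \<and> \<delta> V (acl V \<alpha>) = \<one>\<^bsub>R V\<^esub> \<longrightarrow> restr N U V s = ?n V \<alpha> \<delta>)"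
    proof (intro conjI ballI impI s(1))
      fix V \<alpha> \<delta> assume V: "V \<in> opens X U" and a: "\<alpha> \<in> sec Y V" "\<delta> \<in> sec (dual X B) V"
        and b: "basis_on X V Y 2 (\<lambda>i. if i = 0 then yone V else \<alpha>) \<and> \<delta> V (acl V \<alpha>) = \<one>\<^bsub>R V\<^esub>"
      show "restr N U V s = ?n V \<alpha> \<delta>"
        by (rule sat[OF _ _ a conjunct1[OF b] conjunct2[OF b]]) (use V in simp_all)
    qed
    fix t assume t: "t \<in> sec N U \<and> (\<forall>V\<in>opens X U. \<forall>\<alpha>\<in>sec Y V. \<forall>\<delta>\<in>sec (dual X B) V.
      basis_on X V Y 2 (\<lambda>i. if i = 0 then yone V else \<alpha>) \<and> \<delta> V (acl V \<alpha>) = \<one>\<^bsub>R V\<^esub> \<longrightarrow> restr N U V t = ?n V \<alpha> \<delta>)"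
    show "t = s"
    proof (rule sheaf_eqI[OF module_sheaf_sheaf[OF N_sheaf] U conjunct1[OF t] s(1)])
      fix x assume x: "x \<in> U"
      obtain V \<alpha> c d where V: "opn V" "x \<in> V" "V \<subseteq> U" and fr: "frame2 V Y (yone V) \<alpha> c d"
        by (rule unit_frame[OF U x])
      \<comment> \<open>The coordinate along the class of \<open>\<alpha>\<close> serves as the
        functional \<delta> in the condition defining the norm.\<close>
      obtain \<kappa> where \<kappa>: "frame1 V B (acl V \<alpha>) \<kappa>"
        by (rule B_frame[OF fr V(1)])
      note F = frame2D[OF Y_pre fr V(1)]
      have k: "\<kappa> \<in> sec (dual X B) V" "\<kappa> V (acl V \<alpha>) = \<one>\<^bsub>R V\<^esub>"
        using frame1D(2)[OF pres(4) \<kappa> V(1)] \<kappa> by (simp_all add: frame1_def)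
      have b: "basis_on X V Y 2 (\<lambda>i. if i = 0 then yone V else \<alpha>)"
        by (rule frame2_basis[OF Y_pre _ V(1)]) (use fr in simp)
      have Vo: "V \<in> opens X U" using V by simp
      have "restr N U V t = ?n V \<alpha> \<kappa>"
        by (rule conjunct2[OF t, THEN bspec, OF Vo, THEN bspec, OF F(2), THEN bspec, OF k(1), THEN mp, OF conjI[OF b k(2)]])
      then show "\<exists>V. opn V \<and> x \<in> V \<and> V \<subseteq> U \<and> restr N U V t = restr N U V s"
        using sat[OF V(1,3) F(2) k(1) b k(2)] V by metis
    qed
  qed
  moreover have "U \<in> opens X (pts X)" "\<theta> \<in> sec (dual_obj X Y I) U" using U \<theta> by (simp_all add: dual_obj_def Let_def)
  ultimately show ?thesis by (simp add: norm_map_def norm_target_def s_def del: opens_iff)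
qed

lemma norm_bqm: "binary_quadratic_module X (norm_dual_obj X Y I)"
proof -
  have "quadratic_map X D N (norm_map X Y (dual_obj X Y I))"
    by (rule quadratic_map_transfer[OF D_eq pres(6,9) D_pres(3) wood_quadratic mod_inv_hom[OF to_wood_iso D_pres(3) pres(9)]], rule norm_wood)
  then show ?thesis
    using D_rank line_bundle_locally_free[OF N_line]
    by (simp add: binary_quadratic_module_def norm_dual_obj_def norm_obj_def norm_target_def)
qed

end

section \<open>Naturality of the comparison\<close>

context quad
begin

context
  fixes I :: "('a, 'b, 'm) mod_presheaf" and J :: "('a, 'b, 'n) mod_presheaf" and \<psi>
  assumes I: "quad_mod X Y I" and J: "quad_mod X Y J" and \<psi>: "\<psi> \<in> mod_isos (over X Y) I J"
begin

interpretation I: quad_mod X Y I by (rule I)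
interpretation J: quad_mod X Y J by (rule J)

abbreviation (input) "\<phi> \<equiv> dual_map X I.M J.M \<psi>"
abbreviation (input) "\<epsilon> \<equiv> ext2_map X I.M J.M \<psi>"
abbreviation (input) "\<phi>2 \<equiv> ext2_map X J.D I.D \<phi>"
abbreviation (input) "\<tau> \<equiv> snd (norm_dual_mor X Y I J \<psi>)"
abbreviation (input) "\<rho> \<equiv> snd (wood_mor X Y I J \<psi>)"

lemma norm_mor_eq:
  "norm_dual_mor X Y I J \<psi> = (\<phi>, tensor_map X (ext2 X J.D) (dual X B) (ext2 X I.D) (dual X B) \<phi>2 (mod_id X (dual X B)))"
  by (simp add: norm_dual_mor_def norm_mor_def dual_mor_def)

text \<open>The dual map is built between duals over \<open>X\<close>; \<open>mod_eq\<close> turns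
  it into an isomorphism of the \<open>Y\<close>-module duals with restricted scalars.\<close>

lemma dual_map_D_iso: "\<phi> \<in> mod_isos X J.D I.D"
proof -
  note p = dual_map_iso[OF I.pres(1) J.pres(1) iso_restr_scalars[OF I J \<psi>]]
  have "\<phi> \<in> mod_homs X (pts X) J.D I.D"
    unfolding mod_eq_homs(1)[OF J.D_eq dual_sheaf[OF J.pres(1)]] mod_eq_homs(2)[OF I.D_eq dual_sheaf[OF I.pres(1)]]
    by (rule iso_hom[OF p])
  then show ?thesis using p by (simp add: mod_isos_def)
qed

lemma norm_mor_iso: "\<tau> \<in> mod_isos X J.N I.N"
  unfolding norm_mor_eq snd_conv
  by (intro tensor_map_iso I.D_pres J.D_pres I.pres J.pres ext2_map_iso dual_map_D_iso mod_id_iso)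

text \<open>Both composites send the wedge of \<theta> and \<eta> to the functional whose value at x
  \<and> y is the determinant pairing of \<theta> and \<eta> with \<psi> x and \<psi> y.\<close>

lemma dual_wedge_natural:
  "mod_comp X (ext2 X J.D) I.dual_wedge \<phi>2 = mod_comp X (ext2 X J.D) (dual_map X I.E J.E \<epsilon>) J.dual_wedge"
proof -
  note p = iso_hom[OF iso_restr_scalars[OF I J \<psi>]] and d = iso_hom[OF dual_map_D_iso]
  note e = ext2_map_hom[OF I.pres(1) J.pres(1) p] and d2 = ext2_map_hom[OF J.D_pres(1) I.D_pres(1) d]
  note de = dual_map_hom[OF I.pres(2) J.pres(2) e]
  show ?thesis
  proof (rule ext2_hom_eqI[OF J.D_pres(1) mod_comp_hom[OF J.D_pres(2) d2 I.dual_wedge_spec(1)]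
        mod_comp_hom[OF J.D_pres(2) J.dual_wedge_spec(1) de] dual_sheaf[OF I.pres(2)]])
    fix V \<theta> \<eta> assume V: "opn V" and \<theta>: "\<theta> \<in> sec J.D V" "\<eta> \<in> sec J.D V"
    have w: "wedge X J.D V \<theta> \<eta> \<in> sec (ext2 X J.D) V"
      by (rule bilinD(1)[OF wedge_bilin[OF J.D_pres(1)] V opn_pts[OF V] \<theta>])
    note \<phi>\<theta> = hom_closed[OF d V opn_pts[OF V] \<theta>(1)] hom_closed[OF d V opn_pts[OF V] \<theta>(2)]
    have w': "wedge X I.D V (\<phi> V \<theta>) (\<phi> V \<eta>) \<in> sec (ext2 X I.D) V"
      by (rule bilinD(1)[OF wedge_bilin[OF I.D_pres(1)] V opn_pts[OF V] \<phi>\<theta>])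
    note Jw = hom_closed[OF J.dual_wedge_spec(1) V opn_pts[OF V] w] and Iw = hom_closed[OF I.dual_wedge_spec(1) V opn_pts[OF V] w']
    note \<theta>' = \<theta> [unfolded J.D_simps]
    have "I.dual_wedge V (wedge X I.D V (\<phi> V \<theta>) (\<phi> V \<eta>)) = dual_map X I.E J.E \<epsilon> V (J.dual_wedge V (wedge X J.D V \<theta> \<eta>))"
    proof (rule ext2_hom_eqI[OF I.pres(1) Iw[unfolded dual_sec] dual_map_closed[OF I.pres(2) J.pres(2) e V Jw, unfolded dual_sec] struct_sheaf])
      fix W x y assume W: "opn W" "W \<subseteq> V" and xy: "x \<in> sec I.M W" "y \<in> sec I.M W"
      have wI: "wedge X I.M W x y \<in> sec I.E W" using W xy by simp
      note \<psi>xy = hom_closed[OF p W(1) opn_pts[OF W(1)] xy(1)] hom_closed[OF p W(1) opn_pts[OF W(1)] xy(2)]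
      have "I.dual_wedge V (wedge X I.D V (\<phi> V \<theta>) (\<phi> V \<eta>)) W (wedge X I.M W x y) = J.det_pair W \<theta> \<eta> (\<psi> W x) (\<psi> W y)"
        unfolding I.dual_wedge_apply[OF V W \<phi>\<theta> xy] I.det_pair_def J.det_pair_def
          dual_map_apply[OF I.pres(1) J.pres(1) p V \<theta>'(1) W xy(1)] dual_map_apply[OF I.pres(1) J.pres(1) p V \<theta>'(1) W xy(2)]
          dual_map_apply[OF I.pres(1) J.pres(1) p V \<theta>'(2) W xy(1)] dual_map_apply[OF I.pres(1) J.pres(1) p V \<theta>'(2) W xy(2)] ..
      also have "\<dots> = dual_map X I.E J.E \<epsilon> V (J.dual_wedge V (wedge X J.D V \<theta> \<eta>)) W (wedge X I.M W x y)"
        unfolding dual_map_apply[OF I.pres(2) J.pres(2) e V Jw[unfolded dual_sec] W wI]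
          ext2_map_wedge[OF I.pres(1) J.pres(1) p W(1) xy] J.dual_wedge_apply[OF V W \<theta> \<psi>xy] ..
      finally show "I.dual_wedge V (wedge X I.D V (\<phi> V \<theta>) (\<phi> V \<eta>)) W (wedge X I.M W x y) =
          dual_map X I.E J.E \<epsilon> V (J.dual_wedge V (wedge X J.D V \<theta> \<eta>)) W (wedge X I.M W x y)" .
    qed
    then show "mod_comp X (ext2 X J.D) I.dual_wedge \<phi>2 V (wedge X J.D V \<theta> \<eta>) =
        mod_comp X (ext2 X J.D) (dual_map X I.E J.E \<epsilon>) J.dual_wedge V (wedge X J.D V \<theta> \<eta>)"
      unfolding mod_comp_apply[OF V w] ext2_map_wedge[OF J.D_pres(1) I.D_pres(1) d V \<theta>] .
  qed
qed

text \<open>Only the first tensor factor varies, so on pure tensors this is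
  \<open>dual_wedge_natural\<close>.\<close>

lemma to_wood_natural: "mod_comp X J.N I.to_wood \<tau> = mod_comp X J.N \<rho> J.to_wood"
proof -
  note p = iso_hom[OF iso_restr_scalars[OF I J \<psi>]] and d = iso_hom[OF dual_map_D_iso]
  note d2 = ext2_map_hom[OF J.D_pres(1) I.D_pres(1) d]
  show ?thesis
  proof (rule tensor_hom_eqI[OF J.D_pres(2) J.pres(8) mod_comp_hom[OF J.D_pres(3) iso_hom[OF norm_mor_iso] iso_hom[OF I.to_wood_iso]]
        mod_comp_hom[OF J.D_pres(3) iso_hom[OF J.to_wood_iso] iso_hom[OF wood_mor_parts(2)[OF I J \<psi>]]] I.L_sheaf])
    fix V t \<delta> assume V: "opn V" and t: "t \<in> sec (ext2 X J.D) V" and \<delta>: "\<delta> \<in> sec (dual X B) V"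
    have tin: "tens X (ext2 X J.D) (dual X B) V t \<delta> \<in> sec J.N V"
      by (rule bilinD(1)[OF tens_bilin[OF J.D_pres(2) J.pres(8)] V opn_pts[OF V] t \<delta>])
    have \<tau>: "\<tau> V (tens X (ext2 X J.D) (dual X B) V t \<delta>) = tens X (ext2 X I.D) (dual X B) V (\<phi>2 V t) \<delta>"
      unfolding norm_mor_eq snd_conv
        tensor_map_tens[OF J.D_pres(2) J.pres(8) I.D_pres(2) I.pres(8) d2 mod_id_hom[OF I.pres(8)] V t \<delta>] mod_id_apply[OF V \<delta>] ..
    have n: "I.dual_wedge V (\<phi>2 V t) = dual_map X I.E J.E \<epsilon> V (J.dual_wedge V t)"
      using fun_cong[OF fun_cong[OF dual_wedge_natural, of V], of t] unfolding mod_comp_apply[OF V t] .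
    show "mod_comp X J.N I.to_wood \<tau> V (tens X (ext2 X J.D) (dual X B) V t \<delta>) =
        mod_comp X J.N \<rho> J.to_wood V (tens X (ext2 X J.D) (dual X B) V t \<delta>)"
      unfolding mod_comp_apply[OF V tin] \<tau> I.to_wood_tens[OF V hom_closed[OF d2 V opn_pts[OF V] t] \<delta>]
        J.to_wood_tens[OF V t \<delta>] n
        wood_mor_tens[OF I J \<psi> V hom_closed[OF J.dual_wedge_spec(1) V opn_pts[OF V] t] \<delta>] ..
  qed
qed

text \<open>Both norms are Wood's maps carried back along \<open>to_wood\<close>, which is natural,
  so the property follows from \<open>wood_mor_sim\<close>.\<close>

lemma norm_mor_sim: "norm_dual_mor X Y I J \<psi> \<in> similarities X (norm_dual_obj X Y J) (norm_dual_obj X Y I)"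
proof -
  note d = iso_hom[OF dual_map_D_iso]
  have "norm_map X Y (dual_obj X Y I) U (\<phi> U \<theta>) = \<tau> U (norm_map X Y (dual_obj X Y J) U \<theta>)"
    if U: "opn U" and \<theta>: "\<theta> \<in> sec J.D U" for U \<theta>
  proof -
    have \<theta>': "\<theta> \<in> sec (dual X J.M) U" using \<theta> by simp
    have \<phi>\<theta>: "\<phi> U \<theta> \<in> sec (dual X I.M) U" using hom_closed[OF d U opn_pts[OF U] \<theta>] by simp
    define s where "s = norm_map X Y (dual_obj X Y J) U \<theta>"
    note qJ = J.wood_map_in[OF U \<theta>'] and qI = I.wood_map_in[OF U \<phi>\<theta>]
    have s: "s \<in> sec J.N U" "J.to_wood U s = wood_map X Y J U \<theta>"
      unfolding s_def J.norm_wood[OF U \<theta>'] by (rule mod_inv_closed[OF J.to_wood_iso U qJ], rule mod_inv_right[OF J.to_wood_iso U qJ])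
    have \<tau>s: "\<tau> U s \<in> sec I.N U" by (rule hom_closed[OF iso_hom[OF norm_mor_iso] U opn_pts[OF U] s(1)])
    have "U \<in> opens X (pts X)" using U by simp
    then have w: "wood_map X Y I U (\<phi> U \<theta>) = \<rho> U (wood_map X Y J U \<theta>)"
      using wood_mor_sim[OF I J \<psi>] \<theta>'
      unfolding similarities_def wood_obj_def wood_mor_def dual_mor_def Let_def by (simp del: opens_iff)
    have "I.to_wood U (\<tau> U s) = wood_map X Y I U (\<phi> U \<theta>)"
      using fun_cong[OF fun_cong[OF to_wood_natural, of U], of s] unfolding mod_comp_apply[OF U s(1)] s(2) w .
    then have "mod_inv X I.N I.L I.to_wood U (wood_map X Y I U (\<phi> U \<theta>)) = \<tau> U s"
      using mod_inv_left[OF I.to_wood_iso U \<tau>s] by simp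
    then show ?thesis unfolding I.norm_wood[OF U \<phi>\<theta>] s_def .
  qed
  then show ?thesis
    using dual_map_D_iso norm_mor_iso unfolding norm_mor_eq snd_conv
    by (simp add: similarities_def norm_dual_obj_def norm_obj_def norm_target_def)
qed

text \<open>On the sources only identities have to be dropped; on the targets it is
  \<open>to_wood_natural\<close>.\<close>

lemma comparison_natural:
  "sim_comp X (norm_dual_obj X Y J) (mod_id X I.D, I.to_wood) (norm_dual_mor X Y I J \<psi>) =
    sim_comp X (norm_dual_obj X Y J) (wood_mor X Y I J \<psi>) (mod_id X J.D, J.to_wood)"
proof -
  have "mod_comp X J.D (mod_id X I.D) \<phi> = mod_comp X J.D \<phi> (mod_id X J.D)"
  proof -
    have "mod_id X I.D U (\<phi> U x) = \<phi> U (mod_id X J.D U x)" if U: "opn U" and x: "x \<in> sec J.D U" for U x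
      unfolding mod_id_apply[OF U x] by (rule mod_id_apply[OF U hom_closed[OF iso_hom[OF dual_map_D_iso] U opn_pts[OF U] x]])
    then show ?thesis unfolding mod_comp_def by (intro restrict_ext) simp
  qed
  then show ?thesis
    using to_wood_natural
    by (simp add: sim_comp_def norm_mor_eq wood_mor_def dual_mor_def norm_dual_obj_def norm_obj_def norm_target_def Let_def)
qed

end

text \<open>Dual maps have their identities and composites over the dual on \<open>X\<close>, the
  norm functor over the \<open>Y\<close>-module dual with restricted scalars;
  \<open>mod_eq_maps\<close> identifies them.\<close>

lemma norm_functor:
  assumes good: "\<And>I. pseudoregular X Y I \<Longrightarrow> quad_mod X Y (I :: ('a, 'b, 'm) mod_presheaf)"
  shows "contravariant_functor X Y (norm_dual_obj X Y :: ('a, 'b, 'm) mod_presheaf \<Rightarrow> _) (norm_dual_mor X Y)"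
  unfolding contravariant_functor_def
proof (intro conjI allI impI)
  fix I :: "('a, 'b, 'm) mod_presheaf" assume "pseudoregular X Y I"
  then interpret I: quad_mod X Y I by (rule good)
  show "binary_quadratic_module X (norm_dual_obj X Y I)" by (rule I.norm_bqm)
  show "norm_dual_mor X Y I I (mod_id (over X Y) I) = sim_id X (norm_dual_obj X Y I)"
    by (simp add: norm_dual_mor_def norm_mor_def dual_mor_def over_mod sim_id_def norm_dual_obj_def norm_obj_def norm_target_def
        dual_map_id mod_eq_maps(1)[OF I.D_eq, symmetric] ext2_map_id[OF I.D_pres(1)] tensor_map_id[OF I.D_pres(2) I.pres(8)])
next
  fix I J :: "('a, 'b, 'm) mod_presheaf" and \<psi>
  assume "pseudoregular X Y I \<and> pseudoregular X Y J \<and> \<psi> \<in> mod_isos (over X Y) I J"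
  then show "norm_dual_mor X Y I J \<psi> \<in> similarities X (norm_dual_obj X Y J) (norm_dual_obj X Y I)"
    using norm_mor_sim good by blast
next
  fix I J K :: "('a, 'b, 'm) mod_presheaf" and \<psi> \<chi>
  assume *: "pseudoregular X Y I \<and> pseudoregular X Y J \<and> pseudoregular X Y K \<and>
      \<psi> \<in> mod_isos (over X Y) I J \<and> \<chi> \<in> mod_isos (over X Y) J K"
  interpret I: quad_mod X Y I using * good by blast
  interpret J: quad_mod X Y J using * good by blast
  interpret K: quad_mod X Y K using * good by blast
  note IJ = I.quad_mod_axioms J.quad_mod_axioms and JK = J.quad_mod_axioms K.quad_mod_axioms
  have psi: "\<psi> \<in> mod_isos (over X Y) I J" and chi: "\<chi> \<in> mod_isos (over X Y) J K" using * by blast+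
  note p = iso_hom[OF iso_restr_scalars[OF IJ psi]] and c = iso_hom[OF iso_restr_scalars[OF JK chi]]
  note dp = iso_hom[OF dual_map_D_iso[OF IJ psi]] and dc = iso_hom[OF dual_map_D_iso[OF JK chi]]
  note ep = ext2_map_hom[OF J.D_pres(1) I.D_pres(1) dp] and ec = ext2_map_hom[OF K.D_pres(1) J.D_pres(1) dc]
  show "norm_dual_mor X Y I K (mod_comp (over X Y) I \<chi> \<psi>) =
      sim_comp X (norm_dual_obj X Y K) (norm_dual_mor X Y I J \<psi>) (norm_dual_mor X Y J K \<chi>)"
    by (simp add: norm_dual_mor_def norm_mor_def dual_mor_def over_mod sim_comp_def norm_dual_obj_def norm_obj_def norm_target_def
        dual_map_comp[OF I.pres(1) J.pres(1) K.pres(1) p c] mod_eq_maps(2)[OF K.D_eq, symmetric]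
        ext2_map_comp[OF K.D_pres(1) J.D_pres(1) I.D_pres(1) dc dp]
        tensor_map_comp_left[OF K.D_pres(2) J.D_pres(2) I.D_pres(2) I.pres(8) ec ep])
qed

text \<open>That the comparison respects the quadratic maps is \<open>norm_wood\<close> after
  applying \<open>to_wood\<close> to both sides.\<close>

lemma norm_wood_natural_iso:
  assumes good: "\<And>I. pseudoregular X Y I \<Longrightarrow> quad_mod X Y (I :: ('a, 'b, 'm) mod_presheaf)"
  shows "natural_isomorphism X Y (norm_dual_obj X Y :: ('a, 'b, 'm) mod_presheaf \<Rightarrow> _) (norm_dual_mor X Y)
    (wood_obj X Y) (wood_mor X Y)
    (\<lambda>I. (mod_id X (restr_scalars Y (dual_obj X Y I)), quad_mod.to_wood X Y I))"
  unfolding natural_isomorphism_def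
proof (intro conjI allI impI)
  fix I :: "('a, 'b, 'm) mod_presheaf" assume "pseudoregular X Y I"
  then interpret I: quad_mod X Y I by (rule good)
  have "wood_map X Y I U (mod_id X I.D U \<theta>) = I.to_wood U (norm_map X Y (dual_obj X Y I) U \<theta>)"
    if U: "opn U" and \<theta>: "\<theta> \<in> sec I.D U" for U \<theta>
  proof -
    have \<theta>': "\<theta> \<in> sec (dual X I.M) U" using \<theta> by simp
    show ?thesis
      unfolding mod_id_apply[OF U \<theta>] I.norm_wood[OF U \<theta>'] mod_inv_right[OF I.to_wood_iso U I.wood_map_in[OF U \<theta>']] ..
  qed
  then show "(mod_id X I.D, I.to_wood) \<in> similarities X (norm_dual_obj X Y I) (wood_obj X Y I)"
    using mod_eq_id_iso[OF I.D_eq dual_sheaf[OF I.pres(1)]] I.to_wood_iso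
    by (simp add: similarities_def norm_dual_obj_def norm_obj_def norm_target_def wood_obj_def wood_target_def)
next
  fix I J :: "('a, 'b, 'm) mod_presheaf" and \<psi>
  assume "pseudoregular X Y I \<and> pseudoregular X Y J \<and> \<psi> \<in> mod_isos (over X Y) I J"
  then show "sim_comp X (norm_dual_obj X Y J) (mod_id X (restr_scalars Y (dual_obj X Y I)), quad_mod.to_wood X Y I) (norm_dual_mor X Y I J \<psi>) =
      sim_comp X (norm_dual_obj X Y J) (wood_mor X Y I J \<psi>) (mod_id X (restr_scalars Y (dual_obj X Y J)), quad_mod.to_wood X Y J)"
    using comparison_natural good by blast
qed

end

theorem proposition4p4p3:
  fixes X :: "('a, 'r) r_space"
    and Y :: "('a, 'r, 'b) mod_presheaf"
  assumes "scheme X" and "quadratic_algebra X Y"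
  shows "contravariant_functor X Y
      (norm_dual_obj X Y :: ('a, 'b, 'm) mod_presheaf \<Rightarrow> _) (norm_dual_mor X Y)
    \<and> contravariant_functor X Y
      (wood_obj X Y :: ('a, 'b, 'm) mod_presheaf \<Rightarrow> _) (wood_mor X Y)
    \<and> (\<exists>\<eta>. natural_isomorphism X Y
      (norm_dual_obj X Y :: ('a, 'b, 'm) mod_presheaf \<Rightarrow> _) (norm_dual_mor X Y)
      (wood_obj X Y) (wood_mor X Y) \<eta>)"
proof -
  interpret quad X Y
    by unfold_locales (use assms in \<open>simp_all add: scheme_def\<close>)
  have good: "quad_mod X Y I" if "pseudoregular X Y I" for I :: "('a, 'b, 'm) mod_presheaf"
    by unfold_locales (use that in \<open>simp_all add: pseudoregular_def\<close>)
  show ?thesis using norm_functor wood_functor norm_wood_natural_iso good by blast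
qed

end
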